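(* Let $T>0$. The random field $(a,t)\mapsto L^a_t$, $a\in\mathbb{R}$, $t\in[0,T]$, admits a jointly continuous modification. Moreover, (this modification of) $(a,t)\mapsto L^a_t$ is Hölder continuous of order $\gamma$ for all $\gamma<\frac12$, quasi-surely.
   Context: Setting. Fix reals $0\le\underline\sigma\le\overline\sigma$ and put $G(\alpha)=\frac12(\overline\sigma^2\alpha^+-\underline\sigma^2\alpha^-)$, $\alpha\in\mathbb{R}$. Let $\Omega=C_0(\mathbb{R}^+)$ be the space of real continuous functions $\omega$ on $[0,\infty)$ with $\omega_0=0$, with the topology of locally uniform convergence and Borel $\sigma$-algebra $\mathcal{B}(\Omega)$; $B_t(\omega)=\omega_t$ is the coordinate process; $\Omega_t=\{\omega_{\cdot\wedge t}:\omega\in\Omega\}$; $L_b(\Omega_t)$ is the space of bounded real $\mathcal{B}(\Omega_t)$-measurable functions. $\hat{\mathbb{E}}$ is Peng's $G$-expectation: the sublinear expectation (monotone, constant preserving, subadditive, positively homogeneous), defined on cylinder functions $\varphi(\omega_{t_1},\dots,\omega_{t_d})$ with $\varphi$ bounded Lipschitz and on their completion, under which $B$ is a $G$-Brownian motion, i.e. $B_0=0$, and for all $t,s\ge0$ the increment $B_{t+s}-B_t$ is $G$-normally distributed $\mathcal{N}(0,[\underline\sigma^2s,\overline\sigma^2s])$ and independent from $(B_{t_1},\dots,B_{t_n})$ for all $0\le t_1\le\dots\le t_n\le t$. Here $\xi\sim\mathcal{N}(0,[\underline\sigma^2,\overline\sigma^2])$ means that for every bounded Lipschitz $\varphi$,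 $u(t,x)=\hat{\mathbb{E}}[\varphi(x+\sqrt t\,\xi)]$ is the unique viscosity solution of $\partial_tu=G(\partial^2_{xx}u)$, $u(0,\cdot)=\varphi$; and $Y$ is independent from $X$ if $\hat{\mathbb{E}}[\varphi(X,Y)]=\hat{\mathbb{E}}[\hat{\mathbb{E}}[\varphi(x,Y)]_{x=X}]$ for all bounded Lipschitz $\varphi$. There is a weakly compact family $\mathcal{P}$ of probability measures on $(\Omega,\mathcal{B}(\Omega))$ with $\hat{\mathbb{E}}[\cdot]=\sup_{P\in\mathcal{P}}E_P[\cdot]$; this formula is used for all measurable functions. A set $A\in\mathcal B(\Omega)$ is polar if $\hat c(A):=\sup_{P\in\mathcal{P}}P(A)=0$; "quasi-surely" (q.s.) means outside a polar set. $\mathbb{L}^p$ is the space of (q.s. classes of) measurable $X$ with $\|X\|_p=\hat{\mathbb{E}}[|X|^p]^{1/p}<\infty$. $\langle B\rangle_t=\lim\sum_i(B_{t_{i+1}}-B_{t_i})^2=B_t^2-2\int_0^tB_sdB_s$ (limit in $\mathbb{L}^2$ along partitions of $[0,t]$ with mesh tending to $0$) is the quadratic variation process, continuous and increasing q.s. Local time. $L^a_t=\lim_{\varepsilon\to0}\frac1{2\varepsilon}\int_0^t1_{(a-\varepsilon,a+\varepsilon)}(B_s)d\langle B\rangle_s$ (limit in $\mathbb{L}^2$), equivalently $L^a_t=|B_t-a|-|a|-\int_0^t\mathrm{sgn}(B_s-a)dB_s$ q.s., where $\mathrm{sgn}(x)=1,0,-1$ for $x>0$, $x=0$, $x<0$.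 The stochastic integral is defined for step processes $\eta_t=\sum_{j}\xi_j1_{[t_j,t_{j+1})}(t)$, $\xi_j\in L_b(\Omega_{t_j})$, by $\sum_j\xi_j(B_{t_{j+1}}-B_{t_j})$ and extended continuously, with values in $\mathbb{L}^2$, to the completion $\widetilde M_*^2(0,T)$ of the step processes under the norm $(\hat{\mathbb{E}}[\int_0^T|\eta_t|^2d\langle B\rangle_t])^{1/2}$; $\mathrm{sgn}(B_\cdot-a)$ belongs to this completion. A modification of a field $(X_{a,t})$ is a field $(\tilde X_{a,t})$ with $\tilde X_{a,t}=X_{a,t}$ q.s. for every $(a,t)$. *)

theory Defs
  imports "HOL-Probability.Probability"
begin

section \<open>Path space\<close>

text \<open>A path on \<open>[0,\<infinity>)\<close> is represented by its extension by \<open>0\<close> to negative times, so that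
  equality of elements of the type is equality of the paths on \<open>[0,\<infinity>)\<close>.\<close>

typedef cpath = "{\<omega> :: real \<Rightarrow> real. continuous_on {0..} \<omega> \<and> \<omega> 0 = 0 \<and> (\<forall>t<0. \<omega> t = 0)}"
  morphisms path_fun Abs_cpath
  by (rule exI[of _ "\<lambda>_. 0"]) auto

text \<open>Topology of locally uniform convergence: the sets
  \<open>{\<omega>'. \<forall>t\<in>{0..T}. \<bar>\<omega>' t - \<omega> t\<bar> < e}\<close> form a neighbourhood base of \<open>\<omega>\<close>.
  The \<open>\<sigma>\<close>-algebra \<open>\<B>(\<Omega>)\<close> is then the library's \<open>borel\<close> at type \<open>cpath\<close>.\<close>

instantiation cpath :: topological_space
begin

definition open_cpath :: "cpath set \<Rightarrow> bool" where
  "open_cpath U \<longleftrightarrow> (\<forall>\<omega>\<in>U. \<exists>T e. 0 < e \<and>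
     (\<forall>\<omega>'. (\<forall>t\<in>{0..T}. \<bar>path_fun \<omega>' t - path_fun \<omega> t\<bar> < e) \<longrightarrow> \<omega>' \<in> U))"

instance
proof
  show "open (UNIV :: cpath set)"
    unfolding open_cpath_def by (auto intro: exI[of _ "1::real"])
next
  fix S U :: "cpath set"
  assume S: "open S" and U: "open U"
  show "open (S \<inter> U)"
    unfolding open_cpath_def
  proof
    fix \<omega> assume "\<omega> \<in> S \<inter> U"
    with S obtain T e where 1: "0 < e"
      "\<And>\<omega>'. (\<forall>t\<in>{0..T}. \<bar>path_fun \<omega>' t - path_fun \<omega> t\<bar> < e) \<Longrightarrow> \<omega>' \<in> S"
      unfolding open_cpath_def by blast
    from U \<open>\<omega> \<in> S \<inter> U\<close> obtain T' e' where 2: "0 < e'"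
      "\<And>\<omega>'. (\<forall>t\<in>{0..T'}. \<bar>path_fun \<omega>' t - path_fun \<omega> t\<bar> < e') \<Longrightarrow> \<omega>' \<in> U"
      unfolding open_cpath_def by blast
    have "\<omega>' \<in> S \<inter> U"
      if "\<forall>t\<in>{0..max T T'}. \<bar>path_fun \<omega>' t - path_fun \<omega> t\<bar> < min e e'" for \<omega>'
      using that by (intro IntI 1(2) 2(2)) auto
    moreover have "0 < min e e'"
      using 1(1) 2(1) by simp
    ultimately show "\<exists>T e. 0 < e \<and>
      (\<forall>\<omega>'. (\<forall>t\<in>{0..T}. \<bar>path_fun \<omega>' t - path_fun \<omega> t\<bar> < e) \<longrightarrow> \<omega>' \<in> S \<inter> U)"
      by blast
  qed
next
  fix K :: "cpath set set"
  assume "\<forall>S\<in>K. open S"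
  then show "open (\<Union>K)"
    unfolding open_cpath_def by (meson Union_iff)
qed

end

definition BM :: "real \<Rightarrow> cpath \<Rightarrow> real" where
  "BM t \<omega> = path_fun \<omega> t"


section \<open>Upper expectation, capacity, quasi-sure statements\<close>

definition path_measures :: "cpath measure set" where
  "path_measures = {Q. prob_space Q \<and> sets Q = sets borel}"

text \<open>The coarsest topology making \<open>Q \<mapsto> \<integral>f dQ\<close> continuous for every bounded continuous \<open>f\<close>;
  \<open>euclidean\<close> on the function space is the product topology.\<close>

definition weak_topology :: "cpath measure topology" where
  "weak_topology = pullback_topology path_measures
     (\<lambda>Q (f :: cpath \<Rightarrow>\<^sub>C real). \<integral>\<omega>. apply_bcontfun f \<omega> \<partial>Q) euclidean"

text \<open>The upper expectation \<open>sup E\<^sub>Q\<close>, in two versions: \<open>Ehat\<close> is used only for bounded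
  measurable arguments (where the real supremum is a genuine one), \<open>Ehat_nn\<close> for nonnegative
  ones (where it may be infinite).\<close>

definition Ehat :: "cpath measure set \<Rightarrow> (cpath \<Rightarrow> real) \<Rightarrow> real" where
  "Ehat \<P> X = (SUP Q\<in>\<P>. \<integral>\<omega>. X \<omega> \<partial>Q)"

definition Ehat_nn :: "cpath measure set \<Rightarrow> (cpath \<Rightarrow> ennreal) \<Rightarrow> ennreal" where
  "Ehat_nn \<P> X = (SUP Q\<in>\<P>. \<integral>\<^sup>+\<omega>. X \<omega> \<partial>Q)"

definition capacity :: "cpath measure set \<Rightarrow> cpath set \<Rightarrow> ennreal" where
  "capacity \<P> A = (SUP Q\<in>\<P>. emeasure Q A)"

definition polar :: "cpath measure set \<Rightarrow> cpath set \<Rightarrow> bool" where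
  "polar \<P> A \<longleftrightarrow> A \<in> sets borel \<and> capacity \<P> A = 0"

definition quasi_surely :: "cpath measure set \<Rightarrow> (cpath \<Rightarrow> bool) \<Rightarrow> bool" where
  "quasi_surely \<P> R \<longleftrightarrow> (\<exists>N. polar \<P> N \<and> (\<forall>\<omega>. \<omega> \<notin> N \<longrightarrow> R \<omega>))"

definition in_L2 :: "cpath measure set \<Rightarrow> (cpath \<Rightarrow> real) \<Rightarrow> bool" where
  "in_L2 \<P> X \<longleftrightarrow> X \<in> borel_measurable borel \<and> Ehat_nn \<P> (\<lambda>\<omega>. ennreal (\<bar>X \<omega>\<bar>\<^sup>2)) < \<infinity>"

definition L2_dist_sq :: "cpath measure set \<Rightarrow> (cpath \<Rightarrow> real) \<Rightarrow> (cpath \<Rightarrow> real) \<Rightarrow> ennreal" where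
  "L2_dist_sq \<P> X Y = Ehat_nn \<P> (\<lambda>\<omega>. ennreal (\<bar>X \<omega> - Y \<omega>\<bar>\<^sup>2))"


section \<open>The G-heat equation and the G-normal distribution\<close>

text \<open>The parameters of \<open>G_fun\<close>, \<open>viscosity_solution\<close> and \<open>G_normal\<close> are the lower and
  upper \<^emph>\<open>variances\<close>.\<close>

definition G_fun :: "real \<Rightarrow> real \<Rightarrow> real \<Rightarrow> real" where
  "G_fun v w \<alpha> = (w * max \<alpha> 0 - v * max (- \<alpha>) 0) / 2"

text \<open>\<open>C\<^sup>1\<^sup>,\<^sup>2\<close> functions on \<open>(0,\<infinity>) \<times> \<real>\<close>, together with the derivatives
  \<open>\<partial>\<^sub>t \<psi> = p\<close> and \<open>\<partial>\<^sup>2\<^sub>x\<^sub>x \<psi> = q\<close>.\<close>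

definition C12_test :: "(real \<times> real \<Rightarrow> real) \<Rightarrow> (real \<times> real \<Rightarrow> real) \<Rightarrow> (real \<times> real \<Rightarrow> real) \<Rightarrow> bool"
  where
  "C12_test \<psi> p q \<longleftrightarrow> (\<exists>r.
     (\<forall>t>0. \<forall>x.
        ((\<lambda>t'. \<psi> (t', x)) has_real_derivative p (t, x)) (at t) \<and>
        ((\<lambda>x'. \<psi> (t, x')) has_real_derivative r (t, x)) (at x) \<and>
        ((\<lambda>x'. r (t, x')) has_real_derivative q (t, x)) (at x)) \<and>
     continuous_on ({0<..} \<times> UNIV) \<psi> \<and> continuous_on ({0<..} \<times> UNIV) p \<and>
     continuous_on ({0<..} \<times> UNIV) r \<and> continuous_on ({0<..} \<times> UNIV) q)"

text \<open>\<open>u\<close> solves \<open>\<partial>\<^sub>t u = G(\<partial>\<^sup>2\<^sub>x\<^sub>x u)\<close>, \<open>u(0,\<cdot>) = \<phi>\<close>: test functions touching \<open>u\<close> from above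
  give the subsolution property, those touching from below the supersolution property.\<close>

definition viscosity_solution ::
  "real \<Rightarrow> real \<Rightarrow> (real \<Rightarrow> real) \<Rightarrow> (real \<times> real \<Rightarrow> real) \<Rightarrow> bool" where
  "viscosity_solution v w \<phi> u \<longleftrightarrow>
     continuous_on ({0..} \<times> UNIV) u \<and> (\<forall>x. u (0, x) = \<phi> x) \<and>
     (\<forall>\<psi> p q. C12_test \<psi> p q \<longrightarrow> (\<forall>t>0. \<forall>x. u (t, x) = \<psi> (t, x) \<longrightarrow>
        ((\<forall>s>0. \<forall>y. u (s, y) \<le> \<psi> (s, y)) \<longrightarrow> p (t, x) \<le> G_fun v w (q (t, x))) \<and>
        ((\<forall>s>0. \<forall>y. \<psi> (s, y) \<le> u (s, y)) \<longrightarrow> p (t, x) \<ge> G_fun v w (q (t, x)))))"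

definition bounded_Lipschitz :: "(real \<Rightarrow> real) \<Rightarrow> bool" where
  "bounded_Lipschitz \<phi> \<longleftrightarrow> bounded (range \<phi>) \<and> (\<exists>K. K-lipschitz_on UNIV \<phi>)"

definition G_normal :: "cpath measure set \<Rightarrow> real \<Rightarrow> real \<Rightarrow> (cpath \<Rightarrow> real) \<Rightarrow> bool" where
  "G_normal \<P> v w \<xi> \<longleftrightarrow> (\<forall>\<phi>. bounded_Lipschitz \<phi> \<longrightarrow>
     viscosity_solution v w \<phi> (\<lambda>(t, x). Ehat \<P> (\<lambda>\<omega>. \<phi> (x + sqrt t * \<xi> \<omega>))))"


section \<open>Independence and G-Brownian motion\<close>

text \<open>Bounded Lipschitz functions on \<open>\<real>\<^sup>n \<times> \<real>\<close>; a vector of \<open>\<real>\<^sup>n\<close> is a list of length \<open>n\<close>,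
  and the values on lists of other lengths are irrelevant.\<close>

definition bounded_Lipschitz_vec :: "nat \<Rightarrow> (real list \<Rightarrow> real \<Rightarrow> real) \<Rightarrow> bool" where
  "bounded_Lipschitz_vec n \<phi> \<longleftrightarrow>
     (\<exists>M. \<forall>xs y. length xs = n \<longrightarrow> \<bar>\<phi> xs y\<bar> \<le> M) \<and>
     (\<exists>K. \<forall>xs xs' y y'. length xs = n \<longrightarrow> length xs' = n \<longrightarrow>
        \<bar>\<phi> xs y - \<phi> xs' y'\<bar> \<le> K * ((\<Sum>i<n. \<bar>xs ! i - xs' ! i\<bar>) + \<bar>y - y'\<bar>))"

text \<open>\<open>Y\<close> is independent from the \<open>n\<close>-dimensional random vector \<open>X\<close>.\<close>

definition indep_from ::
  "cpath measure set \<Rightarrow> (cpath \<Rightarrow> real) \<Rightarrow> nat \<Rightarrow> (cpath \<Rightarrow> real list) \<Rightarrow> bool" where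
  "indep_from \<P> Y n X \<longleftrightarrow> (\<forall>\<phi>. bounded_Lipschitz_vec n \<phi> \<longrightarrow>
     Ehat \<P> (\<lambda>\<omega>. \<phi> (X \<omega>) (Y \<omega>)) = Ehat \<P> (\<lambda>\<omega>. Ehat \<P> (\<lambda>\<omega>'. \<phi> (X \<omega>) (Y \<omega>'))))"

text \<open>\<open>BM\<close> is a G-Brownian motion under \<open>Ehat \<P>\<close>; \<open>BM 0 = 0\<close> holds by definition of the
  path space.\<close>

definition G_Brownian :: "real \<Rightarrow> real \<Rightarrow> cpath measure set \<Rightarrow> bool" where
  "G_Brownian \<sigma>l \<sigma>u \<P> \<longleftrightarrow> (\<forall>t\<ge>0. \<forall>s\<ge>0.
     G_normal \<P> (\<sigma>l\<^sup>2 * s) (\<sigma>u\<^sup>2 * s) (\<lambda>\<omega>. BM (t + s) \<omega> - BM t \<omega>) \<and>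
     (\<forall>ts. sorted ts \<and> set ts \<subseteq> {0..t} \<longrightarrow>
        indep_from \<P> (\<lambda>\<omega>. BM (t + s) \<omega> - BM t \<omega>) (length ts) (\<lambda>\<omega>. map (\<lambda>r. BM r \<omega>) ts)))"

definition represents_G_expectation :: "real \<Rightarrow> real \<Rightarrow> cpath measure set \<Rightarrow> bool" where
  "represents_G_expectation \<sigma>l \<sigma>u \<P> \<longleftrightarrow>
     \<P> \<noteq> {} \<and> compactin weak_topology \<P> \<and> G_Brownian \<sigma>l \<sigma>u \<P>"


section \<open>Quadratic variation and local time\<close>

definition partition_of :: "real \<Rightarrow> real list \<Rightarrow> bool" where
  "partition_of t ts \<longleftrightarrow> ts \<noteq> [] \<and> hd ts = 0 \<and> last ts = t \<and> sorted_wrt (<) ts"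

definition mesh_less :: "real list \<Rightarrow> real \<Rightarrow> bool" where
  "mesh_less ts \<delta> \<longleftrightarrow> (\<forall>i. Suc i < length ts \<longrightarrow> ts ! Suc i - ts ! i < \<delta>)"

definition qv_sum :: "real list \<Rightarrow> cpath \<Rightarrow> real" where
  "qv_sum ts \<omega> = (\<Sum>i<length ts - 1. (BM (ts ! Suc i) \<omega> - BM (ts ! i) \<omega>)\<^sup>2)"

text \<open>\<open>A\<close> is a (q.s. continuous and increasing) version of the quadratic variation process
  \<open>(\<langle>B\<rangle>\<^sub>t)\<^sub>t\<^sub>\<ge>\<^sub>0\<close>.\<close>

definition quadratic_variation :: "cpath measure set \<Rightarrow> (real \<Rightarrow> cpath \<Rightarrow> real) \<Rightarrow> bool" where
  "quadratic_variation \<P> A \<longleftrightarrow>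
     (\<forall>t\<ge>0. in_L2 \<P> (A t) \<and>
        (\<forall>\<epsilon>>0. \<exists>\<delta>>0. \<forall>ts. partition_of t ts \<and> mesh_less ts \<delta> \<longrightarrow>
           L2_dist_sq \<P> (qv_sum ts) (A t) < \<epsilon>)) \<and>
     quasi_surely \<P> (\<lambda>\<omega>. continuous_on {0..} (\<lambda>t. A t \<omega>) \<and> mono_on {0..} (\<lambda>t. A t \<omega>))"

text \<open>\<open>\<integral>\<^sub>0\<^sup>t f(s) dA\<^sub>s(\<omega>)\<close> as a pathwise Lebesgue--Stieltjes integral; \<open>A\<close> is extended
  constantly to negative times. The value is meaningful only for those \<open>\<omega>\<close> for which
  \<open>A\<close> is continuous and increasing, i.e. quasi-surely.\<close>

definition integral_dA ::
  "(real \<Rightarrow> cpath \<Rightarrow> real) \<Rightarrow> real \<Rightarrow> (real \<Rightarrow> real) \<Rightarrow> cpath \<Rightarrow> real" where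
  "integral_dA A t f \<omega> =
     (LINT s:{0..t}|interval_measure (\<lambda>s. A (max 0 s) \<omega>). f s)"

text \<open>\<open>L a t\<close> is, for every \<open>a\<close> and \<open>t \<ge> 0\<close>, a version of the local time \<open>L\<^sup>a\<^sub>t\<close>.\<close>

definition local_time ::
  "cpath measure set \<Rightarrow> (real \<Rightarrow> cpath \<Rightarrow> real) \<Rightarrow> (real \<Rightarrow> real \<Rightarrow> cpath \<Rightarrow> real) \<Rightarrow> bool" where
  "local_time \<P> A L \<longleftrightarrow> (\<forall>a. \<forall>t\<ge>0. in_L2 \<P> (L a t) \<and>
     ((\<lambda>\<epsilon>. L2_dist_sq \<P>
         (\<lambda>\<omega>. 1 / (2 * \<epsilon>) * integral_dA A t (\<lambda>s. indicator {a - \<epsilon><..<a + \<epsilon>} (BM s \<omega>)) \<omega>)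
         (L a t)) \<longlongrightarrow> 0) (at_right 0))"


section \<open>Modifications and Hoelder continuity\<close>

definition modification ::
  "cpath measure set \<Rightarrow> real \<Rightarrow> (real \<Rightarrow> real \<Rightarrow> cpath \<Rightarrow> real) \<Rightarrow>
   (real \<Rightarrow> real \<Rightarrow> cpath \<Rightarrow> real) \<Rightarrow> bool" where
  "modification \<P> T X X' \<longleftrightarrow> (\<forall>a. \<forall>t\<in>{0..T}.
     X' a t \<in> borel_measurable borel \<and> quasi_surely \<P> (\<lambda>\<omega>. X' a t \<omega> = X a t \<omega>))"

definition hoelder_on :: "real \<Rightarrow> 'a::metric_space set \<Rightarrow> ('a \<Rightarrow> 'b::metric_space) \<Rightarrow> bool" where
  "hoelder_on \<gamma> S f \<longleftrightarrow> (\<exists>C. \<forall>x\<in>S. \<forall>y\<in>S. dist (f x) (f y) \<le> C * dist x y powr \<gamma>)"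

end

(*
  A set is polar iff it is null under every Q in the representing family, so one may fix Q and
  let all constants depend on it. Comparing the viscosity solution with the strict supersolutions
  a x + b cosh(l x) exp(c t) bounds the moments of the increments of B and, through independence,
  shows that B is a martingale under Q. For a smooth f with antiderivatives F1' = f, F2' = F1, a
  discrete Ito formula writes the integral of f(B) against the quadratic variation as
  2 (F2(B_t) - F2(B_s)) minus twice the stochastic integral of F1(B). If f approximates
  (1/2e)(1_(a-e,a+e) - 1_(b-e,b+e)), then F1 is bounded by 1 and lives on an interval of length
  |b - a| + 2e; two applications of the formula, together with a Burkholder type inequality, give
  E|L^a_t - L^b_t|^(4r) = O(|a - b|^(2r)), and similarly in time, for all large r. Kolmogorov's
  chaining argument over dyadic points then yields the modification, which is globally Hoelder
  because local time vanishes outside the compact range of the path.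
*)
theory Submission
  imports Defs
begin

section \<open>Taylor remainders of powers, weighted Young inequalities and the power series of
  cosh\<close>

section \<open>Elementary inequalities\<close>

text \<open>No continuous-time stochastic integral is formed. Under a fixed \<open>Q\<close> only
  finite sums over equidistant grids occur, and the limit is taken along almost surely convergent
  subsequences with Fatou's lemma, so that only bounds have to survive. Hence moment estimates carry
  an error such as \<open>E / sqrt (real n)\<close>, where \<open>E\<close> may depend on the smooth
  integrand while the leading constant must not. Information about \<open>Q\<close> comes as
  inequalities, because an expectation under \<open>Q\<close> is merely dominated by the sublinear
  one; the martingale identity results from applying them to both signs. Moments of order
  \<open>4 * r\<close> of size \<open>h ^ (2 * r)\<close> in two parameters would give Hoelder order
  up to \<open>1/2 - 1/(2r)\<close>; the chaining settles for \<open>1/2 - 1/r\<close>, which still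
  exhausts all orders below \<open>1/2\<close>. The constants depend on \<open>Q\<close>, the
  modification does not: it is read off pathwise from the values at dyadic points, on a single Borel
  set of regular paths that has full measure under every \<open>Q\<close>. This avoids uniting null
  sets over an uncountable family of measures.\<close>

lemma power_add_bound:
  "\<exists>C\<ge>0. \<forall>x y::real. \<bar>(x + y) ^ Suc n - x ^ Suc n\<bar> \<le> C * \<bar>y\<bar> * (\<bar>x\<bar> + \<bar>y\<bar>) ^ n"
proof (induction n)
  case 0
  show ?case by (rule exI[of _ 1]) auto
next
  case (Suc n)
  then obtain C where C: "C \<ge> 0"
    "\<And>x y::real. \<bar>(x + y) ^ Suc n - x ^ Suc n\<bar> \<le> C * \<bar>y\<bar> * (\<bar>x\<bar> + \<bar>y\<bar>) ^ n" by blast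
  have "\<bar>(x + y) ^ Suc (Suc n) - x ^ Suc (Suc n)\<bar> \<le> (C + 1) * \<bar>y\<bar> * (\<bar>x\<bar> + \<bar>y\<bar>) ^ Suc n" for x y :: real
  proof -
    have "(x + y) ^ Suc (Suc n) - x ^ Suc (Suc n) = (x + y) * ((x + y) ^ Suc n - x ^ Suc n) + y * x ^ Suc n"
      by (simp add: algebra_simps)
    then have "\<bar>(x + y) ^ Suc (Suc n) - x ^ Suc (Suc n)\<bar>
        \<le> \<bar>x + y\<bar> * \<bar>(x + y) ^ Suc n - x ^ Suc n\<bar> + \<bar>y\<bar> * \<bar>x\<bar> ^ Suc n"
      by (metis abs_mult abs_triangle_ineq power_abs)
    also have "\<dots> \<le> (\<bar>x\<bar> + \<bar>y\<bar>) * (C * \<bar>y\<bar> * (\<bar>x\<bar> + \<bar>y\<bar>) ^ n) + \<bar>y\<bar> * (\<bar>x\<bar> + \<bar>y\<bar>) ^ Suc n"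
      using C by (intro add_mono mult_mono power_mono) auto
    also have "\<dots> = (C + 1) * \<bar>y\<bar> * (\<bar>x\<bar> + \<bar>y\<bar>) ^ Suc n" by (simp add: algebra_simps)
    finally show ?thesis .
  qed
  with C(1) show ?case by (intro exI[of _ "C + 1"]) auto
qed

lemma power_add_bound2:
  "\<exists>C\<ge>0. \<forall>x y::real. \<bar>(x + y) ^ (n + 2) - x ^ (n + 2) - real (n + 2) * x ^ (n + 1) * y\<bar>
     \<le> C * y\<^sup>2 * (\<bar>x\<bar> + \<bar>y\<bar>) ^ n"
proof (induction n)
  case 0
  show ?case by (rule exI[of _ 1]) (auto simp: power2_eq_square algebra_simps)
next
  case (Suc n)
  then obtain C where C: "C \<ge> 0"
    "\<And>x y::real. \<bar>(x + y) ^ (n + 2) - x ^ (n + 2) - real (n + 2) * x ^ (n + 1) * y\<bar>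
      \<le> C * y\<^sup>2 * (\<bar>x\<bar> + \<bar>y\<bar>) ^ n" by blast
  have "\<bar>(x + y) ^ (Suc n + 2) - x ^ (Suc n + 2) - real (Suc n + 2) * x ^ (Suc n + 1) * y\<bar>
      \<le> (C + real (n + 2)) * y\<^sup>2 * (\<bar>x\<bar> + \<bar>y\<bar>) ^ Suc n" for x y :: real
  proof -
    let ?R = "(x + y) ^ (n + 2) - x ^ (n + 2) - real (n + 2) * x ^ (n + 1) * y"
    have "(x + y) ^ (Suc n + 2) - x ^ (Suc n + 2) - real (Suc n + 2) * x ^ (Suc n + 1) * y
        = (x + y) * ?R + real (n + 2) * y\<^sup>2 * x ^ Suc n"
      by (simp add: algebra_simps power2_eq_square)
    then have "\<bar>(x + y) ^ (Suc n + 2) - x ^ (Suc n + 2) - real (Suc n + 2) * x ^ (Suc n + 1) * y\<bar>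
        \<le> \<bar>(x + y) * ?R\<bar> + \<bar>real (n + 2) * y\<^sup>2 * x ^ Suc n\<bar>"
      by (metis abs_triangle_ineq)
    also have "\<dots> = \<bar>x + y\<bar> * \<bar>?R\<bar> + real (n + 2) * y\<^sup>2 * \<bar>x\<bar> ^ Suc n"
      by (simp only: abs_mult power_abs) simp
    also have "\<dots> \<le> (\<bar>x\<bar> + \<bar>y\<bar>) * (C * y\<^sup>2 * (\<bar>x\<bar> + \<bar>y\<bar>) ^ n)
        + real (n + 2) * y\<^sup>2 * (\<bar>x\<bar> + \<bar>y\<bar>) ^ Suc n"
    proof (rule add_mono)
      show "\<bar>x + y\<bar> * \<bar>?R\<bar> \<le> (\<bar>x\<bar> + \<bar>y\<bar>) * (C * y\<^sup>2 * (\<bar>x\<bar> + \<bar>y\<bar>) ^ n)"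
        by (rule mult_mono[OF abs_triangle_ineq C(2)]) simp_all
      show "real (n + 2) * y\<^sup>2 * \<bar>x\<bar> ^ Suc n \<le> real (n + 2) * y\<^sup>2 * (\<bar>x\<bar> + \<bar>y\<bar>) ^ Suc n"
        by (rule mult_left_mono, rule power_mono) simp_all
    qed
    also have "\<dots> = (C + real (n + 2)) * y\<^sup>2 * (\<bar>x\<bar> + \<bar>y\<bar>) ^ Suc n" by (simp add: algebra_simps)
    finally show ?thesis .
  qed
  with C(1) show ?case by (intro exI[of _ "C + real (n + 2)"]) auto
qed

lemma power_add_bound3:
  "\<exists>C\<ge>0. \<forall>x y::real. \<bar>(x + y) ^ (n + 3) - x ^ (n + 3) - real (n + 3) * x ^ (n + 2) * y
       - real (n + 3) * real (n + 2) / 2 * x ^ (n + 1) * y\<^sup>2\<bar>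
     \<le> C * \<bar>y\<bar> ^ 3 * (\<bar>x\<bar> + \<bar>y\<bar>) ^ n"
proof (induction n)
  case 0
  have "(x + y) ^ (0 + 3) - x ^ (0 + 3) - real (0 + 3) * x ^ (0 + 2) * y
       - real (0 + 3) * real (0 + 2) / 2 * x ^ (0 + 1) * y\<^sup>2 = y ^ 3" for x y :: real
    by (simp add: power2_eq_square power3_eq_cube algebra_simps)
  then show ?case by (intro exI[of _ 1]) (auto simp: power_abs)
next
  case (Suc n)
  then obtain C where C: "C \<ge> 0"
    "\<And>x y::real. \<bar>(x + y) ^ (n + 3) - x ^ (n + 3) - real (n + 3) * x ^ (n + 2) * y
       - real (n + 3) * real (n + 2) / 2 * x ^ (n + 1) * y\<^sup>2\<bar>
     \<le> C * \<bar>y\<bar> ^ 3 * (\<bar>x\<bar> + \<bar>y\<bar>) ^ n" by blast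
  let ?c = "real (n + 3) * real (n + 2) / 2"
  have "\<bar>(x + y) ^ (Suc n + 3) - x ^ (Suc n + 3) - real (Suc n + 3) * x ^ (Suc n + 2) * y
       - real (Suc n + 3) * real (Suc n + 2) / 2 * x ^ (Suc n + 1) * y\<^sup>2\<bar>
      \<le> (C + ?c) * \<bar>y\<bar> ^ 3 * (\<bar>x\<bar> + \<bar>y\<bar>) ^ Suc n" for x y :: real
  proof -
    let ?R = "(x + y) ^ (n + 3) - x ^ (n + 3) - real (n + 3) * x ^ (n + 2) * y - ?c * x ^ (n + 1) * y\<^sup>2"
    define X where "X = x ^ n"
    define Z where "Z = (x + y) ^ n"
    have e: "(x + y) ^ (Suc n + 3) - x ^ (Suc n + 3) - real (Suc n + 3) * x ^ (Suc n + 2) * y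
       - real (Suc n + 3) * real (Suc n + 2) / 2 * x ^ (Suc n + 1) * y\<^sup>2
        = (x + y) * ?R + ?c * y ^ 3 * x ^ Suc n"
      by (simp add: power_add X_def[symmetric] Z_def[symmetric] numeral_eq_Suc algebra_simps add_divide_distrib)
    have "\<bar>(x + y) ^ (Suc n + 3) - x ^ (Suc n + 3) - real (Suc n + 3) * x ^ (Suc n + 2) * y
       - real (Suc n + 3) * real (Suc n + 2) / 2 * x ^ (Suc n + 1) * y\<^sup>2\<bar>
        \<le> \<bar>(x + y) * ?R\<bar> + \<bar>?c * y ^ 3 * x ^ Suc n\<bar>"
      unfolding e by (rule abs_triangle_ineq)
    also have "\<dots> = \<bar>x + y\<bar> * \<bar>?R\<bar> + ?c * \<bar>y\<bar> ^ 3 * \<bar>x\<bar> ^ Suc n"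
      by (simp only: abs_mult power_abs abs_divide) simp
    also have "\<dots> \<le> (\<bar>x\<bar> + \<bar>y\<bar>) * (C * \<bar>y\<bar> ^ 3 * (\<bar>x\<bar> + \<bar>y\<bar>) ^ n)
        + ?c * \<bar>y\<bar> ^ 3 * (\<bar>x\<bar> + \<bar>y\<bar>) ^ Suc n"
    proof (rule add_mono)
      show "\<bar>x + y\<bar> * \<bar>?R\<bar> \<le> (\<bar>x\<bar> + \<bar>y\<bar>) * (C * \<bar>y\<bar> ^ 3 * (\<bar>x\<bar> + \<bar>y\<bar>) ^ n)"
        by (rule mult_mono[OF abs_triangle_ineq C(2)]) simp_all
      show "?c * \<bar>y\<bar> ^ 3 * \<bar>x\<bar> ^ Suc n \<le> ?c * \<bar>y\<bar> ^ 3 * (\<bar>x\<bar> + \<bar>y\<bar>) ^ Suc n"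
        by (rule mult_left_mono, rule power_mono) simp_all
    qed
    also have "\<dots> = (C + ?c) * \<bar>y\<bar> ^ 3 * (\<bar>x\<bar> + \<bar>y\<bar>) ^ Suc n" by (simp add: algebra_simps)
    finally show ?thesis .
  qed
  with C(1) show ?case by (intro exI[of _ "C + ?c"]) auto
qed

lemma add_power_le:
  fixes a b :: real
  assumes "0 \<le> a" "0 \<le> b"
  shows "(a + b) ^ k \<le> 2 ^ k * (a ^ k + b ^ k)"
proof -
  have "(a + b) ^ k \<le> (2 * max a b) ^ k" using assms by (intro power_mono) auto
  also have "\<dots> = 2 ^ k * (max a b) ^ k" by (simp add: power_mult_distrib)
  also have "(max a b) ^ k \<le> a ^ k + b ^ k" using assms by (auto simp: max_def)
  finally show ?thesis by simp
qed

text \<open>Split by which of \<open>a\<close> and \<open>N * b\<close> is larger. The weight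
  \<open>N\<close> decides which term is cheap: it is the number of grid points when increments are
  accumulated, and a fixed constant when a term is to be absorbed.\<close>

lemma Young_power:
  fixes a b N :: real
  assumes "0 \<le> a" "0 \<le> b" "0 < N"
  shows "a ^ k * b \<le> a ^ Suc k / N + N ^ k * b ^ Suc k"
proof (cases "N * b \<le> a")
  case True
  then have "b \<le> a / N" using assms by (simp add: field_simps)
  then have "a ^ k * b \<le> a ^ k * (a / N)" using assms by (intro mult_left_mono) auto
  also have "\<dots> \<le> a ^ Suc k / N + N ^ k * b ^ Suc k" using assms by (simp add: field_simps)
  finally show ?thesis .
next
  case False
  then have "a ^ k * b \<le> (N * b) ^ k * b" using assms by (intro mult_right_mono power_mono) auto
  also have "\<dots> \<le> a ^ Suc k / N + N ^ k * b ^ Suc k"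
    using assms by (simp add: power_mult_distrib mult_ac)
  finally show ?thesis .
qed

lemma sum_le_cosh:
  fixes x :: real
  assumes "finite I"
  shows "(\<Sum>n\<in>I. if even n then x ^ n /\<^sub>R fact n else 0) \<le> cosh x"
proof -
  have "(\<Sum>n\<in>I. if even n then x ^ n /\<^sub>R fact n else 0) \<le> (\<Sum>n. if even n then x ^ n /\<^sub>R fact n else 0)"
    by (rule sum_le_suminf[OF sums_summable[OF cosh_converges[of x]] assms]) (auto simp: zero_le_even_power)
  then show ?thesis unfolding sums_unique[OF cosh_converges[of x], symmetric] .
qed

text \<open>A single term of the cosh series; it turns exponential barriers into bounds for all even
  moments.\<close>

lemma power_le_fact_cosh: "x ^ (2 * m) \<le> fact (2 * m) * cosh (x::real)"
  using sum_le_cosh[of "{2 * m}" x] by (simp add: field_simps)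

section \<open>Exponential barriers for the G-heat equation\<close>

section \<open>Comparison with smooth supersolutions\<close>

lemma continuous_on_BM: "continuous_on UNIV (BM t)"
proof (cases "t \<ge> 0")
  case True
  show ?thesis
    unfolding continuous_on_open_vimage[OF open_UNIV]
  proof (intro allI impI)
    fix U :: "real set" assume U: "open U"
    show "open (BM t -` U \<inter> UNIV)"
      unfolding open_cpath_def
    proof
      fix \<omega> assume "\<omega> \<in> BM t -` U \<inter> UNIV"
      then obtain e where e: "e > 0" "ball (BM t \<omega>) e \<subseteq> U"
        using U openE by (metis Int_iff vimageE)
      show "\<exists>T e. 0 < e \<and> (\<forall>\<omega>'. (\<forall>t\<in>{0..T}. \<bar>path_fun \<omega>' t - path_fun \<omega> t\<bar> < e) \<longrightarrow> \<omega>' \<in> BM t -` U \<inter> UNIV)"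
      proof (rule exI[of _ t], rule exI[of _ e], intro conjI allI impI e(1))
        fix \<omega>' assume "\<forall>t'\<in>{0..t}. \<bar>path_fun \<omega>' t' - path_fun \<omega> t'\<bar> < e"
        then have "\<bar>BM t \<omega>' - BM t \<omega>\<bar> < e" using True by (auto simp: BM_def)
        then have "BM t \<omega>' \<in> ball (BM t \<omega>) e" by (simp add: dist_real_def abs_minus_commute)
        then show "\<omega>' \<in> BM t -` U \<inter> UNIV" using e(2) by auto
      qed
    qed
  qed
next
  case False
  then have "BM t = (\<lambda>_. 0)"
    using path_fun by (force simp: BM_def)
  then show ?thesis by simp
qed

lemma borel_measurable_BM [measurable]: "BM t \<in> borel_measurable borel"
  by (rule borel_measurable_continuous_onI[OF continuous_on_BM])

lemma continuous_on_path: "continuous_on {0..} (\<lambda>t. BM t \<omega>)"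
  using path_fun[of \<omega>] by (simp add: BM_def)

text \<open>The right-hand side is a strict supersolution which tends to infinity in all directions, so
  the difference would attain a positive maximum at a positive time.\<close>

lemma viscosity_solution_le_cosh:
  assumes vs: "viscosity_solution v w \<phi> u"
    and bd: "\<And>t x. t \<ge> 0 \<Longrightarrow> u (t, x) \<le> K"
    and w: "0 \<le> w" and \<beta>: "0 < \<beta>" and lam: "lam \<noteq> 0"
    and init: "\<And>x. \<phi> x \<le> \<alpha> * x + \<beta> * cosh (lam * x)"
    and t: "t \<ge> 0"
  shows "u (t, x) \<le> \<alpha> * x + \<beta> * cosh (lam * x) * exp ((lam\<^sup>2 * w / 2 + 1) * t)"
proof (rule ccontr)
  \<comment> \<open>The summand \<open>1\<close> makes the supersolution strict: it is the surplus
    of the time derivative over \<open>w / 2\<close> times the second space derivative.\<close>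
  define c where "c = lam\<^sup>2 * w / 2 + 1"
  define W where "W = (\<lambda>(t, x). \<alpha> * x + \<beta> * cosh (lam * x) * exp (c * t))"
  define \<gamma> where "\<gamma> = \<beta> * lam\<^sup>2 / 2"
  have \<gamma>: "\<gamma> > 0" using \<beta> lam by (simp add: \<gamma>_def)
  have c: "c \<ge> 1" using w by (simp add: c_def)
  define D where "D = (\<lambda>p. u p - W p)"
  assume "\<not> ?thesis"
  then have D1: "D (t, x) > 0" by (simp add: D_def W_def c_def)
  \<comment> \<open>The quadratic growth of cosh beats the linear term and the exponential gives
    growth in time, so \<open>W\<close> exceeds the bounded \<open>u\<close> outside a compact
    set.\<close>
  have W_ge: "W (s, y) \<ge> \<gamma> * y\<^sup>2 / 2 - \<alpha>\<^sup>2 / (2 * \<gamma>) + \<beta> * s" if "s \<ge> 0" for s y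
  proof -
    have "cosh (lam * y) \<ge> 1 + (lam * y)\<^sup>2 / 2"
      using sum_le_cosh[of "{0, 2}" "lam * y"] by simp
    moreover have "exp (c * s) \<ge> 1 + s"
    proof -
      have "1 * s \<le> c * s" using c that by (intro mult_right_mono) auto
      then show ?thesis using exp_ge_add_one_self[of "c * s"] by linarith
    qed
    ultimately have "cosh (lam * y) * exp (c * s) \<ge> (1 + (lam * y)\<^sup>2 / 2) * (1 + s)"
      by (rule mult_mono) (simp_all add: that)
    moreover have "(1 + (lam * y)\<^sup>2 / 2) * (1 + s) \<ge> (lam * y)\<^sup>2 / 2 + s"
    proof -
      have "(lam * y)\<^sup>2 / 2 * s \<ge> 0" using that by simp
      moreover have "(1 + (lam * y)\<^sup>2 / 2) * (1 + s) = 1 + s + (lam * y)\<^sup>2 / 2 + (lam * y)\<^sup>2 / 2 * s"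
        by (simp add: distrib_left distrib_right)
      ultimately show ?thesis by linarith
    qed
    ultimately have "\<beta> * (cosh (lam * y) * exp (c * s)) \<ge> \<beta> * ((lam * y)\<^sup>2 / 2 + s)"
      using \<beta> by (intro mult_left_mono) linarith+
    also have "\<beta> * ((lam * y)\<^sup>2 / 2 + s) = \<gamma> * y\<^sup>2 + \<beta> * s"
      by (simp add: \<gamma>_def power_mult_distrib distrib_left)
    finally have 1: "\<beta> * (cosh (lam * y) * exp (c * s)) \<ge> \<gamma> * y\<^sup>2 + \<beta> * s" .
    \<comment> \<open>Completing the square absorbs the linear term at the price of half of the
      quadratic one.\<close>
    have "0 \<le> (\<gamma> * y + \<alpha>)\<^sup>2 / (2 * \<gamma>)" using \<gamma> by simp
    also have "(\<gamma> * y + \<alpha>)\<^sup>2 = \<gamma> * (\<gamma> * y\<^sup>2) + 2 * \<gamma> * (\<alpha> * y) + \<alpha>\<^sup>2"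
      by (simp add: power2_eq_square algebra_simps)
    also have "\<dots> / (2 * \<gamma>) = \<gamma> * y\<^sup>2 / 2 + \<alpha> * y + \<alpha>\<^sup>2 / (2 * \<gamma>)"
      using \<gamma> by (simp add: add_divide_distrib)
    finally show ?thesis using 1 by (simp add: W_def mult.assoc)
  qed
  define K' where "K' = \<bar>K\<bar> + \<alpha>\<^sup>2 / (2 * \<gamma>)"
  define S where "S = {0..K' / \<beta>} \<times> {- (1 + 2 * K' / \<gamma>)..1 + 2 * K' / \<gamma>}"
  have K': "K' \<ge> 0" using \<gamma> by (simp add: K'_def)
  have in_S: "(s, y) \<in> S" if "s \<ge> 0" "D (s, y) > 0" for s y
  proof -
    have *: "\<gamma> * y\<^sup>2 / 2 + \<beta> * s \<le> K'"
      using W_ge[OF that(1), of y] that(2) bd[OF that(1), of y] by (simp add: D_def K'_def)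
    have "\<beta> * s \<le> K'" "\<gamma> * y\<^sup>2 / 2 \<le> K'"
    proof -
      have "0 \<le> \<gamma> * y\<^sup>2 / 2" "0 \<le> \<beta> * s" using \<gamma> \<beta> that(1) by simp_all
      then show "\<beta> * s \<le> K'" "\<gamma> * y\<^sup>2 / 2 \<le> K'" using * by linarith+
    qed
    then have "s \<le> K' / \<beta>" "y\<^sup>2 \<le> 2 * K' / \<gamma>"
      using \<beta> \<gamma> by (simp_all add: pos_le_divide_eq mult.commute)
    moreover have "\<bar>y\<bar> \<le> 1 + y\<^sup>2"
    proof -
      have "0 \<le> (\<bar>y\<bar> - 1)\<^sup>2" by simp
      also have "\<dots> = y\<^sup>2 - 2 * \<bar>y\<bar> + 1" by (simp add: power2_diff)
      finally show ?thesis by linarith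
    qed
    ultimately have "s \<in> {0..K' / \<beta>}" "y \<in> {- (1 + 2 * K' / \<gamma>)..1 + 2 * K' / \<gamma>}"
      using that(1) unfolding atLeastAtMost_iff by linarith+
    then show ?thesis unfolding S_def by (rule SigmaI)
  qed
  have ucont: "continuous_on ({0..} \<times> UNIV) u" and u0: "\<And>x. u (0, x) = \<phi> x"
    using vs by (auto simp: viscosity_solution_def)
  have "compact S" unfolding S_def by (intro compact_Times) auto
  moreover have "continuous_on S D"
  proof -
    have "continuous_on S W"
      unfolding W_def case_prod_unfold by (intro continuous_intros)
    moreover have "S \<subseteq> {0..} \<times> UNIV" unfolding S_def by (intro Sigma_mono) simp_all
    ultimately show ?thesis
      unfolding D_def by (intro continuous_on_diff continuous_on_subset[OF ucont])
  qed
  moreover have "S \<noteq> {}" using in_S[OF t D1] by auto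
  ultimately have "\<exists>p0\<in>S. \<forall>p\<in>S. D p \<le> D p0"
    by (intro continuous_attains_sup)
  then obtain p0 where p0: "p0 \<in> S" "\<And>p. p \<in> S \<Longrightarrow> D p \<le> D p0"
    by auto
  obtain t0 x0 where tx: "p0 = (t0, x0)" by force
  have pos: "D (t0, x0) > 0" using p0(2)[OF in_S[OF t D1]] D1 tx by simp
  have glob: "D (s, y) \<le> D (t0, x0)" if "s \<ge> 0" for s y
  proof (cases "D (s, y) > 0")
    case True
    then show ?thesis using p0(2)[OF in_S[OF that True]] tx by simp
  next
    case False
    then show ?thesis using pos by linarith
  qed
  have t0: "t0 \<ge> 0" using p0(1) tx unfolding S_def by simp
  have "t0 \<noteq> 0"
  proof
    assume "t0 = 0"
    then have "D (t0, x0) = \<phi> x0 - (\<alpha> * x0 + \<beta> * cosh (lam * x0))"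
      by (simp add: D_def W_def u0)
    then show False using pos init[of x0] by linarith
  qed
  with t0 have t0: "t0 > 0" by simp
  \<comment> \<open>Adding the maximal difference \<open>m\<close> lifts \<open>W\<close> to a test
    function that touches \<open>u\<close> from above at the maximum, without changing any
    derivative.\<close>
  define m where "m = D (t0, x0)"
  define \<psi> where "\<psi> = (\<lambda>(t, x). \<alpha> * x + \<beta> * cosh (lam * x) * exp (c * t) + m)"
  define p where "p = (\<lambda>(t, x). \<beta> * cosh (lam * x) * exp (c * t) * c)"
  define r where "r = (\<lambda>(t, x). \<alpha> + \<beta> * lam * sinh (lam * x) * exp (c * t))"
  define q where "q = (\<lambda>(t, x). \<beta> * lam\<^sup>2 * cosh (lam * x) * exp (c * t))"
  have "C12_test \<psi> p q"
    unfolding C12_test_def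
  proof (intro exI[of _ r] conjI allI impI)
    fix t x :: real
    show "((\<lambda>t'. \<psi> (t', x)) has_real_derivative p (t, x)) (at t)"
      unfolding \<psi>_def p_def by (auto intro!: derivative_eq_intros)
    show "((\<lambda>x'. \<psi> (t, x')) has_real_derivative r (t, x)) (at x)"
      unfolding \<psi>_def r_def by (auto intro!: derivative_eq_intros)
    show "((\<lambda>x'. r (t, x')) has_real_derivative q (t, x)) (at x)"
      unfolding q_def r_def by (auto intro!: derivative_eq_intros simp: power2_eq_square)
  qed (unfold \<psi>_def p_def r_def q_def case_prod_unfold, (intro continuous_intros)+)
  moreover have "u (t0, x0) = \<psi> (t0, x0)" by (simp add: \<psi>_def m_def D_def W_def)
  moreover have "\<forall>s>0. \<forall>y. u (s, y) \<le> \<psi> (s, y)"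
  proof (intro allI impI)
    fix s y :: real assume "s > 0"
    then show "u (s, y) \<le> \<psi> (s, y)" using glob[of s y] by (simp add: \<psi>_def m_def D_def W_def)
  qed
  ultimately have "p (t0, x0) \<le> G_fun v w (q (t0, x0))"
    using vs t0 unfolding viscosity_solution_def by blast
  \<comment> \<open>Positive curvature selects the branch of \<open>G_fun\<close> with the upper
    variance.\<close>
  moreover have "q (t0, x0) > 0" using \<beta> lam by (simp add: q_def)
  ultimately have "p (t0, x0) \<le> w * q (t0, x0) / 2" by (simp add: G_fun_def)
  then have "\<beta> * cosh (lam * x0) * exp (c * t0) * (c - lam\<^sup>2 * w / 2) \<le> 0"
    by (simp add: p_def q_def field_simps)
  then have "\<beta> * cosh (lam * x0) * exp (c * t0) \<le> 0" by (simp add: c_def)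
  moreover have "\<beta> * cosh (lam * x0) * exp (c * t0) > 0" using \<beta> by simp
  ultimately show False by simp
qed

section \<open>From barriers to moments of G-normal variables under one measure\<close>

section \<open>Consequences for a single representing measure\<close>

text \<open>The uniform bound \<open>K\<close> makes the integrals bounded above over the family, so
  that the real supremum is a genuine one.\<close>

lemma integral_le_Ehat:
  assumes "\<P> \<subseteq> path_measures" "Q \<in> \<P>" "X \<in> borel_measurable borel" "\<And>\<omega>. \<bar>X \<omega>\<bar> \<le> K"
  shows "(\<integral>\<omega>. X \<omega> \<partial>Q) \<le> Ehat \<P> X"
  unfolding Ehat_def
proof (rule cSUP_upper[OF assms(2)])
  have "(\<integral>\<omega>. X \<omega> \<partial>Q') \<le> K" if "Q' \<in> \<P>" for Q'
  proof -
    interpret prob_space Q' using that assms(1) by (auto simp: path_measures_def)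
    have [measurable_cong]: "sets Q' = sets borel" using that assms(1) by (auto simp: path_measures_def)
    have "integrable Q' X" using assms(3,4) by (intro integrable_const_bound[of _ K]) auto
    then show ?thesis using assms(4) by (intro integral_le_const) (auto intro: AE_I2 abs_le_D1)
  qed
  then show "bdd_above ((\<lambda>Q. \<integral>\<omega>. X \<omega> \<partial>Q) ` \<P>)" by (intro bdd_aboveI[of _ K]) auto
qed

lemma Ehat_le:
  assumes "\<P> \<noteq> {}" "\<And>Q. Q \<in> \<P> \<Longrightarrow> (\<integral>\<omega>. X \<omega> \<partial>Q) \<le> c"
  shows "Ehat \<P> X \<le> c"
  unfolding Ehat_def using assms by (intro cSUP_least)

text \<open>The barrier is evaluated at time 1 and position 0, where its linear part vanishes and
  cosh equals 1. So the slope \<open>\<alpha>\<close> is free: slope 0 yields moments, while slope 1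
  or -1 with small \<open>\<beta>\<close> shows that increments have no drift.\<close>

lemma G_normal_Ehat_le:
  assumes P: "\<P> \<noteq> {}" "\<P> \<subseteq> path_measures" and G: "G_normal \<P> v w \<xi>"
    and \<xi>: "\<xi> \<in> borel_measurable borel" and "0 \<le> w" "0 < \<beta>" "lam \<noteq> 0"
    and \<phi>: "bounded_Lipschitz \<phi>" "\<And>x. \<phi> x \<le> \<alpha> * x + \<beta> * cosh (lam * x)"
  shows "Ehat \<P> (\<lambda>\<omega>. \<phi> (\<xi> \<omega>)) \<le> \<beta> * exp (lam\<^sup>2 * w / 2 + 1)"
proof -
  define u where "u = (\<lambda>(t, x). Ehat \<P> (\<lambda>\<omega>. \<phi> (x + sqrt t * \<xi> \<omega>)))"
  have vs: "viscosity_solution v w \<phi> u"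
    using G \<phi>(1) unfolding G_normal_def u_def by blast
  obtain K where K: "\<And>x. \<bar>\<phi> x\<bar> \<le> K"
    using \<phi>(1) unfolding bounded_Lipschitz_def bounded_iff by auto
  have bd: "u (t, x) \<le> K" for t x
    unfolding u_def split
  proof (rule Ehat_le[OF P(1)])
    fix Q assume "Q \<in> \<P>"
    then interpret prob_space Q using P(2) by (auto simp: path_measures_def)
    show "(\<integral>\<omega>. \<phi> (x + sqrt t * \<xi> \<omega>) \<partial>Q) \<le> K"
    proof (cases "integrable Q (\<lambda>\<omega>. \<phi> (x + sqrt t * \<xi> \<omega>))")
      case True
      then show ?thesis using K by (intro integral_le_const) (auto intro: AE_I2 abs_le_D1)
    next
      \<comment> \<open>The integral of a non-integrable function is \<open>0\<close> by convention,
        and the bound \<open>K\<close> is nonnegative.\<close>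
      case False
      have "0 \<le> K" using K[of 0] by linarith
      then show ?thesis using not_integrable_integral_eq[OF False] by simp
    qed
  qed
  have "u (1, 0) \<le> \<alpha> * 0 + \<beta> * cosh (lam * 0) * exp ((lam\<^sup>2 * w / 2 + 1) * 1)"
    by (rule viscosity_solution_le_cosh[OF vs bd]) (use assms in auto)
  then show ?thesis by (simp add: u_def)
qed

lemma represents_G_expectationD:
  assumes "represents_G_expectation \<sigma>l \<sigma>u \<P>"
  shows "\<P> \<noteq> {}" "\<P> \<subseteq> path_measures" "G_Brownian \<sigma>l \<sigma>u \<P>"
proof -
  have "\<P> \<subseteq> topspace weak_topology"
    using assms compactin_subset_topspace unfolding represents_G_expectation_def by blast
  then show "\<P> \<subseteq> path_measures"
    by (auto simp: weak_topology_def topspace_pullback_topology)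
qed (use assms in \<open>auto simp: represents_G_expectation_def\<close>)

text \<open>G-normality speaks about bounded Lipschitz functions, so powers have to enter through
  truncations.\<close>

lemma bounded_Lipschitz_truncated_power:
  assumes "0 \<le> N"
  shows "bounded_Lipschitz (\<lambda>x. (min \<bar>x\<bar> N) ^ k)"
  unfolding bounded_Lipschitz_def
proof
  show "bounded (range (\<lambda>x::real. (min \<bar>x\<bar> N) ^ k))"
    unfolding bounded_iff using assms by (intro exI[of _ "N ^ k"]) (auto intro!: power_mono)
  show "\<exists>C. C-lipschitz_on UNIV (\<lambda>x::real. (min \<bar>x\<bar> N) ^ k)"
  proof (cases k)
    case 0
    then show ?thesis by (intro exI[of _ 0]) (auto simp: lipschitz_on_def)
  next
    case (Suc j)
    obtain C where C: "C \<ge> 0" "\<And>x y::real. \<bar>(x + y) ^ Suc j - x ^ Suc j\<bar> \<le> C * \<bar>y\<bar> * (\<bar>x\<bar> + \<bar>y\<bar>) ^ j"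
      using power_add_bound[of j] by blast
    have "dist ((min \<bar>x\<bar> N) ^ Suc j) ((min \<bar>y\<bar> N) ^ Suc j) \<le> C * (3 * N) ^ j * dist x y" for x y :: real
    proof -
      define a where "a = min \<bar>y\<bar> N"
      define b where "b = min \<bar>x\<bar> N"
      have ab: "0 \<le> a" "a \<le> N" "0 \<le> b" "b \<le> N" using assms by (auto simp: a_def b_def)
      have d: "\<bar>b - a\<bar> \<le> dist x y" unfolding a_def b_def dist_real_def by linarith
      have "\<bar>a\<bar> + \<bar>b - a\<bar> \<le> 3 * N" using ab by linarith
      then have "(\<bar>a\<bar> + \<bar>b - a\<bar>) ^ j \<le> (3 * N) ^ j" by (intro power_mono) auto
      then have "C * \<bar>b - a\<bar> * (\<bar>a\<bar> + \<bar>b - a\<bar>) ^ j \<le> C * dist x y * (3 * N) ^ j"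
        using C(1) d by (intro mult_mono mult_nonneg_nonneg) simp_all
      with C(2)[of a "b - a"] show ?thesis
        by (simp add: a_def[symmetric] b_def[symmetric] dist_real_def mult_ac)
    qed
    then show ?thesis using C(1) assms Suc
      by (intro exI[of _ "C * (3 * N) ^ j"]) (auto simp: lipschitz_on_def)
  qed
qed

text \<open>The choice \<open>lam = 1 / sqrt s\<close> cancels the scale in
  \<open>lam\<^sup>2 * (c * s)\<close>: the exponential becomes a constant and the Brownian factor
  \<open>s ^ m\<close> remains. Fatou's lemma removes the truncation.\<close>

lemma G_normal_moment:
  assumes P: "\<P> \<noteq> {}" "\<P> \<subseteq> path_measures" and G: "G_normal \<P> v (c * s) \<xi>"
    and \<xi>: "\<xi> \<in> borel_measurable borel" and c: "0 \<le> c" and s: "0 < s" and Q: "Q \<in> \<P>"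
  shows "integrable Q (\<lambda>\<omega>. \<xi> \<omega> ^ (2 * m)) \<and>
    (\<integral>\<omega>. \<xi> \<omega> ^ (2 * m) \<partial>Q) \<le> fact (2 * m) * exp (c / 2 + 1) * s ^ m"
proof -
  interpret prob_space Q using Q P(2) by (auto simp: path_measures_def)
  have [measurable_cong]: "sets Q = sets borel" using Q P(2) by (auto simp: path_measures_def)
  note [measurable] = \<xi>
  define lam where "lam = 1 / sqrt s"
  have lam: "lam \<noteq> 0" "lam\<^sup>2 = 1 / s" "lam ^ (2 * m) = 1 / s ^ m"
    using s by (simp_all add: lam_def power_mult power_divide)
  let ?C = "fact (2 * m) * s ^ m"
  have Cpos: "0 < ?C" using s by simp
  have le: "(min \<bar>x\<bar> (real N)) ^ (2 * m) \<le> 0 * x + ?C * cosh (lam * x)" for x N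
  proof -
    have "(min \<bar>x\<bar> (real N)) ^ (2 * m) \<le> \<bar>x\<bar> ^ (2 * m)" by (intro power_mono) auto
    also have "\<dots> = s ^ m * (lam * x) ^ (2 * m)" using s by (simp add: power_mult_distrib lam(3) power_even_abs)
    also have "\<dots> \<le> s ^ m * (fact (2 * m) * cosh (lam * x))"
      using s by (intro mult_left_mono power_le_fact_cosh) simp
    finally show ?thesis by (simp add: mult_ac)
  qed
  have E: "(\<integral>\<omega>. (min \<bar>\<xi> \<omega>\<bar> (real N)) ^ (2 * m) \<partial>Q) \<le> ?C * exp (c / 2 + 1)" for N
  proof -
    have "(\<integral>\<omega>. (min \<bar>\<xi> \<omega>\<bar> (real N)) ^ (2 * m) \<partial>Q) \<le> Ehat \<P> (\<lambda>\<omega>. (min \<bar>\<xi> \<omega>\<bar> (real N)) ^ (2 * m))"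
      by (rule integral_le_Ehat[OF P(2) Q, where K = "real N ^ (2 * m)"]) (auto intro!: power_mono)
    also have "\<dots> \<le> ?C * exp (lam\<^sup>2 * (c * s) / 2 + 1)"
      by (rule G_normal_Ehat_le[OF P G \<xi> _ Cpos lam(1) bounded_Lipschitz_truncated_power le])
         (use c s in auto)
    also have "lam\<^sup>2 * (c * s) / 2 = c / 2" using s by (simp add: lam(2))
    finally show ?thesis .
  qed
  have lim: "(\<lambda>N. (min \<bar>\<xi> \<omega>\<bar> (real N)) ^ (2 * m)) \<longlonglongrightarrow> \<xi> \<omega> ^ (2 * m)" for \<omega>
  proof (rule tendsto_eventually)
    obtain N0 where N0: "\<bar>\<xi> \<omega>\<bar> \<le> real N0" using real_arch_simple by blast
    show "\<forall>\<^sub>F N in sequentially. (min \<bar>\<xi> \<omega>\<bar> (real N)) ^ (2 * m) = \<xi> \<omega> ^ (2 * m)"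
      using eventually_ge_at_top[of N0]
    proof eventually_elim
      case (elim N)
      then have "min \<bar>\<xi> \<omega>\<bar> (real N) = \<bar>\<xi> \<omega>\<bar>" using N0 by linarith
      then show ?case by (simp add: power_even_abs)
    qed
  qed
  have "(\<integral>\<^sup>+\<omega>. ennreal (\<xi> \<omega> ^ (2 * m)) \<partial>Q)
      = (\<integral>\<^sup>+\<omega>. liminf (\<lambda>N. ennreal ((min \<bar>\<xi> \<omega>\<bar> (real N)) ^ (2 * m))) \<partial>Q)"
    using lim by (intro nn_integral_cong lim_imp_Liminf[symmetric] tendsto_ennrealI) auto
  also have "\<dots> \<le> liminf (\<lambda>N. \<integral>\<^sup>+\<omega>. ennreal ((min \<bar>\<xi> \<omega>\<bar> (real N)) ^ (2 * m)) \<partial>Q)"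
    by (rule nn_integral_liminf) measurable
  also have "\<dots> \<le> ennreal (?C * exp (c / 2 + 1))"
  proof (rule Liminf_le, simp, rule always_eventually, rule allI)
    fix N
    have "integrable Q (\<lambda>\<omega>. (min \<bar>\<xi> \<omega>\<bar> (real N)) ^ (2 * m))"
      by (intro integrable_const_bound[of _ "real N ^ (2 * m)"]) (auto intro!: power_mono)
    then show "(\<integral>\<^sup>+\<omega>. ennreal ((min \<bar>\<xi> \<omega>\<bar> (real N)) ^ (2 * m)) \<partial>Q) \<le> ennreal (?C * exp (c / 2 + 1))"
      using E[of N] by (subst nn_integral_eq_integral) (auto intro!: ennreal_leI)
  qed
  finally have *: "(\<integral>\<^sup>+\<omega>. ennreal (\<xi> \<omega> ^ (2 * m)) \<partial>Q) \<le> ennreal (?C * exp (c / 2 + 1))" .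
  have int: "integrable Q (\<lambda>\<omega>. \<xi> \<omega> ^ (2 * m))"
  proof (rule integrableI_bounded)
    show "(\<integral>\<^sup>+\<omega>. ennreal (norm (\<xi> \<omega> ^ (2 * m))) \<partial>Q) < \<infinity>"
      using le_less_trans[OF * ennreal_less_top] by (simp add: zero_le_even_power)
  qed simp
  with * show ?thesis
    using s by (simp add: nn_integral_eq_integral zero_le_even_power mult_ac)
qed

section \<open>Orthogonality of increments to the natural filtration of the path\<close>

section \<open>The martingale property\<close>

text \<open>Open upper orthants instead of general cylinder sets: they form a pi-system generating
  the past, and their indicators are limits of products of Lipschitz ramps, which are admissible in
  the definition of independence.\<close>

definition path_rects :: "real \<Rightarrow> cpath set set" where
  "path_rects s = {{\<omega>. \<forall>r\<in>R. c r < BM r \<omega>} | R c. finite R \<and> R \<subseteq> {0..s}}"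

definition path_filtration :: "real \<Rightarrow> cpath measure" where
  "path_filtration s = sigma UNIV (path_rects s)"

lemma space_path_filtration [simp]: "space (path_filtration s) = UNIV"
  by (simp add: path_filtration_def space_measure_of_conv)

lemma sets_path_filtration: "sets (path_filtration s) = sigma_sets UNIV (path_rects s)"
  unfolding path_filtration_def by (rule sets_measure_of) simp

lemma sets_path_filtration_mono: "s \<le> t \<Longrightarrow> sets (path_filtration s) \<subseteq> sets (path_filtration t)"
  unfolding sets_path_filtration by (rule sigma_sets_mono') (fastforce simp: path_rects_def)

lemma BM_measurable_path_filtration:
  assumes "0 \<le> r" "r \<le> s"
  shows "BM r \<in> borel_measurable (path_filtration s)"
proof -
  have "{\<omega>. a < BM r \<omega>} \<in> sets (path_filtration s)" for a
  proof -
    have "{\<omega>. a < BM r \<omega>} \<in> path_rects s"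
      unfolding path_rects_def using assms
      by (intro CollectI exI[of _ "{r}"] exI[of _ "\<lambda>_. a"]) auto
    then show ?thesis unfolding sets_path_filtration by (rule sigma_sets.Basic)
  qed
  then show ?thesis by (simp add: borel_measurable_iff_greater)
qed

lemma path_rects_borel: "path_rects s \<subseteq> sets borel"
proof
  fix A assume "A \<in> path_rects s"
  then obtain R c where R: "finite R" "A = {\<omega>. \<forall>r\<in>R. c r < BM r \<omega>}" by (auto simp: path_rects_def)
  have "Measurable.pred borel (\<lambda>\<omega>. \<forall>r\<in>R. c r < BM r \<omega>)"
    using R(1) by (intro pred_intros_finite) measurable
  then show "A \<in> sets borel" unfolding R(2) pred_def by simp
qed

lemma sets_path_filtration_borel: "sets (path_filtration s) \<subseteq> sets borel"
proof -
  have "sigma_sets (space borel) (path_rects s) \<subseteq> sets borel"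
    by (rule sets.sigma_sets_subset[OF path_rects_borel])
  then show ?thesis by (simp add: sets_path_filtration)
qed

lemma Int_stable_path_rects: "Int_stable (path_rects s)"
proof (rule Int_stableI)
  fix A A' assume "A \<in> path_rects s" "A' \<in> path_rects s"
  then obtain R c R' c' where R: "finite R" "R \<subseteq> {0..s}" "A = {\<omega>. \<forall>r\<in>R. c r < BM r \<omega>}"
    "finite R'" "R' \<subseteq> {0..s}" "A' = {\<omega>. \<forall>r\<in>R'. c' r < BM r \<omega>}"
    unfolding path_rects_def by blast
  define d where "d r = (if r \<in> R \<and> r \<in> R' then max (c r) (c' r) else if r \<in> R then c r else c' r)" for r
  have "A \<inter> A' = {\<omega>. \<forall>r\<in>R \<union> R'. d r < BM r \<omega>}"
    unfolding R(3,6) d_def by auto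
  then show "A \<inter> A' \<in> path_rects s"
    unfolding path_rects_def using R by blast
qed

definition ramp :: "nat \<Rightarrow> real \<Rightarrow> real" where
  "ramp k x = max 0 (min 1 (real k * x))"

lemma ramp_bounds: "0 \<le> ramp k x" "ramp k x \<le> 1"
  by (auto simp: ramp_def)

lemma ramp_Lipschitz: "\<bar>ramp k x - ramp k y\<bar> \<le> real k * \<bar>x - y\<bar>"
proof -
  have "\<bar>real k * x - real k * y\<bar> = real k * \<bar>x - y\<bar>"
    by (simp add: abs_mult right_diff_distrib[symmetric])
  then show ?thesis unfolding ramp_def by linarith
qed

lemma ramp_tendsto: "(\<lambda>k. ramp k x) \<longlonglongrightarrow> indicator {0<..} x"
proof (cases "x > 0")
  case True
  obtain n0 where n0: "1 / x \<le> real n0" using real_arch_simple by blast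
  have "\<forall>\<^sub>F k in sequentially. ramp k x = 1"
    using eventually_ge_at_top[of n0]
  proof eventually_elim
    case (elim k)
    then have "1 / x \<le> real k" using n0 by linarith
    then have "1 \<le> real k * x" using True by (simp add: field_simps)
    then show ?case by (simp add: ramp_def)
  qed
  then show ?thesis using True by (intro tendsto_eventually) simp
next
  case False
  then have "ramp k x = 0" for k
    using mult_nonneg_nonpos[of "real k" x] by (simp add: ramp_def)
  then show ?thesis using False by simp
qed

lemma borel_measurable_ramp [measurable]: "ramp k \<in> borel_measurable borel"
  unfolding ramp_def by measurable

definition truncate :: "real \<Rightarrow> real \<Rightarrow> real" where
  "truncate N y = max (- N) (min y N)"

lemma truncate_Lipschitz: "\<bar>truncate N x - truncate N y\<bar> \<le> \<bar>x - y\<bar>"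
  unfolding truncate_def by linarith

lemma abs_truncate_le: "0 \<le> N \<Longrightarrow> \<bar>truncate N y\<bar> \<le> N"
  unfolding truncate_def by linarith

lemma abs_truncate_le_abs: "0 \<le> N \<Longrightarrow> \<bar>truncate N y\<bar> \<le> \<bar>y\<bar>"
  unfolding truncate_def by linarith

lemma borel_measurable_truncate [measurable]: "truncate N \<in> borel_measurable borel"
  unfolding truncate_def by measurable

text \<open>Where the truncation acts, \<open>\<bar>y\<bar> > N \<ge> 2 / \<beta>\<close>, so the
  absolute value of \<open>y\<close> is below \<open>\<beta>\<close> times half its square, a
  multiple of a term of the cosh series. The truncated identity thus lies under a barrier of slope 1
  with an arbitrarily small cosh part.\<close>

lemma truncate_diff_le_cosh:
  assumes "0 < \<beta>" "2 / \<beta> \<le> N"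
  shows "\<bar>truncate N y - y\<bar> \<le> \<beta> * cosh y"
proof (cases "\<bar>y\<bar> \<le> N")
  case True
  then have "truncate N y = y" unfolding truncate_def by linarith
  then show ?thesis using assms by simp
next
  case False
  have N: "0 < N" using assms by (meson divide_pos_pos less_le_trans zero_less_numeral)
  have "\<bar>truncate N y - y\<bar> \<le> \<bar>y\<bar>" using N unfolding truncate_def by linarith
  also have "\<bar>y\<bar> * 1 \<le> \<bar>y\<bar> * (\<beta> * \<bar>y\<bar> / 2)"
  proof (rule mult_left_mono)
    have "2 \<le> N * \<beta>" using assms by (simp add: pos_divide_le_eq)
    also have "\<dots> \<le> \<bar>y\<bar> * \<beta>" using False assms(1) by (intro mult_right_mono) auto
    finally show "1 \<le> \<beta> * \<bar>y\<bar> / 2" by (simp add: mult.commute)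
  qed simp
  also have "\<bar>y\<bar> * (\<beta> * \<bar>y\<bar> / 2) = \<beta> * (y\<^sup>2 / 2)"
    by (simp add: power2_eq_square abs_mult_self_eq flip: power2_abs)
  also have "\<dots> \<le> \<beta> * cosh y"
    using sum_le_cosh[of "{0, 2}" y] assms(1) by (intro mult_left_mono) simp_all
  finally show ?thesis by simp
qed

lemma bounded_Lipschitz_truncate:
  assumes "0 \<le> N" "\<bar>\<sigma>\<bar> = 1"
  shows "bounded_Lipschitz (\<lambda>y. \<sigma> * truncate N y)"
  unfolding bounded_Lipschitz_def
proof
  show "bounded (range (\<lambda>y. \<sigma> * truncate N y))"
    unfolding bounded_iff using abs_truncate_le[OF assms(1)] assms(2)
    by (intro exI[of _ N]) (auto simp: abs_mult)
  show "\<exists>K. K-lipschitz_on UNIV (\<lambda>y. \<sigma> * truncate N y)"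
    using truncate_Lipschitz[of N] assms(2)
    by (intro exI[of _ 1])
       (auto simp: lipschitz_on_def dist_real_def abs_mult simp flip: right_diff_distrib)
qed

text \<open>Products of factors in \<open>[0,1]\<close> are Lipschitz by telescoping; boundedness of
  the truncation then handles the remaining factor.\<close>

lemma bounded_Lipschitz_vec_ramp_truncate:
  assumes N: "0 \<le> N" and \<sigma>: "\<bar>\<sigma>\<bar> = 1"
  shows "bounded_Lipschitz_vec n (\<lambda>xs y. (\<Prod>i<n. ramp k (xs ! i - c i)) * (\<sigma> * truncate N y))"
proof -
  let ?z = "\<lambda>xs. \<Prod>i<n. ramp k (xs ! i - c i)"
  have z: "0 \<le> ?z xs" "?z xs \<le> 1" for xs
    by (auto intro!: prod_nonneg prod_le_1 simp: ramp_bounds)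
  have bd: "\<bar>?z xs * (\<sigma> * truncate N y)\<bar> \<le> N" for xs y
  proof -
    have "?z xs * \<bar>truncate N y\<bar> \<le> 1 * N"
      using z abs_truncate_le[OF N] N by (intro mult_mono) auto
    then show ?thesis using z(1)[of xs] \<sigma> by (simp add: abs_mult)
  qed
  have lip: "\<bar>?z xs * (\<sigma> * truncate N y) - ?z xs' * (\<sigma> * truncate N y')\<bar>
      \<le> (real k * N + 1) * ((\<Sum>i<n. \<bar>xs ! i - xs' ! i\<bar>) + \<bar>y - y'\<bar>)" for xs xs' y y'
  proof -
    have zd: "\<bar>?z xs - ?z xs'\<bar> \<le> (\<Sum>i<n. real k * \<bar>xs ! i - xs' ! i\<bar>)"
    proof -
      have "\<bar>?z xs - ?z xs'\<bar> \<le> (\<Sum>i<n. norm (ramp k (xs ! i - c i) - ramp k (xs' ! i - c i)))"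
        unfolding real_norm_def[symmetric]
        by (rule norm_prod_diff) (simp_all add: ramp_bounds)
      also have "\<dots> \<le> (\<Sum>i<n. real k * \<bar>xs ! i - xs' ! i\<bar>)"
      proof (rule sum_mono)
        fix i
        show "norm (ramp k (xs ! i - c i) - ramp k (xs' ! i - c i)) \<le> real k * \<bar>xs ! i - xs' ! i\<bar>"
          using ramp_Lipschitz[of k "xs ! i - c i" "xs' ! i - c i"] by simp
      qed
      finally show ?thesis .
    qed
    have "?z xs * (\<sigma> * truncate N y) - ?z xs' * (\<sigma> * truncate N y')
        = \<sigma> * ((?z xs - ?z xs') * truncate N y + ?z xs' * (truncate N y - truncate N y'))"
      by (simp add: algebra_simps)
    then have "\<bar>?z xs * (\<sigma> * truncate N y) - ?z xs' * (\<sigma> * truncate N y')\<bar>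
        = \<bar>(?z xs - ?z xs') * truncate N y + ?z xs' * (truncate N y - truncate N y')\<bar>"
      using \<sigma> by (simp add: abs_mult)
    also have "\<dots> \<le> \<bar>?z xs - ?z xs'\<bar> * \<bar>truncate N y\<bar> + ?z xs' * \<bar>truncate N y - truncate N y'\<bar>"
      using abs_triangle_ineq[of "(?z xs - ?z xs') * truncate N y" "?z xs' * (truncate N y - truncate N y')"]
      by (simp only: abs_mult abs_of_nonneg[OF z(1)])
    also have "\<dots> \<le> (\<Sum>i<n. real k * \<bar>xs ! i - xs' ! i\<bar>) * N + 1 * \<bar>y - y'\<bar>"
    proof (rule add_mono)
      show "\<bar>?z xs - ?z xs'\<bar> * \<bar>truncate N y\<bar> \<le> (\<Sum>i<n. real k * \<bar>xs ! i - xs' ! i\<bar>) * N"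
        by (rule mult_mono[OF zd abs_truncate_le[OF N]]) (simp_all add: sum_nonneg)
      show "?z xs' * \<bar>truncate N y - truncate N y'\<bar> \<le> 1 * \<bar>y - y'\<bar>"
        by (rule mult_mono[OF z(2) truncate_Lipschitz]) simp_all
    qed
    also have "\<dots> = (real k * N) * (\<Sum>i<n. \<bar>xs ! i - xs' ! i\<bar>) + 1 * \<bar>y - y'\<bar>"
      by (simp add: sum_distrib_left[symmetric] mult_ac)
    also have "\<dots> \<le> (real k * N + 1) * (\<Sum>i<n. \<bar>xs ! i - xs' ! i\<bar>) + (real k * N + 1) * \<bar>y - y'\<bar>"
      using N by (intro add_mono mult_right_mono) (simp_all add: sum_nonneg)
    finally show ?thesis by (simp add: distrib_left)
  qed
  show ?thesis unfolding bounded_Lipschitz_vec_def using bd lip by blast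
qed

text \<open>With ramps for the indicator and a truncation for the increment, independence allows the
  past to be frozen. The inner upper expectation of the signed truncated increment is then at most
  \<open>\<beta> * e\<close> with \<open>\<beta>\<close> arbitrarily small, and the limits in the
  truncation and in the ramps follow by dominated convergence. Sublinearity gives an upper bound
  only, which is why the sign \<open>\<sigma>\<close> is a parameter.\<close>

lemma G_Brownian_rect_integral_le:
  assumes P: "\<P> \<noteq> {}" "\<P> \<subseteq> path_measures" and G: "G_Brownian \<sigma>l \<sigma>u \<P>"
    and Q: "Q \<in> \<P>" and st: "0 \<le> s" "s \<le> t" and R: "finite R" "R \<subseteq> {0..s}"
    and int: "integrable Q (\<lambda>\<omega>. BM t \<omega> - BM s \<omega>)" and \<sigma>: "\<bar>\<sigma>\<bar> = 1"
  shows "(\<integral>\<omega>. indicator {\<omega>. \<forall>r\<in>R. c r < BM r \<omega>} \<omega> * (\<sigma> * (BM t \<omega> - BM s \<omega>)) \<partial>Q) \<le> 0"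
proof -
  interpret prob_space Q using Q P(2) by (auto simp: path_measures_def)
  have [measurable_cong]: "sets Q = sets borel" using Q P(2) by (auto simp: path_measures_def)
  define h where "h \<omega> = BM t \<omega> - BM s \<omega>" for \<omega>
  have [measurable]: "h \<in> borel_measurable borel" unfolding h_def by measurable
  have inth: "integrable Q h" using int unfolding h_def .
  \<comment> \<open>Independence is stated for sorted lists of times, so the finite set of times is
    listed in increasing order.\<close>
  define ts where "ts = sorted_list_of_set R"
  define n where "n = length ts"
  have ts: "sorted ts" "set ts \<subseteq> {0..s}" "set ts = R" using R by (simp_all add: ts_def)
  define X where "X \<omega> = map (\<lambda>r. BM r \<omega>) ts" for \<omega>
  define z where "z k xs = (\<Prod>i<n. ramp k (xs ! i - c (ts ! i)))" for k xs
  have z01: "0 \<le> z k xs" "z k xs \<le> 1" for k xs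
    unfolding z_def by (auto intro!: prod_nonneg prod_le_1 simp: ramp_bounds)
  have zX: "z k (X \<omega>) = (\<Prod>i<n. ramp k (BM (ts ! i) \<omega> - c (ts ! i)))" for k \<omega>
    unfolding z_def X_def n_def by (intro prod.cong) auto
  have [measurable]: "(\<lambda>\<omega>. z k (X \<omega>)) \<in> borel_measurable borel" for k
    unfolding zX by measurable
  have Gn: "G_normal \<P> (\<sigma>l\<^sup>2 * (t - s)) (\<sigma>u\<^sup>2 * (t - s)) h"
    using G[unfolded G_Brownian_def, rule_format, of s "t - s", THEN conjunct1] st
    unfolding h_def by simp
  have ind: "indep_from \<P> h n X"
    using G[unfolded G_Brownian_def, rule_format, of s "t - s", THEN conjunct2, rule_format, of ts] st ts(1,2)
    unfolding h_def X_def n_def by simp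
  define e where "e = exp (1\<^sup>2 * (\<sigma>u\<^sup>2 * (t - s)) / 2 + 1)"
  have e: "e > 0" by (simp add: e_def)
  have trunc: "(\<integral>\<omega>. z k (X \<omega>) * (\<sigma> * truncate N (h \<omega>)) \<partial>Q) \<le> \<beta> * e"
    if \<beta>: "0 < \<beta>" and N: "2 / \<beta> \<le> N" for k N \<beta>
  proof -
    have N0: "0 \<le> N" using \<beta> N by (meson divide_nonneg_pos order_trans zero_le_numeral)
    have small: "Ehat \<P> (\<lambda>\<omega>. \<sigma> * truncate N (h \<omega>)) \<le> \<beta> * e"
      unfolding e_def
    proof (rule G_normal_Ehat_le[OF P Gn _ _ \<beta> _ bounded_Lipschitz_truncate[OF N0 \<sigma>], where \<alpha> = \<sigma>])
      fix y
      have "\<bar>\<sigma> * (truncate N y - y)\<bar> \<le> \<beta> * cosh y"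
        using truncate_diff_le_cosh[OF \<beta> N, of y] \<sigma> by (simp add: abs_mult)
      then show "\<sigma> * truncate N y \<le> \<sigma> * y + \<beta> * cosh (1 * y)" by (simp add: right_diff_distrib)
    qed (use st in auto)
    have inner: "Ehat \<P> (\<lambda>\<omega>'. z k xs * (\<sigma> * truncate N (h \<omega>'))) \<le> \<beta> * e" for xs
    proof (rule Ehat_le[OF P(1)])
      fix Q' assume Q': "Q' \<in> \<P>"
      have "(\<integral>\<omega>'. \<sigma> * truncate N (h \<omega>') \<partial>Q') \<le> \<beta> * e"
        using integral_le_Ehat[OF P(2) Q', of "\<lambda>\<omega>. \<sigma> * truncate N (h \<omega>)" N] small
          abs_truncate_le[OF N0] \<sigma> by (simp add: abs_mult)
      then have "z k xs * (\<integral>\<omega>'. \<sigma> * truncate N (h \<omega>') \<partial>Q') \<le> z k xs * (\<beta> * e)"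
        using z01 by (intro mult_left_mono)
      also have "\<dots> \<le> 1 * (\<beta> * e)" using z01 \<beta> e by (intro mult_right_mono) auto
      finally show "(\<integral>\<omega>'. z k xs * (\<sigma> * truncate N (h \<omega>')) \<partial>Q') \<le> \<beta> * e" by simp
    qed
    have bl: "bounded_Lipschitz_vec n (\<lambda>xs y. z k xs * (\<sigma> * truncate N y))"
      unfolding z_def by (rule bounded_Lipschitz_vec_ramp_truncate[OF N0 \<sigma>])
    have "(\<integral>\<omega>. z k (X \<omega>) * (\<sigma> * truncate N (h \<omega>)) \<partial>Q)
        \<le> Ehat \<P> (\<lambda>\<omega>. z k (X \<omega>) * (\<sigma> * truncate N (h \<omega>)))"
    proof (rule integral_le_Ehat[OF P(2) Q, where K = N])
      fix \<omega>
      have "z k (X \<omega>) * \<bar>truncate N (h \<omega>)\<bar> \<le> 1 * N"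
        using z01 abs_truncate_le[OF N0] N0 by (intro mult_mono) auto
      then show "\<bar>z k (X \<omega>) * (\<sigma> * truncate N (h \<omega>))\<bar> \<le> N"
        using z01(1)[of k "X \<omega>"] \<sigma> by (simp add: abs_mult)
    qed measurable
    also have "\<dots> = Ehat \<P> (\<lambda>\<omega>. Ehat \<P> (\<lambda>\<omega>'. z k (X \<omega>) * (\<sigma> * truncate N (h \<omega>'))))"
      by (rule ind[unfolded indep_from_def, rule_format, OF bl])
    also have "\<dots> \<le> \<beta> * e"
    proof (rule Ehat_le[OF P(1)])
      fix Q' assume Q': "Q' \<in> \<P>"
      then interpret Q': prob_space Q' using P(2) by (auto simp: path_measures_def)
      let ?g = "\<lambda>\<omega>. Ehat \<P> (\<lambda>\<omega>'. z k (X \<omega>) * (\<sigma> * truncate N (h \<omega>')))"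
      show "(\<integral>\<omega>. ?g \<omega> \<partial>Q') \<le> \<beta> * e"
      proof (cases "integrable Q' ?g")
        case True
        then show ?thesis using inner by (intro Q'.integral_le_const) auto
      next
        \<comment> \<open>Integrability of the inner upper expectation is not established; without
          it the integral is \<open>0\<close> by convention, which is below the nonnegative
          bound.\<close>
        case False
        have "0 \<le> \<beta> * e" using \<beta> e by simp
        then show ?thesis using not_integrable_integral_eq[OF False] by simp
      qed
    qed
    finally show ?thesis .
  qed
  have trunc_lim: "(\<lambda>N. \<integral>\<omega>. z k (X \<omega>) * (\<sigma> * truncate (real N) (h \<omega>)) \<partial>Q)
      \<longlonglongrightarrow> (\<integral>\<omega>. z k (X \<omega>) * (\<sigma> * h \<omega>) \<partial>Q)" for k
  proof (rule integral_dominated_convergence[where w = "\<lambda>\<omega>. \<bar>h \<omega>\<bar>"])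
    show "AE \<omega> in Q. (\<lambda>N. z k (X \<omega>) * (\<sigma> * truncate (real N) (h \<omega>))) \<longlonglongrightarrow> z k (X \<omega>) * (\<sigma> * h \<omega>)"
    proof (rule AE_I2)
      fix \<omega>
      have "(\<lambda>N. truncate (real N) (h \<omega>)) \<longlonglongrightarrow> h \<omega>"
      proof (rule tendsto_eventually)
        obtain N0 where N0: "\<bar>h \<omega>\<bar> \<le> real N0" using real_arch_simple by blast
        show "\<forall>\<^sub>F N in sequentially. truncate (real N) (h \<omega>) = h \<omega>"
          using eventually_ge_at_top[of N0]
        proof eventually_elim
          case (elim N)
          then show ?case using N0 unfolding truncate_def by linarith
        qed
      qed
      then show "(\<lambda>N. z k (X \<omega>) * (\<sigma> * truncate (real N) (h \<omega>))) \<longlonglongrightarrow> z k (X \<omega>) * (\<sigma> * h \<omega>)"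
        by (intro tendsto_mult tendsto_const)
    qed
    show "AE \<omega> in Q. norm (z k (X \<omega>) * (\<sigma> * truncate (real N) (h \<omega>))) \<le> \<bar>h \<omega>\<bar>" for N
    proof (rule AE_I2)
      fix \<omega>
      have "z k (X \<omega>) * \<bar>truncate (real N) (h \<omega>)\<bar> \<le> 1 * \<bar>h \<omega>\<bar>"
        using z01 abs_truncate_le_abs[of "real N"] by (intro mult_mono) auto
      then show "norm (z k (X \<omega>) * (\<sigma> * truncate (real N) (h \<omega>))) \<le> \<bar>h \<omega>\<bar>"
        using z01(1)[of k "X \<omega>"] \<sigma> by (simp add: abs_mult)
    qed
    show "integrable Q (\<lambda>\<omega>. \<bar>h \<omega>\<bar>)" using inth by simp
  qed measurable
  have step: "(\<integral>\<omega>. z k (X \<omega>) * (\<sigma> * h \<omega>) \<partial>Q) \<le> 0" for k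
  proof (rule field_le_epsilon)
    fix \<epsilon> :: real assume \<epsilon>: "0 < \<epsilon>"
    define \<beta> where "\<beta> = \<epsilon> / e"
    have \<beta>: "\<beta> > 0" using \<epsilon> e by (simp add: \<beta>_def)
    obtain N0 where N0: "2 / \<beta> \<le> real N0" using real_arch_simple by blast
    have "(\<integral>\<omega>. z k (X \<omega>) * (\<sigma> * h \<omega>) \<partial>Q) \<le> \<beta> * e"
    proof (rule LIMSEQ_le_const2[OF trunc_lim], intro exI allI impI)
      fix N assume "N0 \<le> N"
      then have "2 / \<beta> \<le> real N" using N0 by linarith
      then show "(\<integral>\<omega>. z k (X \<omega>) * (\<sigma> * truncate (real N) (h \<omega>)) \<partial>Q) \<le> \<beta> * e" by (rule trunc[OF \<beta>])
    qed
    then show "(\<integral>\<omega>. z k (X \<omega>) * (\<sigma> * h \<omega>) \<partial>Q) \<le> 0 + \<epsilon>" using e by (simp add: \<beta>_def)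
  qed
  have "(\<lambda>k. \<integral>\<omega>. z k (X \<omega>) * (\<sigma> * h \<omega>) \<partial>Q)
      \<longlonglongrightarrow> (\<integral>\<omega>. indicator {\<omega>. \<forall>r\<in>R. c r < BM r \<omega>} \<omega> * (\<sigma> * h \<omega>) \<partial>Q)"
  proof (rule integral_dominated_convergence[where w = "\<lambda>\<omega>. \<bar>h \<omega>\<bar>"])
    show "AE \<omega> in Q. (\<lambda>k. z k (X \<omega>) * (\<sigma> * h \<omega>))
        \<longlonglongrightarrow> indicator {\<omega>. \<forall>r\<in>R. c r < BM r \<omega>} \<omega> * (\<sigma> * h \<omega>)"
    proof (rule AE_I2)
      fix \<omega>
      have "(\<lambda>k. z k (X \<omega>)) \<longlonglongrightarrow> (\<Prod>i<n. indicator {0<..} (BM (ts ! i) \<omega> - c (ts ! i)))"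
        unfolding zX by (intro tendsto_prod ramp_tendsto)
      also have "(\<Prod>i<n. indicator {0<..} (BM (ts ! i) \<omega> - c (ts ! i)) :: real)
          = indicator {\<omega>. \<forall>r\<in>R. c r < BM r \<omega>} \<omega>"
      proof (cases "\<forall>i<n. c (ts ! i) < BM (ts ! i) \<omega>")
        case True
        then have "\<forall>r\<in>R. c r < BM r \<omega>" unfolding ts(3)[symmetric] n_def by (simp add: all_set_conv_all_nth)
        then show ?thesis using True by simp
      next
        case False
        then obtain i where i: "i < n" "\<not> c (ts ! i) < BM (ts ! i) \<omega>" by blast
        then have "(\<Prod>i<n. indicator {0<..} (BM (ts ! i) \<omega> - c (ts ! i)) :: real) = 0"
          by (intro prod_zero) (auto intro!: bexI[of _ i])
        moreover have "\<not> (\<forall>r\<in>R. c r < BM r \<omega>)"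
          using i nth_mem unfolding ts(3)[symmetric] n_def by blast
        ultimately show ?thesis by simp
      qed
      finally show "(\<lambda>k. z k (X \<omega>) * (\<sigma> * h \<omega>))
        \<longlonglongrightarrow> indicator {\<omega>. \<forall>r\<in>R. c r < BM r \<omega>} \<omega> * (\<sigma> * h \<omega>)"
        by (intro tendsto_mult tendsto_const)
    qed
    show "AE \<omega> in Q. norm (z k (X \<omega>) * (\<sigma> * h \<omega>)) \<le> \<bar>h \<omega>\<bar>" for k
    proof (rule AE_I2)
      fix \<omega>
      have "z k (X \<omega>) * \<bar>h \<omega>\<bar> \<le> 1 * \<bar>h \<omega>\<bar>" using z01 by (intro mult_right_mono) auto
      then show "norm (z k (X \<omega>) * (\<sigma> * h \<omega>)) \<le> \<bar>h \<omega>\<bar>"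
        using z01(1)[of k "X \<omega>"] \<sigma> by (simp add: abs_mult)
    qed
    have "{\<omega>. \<forall>r\<in>R. c r < BM r \<omega>} \<in> sets borel"
      using path_rects_borel[of s] R unfolding path_rects_def by blast
    then show "(\<lambda>\<omega>. indicator {\<omega>. \<forall>r\<in>R. c r < BM r \<omega>} \<omega> * (\<sigma> * h \<omega>)) \<in> borel_measurable Q"
      by measurable
    show "integrable Q (\<lambda>\<omega>. \<bar>h \<omega>\<bar>)" using inth by simp
  qed measurable
  then show ?thesis
    unfolding h_def by (rule LIMSEQ_le_const2) (use step[unfolded h_def] in auto)
qed

text \<open>Both signs together make the increment integrate to zero over each orthant. The
  pi-lambda argument extends this to the whole past, so the conditional expectation vanishes, and a
  factor \<open>Z\<close> from the past can be pulled out without being bounded.\<close>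

lemma G_Brownian_martingale:
  assumes P: "\<P> \<noteq> {}" "\<P> \<subseteq> path_measures" and G: "G_Brownian \<sigma>l \<sigma>u \<P>"
    and Q: "Q \<in> \<P>" and st: "0 \<le> s" "s \<le> t"
    and inth: "integrable Q (\<lambda>\<omega>. BM t \<omega> - BM s \<omega>)"
    and Z: "Z \<in> borel_measurable (path_filtration s)"
    and int: "integrable Q (\<lambda>\<omega>. Z \<omega> * (BM t \<omega> - BM s \<omega>))"
  shows "(\<integral>\<omega>. Z \<omega> * (BM t \<omega> - BM s \<omega>) \<partial>Q) = 0"
proof -
  interpret prob_space Q using Q P(2) by (auto simp: path_measures_def)
  have sQ [measurable_cong]: "sets Q = sets borel" using Q P(2) by (auto simp: path_measures_def)
  have space: "space Q = UNIV" using sets_eq_imp_space_eq[OF sQ] by simp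
  have sub: "subalgebra Q (path_filtration s)"
    using sets_path_filtration_borel[of s] by (simp add: subalgebra_def space sQ)
  have "finite_measure_subalgebra Q (path_filtration s)"
    by (intro finite_measure_subalgebra.intro finite_measure_axioms finite_measure_subalgebra_axioms.intro sub)
  note sfs = finite_measure_subalgebra_is_sigma_finite[OF this]
  define h where "h \<omega> = BM t \<omega> - BM s \<omega>" for \<omega>
  have [measurable]: "h \<in> borel_measurable Q"
    unfolding h_def measurable_cong_sets[OF sQ refl] by (intro borel_measurable_diff borel_measurable_BM)
  have ih: "integrable Q h" using inth unfolding h_def .
  have sih: "set_integrable Q A h" if "A \<in> sets borel" for A
    unfolding set_integrable_def by (rule integrable_mult_indicator[OF _ ih]) (simp add: that sQ)
  have rect: "(LINT \<omega>:A|Q. h \<omega>) = 0" if A: "A \<in> path_rects s" for A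
  proof -
    obtain R c where R: "finite R" "R \<subseteq> {0..s}" "A = {\<omega>. \<forall>r\<in>R. c r < BM r \<omega>}"
      using A by (auto simp: path_rects_def)
    have "(\<integral>\<omega>. indicator A \<omega> * (\<sigma> * h \<omega>) \<partial>Q) \<le> 0" if "\<bar>\<sigma>\<bar> = 1" for \<sigma> :: real
      unfolding h_def R(3) using that by (rule G_Brownian_rect_integral_le[OF P G Q st R(1,2) inth])
    from this[of 1] this[of "- 1"]
    have "(\<integral>\<omega>. indicator A \<omega> * h \<omega> \<partial>Q) \<le> 0" "- (\<integral>\<omega>. indicator A \<omega> * h \<omega> \<partial>Q) \<le> 0"
      by simp_all
    then show ?thesis unfolding set_lebesgue_integral_def real_scaleR_def by linarith
  qed
  have zero: "(LINT \<omega>:A|Q. h \<omega>) = 0" if "A \<in> sigma_sets UNIV (path_rects s)" for A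
    using Int_stable_path_rects[of s] subset_UNIV[of "path_rects s", folded Pow_UNIV] that
  proof (induct A rule: sigma_sets_induct_disjoint)
    case (basic A) then show ?case by (rule rect)
  next
    case empty then show ?case by (simp add: set_lebesgue_integral_def)
  next
    case (compl A)
    have A: "A \<in> sets borel"
      using compl(1) sets_path_filtration_borel[of s] by (auto simp: sets_path_filtration)
    \<comment> \<open>The whole space is the orthant belonging to the empty set of times.\<close>
    have "(LINT \<omega>:UNIV|Q. h \<omega>) = 0"
      by (rule rect, unfold path_rects_def, rule CollectI, rule exI[of _ "{}"]) simp
    moreover have "(LINT \<omega>:UNIV|Q. h \<omega>) = (LINT \<omega>:A|Q. h \<omega>) + (LINT \<omega>:UNIV - A|Q. h \<omega>)"
      using set_integral_Un[OF _ sih[of A] sih[of "UNIV - A"]] A by (simp add: Compl_eq_Diff_UNIV)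
    ultimately show ?case using compl(2) by simp
  next
    case (union A)
    have A: "A i \<in> sets borel" for i
      using union(2) sets_path_filtration_borel[of s] by (auto simp: sets_path_filtration)
    have "(LINT \<omega>:(\<Union>i. A i)|Q. h \<omega>) = (\<Sum>i. (LINT \<omega>:(A i)|Q. h \<omega>))"
      by (rule lebesgue_integral_countable_add)
         (use union(1) A sQ sih[of "\<Union>i. A i"] in \<open>auto simp: disjoint_family_on_def\<close>)
    then show ?case using union(3) by simp
  qed
  have ae: "AE \<omega> in Q. real_cond_exp Q (path_filtration s) h \<omega> = 0"
  proof (rule sigma_finite_subalgebra.real_cond_exp_charact[OF sfs])
    fix A assume "A \<in> sets (path_filtration s)"
    then show "(LINT \<omega>:A|Q. h \<omega>) = (LINT \<omega>:A|Q. 0)"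
      using zero by (simp add: sets_path_filtration set_lebesgue_integral_def)
  qed (use ih in simp_all)
  have "(\<integral>\<omega>. Z \<omega> * real_cond_exp Q (path_filtration s) h \<omega> \<partial>Q) = (\<integral>\<omega>. 0 \<partial>Q)"
  proof (rule integral_cong_AE)
    show "(\<lambda>\<omega>. Z \<omega> * real_cond_exp Q (path_filtration s) h \<omega>) \<in> borel_measurable Q"
      using measurable_from_subalg[OF sub Z] by simp
  qed (use ae in auto)
  moreover have "(\<integral>\<omega>. Z \<omega> * real_cond_exp Q (path_filtration s) h \<omega> \<partial>Q) = (\<integral>\<omega>. Z \<omega> * h \<omega> \<partial>Q)"
    by (rule sigma_finite_subalgebra.real_cond_exp_intg(2)[OF sfs]) (use int Z in \<open>simp_all add: h_def\<close>)
  ultimately show ?thesis by (simp add: h_def)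
qed

section \<open>An algebra of random variables that settles integrability\<close>

section \<open>Random variables with moments of all orders\<close>

context prob_space
begin

text \<open>Finiteness of all moments is stable under products, unlike integrability, so every
  polynomial expression in increments and adapted coefficients is integrable by structural rules
  alone.\<close>

definition fin_mom :: "('a \<Rightarrow> real) \<Rightarrow> bool" where
  "fin_mom X \<longleftrightarrow> X \<in> borel_measurable M \<and> (\<forall>k. integrable M (\<lambda>\<omega>. \<bar>X \<omega>\<bar> ^ k))"

lemma fin_mom_measurable: "fin_mom X \<Longrightarrow> X \<in> borel_measurable M"
  by (simp add: fin_mom_def)

lemma fin_mom_integrable: "fin_mom X \<Longrightarrow> integrable M X"
proof -
  assume X: "fin_mom X"
  then have "integrable M (\<lambda>\<omega>. \<bar>X \<omega>\<bar> ^ 1)" unfolding fin_mom_def by blast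
  then have "integrable M (\<lambda>\<omega>. \<bar>X \<omega>\<bar>)" by simp
  then show "integrable M X" by (rule integrable_abs_cancel[OF _ fin_mom_measurable[OF X]])
qed

lemma fin_mom_bound:
  assumes "fin_mom Y" "X \<in> borel_measurable M" "\<And>\<omega>. \<bar>X \<omega>\<bar> \<le> \<bar>Y \<omega>\<bar>"
  shows "fin_mom X"
  unfolding fin_mom_def
proof (intro conjI allI assms(2))
  fix k
  show "integrable M (\<lambda>\<omega>. \<bar>X \<omega>\<bar> ^ k)"
  proof (rule Bochner_Integration.integrable_bound)
    show "integrable M (\<lambda>\<omega>. \<bar>Y \<omega>\<bar> ^ k)" using assms(1) by (simp add: fin_mom_def)
    show "(\<lambda>\<omega>. \<bar>X \<omega>\<bar> ^ k) \<in> borel_measurable M" using assms(2) by simp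
    show "AE \<omega> in M. norm (\<bar>X \<omega>\<bar> ^ k) \<le> norm (\<bar>Y \<omega>\<bar> ^ k)"
    proof (rule AE_I2)
      fix \<omega>
      show "norm (\<bar>X \<omega>\<bar> ^ k) \<le> norm (\<bar>Y \<omega>\<bar> ^ k)" using power_mono[OF assms(3)] by simp
    qed
  qed
qed

lemma fin_mom_const: "fin_mom (\<lambda>_. c)"
  by (simp add: fin_mom_def)

lemma fin_mom_bounded:
  assumes "X \<in> borel_measurable M" "\<And>\<omega>. \<bar>X \<omega>\<bar> \<le> c"
  shows "fin_mom X"
  using order_trans[OF assms(2) abs_ge_self] by (rule fin_mom_bound[OF fin_mom_const[of c] assms(1)])

lemma fin_mom_mult:
  assumes "fin_mom X" "fin_mom Y"
  shows "fin_mom (\<lambda>\<omega>. X \<omega> * Y \<omega>)"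
  unfolding fin_mom_def
proof (intro conjI allI)
  note [measurable] = fin_mom_measurable[OF assms(1)] fin_mom_measurable[OF assms(2)]
  show "(\<lambda>\<omega>. X \<omega> * Y \<omega>) \<in> borel_measurable M" by measurable
  fix k
  show "integrable M (\<lambda>\<omega>. \<bar>X \<omega> * Y \<omega>\<bar> ^ k)"
  proof (rule Bochner_Integration.integrable_bound)
    show "integrable M (\<lambda>\<omega>. \<bar>X \<omega>\<bar> ^ (k * 2) + \<bar>Y \<omega>\<bar> ^ (k * 2))"
      using assms unfolding fin_mom_def by (intro Bochner_Integration.integrable_add) blast+
    show "AE \<omega> in M. norm (\<bar>X \<omega> * Y \<omega>\<bar> ^ k) \<le> norm (\<bar>X \<omega>\<bar> ^ (k * 2) + \<bar>Y \<omega>\<bar> ^ (k * 2))"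
    proof (rule AE_I2)
      fix \<omega>
      have "0 \<le> (\<bar>X \<omega>\<bar> ^ k - \<bar>Y \<omega>\<bar> ^ k)\<^sup>2" by simp
      then have "2 * (\<bar>X \<omega>\<bar> ^ k * \<bar>Y \<omega>\<bar> ^ k) \<le> \<bar>X \<omega>\<bar> ^ (k * 2) + \<bar>Y \<omega>\<bar> ^ (k * 2)"
        by (simp add: power2_diff power_mult)
      moreover have "0 \<le> \<bar>X \<omega>\<bar> ^ k * \<bar>Y \<omega>\<bar> ^ k" by simp
      ultimately have "\<bar>X \<omega>\<bar> ^ k * \<bar>Y \<omega>\<bar> ^ k \<le> \<bar>X \<omega>\<bar> ^ (k * 2) + \<bar>Y \<omega>\<bar> ^ (k * 2)" by linarith
      then show "norm (\<bar>X \<omega> * Y \<omega>\<bar> ^ k) \<le> norm (\<bar>X \<omega>\<bar> ^ (k * 2) + \<bar>Y \<omega>\<bar> ^ (k * 2))"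
        by (simp add: abs_mult power_mult_distrib)
    qed
  qed measurable
qed

lemma fin_mom_add:
  assumes "fin_mom X" "fin_mom Y"
  shows "fin_mom (\<lambda>\<omega>. X \<omega> + Y \<omega>)"
  unfolding fin_mom_def
proof (intro conjI allI)
  note [measurable] = fin_mom_measurable[OF assms(1)] fin_mom_measurable[OF assms(2)]
  show "(\<lambda>\<omega>. X \<omega> + Y \<omega>) \<in> borel_measurable M" by measurable
  fix k
  show "integrable M (\<lambda>\<omega>. \<bar>X \<omega> + Y \<omega>\<bar> ^ k)"
  proof (rule Bochner_Integration.integrable_bound)
    show "integrable M (\<lambda>\<omega>. 2 ^ k * (\<bar>X \<omega>\<bar> ^ k + \<bar>Y \<omega>\<bar> ^ k))"
      using assms unfolding fin_mom_def
      by (intro Bochner_Integration.integrable_add integrable_mult_right) blast+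
    show "AE \<omega> in M. norm (\<bar>X \<omega> + Y \<omega>\<bar> ^ k) \<le> norm (2 ^ k * (\<bar>X \<omega>\<bar> ^ k + \<bar>Y \<omega>\<bar> ^ k))"
    proof (rule AE_I2)
      fix \<omega>
      have "\<bar>X \<omega> + Y \<omega>\<bar> ^ k \<le> (\<bar>X \<omega>\<bar> + \<bar>Y \<omega>\<bar>) ^ k" by (intro power_mono) auto
      also have "\<dots> \<le> 2 ^ k * (\<bar>X \<omega>\<bar> ^ k + \<bar>Y \<omega>\<bar> ^ k)" by (rule add_power_le) auto
      finally show "norm (\<bar>X \<omega> + Y \<omega>\<bar> ^ k) \<le> norm (2 ^ k * (\<bar>X \<omega>\<bar> ^ k + \<bar>Y \<omega>\<bar> ^ k))"
        by simp
    qed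
  qed measurable
qed

lemma fin_mom_uminus: "fin_mom X \<Longrightarrow> fin_mom (\<lambda>\<omega>. - X \<omega>)"
  by (simp add: fin_mom_def)

lemma fin_mom_diff: "fin_mom X \<Longrightarrow> fin_mom Y \<Longrightarrow> fin_mom (\<lambda>\<omega>. X \<omega> - Y \<omega>)"
  using fin_mom_add[OF _ fin_mom_uminus, of X Y] by simp

lemma fin_mom_abs: "fin_mom X \<Longrightarrow> fin_mom (\<lambda>\<omega>. \<bar>X \<omega>\<bar>)"
  unfolding fin_mom_def by (intro conjI borel_measurable_abs) (simp_all add: conjunct1)

lemma fin_mom_power: "fin_mom X \<Longrightarrow> fin_mom (\<lambda>\<omega>. X \<omega> ^ k)"
  by (induction k) (simp_all add: fin_mom_const fin_mom_mult)

lemma fin_mom_sum: "(\<And>i. i \<in> I \<Longrightarrow> fin_mom (X i)) \<Longrightarrow> fin_mom (\<lambda>\<omega>. \<Sum>i\<in>I. X i \<omega>)"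
  by (induction I rule: infinite_finite_induct) (simp_all add: fin_mom_const fin_mom_add)

lemmas fin_mom_intros = fin_mom_const fin_mom_mult fin_mom_add fin_mom_uminus fin_mom_diff
  fin_mom_abs fin_mom_power fin_mom_sum

text \<open>The barrier controls even powers; expanding
  \<open>(\<bar>x\<bar> ^ k - 1)\<^sup>2 \<ge> 0\<close> bounds every other moment by an even
  one.\<close>

lemma fin_momI_even:
  assumes "X \<in> borel_measurable M" "\<And>m. integrable M (\<lambda>\<omega>. X \<omega> ^ (2 * m))"
  shows "fin_mom X"
  unfolding fin_mom_def
proof (intro conjI allI assms(1))
  fix k
  show "integrable M (\<lambda>\<omega>. \<bar>X \<omega>\<bar> ^ k)"
  proof (rule Bochner_Integration.integrable_bound)
    show "integrable M (\<lambda>\<omega>. 1 + X \<omega> ^ (2 * k))"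
      using assms(2) by (intro Bochner_Integration.integrable_add) auto
    show "(\<lambda>\<omega>. \<bar>X \<omega>\<bar> ^ k) \<in> borel_measurable M" using assms(1) by simp
    show "AE \<omega> in M. norm (\<bar>X \<omega>\<bar> ^ k) \<le> norm (1 + X \<omega> ^ (2 * k))"
    proof (rule AE_I2)
      fix \<omega>
      have "0 \<le> (\<bar>X \<omega>\<bar> ^ k - 1)\<^sup>2" by simp
      also have "\<dots> = (\<bar>X \<omega>\<bar> ^ k)\<^sup>2 - 2 * \<bar>X \<omega>\<bar> ^ k + 1" by (simp add: power2_diff)
      also have "(\<bar>X \<omega>\<bar> ^ k)\<^sup>2 = X \<omega> ^ (2 * k)"
        by (metis power_even_abs power_mult mult.commute dvd_triv_left)
      finally have "2 * \<bar>X \<omega>\<bar> ^ k \<le> 1 + X \<omega> ^ (2 * k)" by linarith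
      moreover have "0 \<le> \<bar>X \<omega>\<bar> ^ k" by simp
      ultimately have "\<bar>X \<omega>\<bar> ^ k \<le> 1 + X \<omega> ^ (2 * k)" by linarith
      then show "norm (\<bar>X \<omega>\<bar> ^ k) \<le> norm (1 + X \<omega> ^ (2 * k))" by simp
    qed
  qed
qed

lemma expectation_mono_fin_mom:
  assumes "fin_mom X" "fin_mom Y" "\<And>\<omega>. X \<omega> \<le> Y \<omega>"
  shows "expectation X \<le> expectation Y"
  using assms by (intro integral_mono fin_mom_integrable) auto

lemma expectation_le_lin3:
  assumes "fin_mom V" "fin_mom X" "fin_mom Y" "fin_mom Z"
    "\<And>\<omega>. V \<omega> \<le> a * X \<omega> + b * Y \<omega> + c * Z \<omega>"
  shows "expectation V \<le> a * expectation X + b * expectation Y + c * expectation Z"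
proof -
  note i = assms(1-4)[THEN fin_mom_integrable]
  have "expectation V \<le> expectation (\<lambda>\<omega>. a * X \<omega> + b * Y \<omega> + c * Z \<omega>)"
    using assms(5) i by (intro integral_mono) auto
  then show ?thesis using i by simp
qed

end

section \<open>Burkholder type inequalities on a grid\<close>

section \<open>Moment inequalities for discrete stochastic integrals\<close>

text \<open>Second order Taylor expansion whose remainder is split by the weighted Young inequality.
  If \<open>N\<close> is the number of steps, the factors \<open>1 + c / N\<close> compound to at
  most \<open>exp c\<close>, and the price \<open>N ^ p\<close> is compensated by the moment of a
  single increment, which is of order \<open>N\<close> to the power \<open>-(p + 1)\<close>.\<close>

lemma even_power_step:
  "\<exists>c\<ge>0. \<forall>x y N::real. 1 \<le> N \<longrightarrow> (x + y) ^ (2 * p + 2)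
     \<le> (1 + c / N) * x ^ (2 * p + 2) + real (2 * p + 2) * (x ^ (2 * p + 1) * y) + 2 * c * N ^ p * y ^ (2 * p + 2)"
proof -
  obtain C where C: "C \<ge> 0"
    "\<And>x y::real. \<bar>(x + y) ^ (2 * p + 2) - x ^ (2 * p + 2) - real (2 * p + 2) * x ^ (2 * p + 1) * y\<bar>
      \<le> C * y\<^sup>2 * (\<bar>x\<bar> + \<bar>y\<bar>) ^ (2 * p)"
    using power_add_bound2[of "2 * p"] by blast
  define c where "c = C * 2 ^ (2 * p)"
  have c: "c \<ge> 0" using C(1) by (simp add: c_def)
  have "(x + y) ^ (2 * p + 2)
     \<le> (1 + c / N) * x ^ (2 * p + 2) + real (2 * p + 2) * (x ^ (2 * p + 1) * y) + 2 * c * N ^ p * y ^ (2 * p + 2)"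
    if N: "1 \<le> N" for x y N :: real
  proof -
    define X where "X = x ^ (2 * p + 2)"
    define Y where "Y = y ^ (2 * p + 2)"
    have Y: "0 \<le> Y" unfolding Y_def by (rule zero_le_even_power) simp
    have e: "y\<^sup>2 * x ^ (2 * p) = (x\<^sup>2) ^ p * y\<^sup>2" "X = (x\<^sup>2) ^ Suc p" "Y = (y\<^sup>2) ^ Suc p"
      unfolding X_def Y_def power_add power_mult power_Suc by (rule mult.commute)+
    have "y\<^sup>2 * (\<bar>x\<bar> + \<bar>y\<bar>) ^ (2 * p) \<le> y\<^sup>2 * (2 ^ (2 * p) * (\<bar>x\<bar> ^ (2 * p) + \<bar>y\<bar> ^ (2 * p)))"
      by (intro mult_left_mono add_power_le) auto
    also have "\<dots> = 2 ^ (2 * p) * (y\<^sup>2 * x ^ (2 * p) + Y)"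
      by (simp add: Y_def power_even_abs distrib_left power_add power2_eq_square mult_ac)
    also have "\<dots> \<le> 2 ^ (2 * p) * ((X / N + N ^ p * Y) + Y)"
      unfolding e using Young_power[of "x\<^sup>2" "y\<^sup>2" N p] N by (intro mult_left_mono add_right_mono) auto
    also have "\<dots> \<le> 2 ^ (2 * p) * ((X / N + N ^ p * Y) + N ^ p * Y)"
      using mult_right_mono[OF one_le_power[OF N, of p] Y] by (intro mult_left_mono add_left_mono) auto
    finally have "C * (y\<^sup>2 * (\<bar>x\<bar> + \<bar>y\<bar>) ^ (2 * p)) \<le> C * (2 ^ (2 * p) * ((X / N + N ^ p * Y) + N ^ p * Y))"
      using C(1) by (rule mult_left_mono)
    also have "\<dots> = c / N * X + 2 * c * N ^ p * Y" by (simp add: c_def algebra_simps)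
    finally have 1: "C * y\<^sup>2 * (\<bar>x\<bar> + \<bar>y\<bar>) ^ (2 * p) \<le> c / N * X + 2 * c * N ^ p * Y" by (simp add: mult.assoc)
    have "(x + y) ^ (2 * p + 2) - X - real (2 * p + 2) * x ^ (2 * p + 1) * y \<le> c / N * X + 2 * c * N ^ p * Y"
      using order_trans[OF C(2)[of x y] 1] unfolding X_def by (rule abs_le_D1)
    then show ?thesis unfolding X_def[symmetric] Y_def[symmetric] distrib_right by (simp add: mult.assoc)
  qed
  with c show ?thesis by blast
qed

lemma even_power_tangent: "(x::real) ^ (2 * m + 2) + real (2 * m + 2) * x ^ (2 * m + 1) * y \<le> (x + y) ^ (2 * m + 2)"
proof -
  have "convex_on UNIV (\<lambda>x::real. x ^ (2 * m + 2))" by (rule convex_power_even) simp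
  moreover have "((\<lambda>x::real. x ^ (2 * m + 2)) has_real_derivative real (2 * m + 2) * x ^ (2 * m + 1)) (at x)"
    by (rule DERIV_cong[OF DERIV_pow]) simp
  ultimately have "(x + y) ^ (2 * m + 2) - x ^ (2 * m + 2) \<ge> (real (2 * m + 2) * x ^ (2 * m + 1)) * ((x + y) - x)"
    by (intro convex_on_imp_above_tangent[of UNIV]) auto
  then show ?thesis by simp
qed

text \<open>What is kept of the G-Brownian motion under one measure: Brownian scaling of all even
  moments, adaptedness, and orthogonality of increments to the past. The factor \<open>Z\<close> may
  be unbounded, because powers of martingale sums are inserted for it.\<close>

locale moment_martingale = prob_space M for M :: "'a measure" +
  fixes B :: "real \<Rightarrow> 'a \<Rightarrow> real" and F :: "real \<Rightarrow> 'a measure"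
  assumes subalg: "0 \<le> t \<Longrightarrow> subalgebra M (F t)"
    and F_mono: "0 \<le> s \<Longrightarrow> s \<le> t \<Longrightarrow> subalgebra (F t) (F s)"
    and B_adapted: "0 \<le> t \<Longrightarrow> B t \<in> borel_measurable (F t)"
    and mom: "\<exists>K\<ge>0. \<forall>s t. 0 \<le> s \<longrightarrow> s \<le> t \<longrightarrow> integrable M (\<lambda>\<omega>. (B t \<omega> - B s \<omega>) ^ (2 * m)) \<and>
        expectation (\<lambda>\<omega>. (B t \<omega> - B s \<omega>) ^ (2 * m)) \<le> K * (t - s) ^ m"
    and mart: "0 \<le> s \<Longrightarrow> s \<le> t \<Longrightarrow> Z \<in> borel_measurable (F s) \<Longrightarrow>
        integrable M (\<lambda>\<omega>. Z \<omega> * (B t \<omega> - B s \<omega>)) \<Longrightarrow> expectation (\<lambda>\<omega>. Z \<omega> * (B t \<omega> - B s \<omega>)) = 0"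
begin

text \<open>Equidistant grid points. Indices beyond \<open>n\<close> are allowed and continue the
  grid past \<open>t\<close>, so adaptedness of coefficients can be required for every
  index.\<close>

definition node :: "real \<Rightarrow> real \<Rightarrow> nat \<Rightarrow> nat \<Rightarrow> real" where
  "node s t n i = s + real i * ((t - s) / real n)"

definition inc :: "real \<Rightarrow> real \<Rightarrow> nat \<Rightarrow> nat \<Rightarrow> 'a \<Rightarrow> real" where
  "inc s t n i \<omega> = B (node s t n (Suc i)) \<omega> - B (node s t n i) \<omega>"

definition mart_sum :: "real \<Rightarrow> real \<Rightarrow> nat \<Rightarrow> (nat \<Rightarrow> 'a \<Rightarrow> real) \<Rightarrow> nat \<Rightarrow> 'a \<Rightarrow> real" where
  "mart_sum s t n g j \<omega> = (\<Sum>i<j. g i \<omega> * inc s t n i \<omega>)"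

definition bdd_adapted :: "real \<Rightarrow> real \<Rightarrow> nat \<Rightarrow> (nat \<Rightarrow> 'a \<Rightarrow> real) \<Rightarrow> real \<Rightarrow> bool" where
  "bdd_adapted s t n g k \<longleftrightarrow> 0 \<le> s \<and> s \<le> t \<and> 1 \<le> n \<and>
     (\<forall>i. g i \<in> borel_measurable (F (node s t n i))) \<and> (\<forall>i \<omega>. \<bar>g i \<omega>\<bar> \<le> k)"

lemma measurable_F_M: "0 \<le> t \<Longrightarrow> X \<in> borel_measurable (F t) \<Longrightarrow> X \<in> borel_measurable M"
  using measurable_from_subalg[OF subalg] .

lemma measurable_F_mono: "0 \<le> s \<Longrightarrow> s \<le> t \<Longrightarrow> X \<in> borel_measurable (F s) \<Longrightarrow> X \<in> borel_measurable (F t)"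
  using measurable_from_subalg[OF F_mono] .

lemma B_measurable: "0 \<le> t \<Longrightarrow> B t \<in> borel_measurable M"
  using measurable_F_M B_adapted by blast

lemma node_0 [simp]: "node s t n 0 = s"
  by (simp add: node_def)

lemma node_n: "1 \<le> n \<Longrightarrow> node s t n n = t"
  by (simp add: node_def)

lemma node_Suc_diff: "node s t n (Suc i) - node s t n i = (t - s) / real n"
  unfolding node_def of_nat_Suc distrib_right by simp

lemma node_mono: "s \<le> t \<Longrightarrow> i \<le> j \<Longrightarrow> node s t n i \<le> node s t n j"
  unfolding node_def by (intro add_left_mono mult_right_mono) auto

lemma node_nonneg: "0 \<le> s \<Longrightarrow> s \<le> t \<Longrightarrow> 0 \<le> node s t n i"
  unfolding node_def by simp

lemma increment_fin_mom:
  assumes "0 \<le> s" "s \<le> t"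
  shows "fin_mom (\<lambda>\<omega>. B t \<omega> - B s \<omega>)"
proof (rule fin_momI_even)
  show "(\<lambda>\<omega>. B t \<omega> - B s \<omega>) \<in> borel_measurable M" using B_measurable assms by simp
  show "integrable M (\<lambda>\<omega>. (B t \<omega> - B s \<omega>) ^ (2 * m))" for m using mom[of m] assms by blast
qed

lemma inc_fin_mom: "0 \<le> s \<Longrightarrow> s \<le> t \<Longrightarrow> fin_mom (inc s t n i)"
  using increment_fin_mom[of "node s t n i" "node s t n (Suc i)"] node_nonneg node_mono
  unfolding inc_def[abs_def] by simp

lemma inc_moment:
  "\<exists>K\<ge>0. \<forall>s t n i. 0 \<le> s \<longrightarrow> s \<le> t \<longrightarrow> expectation (\<lambda>\<omega>. inc s t n i \<omega> ^ (2 * m)) \<le> K * ((t - s) / real n) ^ m"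
proof -
  obtain K where K: "K \<ge> 0" "\<And>s t. 0 \<le> s \<Longrightarrow> s \<le> t \<Longrightarrow>
      expectation (\<lambda>\<omega>. (B t \<omega> - B s \<omega>) ^ (2 * m)) \<le> K * (t - s) ^ m" using mom[of m] by blast
  have "expectation (\<lambda>\<omega>. inc s t n i \<omega> ^ (2 * m)) \<le> K * ((t - s) / real n) ^ m" if "0 \<le> s" "s \<le> t" for s t n i
    using K(2)[OF node_nonneg[OF that] node_mono[OF that(2), of i "Suc i"]] unfolding inc_def node_Suc_diff by simp
  with K(1) show ?thesis by blast
qed

lemma inc_orthogonal:
  assumes "0 \<le> s" "s \<le> t" "Z \<in> borel_measurable (F (node s t n i))" "fin_mom Z"
  shows "expectation (\<lambda>\<omega>. Z \<omega> * inc s t n i \<omega>) = 0"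
  using mart[OF node_nonneg[OF assms(1,2)] node_mono[OF assms(2), of i "Suc i"] assms(3)]
    fin_mom_integrable[OF fin_mom_mult[OF assms(4) inc_fin_mom[OF assms(1,2), of n i]]]
  unfolding inc_def by simp

lemma bdd_adapted_measurable:
  "bdd_adapted s t n g k \<Longrightarrow> g i \<in> borel_measurable (F (node s t n i))"
  by (simp add: bdd_adapted_def)

lemma bdd_adapted_fin_mom:
  assumes "bdd_adapted s t n g k"
  shows "fin_mom (g i)"
  using assms measurable_F_M[OF node_nonneg] unfolding bdd_adapted_def by (intro fin_mom_bounded[of _ k]) blast+

lemma B_node_measurable:
  assumes "0 \<le> s" "s \<le> t" "i \<le> j"
  shows "B (node s t n i) \<in> borel_measurable (F (node s t n j))"
  using assms by (intro measurable_F_mono[OF node_nonneg node_mono B_adapted[OF node_nonneg]])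

lemma inc_measurable_F:
  assumes "0 \<le> s" "s \<le> t" "i < j"
  shows "inc s t n i \<in> borel_measurable (F (node s t n j))"
  unfolding inc_def[abs_def] using assms by (intro borel_measurable_diff B_node_measurable) auto

lemma mart_sum_measurable_F:
  assumes "bdd_adapted s t n g k"
  shows "mart_sum s t n g j \<in> borel_measurable (F (node s t n j))"
  unfolding mart_sum_def[abs_def]
proof (intro borel_measurable_sum borel_measurable_times)
  fix i assume "i \<in> {..<j}"
  then show "g i \<in> borel_measurable (F (node s t n j))" "inc s t n i \<in> borel_measurable (F (node s t n j))"
    using assms measurable_F_mono[OF node_nonneg node_mono bdd_adapted_measurable[OF assms], of i j] inc_measurable_F
    by (auto simp: bdd_adapted_def)
qed

lemma mart_sum_fin_mom: "bdd_adapted s t n g k \<Longrightarrow> fin_mom (mart_sum s t n g j)"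
  unfolding mart_sum_def[abs_def]
  by (intro fin_mom_sum fin_mom_mult bdd_adapted_fin_mom inc_fin_mom) (auto simp: bdd_adapted_def)

text \<open>In the expansion of the even power the first order term has mean zero by orthogonality.
  What remains is a linear recursion in the number of steps, solved as in Gronwall's lemma.\<close>

lemma mart_sum_moment:
  "\<exists>C\<ge>0. \<forall>s t n g k j. bdd_adapted s t n g k \<longrightarrow> j \<le> n \<longrightarrow>
     expectation (\<lambda>\<omega>. mart_sum s t n g j \<omega> ^ (2 * m)) \<le> C * k ^ (2 * m) * (t - s) ^ m"
proof (cases m)
  case 0
  then show ?thesis by (intro exI[of _ 1]) simp
next
  case (Suc p)
  have m2: "2 * m = 2 * p + 2" using Suc by simp
  obtain c where c: "c \<ge> 0" "\<And>x y N::real. 1 \<le> N \<Longrightarrow> (x + y) ^ (2 * p + 2)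
     \<le> (1 + c / N) * x ^ (2 * p + 2) + real (2 * p + 2) * (x ^ (2 * p + 1) * y) + 2 * c * N ^ p * y ^ (2 * p + 2)"
    using even_power_step[of p] by blast
  obtain K where K: "K \<ge> 0" "\<And>s t n i. 0 \<le> s \<Longrightarrow> s \<le> t \<Longrightarrow>
      expectation (\<lambda>\<omega>. inc s t n i \<omega> ^ (2 * m)) \<le> K * ((t - s) / real n) ^ m"
    using inc_moment[of m] by blast
  have main: "expectation (\<lambda>\<omega>. mart_sum s t n g j \<omega> ^ (2 * m)) \<le> (exp c * 2 * c * K) * k ^ (2 * m) * (t - s) ^ m"
    if a: "bdd_adapted s t n g k" and jn: "j \<le> n" for s t n g k j
  proof -
    have st: "0 \<le> s" "s \<le> t" "1 \<le> n" and gk: "\<And>i \<omega>. \<bar>g i \<omega>\<bar> \<le> k"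
      using a by (auto simp: bdd_adapted_def)
    have k: "0 \<le> k" using gk[of 0] abs_ge_zero order_trans by blast
    have rn: "1 \<le> real n" using st by simp
    \<comment> \<open>The cost of one step; the powers of \<open>n\<close> are balanced so that
      \<open>real n * D\<close> no longer depends on \<open>n\<close>.\<close>
    define D where "D = 2 * c * real n ^ p * (k ^ (2 * m) * (K * ((t - s) / real n) ^ m))"
    have D: "0 \<le> D" unfolding D_def using c(1) K(1) k st by simp
    let ?M = "mart_sum s t n g"
    have step: "expectation (\<lambda>\<omega>. ?M (Suc i) \<omega> ^ (2 * m)) \<le> (1 + c / real n) * expectation (\<lambda>\<omega>. ?M i \<omega> ^ (2 * m)) + D" for i
    proof -
      note fm = mart_sum_fin_mom[OF a] bdd_adapted_fin_mom[OF a] inc_fin_mom[OF st(1,2)]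
      have "expectation (\<lambda>\<omega>. ?M (Suc i) \<omega> ^ (2 * m)) \<le> (1 + c / real n) * expectation (\<lambda>\<omega>. ?M i \<omega> ^ (2 * m))
          + real (2 * p + 2) * expectation (\<lambda>\<omega>. (?M i \<omega> ^ (2 * p + 1) * g i \<omega>) * inc s t n i \<omega>)
          + 2 * c * real n ^ p * expectation (\<lambda>\<omega>. (g i \<omega> * inc s t n i \<omega>) ^ (2 * m))"
      proof (rule expectation_le_lin3)
        fix \<omega>
        show "?M (Suc i) \<omega> ^ (2 * m) \<le> (1 + c / real n) * ?M i \<omega> ^ (2 * m)
          + real (2 * p + 2) * ((?M i \<omega> ^ (2 * p + 1) * g i \<omega>) * inc s t n i \<omega>)
          + 2 * c * real n ^ p * (g i \<omega> * inc s t n i \<omega>) ^ (2 * m)"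
          using c(2)[OF rn, of "?M i \<omega>" "g i \<omega> * inc s t n i \<omega>"] unfolding m2 mart_sum_def
          by (simp only: sum.lessThan_Suc mult.assoc)
      qed (intro fin_mom_intros fm)+
      also have "expectation (\<lambda>\<omega>. (?M i \<omega> ^ (2 * p + 1) * g i \<omega>) * inc s t n i \<omega>) = 0"
        by (intro inc_orthogonal st borel_measurable_times borel_measurable_power mart_sum_measurable_F[OF a]
            bdd_adapted_measurable[OF a] fin_mom_intros fm)
      also have "expectation (\<lambda>\<omega>. (g i \<omega> * inc s t n i \<omega>) ^ (2 * m)) \<le> k ^ (2 * m) * (K * ((t - s) / real n) ^ m)"
      proof -
        have "expectation (\<lambda>\<omega>. (g i \<omega> * inc s t n i \<omega>) ^ (2 * m)) \<le> expectation (\<lambda>\<omega>. k ^ (2 * m) * inc s t n i \<omega> ^ (2 * m))"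
        proof (rule expectation_mono_fin_mom)
          fix \<omega>
          have "\<bar>g i \<omega>\<bar> ^ (2 * m) \<le> k ^ (2 * m)" by (rule power_mono[OF gk]) simp
          then show "(g i \<omega> * inc s t n i \<omega>) ^ (2 * m) \<le> k ^ (2 * m) * inc s t n i \<omega> ^ (2 * m)"
            unfolding power_mult_distrib by (intro mult_right_mono) (simp_all add: power_even_abs)
        qed (intro fin_mom_intros fm)+
        also have "\<dots> \<le> k ^ (2 * m) * (K * ((t - s) / real n) ^ m)"
          using K(2)[OF st(1,2)] k by (simp add: mult_left_mono)
        finally show ?thesis .
      qed
      then have "2 * c * real n ^ p * expectation (\<lambda>\<omega>. (g i \<omega> * inc s t n i \<omega>) ^ (2 * m)) \<le> D"
        unfolding D_def using c(1) by (intro mult_left_mono) simp_all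
      finally show ?thesis by simp
    qed
    have ge1: "1 \<le> 1 + c / real n" using c(1) by simp
    \<comment> \<open>Each step multiplies by \<open>1 + c / real n\<close> and adds
      \<open>D\<close>; overestimating every growth factor by the final one gives a closed
      form.\<close>
    have ind: "expectation (\<lambda>\<omega>. ?M i \<omega> ^ (2 * m)) \<le> (1 + c / real n) ^ i * (real i * D)" for i
    proof (induction i)
      case 0
      then show ?case by (simp add: mart_sum_def Suc)
    next
      case (Suc i)
      have "expectation (\<lambda>\<omega>. ?M (Suc i) \<omega> ^ (2 * m)) \<le> (1 + c / real n) * ((1 + c / real n) ^ i * (real i * D)) + 1 * D"
        using step[of i] mult_left_mono[OF Suc, of "1 + c / real n"] ge1 by linarith
      also have "\<dots> \<le> (1 + c / real n) * ((1 + c / real n) ^ i * (real i * D)) + (1 + c / real n) ^ Suc i * D"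
        using D one_le_power[OF ge1, of "Suc i"] by (intro add_left_mono mult_right_mono)
      also have "\<dots> = (1 + c / real n) ^ Suc i * (real (Suc i) * D)"
      proof -
        have "r * (r ^ i * (real i * D)) + r ^ Suc i * D = r ^ Suc i * (real (Suc i) * D)" for r :: real
          by (simp add: algebra_simps)
        then show ?thesis .
      qed
      finally show ?case .
    qed
    have "expectation (\<lambda>\<omega>. ?M j \<omega> ^ (2 * m)) \<le> (1 + c / real n) ^ j * (real j * D)" by (rule ind)
    also have "\<dots> \<le> (1 + c / real n) ^ n * (real n * D)"
      using ge1 D jn by (intro mult_mono power_increasing) auto
    also have "\<dots> \<le> exp c * (real n * D)"
      using exp_ge_one_plus_x_over_n_power_n[of n c] c(1) st(3) D by (intro mult_right_mono) auto
    also have "real n * D = 2 * c * K * k ^ (2 * m) * (t - s) ^ m"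
      using st(3) unfolding D_def Suc by (simp add: power_divide field_simps)
    finally show ?thesis by (simp add: mult_ac)
  qed
  show ?thesis using main c(1) K(1) by (intro exI[of _ "exp c * 2 * c * K"]) auto
qed

end

text \<open>The increment of \<open>x\<^sup>2\<^sup>q\<^sup>+\<^sup>2 - c x\<^sup>2\<^sup>q s\<close>, where \<open>s\<close> is the quadratic variation of \<open>x\<close>
  and \<open>q = r + 1\<close>: the constant \<open>c\<close> is chosen such that the second order terms cancel, and
  convexity of \<open>x\<^sup>2\<^sup>q\<close> disposes of the term with \<open>s\<close>.\<close>

lemma even_power_Ito_step:
  fixes r :: nat
  defines "c \<equiv> real ((r + 2) * (2 * r + 3))"
  shows "\<exists>C\<ge>0. \<forall>x y s::real. 0 \<le> s \<longrightarrow> (x + y) ^ (2 * r + 4) - c * (x + y) ^ (2 * r + 2) * (s + y\<^sup>2)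
     \<le> x ^ (2 * r + 4) - c * x ^ (2 * r + 2) * s + real (2 * r + 4) * (x ^ (2 * r + 3) * y)
       - c * real (2 * r + 2) * (s * x ^ (2 * r + 1) * y) + C * (\<bar>y\<bar> ^ 3 * (\<bar>x\<bar> + \<bar>y\<bar>) ^ (2 * r + 1))"
proof -
  obtain C1 where C1: "C1 \<ge> 0"
    "\<And>x y::real. \<bar>(x + y) ^ Suc (2 * r + 1) - x ^ Suc (2 * r + 1)\<bar> \<le> C1 * \<bar>y\<bar> * (\<bar>x\<bar> + \<bar>y\<bar>) ^ (2 * r + 1)"
    using power_add_bound[of "2 * r + 1"] by blast
  obtain C3 where C3: "C3 \<ge> 0"
    "\<And>x y::real. \<bar>(x + y) ^ ((2 * r + 1) + 3) - x ^ ((2 * r + 1) + 3) - real ((2 * r + 1) + 3) * x ^ ((2 * r + 1) + 2) * y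
       - real ((2 * r + 1) + 3) * real ((2 * r + 1) + 2) / 2 * x ^ ((2 * r + 1) + 1) * y\<^sup>2\<bar>
     \<le> C3 * \<bar>y\<bar> ^ 3 * (\<bar>x\<bar> + \<bar>y\<bar>) ^ (2 * r + 1)"
    using power_add_bound3[of "2 * r + 1"] by blast
  have c0: "0 \<le> c" by (simp add: c_def)
  \<comment> \<open>The second Taylor coefficient is exactly \<open>c\<close>; this is the
    cancellation for which \<open>c\<close> was chosen.\<close>
  have ce: "real ((2 * r + 1) + 3) * real ((2 * r + 1) + 2) / 2 = c" by (simp add: c_def algebra_simps)
  have ee: "(2 * r + 1) + 3 = 2 * r + 4" "(2 * r + 1) + 2 = 2 * r + 3" "(2 * r + 1) + 1 = 2 * r + 2" "Suc (2 * r + 1) = 2 * r + 2"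
    by simp_all
  have "(x + y) ^ (2 * r + 4) - c * (x + y) ^ (2 * r + 2) * (s + y\<^sup>2)
     \<le> x ^ (2 * r + 4) - c * x ^ (2 * r + 2) * s + real (2 * r + 4) * (x ^ (2 * r + 3) * y)
       - c * real (2 * r + 2) * (s * x ^ (2 * r + 1) * y) + (C3 + c * C1) * (\<bar>y\<bar> ^ 3 * (\<bar>x\<bar> + \<bar>y\<bar>) ^ (2 * r + 1))"
    if s: "0 \<le> s" for x y s :: real
  proof -
    define T where "T = \<bar>y\<bar> ^ 3 * (\<bar>x\<bar> + \<bar>y\<bar>) ^ (2 * r + 1)"
    define P where "P = (x + y) ^ (2 * r + 2)"
    define X where "X = x ^ (2 * r + 2)"
    have 1: "(x + y) ^ (2 * r + 4) \<le> x ^ (2 * r + 4) + real (2 * r + 4) * (x ^ (2 * r + 3) * y) + c * X * y\<^sup>2 + C3 * T"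
      using C3(2)[of x y, unfolded ce, unfolded ee, THEN abs_le_D1] unfolding T_def X_def mult.assoc by linarith
    \<comment> \<open>The new bracket increment is multiplied by the power at \<open>x + y\<close>;
      moving it back to \<open>x\<close> costs only a third order term.\<close>
    have 2: "X - P \<le> C1 * \<bar>y\<bar> * (\<bar>x\<bar> + \<bar>y\<bar>) ^ (2 * r + 1)"
      using C1(2)[of x y, unfolded ee, THEN abs_le_D2] unfolding X_def P_def by simp
    have "y\<^sup>2 * (X - P) \<le> y\<^sup>2 * (C1 * \<bar>y\<bar> * (\<bar>x\<bar> + \<bar>y\<bar>) ^ (2 * r + 1))"
      using 2 by (rule mult_left_mono) simp
    also have "\<dots> = C1 * T"
    proof -
      have "\<bar>y\<bar> ^ 3 = y\<^sup>2 * \<bar>y\<bar>" by (simp add: power3_eq_cube power2_eq_square)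
      then show ?thesis unfolding T_def by (simp add: mult_ac)
    qed
    finally have 3: "c * (y\<^sup>2 * (X - P)) \<le> c * (C1 * T)" using c0 by (rule mult_left_mono)
    have "X + real (2 * r + 2) * x ^ (2 * r + 1) * y \<le> P"
      using even_power_tangent[of x r y] unfolding X_def P_def .
    then have "s * (X + real (2 * r + 2) * x ^ (2 * r + 1) * y) \<le> s * P" using s by (rule mult_left_mono)
    then have 4: "c * (s * (X + real (2 * r + 2) * x ^ (2 * r + 1) * y)) \<le> c * (s * P)" using c0 by (rule mult_left_mono)
    have "c * P * (s + y\<^sup>2) = c * (s * P) + c * X * y\<^sup>2 - c * (y\<^sup>2 * (X - P))"
      by (simp add: algebra_simps)
    moreover have "c * (s * (X + real (2 * r + 2) * x ^ (2 * r + 1) * y))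
        = c * X * s + c * real (2 * r + 2) * (s * x ^ (2 * r + 1) * y)"
      by (simp add: algebra_simps)
    moreover have "(C3 + c * C1) * T = C3 * T + c * (C1 * T)" by (simp add: algebra_simps)
    ultimately show ?thesis using 1 3 4
      unfolding T_def[symmetric] P_def[symmetric] X_def[symmetric] by linarith
  qed
  then show ?thesis using C1(1) C3(1) c0 by (intro exI[of _ "C3 + c * C1"]) auto
qed

lemma mult_le_weighted_squares:
  fixes a b \<theta> :: real
  assumes "0 \<le> a" "0 \<le> b" "0 < \<theta>"
  shows "a * b \<le> \<theta> * a\<^sup>2 + b\<^sup>2 / \<theta>"
proof (cases "b \<le> \<theta> * a")
  case True
  then have "a * b \<le> a * (\<theta> * a)" using assms by (intro mult_left_mono)
  also have "\<dots> = \<theta> * a\<^sup>2" by (simp add: power2_eq_square)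
  finally show ?thesis using assms by (simp add: add_increasing2)
next
  case False
  then have "a \<le> b / \<theta>" using assms by (simp add: pos_le_divide_eq mult.commute)
  then have "a * b \<le> b / \<theta> * b" using assms by (intro mult_right_mono)
  also have "\<dots> = b\<^sup>2 / \<theta>" by (simp add: power2_eq_square)
  finally show ?thesis using assms by (simp add: add_increasing)
qed

lemma cube_times_power_le:
  fixes x h \<theta> :: real
  assumes "\<theta> > 0"
  shows "\<bar>h\<bar> ^ 3 * (\<bar>x\<bar> + \<bar>h\<bar>) ^ (2 * r + 1)
    \<le> \<theta> * h ^ (2 * 3) + 2 ^ (4 * r + 2) / \<theta> * x ^ (2 * (2 * r + 1)) + 2 ^ (4 * r + 2) / \<theta> * h ^ (2 * (2 * r + 1))"
proof -
  define a where "a = \<bar>h\<bar> ^ 3"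
  define b where "b = (\<bar>x\<bar> + \<bar>h\<bar>) ^ (2 * r + 1)"
  have ab: "0 \<le> a" "0 \<le> b" by (simp_all add: a_def b_def)
  have "a * b \<le> \<theta> * a\<^sup>2 + b\<^sup>2 / \<theta>"
    by (rule mult_le_weighted_squares[OF ab assms])
  moreover have "\<theta> * a\<^sup>2 = \<theta> * h ^ (2 * 3)" unfolding a_def by (simp flip: power_mult add: power_even_abs)
  moreover have "b\<^sup>2 / \<theta> \<le> 2 ^ (4 * r + 2) / \<theta> * x ^ (2 * (2 * r + 1)) + 2 ^ (4 * r + 2) / \<theta> * h ^ (2 * (2 * r + 1))"
  proof -
    have "b\<^sup>2 = (\<bar>x\<bar> + \<bar>h\<bar>) ^ ((2 * r + 1) * 2)" unfolding b_def power_mult ..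
    also have "(2 * r + 1) * 2 = 4 * r + 2" by simp
    finally have "b\<^sup>2 = (\<bar>x\<bar> + \<bar>h\<bar>) ^ (4 * r + 2)" .
    also have "\<dots> \<le> 2 ^ (4 * r + 2) * (\<bar>x\<bar> ^ (4 * r + 2) + \<bar>h\<bar> ^ (4 * r + 2))"
      by (rule add_power_le) auto
    also have "\<bar>x\<bar> ^ (4 * r + 2) = x ^ (2 * (2 * r + 1))" by (simp add: power_even_abs algebra_simps)
    also have "\<bar>h\<bar> ^ (4 * r + 2) = h ^ (2 * (2 * r + 1))" by (simp add: power_even_abs algebra_simps)
    finally have "b\<^sup>2 / \<theta> \<le> 2 ^ (4 * r + 2) * (x ^ (2 * (2 * r + 1)) + h ^ (2 * (2 * r + 1))) / \<theta>"
      using assms by (intro divide_right_mono) auto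
    then show ?thesis by (simp add: distrib_left add_divide_distrib)
  qed
  ultimately show ?thesis unfolding a_def[symmetric] b_def[symmetric] by linarith
qed

context moment_martingale
begin

definition quad_sum :: "real \<Rightarrow> real \<Rightarrow> nat \<Rightarrow> (nat \<Rightarrow> 'a \<Rightarrow> real) \<Rightarrow> nat \<Rightarrow> 'a \<Rightarrow> real" where
  "quad_sum s t n g j \<omega> = (\<Sum>i<j. (g i \<omega> * inc s t n i \<omega>)\<^sup>2)"

lemma quad_sum_measurable_F:
  assumes "bdd_adapted s t n g k"
  shows "quad_sum s t n g j \<in> borel_measurable (F (node s t n j))"
  unfolding quad_sum_def[abs_def]
proof (intro borel_measurable_sum borel_measurable_times borel_measurable_power)
  fix i assume "i \<in> {..<j}"
  then show "g i \<in> borel_measurable (F (node s t n j))" "inc s t n i \<in> borel_measurable (F (node s t n j))"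
    using assms measurable_F_mono[OF node_nonneg node_mono bdd_adapted_measurable[OF assms], of i j] inc_measurable_F
    by (auto simp: bdd_adapted_def)
qed

lemma quad_sum_fin_mom: "bdd_adapted s t n g k \<Longrightarrow> fin_mom (quad_sum s t n g j)"
  unfolding quad_sum_def[abs_def]
  by (intro fin_mom_sum fin_mom_mult fin_mom_power bdd_adapted_fin_mom inc_fin_mom) (auto simp: bdd_adapted_def)

lemma quad_sum_nonneg: "0 \<le> quad_sum s t n g j \<omega>"
  unfolding quad_sum_def by (simp add: sum_nonneg)

text \<open>An increment is of size \<open>n\<close> to the power \<open>-1/2\<close>, so its cube
  should cost \<open>n\<close> to the power \<open>-3/2\<close>. The weight
  \<open>\<theta> = real n * sqrt (real n)\<close> in the splitting into squares achieves this:
  sixth moments of order \<open>n\<close> to the power \<open>-3\<close> and bounded moments of the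
  martingale then contribute equally. Summed over \<open>n\<close> steps the error still vanishes
  like \<open>1 / sqrt (real n)\<close>.\<close>

lemma increment_cube_bound:
  "\<exists>E\<ge>0. \<forall>n g i. bdd_adapted s t n g 1 \<longrightarrow> i \<le> n \<longrightarrow>
     expectation (\<lambda>\<omega>. \<bar>inc s t n i \<omega>\<bar> ^ 3 * (\<bar>mart_sum s t n g i \<omega>\<bar> + \<bar>inc s t n i \<omega>\<bar>) ^ (2 * r + 1))
       \<le> E / (real n * sqrt (real n))"
proof -
  obtain K where K: "K \<ge> 0" "\<And>s t n i. 0 \<le> s \<Longrightarrow> s \<le> t \<Longrightarrow>
      expectation (\<lambda>\<omega>. inc s t n i \<omega> ^ (2 * 3)) \<le> K * ((t - s) / real n) ^ 3"
    using inc_moment[of 3] by blast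
  obtain K' where K': "K' \<ge> 0" "\<And>s t n i. 0 \<le> s \<Longrightarrow> s \<le> t \<Longrightarrow>
      expectation (\<lambda>\<omega>. inc s t n i \<omega> ^ (2 * (2 * r + 1))) \<le> K' * ((t - s) / real n) ^ (2 * r + 1)"
    using inc_moment[of "2 * r + 1"] by blast
  obtain C where C: "C \<ge> 0" "\<And>s t n g k j. bdd_adapted s t n g k \<Longrightarrow> j \<le> n \<Longrightarrow>
     expectation (\<lambda>\<omega>. mart_sum s t n g j \<omega> ^ (2 * (2 * r + 1))) \<le> C * k ^ (2 * (2 * r + 1)) * (t - s) ^ (2 * r + 1)"
    using mart_sum_moment[of "2 * r + 1"] by blast
  define D where "D = (2::real) ^ (4 * r + 2)"
  define \<tau> where "\<tau> = \<bar>t - s\<bar>"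
  define E where "E = K * \<tau> ^ 3 + D * C * \<tau> ^ (2 * r + 1) + D * K' * \<tau> ^ (2 * r + 1)"
  have D: "0 \<le> D" by (simp add: D_def)
  have \<tau>: "0 \<le> \<tau>" by (simp add: \<tau>_def)
  have E: "0 \<le> E" unfolding E_def using K(1) K'(1) C(1) D \<tau> by simp
  have "expectation (\<lambda>\<omega>. \<bar>inc s t n i \<omega>\<bar> ^ 3 * (\<bar>mart_sum s t n g i \<omega>\<bar> + \<bar>inc s t n i \<omega>\<bar>) ^ (2 * r + 1))
       \<le> E / (real n * sqrt (real n))" if a: "bdd_adapted s t n g 1" and i: "i \<le> n" for n g i
  proof -
    have st: "0 \<le> s" "s \<le> t" "1 \<le> n" using a by (auto simp: bdd_adapted_def)
    have ts: "t - s = \<tau>" using st by (simp add: \<tau>_def)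
    define \<theta> where "\<theta> = real n * sqrt (real n)"
    have \<theta>: "\<theta> > 0" using st by (simp add: \<theta>_def)
    note fm = mart_sum_fin_mom[OF a] inc_fin_mom[OF st(1,2)]
    have "expectation (\<lambda>\<omega>. \<bar>inc s t n i \<omega>\<bar> ^ 3 * (\<bar>mart_sum s t n g i \<omega>\<bar> + \<bar>inc s t n i \<omega>\<bar>) ^ (2 * r + 1))
      \<le> \<theta> * expectation (\<lambda>\<omega>. inc s t n i \<omega> ^ (2 * 3))
        + D / \<theta> * expectation (\<lambda>\<omega>. mart_sum s t n g i \<omega> ^ (2 * (2 * r + 1)))
        + D / \<theta> * expectation (\<lambda>\<omega>. inc s t n i \<omega> ^ (2 * (2 * r + 1)))"
      unfolding D_def by (rule expectation_le_lin3) ((intro fin_mom_intros fm)+, rule cube_times_power_le[OF \<theta>])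
    also have "\<dots> \<le> \<theta> * (K * (\<tau> / real n) ^ 3) + D / \<theta> * (C * \<tau> ^ (2 * r + 1)) + D / \<theta> * (K' * \<tau> ^ (2 * r + 1))"
    proof (intro add_mono mult_left_mono)
      show "expectation (\<lambda>\<omega>. inc s t n i \<omega> ^ (2 * 3)) \<le> K * (\<tau> / real n) ^ 3"
        using K(2)[OF st(1,2), of n i] unfolding ts .
      show "expectation (\<lambda>\<omega>. mart_sum s t n g i \<omega> ^ (2 * (2 * r + 1))) \<le> C * \<tau> ^ (2 * r + 1)"
        using C(2)[OF a i] unfolding ts by simp
      have "expectation (\<lambda>\<omega>. inc s t n i \<omega> ^ (2 * (2 * r + 1))) \<le> K' * (\<tau> / real n) ^ (2 * r + 1)"
        using K'(2)[OF st(1,2), of n i] unfolding ts .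
      also have "\<dots> \<le> K' * (\<tau> / 1) ^ (2 * r + 1)"
        using K'(1) \<tau> st(3) by (intro mult_left_mono power_mono divide_left_mono) auto
      finally show "expectation (\<lambda>\<omega>. inc s t n i \<omega> ^ (2 * (2 * r + 1))) \<le> K' * \<tau> ^ (2 * r + 1)" by simp
    qed (use \<theta> D in simp_all)
    also have "\<theta> * (K * (\<tau> / real n) ^ 3) = K * \<tau> ^ 3 / \<theta>"
    proof -
      have n0: "real n > 0" using st by simp
      have "\<theta> * \<theta> = real n ^ 3"
        using n0 unfolding \<theta>_def by (simp add: power3_eq_cube mult_ac)
      then have "\<theta> * (K * (\<tau> / real n) ^ 3) = \<theta> * (K * \<tau> ^ 3 / (\<theta> * \<theta>))"
        by (simp add: power_divide)
      also have "\<dots> = K * \<tau> ^ 3 / \<theta>" using \<theta> by simp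
      finally show ?thesis .
    qed
    also have "K * \<tau> ^ 3 / \<theta> + D / \<theta> * (C * \<tau> ^ (2 * r + 1)) + D / \<theta> * (K' * \<tau> ^ (2 * r + 1)) = E / \<theta>"
      unfolding E_def by (simp add: add_divide_distrib)
    finally show ?thesis unfolding \<theta>_def .
  qed
  then show ?thesis using E by blast
qed

text \<open>Write \<open>M\<close> for the martingale sum and \<open>S\<close> for its bracket. The
  process \<open>M ^ (2 * r + 4) - c * M ^ (2 * r + 2) * S\<close> starts at zero and has
  nonpositive drift up to third order errors. This bounds the highest moment by the mixed one, and
  Young's inequality trades the mixed one for a power of \<open>S\<close>.\<close>

lemma mart_sum_le_quad_sum:
  "\<exists>C\<ge>0. \<forall>s t. \<exists>E\<ge>0. \<forall>n g. bdd_adapted s t n g 1 \<longrightarrow>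
     expectation (\<lambda>\<omega>. mart_sum s t n g n \<omega> ^ (2 * r + 4))
       \<le> C * expectation (\<lambda>\<omega>. quad_sum s t n g n \<omega> ^ (r + 2)) + E / sqrt (real n)"
proof -
  define c where "c = real ((r + 2) * (2 * r + 3))"
  obtain C where C: "C \<ge> 0" "\<And>x y s::real. 0 \<le> s \<Longrightarrow>
     (x + y) ^ (2 * r + 4) - c * (x + y) ^ (2 * r + 2) * (s + y\<^sup>2)
     \<le> x ^ (2 * r + 4) - c * x ^ (2 * r + 2) * s + real (2 * r + 4) * (x ^ (2 * r + 3) * y)
       - c * real (2 * r + 2) * (s * x ^ (2 * r + 1) * y) + C * (\<bar>y\<bar> ^ 3 * (\<bar>x\<bar> + \<bar>y\<bar>) ^ (2 * r + 1))"
    using even_power_Ito_step[of r] unfolding c_def by blast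
  have c: "c > 0" unfolding c_def of_nat_0_less_iff by simp
  have "\<exists>E\<ge>0. \<forall>n g. bdd_adapted s t n g 1 \<longrightarrow>
     expectation (\<lambda>\<omega>. mart_sum s t n g n \<omega> ^ (2 * r + 4))
       \<le> (2 * c * (2 * c) ^ (r + 1)) * expectation (\<lambda>\<omega>. quad_sum s t n g n \<omega> ^ (r + 2)) + E / sqrt (real n)" for s t
  proof -
    obtain E where E: "E \<ge> 0" "\<And>n g i. bdd_adapted s t n g 1 \<Longrightarrow> i \<le> n \<Longrightarrow>
       expectation (\<lambda>\<omega>. \<bar>inc s t n i \<omega>\<bar> ^ 3 * (\<bar>mart_sum s t n g i \<omega>\<bar> + \<bar>inc s t n i \<omega>\<bar>) ^ (2 * r + 1))
       \<le> E / (real n * sqrt (real n))"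
      using increment_cube_bound[of s t r] by blast
    have "expectation (\<lambda>\<omega>. mart_sum s t n g n \<omega> ^ (2 * r + 4))
       \<le> (2 * c * (2 * c) ^ (r + 1)) * expectation (\<lambda>\<omega>. quad_sum s t n g n \<omega> ^ (r + 2)) + (2 * C * E) / sqrt (real n)"
      if a: "bdd_adapted s t n g 1" for n g
    proof -
      have st: "0 \<le> s" "s \<le> t" "1 \<le> n" and g1: "\<And>i \<omega>. \<bar>g i \<omega>\<bar> \<le> 1"
        using a by (auto simp: bdd_adapted_def)
      let ?M = "mart_sum s t n g"
      let ?S = "quad_sum s t n g"
      note fm = mart_sum_fin_mom[OF a] inc_fin_mom[OF st(1,2)] bdd_adapted_fin_mom[OF a] quad_sum_fin_mom[OF a]
      note ms = borel_measurable_times borel_measurable_power mart_sum_measurable_F[OF a]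
        bdd_adapted_measurable[OF a] quad_sum_measurable_F[OF a]
      define U where "U i = (\<lambda>\<omega>. ?M i \<omega> ^ (2 * r + 4) - c * ?M i \<omega> ^ (2 * r + 2) * ?S i \<omega>)" for i
      have fU: "fin_mom (U i)" for i unfolding U_def by (intro fin_mom_intros fm)
      define W where "W i = (\<lambda>\<omega>. \<bar>inc s t n i \<omega>\<bar> ^ 3 * (\<bar>?M i \<omega>\<bar> + \<bar>inc s t n i \<omega>\<bar>) ^ (2 * r + 1))" for i
      have fW: "fin_mom (W i)" for i unfolding W_def by (intro fin_mom_intros fm)
      define V where "V i = (\<lambda>\<omega>. real (2 * r + 4) * (?M i \<omega> ^ (2 * r + 3) * g i \<omega>)
         - c * real (2 * r + 2) * (?S i \<omega> * ?M i \<omega> ^ (2 * r + 1) * g i \<omega>))" for i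
      have fV: "fin_mom (V i)" for i unfolding V_def by (intro fin_mom_intros fm)
      have V0: "expectation (\<lambda>\<omega>. V i \<omega> * inc s t n i \<omega>) = 0" for i
        by (rule inc_orthogonal[OF st(1,2) _ fV]) (unfold V_def, intro borel_measurable_diff ms borel_measurable_const)
      have pt: "U (Suc i) \<omega> \<le> 1 * U i \<omega> + 1 * (V i \<omega> * inc s t n i \<omega>) + C * W i \<omega>" for i \<omega>
      proof -
        define x where "x = ?M i \<omega>"
        define h where "h = inc s t n i \<omega>"
        define y where "y = g i \<omega> * h"
        have y: "\<bar>y\<bar> \<le> \<bar>h\<bar>"
          using mult_right_mono[OF g1[of i \<omega>] abs_ge_zero[of h]] by (simp add: y_def abs_mult)
        have "\<bar>y\<bar> ^ 3 * (\<bar>x\<bar> + \<bar>y\<bar>) ^ (2 * r + 1) \<le> W i \<omega>"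
          unfolding W_def x_def[symmetric] h_def[symmetric]
          using y by (intro mult_mono power_mono add_left_mono) auto
        then have 1: "C * (\<bar>y\<bar> ^ 3 * (\<bar>x\<bar> + \<bar>y\<bar>) ^ (2 * r + 1)) \<le> C * W i \<omega>"
          using C(1) by (rule mult_left_mono)
        have 2: "?M (Suc i) \<omega> = x + y" "?S (Suc i) \<omega> = ?S i \<omega> + y\<^sup>2"
          by (simp_all add: x_def y_def h_def mart_sum_def quad_sum_def)
        have 3: "V i \<omega> * h = real (2 * r + 4) * (x ^ (2 * r + 3) * y) - c * real (2 * r + 2) * (?S i \<omega> * x ^ (2 * r + 1) * y)"
          unfolding V_def x_def[symmetric] y_def left_diff_distrib by (simp only: mult.assoc)
        have gen: "a \<le> 1 * b + 1 * (d - e) + W" if "a \<le> b + d - e + T" "T \<le> W" for a b d e T W :: real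
          using that by simp
        show ?thesis
          unfolding U_def 2 x_def[symmetric] h_def[symmetric] 3
          by (rule gen[OF C(2)[OF quad_sum_nonneg] 1])
      qed
      have step: "expectation (U (Suc i)) \<le> expectation (U i) + C * (E / (real n * sqrt (real n)))" if i: "i < n" for i
      proof -
        have "expectation (U (Suc i)) \<le> 1 * expectation (U i) + 1 * expectation (\<lambda>\<omega>. V i \<omega> * inc s t n i \<omega>) + C * expectation (W i)"
          by (rule expectation_le_lin3[OF fU fU fin_mom_mult[OF fV inc_fin_mom[OF st(1,2)]] fW pt])
        moreover have "C * expectation (W i) \<le> C * (E / (real n * sqrt (real n)))"
          using E(2)[OF a, of i] i C(1) unfolding W_def by (intro mult_left_mono) auto
        ultimately show ?thesis using V0 by simp
      qed
      have "expectation (U i) \<le> real i * (C * (E / (real n * sqrt (real n))))" if "i \<le> n" for i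
        using that
      proof (induction i)
        case 0
        then show ?case by (simp add: U_def mart_sum_def power_0_left)
      next
        case (Suc i)
        then have "expectation (U (Suc i)) \<le> real i * (C * (E / (real n * sqrt (real n)))) + C * (E / (real n * sqrt (real n)))"
          using step[of i] by force
        then show ?case by (simp only: of_nat_Suc distrib_right mult_1 add.commute)
      qed
      from this[of n] have Un: "expectation (U n) \<le> C * E / sqrt (real n)"
        using st(3) by simp
      \<comment> \<open>Young's inequality with weight \<open>2 * c\<close> leaves exactly half of
        the moment on the right, where it can be absorbed because all moments are finite.\<close>
      have "expectation (\<lambda>\<omega>. ?M n \<omega> ^ (2 * r + 4)) \<le> 1 * expectation (U n) + (1 / 2) * expectation (\<lambda>\<omega>. ?M n \<omega> ^ (2 * r + 4))
          + c * (2 * c) ^ (r + 1) * expectation (\<lambda>\<omega>. ?S n \<omega> ^ (r + 2))"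
      proof (rule expectation_le_lin3)
        fix \<omega>
        define x where "x = ?M n \<omega>"
        define S where "S = ?S n \<omega>"
        have "(x\<^sup>2) ^ (r + 1) * S \<le> (x\<^sup>2) ^ Suc (r + 1) / (2 * c) + (2 * c) ^ (r + 1) * S ^ Suc (r + 1)"
          using quad_sum_nonneg c unfolding S_def by (intro Young_power) auto
        then have "c * ((x\<^sup>2) ^ (r + 1) * S) \<le> c * ((x\<^sup>2) ^ Suc (r + 1) / (2 * c) + (2 * c) ^ (r + 1) * S ^ Suc (r + 1))"
          using c by (intro mult_left_mono) auto
        also have "\<dots> = (1 / 2) * (x\<^sup>2) ^ Suc (r + 1) + c * (2 * c) ^ (r + 1) * S ^ Suc (r + 1)"
          using c by (simp add: distrib_left)
        finally have "c * ((x\<^sup>2) ^ (r + 1) * S) \<le> (1 / 2) * (x\<^sup>2) ^ Suc (r + 1) + c * (2 * c) ^ (r + 1) * S ^ Suc (r + 1)" .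
        moreover have "2 * r + 2 = 2 * (r + 1)" "2 * r + 4 = 2 * Suc (r + 1)" by simp_all
        then have "(x\<^sup>2) ^ (r + 1) = x ^ (2 * r + 2)" "(x\<^sup>2) ^ Suc (r + 1) = x ^ (2 * r + 4)"
          by (simp_all only: power_mult)
        moreover have "Suc (r + 1) = r + 2" by simp
        ultimately show "?M n \<omega> ^ (2 * r + 4) \<le> 1 * U n \<omega> + (1 / 2) * ?M n \<omega> ^ (2 * r + 4) + c * (2 * c) ^ (r + 1) * ?S n \<omega> ^ (r + 2)"
          unfolding U_def x_def[symmetric] S_def[symmetric] by (simp only: mult.assoc mult_1)
      qed (intro fin_mom_intros fm fU)+
      then have "expectation (\<lambda>\<omega>. ?M n \<omega> ^ (2 * r + 4)) \<le> 2 * (C * E / sqrt (real n))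
          + 2 * (c * (2 * c) ^ (r + 1) * expectation (\<lambda>\<omega>. ?S n \<omega> ^ (r + 2)))"
        using Un by linarith
      then show ?thesis by (simp add: mult.assoc)
    qed
    moreover have "0 \<le> 2 * C * E" using C(1) E(1) by simp
    ultimately show ?thesis by blast
  qed
  moreover have "0 \<le> 2 * c * (2 * c) ^ (r + 1)" using c by simp
  ultimately show ?thesis by blast
qed

end

section \<open>Antiderivatives, the discrete Ito formula and uniform moment bounds\<close>

section \<open>Riemann sums against the quadratic variation\<close>

text \<open>\<open>L\<close> is a Lipschitz constant of \<open>f\<close>, and \<open>F1' = f\<close>, \<open>F2' = F1\<close>.\<close>

definition antiderivs :: "real \<Rightarrow> (real \<Rightarrow> real) \<Rightarrow> (real \<Rightarrow> real) \<Rightarrow> (real \<Rightarrow> real) \<Rightarrow> bool" where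
  "antiderivs L f F1 F2 \<longleftrightarrow> 0 \<le> L \<and> (\<forall>x y. \<bar>f x - f y\<bar> \<le> L * \<bar>x - y\<bar>) \<and>
     (\<forall>x. (F1 has_real_derivative f x) (at x)) \<and> (\<forall>x. (F2 has_real_derivative F1 x) (at x))"

lemma MVT_abs_le:
  assumes d: "\<And>z. (g has_real_derivative g' z) (at z)" and b: "\<And>z. \<bar>z - x\<bar> \<le> \<bar>y - x\<bar> \<Longrightarrow> \<bar>g' z\<bar> \<le> k"
  shows "\<bar>g y - g x\<bar> \<le> k * \<bar>y - x\<bar>"
proof -
  consider "x < y" | "x = y" | "y < x" by linarith
  then show ?thesis
  proof cases
    case 1
    then obtain z where z: "x < z" "z < y" "g y - g x = (y - x) * g' z" using MVT2[OF 1 d] by blast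
    then show ?thesis using b[of z] 1 by (simp add: abs_mult mult.commute mult_left_mono)
  next
    case 3
    then obtain z where z: "y < z" "z < x" "g x - g y = (x - y) * g' z" using MVT2[OF 3 d] by blast
    then have "\<bar>g y - g x\<bar> = \<bar>y - x\<bar> * \<bar>g' z\<bar>" by (metis abs_minus_commute abs_mult)
    then show ?thesis using b[of z] z by (simp add: mult.commute mult_left_mono)
  qed simp
qed

text \<open>As \<open>f\<close> is only Lipschitz, the third order remainder comes from two
  applications of the mean value bound instead of a third derivative.\<close>

lemma antiderivs_Taylor:
  assumes "antiderivs L f F1 F2"
  shows "\<bar>F2 y - F2 x - F1 x * (y - x) - f x / 2 * (y - x)\<^sup>2\<bar> \<le> L * \<bar>y - x\<bar> ^ 3"
proof -
  have L: "0 \<le> L" "\<And>x y. \<bar>f x - f y\<bar> \<le> L * \<bar>x - y\<bar>"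
    and F1: "\<And>x. (F1 has_real_derivative f x) (at x)" and F2: "\<And>x. (F2 has_real_derivative F1 x) (at x)"
    using assms unfolding antiderivs_def by blast+
  have 1: "\<bar>F1 z - F1 x - f x * (z - x)\<bar> \<le> L * \<bar>z - x\<bar> * \<bar>z - x\<bar>" for z
  proof -
    have "\<bar>(F1 z - f x * z) - (F1 x - f x * x)\<bar> \<le> L * \<bar>z - x\<bar> * \<bar>z - x\<bar>"
    proof (rule MVT_abs_le)
      fix w
      show "((\<lambda>z. F1 z - f x * z) has_real_derivative f w - f x) (at w)"
        by (auto intro!: derivative_eq_intros F1)
      assume "\<bar>w - x\<bar> \<le> \<bar>z - x\<bar>"
      then show "\<bar>f w - f x\<bar> \<le> L * \<bar>z - x\<bar>" using L(2)[of w x] L(1) mult_left_mono order_trans by metis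
    qed
    then show ?thesis by (simp add: algebra_simps)
  qed
  have "\<bar>(F2 y - F1 x * (y - x) - f x / 2 * (y - x)\<^sup>2) - (F2 x - F1 x * (x - x) - f x / 2 * (x - x)\<^sup>2)\<bar>
      \<le> (L * \<bar>y - x\<bar> * \<bar>y - x\<bar>) * \<bar>y - x\<bar>"
  proof (rule MVT_abs_le)
    fix w
    show "((\<lambda>z. F2 z - F1 x * (z - x) - f x / 2 * (z - x)\<^sup>2) has_real_derivative F1 w - F1 x - f x * (w - x)) (at w)"
      by (auto intro!: derivative_eq_intros F2)
    assume w: "\<bar>w - x\<bar> \<le> \<bar>y - x\<bar>"
    have "\<bar>F1 w - F1 x - f x * (w - x)\<bar> \<le> L * \<bar>w - x\<bar> * \<bar>w - x\<bar>" by (rule 1)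
    also have "\<dots> \<le> L * \<bar>y - x\<bar> * \<bar>y - x\<bar>" using w L(1) by (intro mult_mono) simp_all
    finally show "\<bar>F1 w - F1 x - f x * (w - x)\<bar> \<le> L * \<bar>y - x\<bar> * \<bar>y - x\<bar>" .
  qed
  then show ?thesis by (simp add: power3_eq_cube algebra_simps)
qed

lemma antiderivs_F1_continuous: "antiderivs L f F1 F2 \<Longrightarrow> continuous_on UNIV F1"
  unfolding antiderivs_def by (meson DERIV_isCont continuous_at_imp_continuous_on)

lemma antiderivs_f_continuous:
  assumes "antiderivs L f F1 F2"
  shows "continuous_on UNIV f"
proof -
  have "L-lipschitz_on UNIV f"
    using assms unfolding antiderivs_def lipschitz_on_def dist_real_def by blast
  then show ?thesis by (rule lipschitz_on_continuous_on)
qed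

text \<open>Comparison with the largest term loses a factor \<open>n\<close> against Hoelder's
  inequality, which the third powers of increments can afford.\<close>

lemma sum_power_le:
  fixes a :: "nat \<Rightarrow> real"
  assumes "\<And>i. 0 \<le> a i" "1 \<le> n"
  shows "(\<Sum>i<n. a i) ^ p \<le> real n ^ p * (\<Sum>i<n. a i ^ p)"
proof -
  have ne: "a ` {..<n} \<noteq> {}" "finite (a ` {..<n})" using assms(2) by (auto simp: lessThan_empty_iff)
  obtain j where j: "j < n" "Max (a ` {..<n}) = a j" using Max_in[OF ne(2,1)] by auto
  have "(\<Sum>i<n. a i) \<le> (\<Sum>i<n. a j)"
    using Max_ge[OF ne(2)] j(2) by (intro sum_mono) auto
  then have "(\<Sum>i<n. a i) ^ p \<le> (real n * a j) ^ p"
    using assms(1) by (intro power_mono sum_nonneg) auto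
  also have "\<dots> = real n ^ p * a j ^ p" by (rule power_mult_distrib)
  also have "\<dots> \<le> real n ^ p * (\<Sum>i<n. a i ^ p)"
    using j(1) assms(1) by (intro mult_left_mono member_le_sum) auto
  finally show ?thesis .
qed

lemma add3_power_le:
  fixes a b c :: real
  assumes "0 \<le> a" "0 \<le> b" "0 \<le> c"
  shows "(a + b + c) ^ k \<le> 3 ^ k * (a ^ k + b ^ k + c ^ k)"
proof -
  define m where "m = max a (max b c)"
  have "(a + b + c) ^ k \<le> (3 * m) ^ k" using assms unfolding m_def by (intro power_mono) auto
  also have "\<dots> = 3 ^ k * m ^ k" by (rule power_mult_distrib)
  also have "m ^ k \<le> a ^ k + b ^ k + c ^ k"
  proof -
    have "m = a \<or> m = b \<or> m = c" unfolding m_def by linarith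
    moreover have "0 \<le> a ^ k" "0 \<le> b ^ k" "0 \<le> c ^ k" using assms by simp_all
    ultimately show ?thesis by auto
  qed
  finally show ?thesis by simp
qed

lemma antiderivative_of_bump:
  fixes f :: "real \<Rightarrow> real"
  assumes f: "continuous_on UNIV f" "\<And>x. 0 \<le> f x" "\<And>x. f x \<le> 1"
    and out: "\<And>x. x \<le> p \<Longrightarrow> f x = 0" "\<And>x. q \<le> x \<Longrightarrow> f x = 0" and pq: "p \<le> q"
  shows "\<exists>F. (\<forall>x. (F has_real_derivative f x) (at x)) \<and> (\<forall>x\<le>p. F x = 0) \<and> (\<forall>x\<ge>q. F x = F q) \<and>
    (\<forall>x. 0 \<le> F x \<and> F x \<le> q - p)"
proof -
  obtain G where G: "\<And>x. (G has_vector_derivative f x) (at x)"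
    using einterval_antiderivative[of "-\<infinity>" "\<infinity>" f] f(1) by (auto simp: continuous_on_eq_continuous_at)
  define F where "F x = G x - G p" for x
  have d: "(F has_real_derivative f x) (at x)" for x
    using G[of x] unfolding F_def
    by (auto intro!: derivative_eq_intros simp: has_real_derivative_iff_has_vector_derivative)
  have eq: "F y = F x" if "x \<le> y" "\<And>z. x \<le> z \<Longrightarrow> z \<le> y \<Longrightarrow> f z = 0" for x y
  proof (cases "x = y")
    case False
    then have "x < y" using that(1) by simp
    then obtain z where "x < z" "z < y" "F y - F x = (y - x) * f z" using MVT2[OF _ d] by blast
    then show ?thesis using that(2)[of z] by simp
  qed simp
  have mono: "F x \<le> F y" if "x \<le> y" for x y
    by (rule DERIV_nonneg_imp_nondecreasing[OF that]) (use d f(2) in blast)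
  have 0: "F x = 0" if "x \<le> p" for x
    using eq[OF that] out(1) by (simp add: F_def)
  have q: "F x = F q" if "q \<le> x" for x
    using eq[OF that] out(2) by simp
  have "\<bar>F q - F p\<bar> \<le> 1 * \<bar>q - p\<bar>" by (rule MVT_abs_le[OF d]) (use f in simp)
  then have Fq: "F q \<le> q - p" using 0[of p] pq by simp
  have "0 \<le> F x \<and> F x \<le> q - p" for x
  proof
    show "0 \<le> F x" using mono[of "min x p" x] 0[of "min x p"] by simp
    show "F x \<le> q - p" using mono[of x "max x q"] q[of "max x q"] Fq by simp
  qed
  then show ?thesis using d 0 q by blast
qed

lemma continuous_antiderivative_exists:
  fixes f :: "real \<Rightarrow> real"
  assumes "continuous_on UNIV f"
  shows "\<exists>F. \<forall>x. (F has_real_derivative f x) (at x)"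
  using einterval_antiderivative[of "-\<infinity>" "\<infinity>" f] assms
  by (auto simp: continuous_on_eq_continuous_at has_real_derivative_iff_has_vector_derivative)

text \<open>A trapezoid which is 1 on the given interval and vanishes at distance
  \<open>\<eta>\<close> from it. Its support has length \<open>3 * \<eta>\<close>, and this bounds
  the antiderivative that vanishes to the left.\<close>

lemma plateau_exists:
  fixes lo \<eta> :: real
  assumes "0 < \<eta>"
  shows "\<exists>f F1 F2 L. antiderivs L f F1 F2 \<and> (\<forall>x. 0 \<le> f x) \<and> (\<forall>x\<in>{lo..lo + \<eta>}. 1 \<le> f x) \<and> (\<forall>x. \<bar>F1 x\<bar> \<le> 3 * \<eta>) \<and> (\<exists>c. \<forall>x. \<bar>f x\<bar> \<le> c)"
proof -
  define f where "f x = max 0 (1 - max 0 (max (lo - x) (x - (lo + \<eta>))) / \<eta>)" for x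
  have lip: "\<bar>f x - f y\<bar> \<le> 1 / \<eta> * \<bar>x - y\<bar>" for x y
  proof -
    define a where "a x = max 0 (max (lo - x) (x - (lo + \<eta>)))" for x
    have "\<bar>a x - a y\<bar> \<le> \<bar>x - y\<bar>" unfolding a_def by linarith
    then have "\<bar>a x - a y\<bar> / \<eta> \<le> \<bar>x - y\<bar> / \<eta>" using assms by (intro divide_right_mono) auto
    moreover have "\<bar>a x / \<eta> - a y / \<eta>\<bar> = \<bar>a x - a y\<bar> / \<eta>" using assms by (simp add: diff_divide_distrib[symmetric])
    moreover have "\<bar>f x - f y\<bar> \<le> \<bar>a x / \<eta> - a y / \<eta>\<bar>" unfolding f_def a_def[symmetric] by linarith
    ultimately show ?thesis by simp
  qed
  have "(1 / \<eta>)-lipschitz_on UNIV f" using lip assms by (simp add: lipschitz_on_def dist_real_def)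
  then have cont: "continuous_on UNIV f" by (rule lipschitz_on_continuous_on)
  have f01: "0 \<le> f x" "f x \<le> 1" for x using assms by (simp_all add: f_def)
  have "f x = 0" if "x \<le> lo - \<eta>" for x
  proof -
    have "\<eta> \<le> max 0 (max (lo - x) (x - (lo + \<eta>)))" using that by linarith
    then have "1 \<le> max 0 (max (lo - x) (x - (lo + \<eta>))) / \<eta>" using assms by simp
    then show ?thesis unfolding f_def by linarith
  qed
  moreover have "f x = 0" if "lo + 2 * \<eta> \<le> x" for x
  proof -
    have "\<eta> \<le> max 0 (max (lo - x) (x - (lo + \<eta>)))" using that by linarith
    then have "1 \<le> max 0 (max (lo - x) (x - (lo + \<eta>))) / \<eta>" using assms by simp
    then show ?thesis unfolding f_def by linarith
  qed
  moreover have "lo - \<eta> \<le> lo + 2 * \<eta>" using assms by simp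
  ultimately obtain F1 where F1: "\<And>x. (F1 has_real_derivative f x) (at x)"
    "\<And>x. 0 \<le> F1 x \<and> F1 x \<le> (lo + 2 * \<eta>) - (lo - \<eta>)"
    using antiderivative_of_bump[OF cont f01, of "lo - \<eta>" "lo + 2 * \<eta>"] by blast
  have "continuous_on UNIV F1" using F1(1) by (meson DERIV_isCont continuous_at_imp_continuous_on)
  then obtain F2 where F2: "\<And>x. (F2 has_real_derivative F1 x) (at x)"
    using continuous_antiderivative_exists by blast
  have "antiderivs (1 / \<eta>) f F1 F2" unfolding antiderivs_def using lip F1(1) F2 assms by simp
  moreover have "1 \<le> f x" if "x \<in> {lo..lo + \<eta>}" for x
  proof -
    have "max 0 (max (lo - x) (x - (lo + \<eta>))) = 0" using that by simp
    then show ?thesis unfolding f_def by simp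
  qed
  moreover have "\<bar>F1 x\<bar> \<le> 3 * \<eta>" for x using F1(2)[of x] by linarith
  moreover have "\<bar>f x\<bar> \<le> 1" for x using f01[of x] by simp
  ultimately show ?thesis
    by (rule_tac exI[of _ f], rule_tac exI[of _ F1], rule_tac exI[of _ F2], rule_tac exI[of _ "1 / \<eta>"])
       (intro conjI allI ballI exI[of _ 1] f01(1))
qed

context moment_martingale
begin

text \<open>Discrete form of the integral of \<open>f(B)\<close> against the quadratic variation; it
  involves increments of \<open>B\<close> only and is therefore within reach of the martingale
  estimates.\<close>

definition riem :: "(real \<Rightarrow> real) \<Rightarrow> real \<Rightarrow> real \<Rightarrow> nat \<Rightarrow> 'a \<Rightarrow> real" where
  "riem f s t n \<omega> = (\<Sum>i<n. f (B (node s t n i) \<omega>) * (inc s t n i \<omega>)\<^sup>2)"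

definition cube_sum :: "real \<Rightarrow> real \<Rightarrow> nat \<Rightarrow> 'a \<Rightarrow> real" where
  "cube_sum s t n \<omega> = (\<Sum>i<n. \<bar>inc s t n i \<omega>\<bar> ^ 3)"

lemma cube_sum_fin_mom: "0 \<le> s \<Longrightarrow> s \<le> t \<Longrightarrow> fin_mom (cube_sum s t n)"
  unfolding cube_sum_def[abs_def] by (intro fin_mom_intros inc_fin_mom)

lemma cube_sum_nonneg: "0 \<le> cube_sum s t n \<omega>"
  unfolding cube_sum_def by (simp add: sum_nonneg)

text \<open>Counting powers of \<open>n\<close> gives \<open>n ^ (2 * m + 1) / n ^ (3 * m)\<close>,
  which is at most \<open>1 / n\<close> as soon as \<open>m\<close> is at least 2.\<close>

lemma cube_sum_moment:
  assumes "0 \<le> s" "s \<le> t" "2 \<le> m"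
  shows "\<exists>E\<ge>0. \<forall>n\<ge>1. expectation (\<lambda>\<omega>. cube_sum s t n \<omega> ^ (2 * m)) \<le> E / real n"
proof -
  obtain K where K: "K \<ge> 0" "\<And>s t n i. 0 \<le> s \<Longrightarrow> s \<le> t \<Longrightarrow>
      expectation (\<lambda>\<omega>. inc s t n i \<omega> ^ (2 * (3 * m))) \<le> K * ((t - s) / real n) ^ (3 * m)"
    using inc_moment[of "3 * m"] by blast
  have "expectation (\<lambda>\<omega>. cube_sum s t n \<omega> ^ (2 * m)) \<le> K * (t - s) ^ (3 * m) / real n" if n: "1 \<le> n" for n
  proof -
    note fm = inc_fin_mom[OF assms(1,2)] cube_sum_fin_mom[OF assms(1,2)]
    have "expectation (\<lambda>\<omega>. cube_sum s t n \<omega> ^ (2 * m))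
        \<le> expectation (\<lambda>\<omega>. real n ^ (2 * m) * (\<Sum>i<n. inc s t n i \<omega> ^ (2 * (3 * m))))"
    proof (rule expectation_mono_fin_mom)
      fix \<omega>
      have "cube_sum s t n \<omega> ^ (2 * m) \<le> real n ^ (2 * m) * (\<Sum>i<n. (\<bar>inc s t n i \<omega>\<bar> ^ 3) ^ (2 * m))"
        unfolding cube_sum_def by (rule sum_power_le[OF _ n]) simp
      also have "(\<Sum>i<n. (\<bar>inc s t n i \<omega>\<bar> ^ 3) ^ (2 * m)) = (\<Sum>i<n. inc s t n i \<omega> ^ (2 * (3 * m)))"
      proof (rule sum.cong[OF refl])
        fix i
        have "(\<bar>inc s t n i \<omega>\<bar> ^ 3) ^ (2 * m) = \<bar>inc s t n i \<omega>\<bar> ^ (2 * (3 * m))"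
          unfolding power_mult[symmetric] by (rule arg_cong2[where f = power]) simp_all
        then show "(\<bar>inc s t n i \<omega>\<bar> ^ 3) ^ (2 * m) = inc s t n i \<omega> ^ (2 * (3 * m))"
          by (simp add: power_even_abs)
      qed
      finally show "cube_sum s t n \<omega> ^ (2 * m) \<le> real n ^ (2 * m) * (\<Sum>i<n. inc s t n i \<omega> ^ (2 * (3 * m)))" .
    qed (intro fin_mom_intros fm)+
    also have "\<dots> = real n ^ (2 * m) * (\<Sum>i<n. expectation (\<lambda>\<omega>. inc s t n i \<omega> ^ (2 * (3 * m))))"
      by (subst integral_mult_right_zero, subst Bochner_Integration.integral_sum)
         (auto intro!: fin_mom_integrable fin_mom_intros fm)
    also have "\<dots> \<le> real n ^ (2 * m) * (\<Sum>i<n. K * ((t - s) / real n) ^ (3 * m))"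
      by (intro mult_left_mono sum_mono K(2) assms) auto
    also have "\<dots> = K * (t - s) ^ (3 * m) * (real n ^ (2 * m + 1) / real n ^ (3 * m))"
      by (simp add: power_divide)
    also have "\<dots> \<le> K * (t - s) ^ (3 * m) * (1 / real n)"
    proof (rule mult_left_mono)
      have "real n ^ (2 * m + 2) \<le> real n ^ (3 * m)" using n assms(3) by (intro power_increasing) auto
      then show "real n ^ (2 * m + 1) / real n ^ (3 * m) \<le> 1 / real n"
        using n by (simp add: field_simps)
    qed (use K(1) assms in auto)
    finally show ?thesis by simp
  qed
  moreover have "0 \<le> K * (t - s) ^ (3 * m)" using K(1) assms by simp
  ultimately show ?thesis by blast
qed

lemma F1_bdd_adapted:
  assumes "antiderivs L f F1 F2" "\<And>x. \<bar>F1 x\<bar> \<le> k" "0 \<le> s" "s \<le> t" "1 \<le> n"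
  shows "bdd_adapted s t n (\<lambda>i \<omega>. F1 (B (node s t n i) \<omega>)) k"
  unfolding bdd_adapted_def
proof (intro conjI allI assms)
  fix i
  have "F1 \<in> borel_measurable borel"
    by (rule borel_measurable_continuous_onI[OF antiderivs_F1_continuous[OF assms(1)]])
  then show "(\<lambda>\<omega>. F1 (B (node s t n i) \<omega>)) \<in> borel_measurable (F (node s t n i))"
    using B_node_measurable[OF assms(3,4), of i i n] by (rule measurable_compose[rotated]) simp
qed

text \<open>Taylor's formula for \<open>F2\<close> on each cell, solved for the second order term;
  the increments of \<open>F2\<close> telescope and those with \<open>F1\<close> form a martingale
  sum.\<close>

lemma riem_Ito:
  assumes a: "antiderivs L f F1 F2" and n: "1 \<le> n"
  shows "\<bar>riem f s t n \<omega> - (2 * (F2 (B t \<omega>) - F2 (B s \<omega>))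
     - 2 * mart_sum s t n (\<lambda>i \<omega>. F1 (B (node s t n i) \<omega>)) n \<omega>)\<bar> \<le> 2 * L * cube_sum s t n \<omega>"
proof -
  define Y where "Y i = B (node s t n i) \<omega>" for i
  have i: "inc s t n i \<omega> = Y (Suc i) - Y i" for i by (simp add: inc_def Y_def)
  have tel: "F2 (B t \<omega>) - F2 (B s \<omega>) = (\<Sum>i<n. F2 (Y (Suc i)) - F2 (Y i))"
    using sum_lessThan_telescope[of "\<lambda>i. F2 (Y i)" n] by (simp add: Y_def node_n[OF n])
  define d where "d i = F2 (Y (Suc i)) - F2 (Y i) - F1 (Y i) * (Y (Suc i) - Y i) - f (Y i) / 2 * (Y (Suc i) - Y i)\<^sup>2" for i
  have eq: "riem f s t n \<omega> - (2 * (F2 (B t \<omega>) - F2 (B s \<omega>))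
     - 2 * mart_sum s t n (\<lambda>i \<omega>. F1 (B (node s t n i) \<omega>)) n \<omega>) = (\<Sum>i<n. - 2 * d i)"
    unfolding tel riem_def mart_sum_def i Y_def[symmetric] sum_distrib_left sum_subtractf[symmetric] d_def
    by (intro sum.cong refl) (simp add: algebra_simps)
  have "\<bar>- 2 * d i\<bar> \<le> 2 * L * \<bar>Y (Suc i) - Y i\<bar> ^ 3" for i
    using antiderivs_Taylor[OF a, of "Y (Suc i)" "Y i", folded d_def] by (simp add: abs_mult)
  then have "(\<Sum>i<n. \<bar>- 2 * d i\<bar>) \<le> (\<Sum>i<n. 2 * L * \<bar>Y (Suc i) - Y i\<bar> ^ 3)"
    by (rule sum_mono)
  then have "\<bar>\<Sum>i<n. - 2 * d i\<bar> \<le> (\<Sum>i<n. 2 * L * \<bar>Y (Suc i) - Y i\<bar> ^ 3)"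
    by (rule order_trans[OF sum_abs])
  then show ?thesis unfolding eq cube_sum_def i sum_distrib_left .
qed

lemma riem_fin_mom:
  assumes "antiderivs L f F1 F2" "0 \<le> s" "s \<le> t" "\<And>x. \<bar>f x\<bar> \<le> c"
  shows "fin_mom (riem f s t n)"
proof -
  have "f \<in> borel_measurable borel"
    by (rule borel_measurable_continuous_onI[OF antiderivs_f_continuous[OF assms(1)]])
  then have "fin_mom (\<lambda>\<omega>. f (B (node s t n i) \<omega>))" for i
    using B_measurable[OF node_nonneg[OF assms(2,3)]] assms(4)
    by (intro fin_mom_bounded[of _ c]) (auto intro: measurable_compose)
  then show ?thesis unfolding riem_def[abs_def] by (intro fin_mom_intros inc_fin_mom assms)
qed

text \<open>In the discrete Ito formula both the increment of \<open>F2\<close> and the martingale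
  part have size \<open>k * sqrt (t - s)\<close>. The Lipschitz constant of \<open>f\<close>, which
  explodes when \<open>f\<close> approaches an indicator, enters only the vanishing error.\<close>

lemma riem_moment_time:
  assumes m: "2 \<le> m"
  shows "\<exists>C\<ge>0. \<forall>s t k L f F1 F2 c. 0 \<le> s \<longrightarrow> s \<le> t \<longrightarrow> antiderivs L f F1 F2 \<longrightarrow> (\<forall>x. \<bar>F1 x\<bar> \<le> k) \<longrightarrow> (\<forall>x. \<bar>f x\<bar> \<le> c) \<longrightarrow>
    (\<exists>E\<ge>0. \<forall>n\<ge>1. expectation (\<lambda>\<omega>. riem f s t n \<omega> ^ (2 * m)) \<le> C * k ^ (2 * m) * (t - s) ^ m + E / real n)"
proof -
  obtain K where K: "K \<ge> 0" "\<And>s t. 0 \<le> s \<Longrightarrow> s \<le> t \<Longrightarrow>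
      expectation (\<lambda>\<omega>. (B t \<omega> - B s \<omega>) ^ (2 * m)) \<le> K * (t - s) ^ m" using mom[of m] by blast
  obtain C where C: "C \<ge> 0" "\<And>s t n g k j. bdd_adapted s t n g k \<Longrightarrow> j \<le> n \<Longrightarrow>
     expectation (\<lambda>\<omega>. mart_sum s t n g j \<omega> ^ (2 * m)) \<le> C * k ^ (2 * m) * (t - s) ^ m"
    using mart_sum_moment[of m] by blast
  \<comment> \<open>The base \<open>6\<close> is the product of the \<open>3\<close> summands and
    the factor \<open>2\<close> in the Ito formula.\<close>
  define C' where "C' = 6 ^ (2 * m) * (K + C)"
  have C': "0 \<le> C'" using K(1) C(1) by (simp add: C'_def)
  have "\<exists>E\<ge>0. \<forall>n\<ge>1. expectation (\<lambda>\<omega>. riem f s t n \<omega> ^ (2 * m)) \<le> C' * k ^ (2 * m) * (t - s) ^ m + E / real n"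
    if st: "0 \<le> s" "s \<le> t" and a: "antiderivs L f F1 F2" and k: "\<forall>x. \<bar>F1 x\<bar> \<le> k" and c: "\<forall>x. \<bar>f x\<bar> \<le> c"
    for s t k L f F1 F2 c
  proof -
    obtain E where E: "E \<ge> 0" "\<And>n. 1 \<le> n \<Longrightarrow> expectation (\<lambda>\<omega>. cube_sum s t n \<omega> ^ (2 * m)) \<le> E / real n"
      using cube_sum_moment[OF st m] by blast
    have L: "0 \<le> L" using a by (simp add: antiderivs_def)
    have F2: "\<And>x. (F2 has_real_derivative F1 x) (at x)" using a by (simp add: antiderivs_def)
    have k0: "0 \<le> k" using k abs_ge_zero order_trans by blast
    have "expectation (\<lambda>\<omega>. riem f s t n \<omega> ^ (2 * m)) \<le> C' * k ^ (2 * m) * (t - s) ^ m + (6 ^ (2 * m) * L ^ (2 * m) * E) / real n"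
      if n: "1 \<le> n" for n
    proof -
      define Mt where "Mt = mart_sum s t n (\<lambda>i \<omega>. F1 (B (node s t n i) \<omega>)) n"
      have ba: "bdd_adapted s t n (\<lambda>i \<omega>. F1 (B (node s t n i) \<omega>)) k"
        using F1_bdd_adapted[OF a _ st n] k by blast
      note fm = mart_sum_fin_mom[OF ba, of n, folded Mt_def] increment_fin_mom[OF st] cube_sum_fin_mom[OF st]
        riem_fin_mom[OF a st c[rule_format]]
      have "expectation (\<lambda>\<omega>. riem f s t n \<omega> ^ (2 * m)) \<le> 6 ^ (2 * m) * k ^ (2 * m) * expectation (\<lambda>\<omega>. (B t \<omega> - B s \<omega>) ^ (2 * m))
         + 6 ^ (2 * m) * expectation (\<lambda>\<omega>. Mt \<omega> ^ (2 * m)) + 6 ^ (2 * m) * L ^ (2 * m) * expectation (\<lambda>\<omega>. cube_sum s t n \<omega> ^ (2 * m))"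
      proof (rule expectation_le_lin3)
        fix \<omega>
        define x where "x = \<bar>B t \<omega> - B s \<omega>\<bar>"
        have "\<bar>F2 (B t \<omega>) - F2 (B s \<omega>)\<bar> \<le> k * x" unfolding x_def
          by (rule MVT_abs_le[OF F2]) (use k in blast)
        have "\<bar>riem f s t n \<omega>\<bar> \<le> 2 * (k * x) + 2 * \<bar>Mt \<omega>\<bar> + 2 * (L * cube_sum s t n \<omega>)"
        proof -
          have gen: "\<bar>R\<bar> \<le> 2 * p + 2 * \<bar>Q\<bar> + 2 * q" if "\<bar>d\<bar> \<le> p" "\<bar>R - (2 * d - 2 * Q)\<bar> \<le> 2 * q" for R p Q q d :: real
            using that by linarith
          show ?thesis
            by (rule gen[OF \<open>\<bar>F2 (B t \<omega>) - F2 (B s \<omega>)\<bar> \<le> k * x\<close>])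
               (rule riem_Ito[OF a n, of s t \<omega>, folded Mt_def, unfolded mult.assoc])
        qed
        then have "\<bar>riem f s t n \<omega>\<bar> ^ (2 * m) \<le> (2 * (k * x) + 2 * \<bar>Mt \<omega>\<bar> + 2 * (L * cube_sum s t n \<omega>)) ^ (2 * m)"
          by (rule power_mono) simp
        also have "\<dots> \<le> 3 ^ (2 * m) * ((2 * (k * x)) ^ (2 * m) + (2 * \<bar>Mt \<omega>\<bar>) ^ (2 * m) + (2 * (L * cube_sum s t n \<omega>)) ^ (2 * m))"
          using k0 L cube_sum_nonneg by (intro add3_power_le) (simp_all add: x_def)
        also have "\<dots> = (3 ^ (2 * m) * 2 ^ (2 * m)) * (k ^ (2 * m) * x ^ (2 * m)) + (3 ^ (2 * m) * 2 ^ (2 * m)) * \<bar>Mt \<omega>\<bar> ^ (2 * m)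
            + (3 ^ (2 * m) * 2 ^ (2 * m)) * (L ^ (2 * m) * cube_sum s t n \<omega> ^ (2 * m))"
          unfolding power_mult_distrib distrib_left by (simp only: mult.assoc)
        also have "3 ^ (2 * m) * 2 ^ (2 * m) = (6::real) ^ (2 * m)" unfolding power_mult_distrib[symmetric] by simp
        finally show "riem f s t n \<omega> ^ (2 * m) \<le> 6 ^ (2 * m) * k ^ (2 * m) * (B t \<omega> - B s \<omega>) ^ (2 * m)
          + 6 ^ (2 * m) * Mt \<omega> ^ (2 * m) + 6 ^ (2 * m) * L ^ (2 * m) * cube_sum s t n \<omega> ^ (2 * m)"
          by (simp add: x_def power_even_abs mult.assoc)
      qed (intro fin_mom_intros fm)+
      also have "\<dots> \<le> 6 ^ (2 * m) * k ^ (2 * m) * (K * (t - s) ^ m) + 6 ^ (2 * m) * (C * k ^ (2 * m) * (t - s) ^ m)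
          + 6 ^ (2 * m) * L ^ (2 * m) * (E / real n)"
        using K(2)[OF st] C(2)[OF ba, of n] E(2)[OF n] k0 L unfolding Mt_def
        by (intro add_mono mult_left_mono) simp_all
      also have "\<dots> = C' * k ^ (2 * m) * (t - s) ^ m + (6 ^ (2 * m) * L ^ (2 * m) * E) / real n"
        unfolding C'_def by (simp add: algebra_simps)
      finally show ?thesis .
    qed
    moreover have "0 \<le> 6 ^ (2 * m) * L ^ (2 * m) * E" using L E(1) by simp
    ultimately show ?thesis by blast
  qed
  with C' show ?thesis by blast
qed

end

text \<open>Outside the interval \<open>F2\<close> is locally constant, so both arguments may be
  projected onto it.\<close>

lemma localized_antiderivative_increment:
  assumes F2: "\<And>x. (F2 has_real_derivative F1 x) (at x)" and F1: "\<And>x. \<bar>F1 x\<bar> \<le> 1"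
    and out: "\<And>x. x < lo \<Longrightarrow> F1 x = 0" "\<And>x. lo + \<eta> < x \<Longrightarrow> F1 x = 0" and \<eta>: "0 < \<eta>"
  shows "\<bar>F2 y - F2 x\<bar> \<le> \<eta>"
proof -
  define c where "c x = max lo (min x (lo + \<eta>))" for x
  have eq: "F2 x = F2 (c x)" for x
  proof -
    consider "x < lo" | "lo \<le> x" "x \<le> lo + \<eta>" | "lo + \<eta> < x" by linarith
    then show ?thesis
    proof cases
      case 1
      then obtain z where "x < z" "z < lo" "F2 lo - F2 x = (lo - x) * F1 z" using MVT2[OF 1 F2] by blast
      then show ?thesis using out(1)[of z] 1 \<eta> by (simp add: c_def)
    next
      case 2
      then show ?thesis by (simp add: c_def)
    next
      case 3
      then obtain z where "lo + \<eta> < z" "F2 x - F2 (lo + \<eta>) = (x - (lo + \<eta>)) * F1 z" using MVT2[OF 3 F2] by blast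
      then show ?thesis using out(2)[of z] 3 \<eta> by (simp add: c_def)
    qed
  qed
  have "\<bar>F2 (c y) - F2 (c x)\<bar> \<le> 1 * \<bar>c y - c x\<bar>"
    by (rule MVT_abs_le[OF F2]) (rule F1)
  also have "\<dots> \<le> \<eta>" using \<eta> unfolding c_def mult_1 by linarith
  finally show ?thesis using eq by simp
qed

context moment_martingale
begin

text \<open>The square of \<open>F1\<close> is below the indicator of the interval, which is below
  the plateau \<open>f\<close>.\<close>

lemma quad_sum_F1_le_riem:
  assumes "\<And>x. \<bar>F1 x\<bar> \<le> 1" "\<And>x. x < lo \<Longrightarrow> F1 x = 0" "\<And>x. lo + \<eta> < x \<Longrightarrow> F1 x = 0"
    and "\<And>x. 0 \<le> f x" "\<forall>x\<in>{lo..lo + \<eta>}. 1 \<le> f x"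
  shows "quad_sum s t n (\<lambda>i \<omega>. F1 (B (node s t n i) \<omega>)) n \<omega> \<le> riem f s t n \<omega>"
  unfolding quad_sum_def riem_def
proof (rule sum_mono)
  fix i
  define x where "x = B (node s t n i) \<omega>"
  have "(F1 x)\<^sup>2 \<le> f x"
  proof (cases "x \<in> {lo..lo + \<eta>}")
    case True
    have "(F1 x)\<^sup>2 \<le> 1" using assms(1)[of x] by (simp add: abs_square_le_1)
    then show ?thesis using assms(5) True by force
  next
    case False
    then have "F1 x = 0" using assms(2,3) by force
    then show ?thesis using assms(4) by simp
  qed
  then show "(F1 (B (node s t n i) \<omega>) * inc s t n i \<omega>)\<^sup>2 \<le> f (B (node s t n i) \<omega>) * (inc s t n i \<omega>)\<^sup>2"
    unfolding x_def[symmetric] power_mult_distrib by (rule mult_right_mono) simp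
qed

text \<open>The factor \<open>\<eta>\<^sup>2\<^sup>r\<close> comes from dominating the quadratic variation of the martingale part, whose
  integrand lives on an interval of length \<open>\<eta>\<close>, by a Riemann sum for a plateau function, which has
  an antiderivative bounded by \<open>3 \<eta>\<close>.\<close>

lemma riem_moment_space:
  assumes r: "2 \<le> r"
  shows "\<exists>C\<ge>0. \<forall>s t \<eta> lo L f F1 F2 c. 0 \<le> s \<longrightarrow> s \<le> t \<longrightarrow> antiderivs L f F1 F2 \<longrightarrow> (\<forall>x. \<bar>F1 x\<bar> \<le> 1) \<longrightarrow> (\<forall>x. \<bar>f x\<bar> \<le> c) \<longrightarrow>
    0 < \<eta> \<longrightarrow> (\<forall>x<lo. F1 x = 0) \<longrightarrow> (\<forall>x>lo + \<eta>. F1 x = 0) \<longrightarrow>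
    (\<exists>E\<ge>0. \<forall>n\<ge>1. expectation (\<lambda>\<omega>. riem f s t n \<omega> ^ (4 * r))
       \<le> C * (\<eta> ^ (4 * r) + \<eta> ^ (2 * r) * (t - s) ^ r) + E / sqrt (real n))"
proof -
  \<comment> \<open>The Burkholder estimate is used with parameter \<open>2 * u\<close>: the
    martingale then appears with power \<open>4 * r\<close> and its bracket with power
    \<open>2 * r\<close>.\<close>
  obtain u where u: "r = Suc u" using r by (cases r) auto
  have ru: "2 * (2 * u) + 4 = 4 * r" "2 * u + 2 = 2 * r" using u by simp_all
  obtain C1 where C1: "C1 \<ge> 0" "\<forall>s t. \<exists>E\<ge>0. \<forall>n g. bdd_adapted s t n g 1 \<longrightarrow>
     expectation (\<lambda>\<omega>. mart_sum s t n g n \<omega> ^ (4 * r))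
       \<le> C1 * expectation (\<lambda>\<omega>. quad_sum s t n g n \<omega> ^ (2 * r)) + E / sqrt (real n)"
    using mart_sum_le_quad_sum[of "2 * u"] unfolding ru by blast
  obtain C2 where C2: "C2 \<ge> 0" "\<forall>s t k L f F1 F2 c. 0 \<le> s \<longrightarrow> s \<le> t \<longrightarrow> antiderivs L f F1 F2 \<longrightarrow> (\<forall>x. \<bar>F1 x\<bar> \<le> k) \<longrightarrow> (\<forall>x. \<bar>f x\<bar> \<le> c) \<longrightarrow>
    (\<exists>E\<ge>0. \<forall>n\<ge>1. expectation (\<lambda>\<omega>. riem f s t n \<omega> ^ (2 * r)) \<le> C2 * k ^ (2 * r) * (t - s) ^ r + E / real n)"
    using riem_moment_time[OF r] by blast
  define C where "C = 6 ^ (4 * r) * (1 + C1 * C2 * 3 ^ (2 * r))"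
  have C: "0 \<le> C" using C1(1) C2(1) by (simp add: C_def)
  have "\<exists>E\<ge>0. \<forall>n\<ge>1. expectation (\<lambda>\<omega>. riem f s t n \<omega> ^ (4 * r))
       \<le> C * (\<eta> ^ (4 * r) + \<eta> ^ (2 * r) * (t - s) ^ r) + E / sqrt (real n)"
    if st: "0 \<le> s" "s \<le> t" and a: "antiderivs L f F1 F2" and F1: "\<forall>x. \<bar>F1 x\<bar> \<le> 1" and c: "\<forall>x. \<bar>f x\<bar> \<le> c"
      and \<eta>: "0 < \<eta>" and out: "\<forall>x<lo. F1 x = 0" "\<forall>x>lo + \<eta>. F1 x = 0"
    for s t \<eta> lo L f F1 F2 c
  proof -
    obtain E1 where E1: "E1 \<ge> 0" "\<And>n g. bdd_adapted s t n g 1 \<Longrightarrow>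
     expectation (\<lambda>\<omega>. mart_sum s t n g n \<omega> ^ (4 * r))
       \<le> C1 * expectation (\<lambda>\<omega>. quad_sum s t n g n \<omega> ^ (2 * r)) + E1 / sqrt (real n)"
      using C1(2) by blast
    obtain pf pF1 pF2 pL where p: "antiderivs pL pf pF1 pF2" "\<And>x. 0 \<le> pf x" "\<forall>x\<in>{lo..lo + \<eta>}. 1 \<le> pf x" "\<forall>x. \<bar>pF1 x\<bar> \<le> 3 * \<eta>"
      and pc0: "\<exists>pc. \<forall>x. \<bar>pf x\<bar> \<le> pc"
      using plateau_exists[OF \<eta>, of lo] by blast
    obtain pc where pc: "\<forall>x. \<bar>pf x\<bar> \<le> pc" using pc0 by blast
    obtain E2 where E2: "E2 \<ge> 0" "\<And>n. 1 \<le> n \<Longrightarrow> expectation (\<lambda>\<omega>. riem pf s t n \<omega> ^ (2 * r)) \<le> C2 * (3 * \<eta>) ^ (2 * r) * (t - s) ^ r + E2 / real n"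
      using C2(2) st p(1,4) pc by meson
    have "2 \<le> 2 * r" using r by simp
    obtain E3 where E3: "E3 \<ge> 0" "\<And>n. 1 \<le> n \<Longrightarrow> expectation (\<lambda>\<omega>. cube_sum s t n \<omega> ^ (4 * r)) \<le> E3 / real n"
      using cube_sum_moment[OF st \<open>2 \<le> 2 * r\<close>] by (auto simp: mult.assoc[symmetric])
    have L: "0 \<le> L" using a by (simp add: antiderivs_def)
    have F2: "\<And>x. (F2 has_real_derivative F1 x) (at x)" using a by (simp add: antiderivs_def)
    define E where "E = 6 ^ (4 * r) * (C1 * E2 + E1 + L ^ (4 * r) * E3)"
    have E: "0 \<le> E" unfolding E_def using C1(1) E1(1) E2(1) E3(1) L by simp
    have "expectation (\<lambda>\<omega>. riem f s t n \<omega> ^ (4 * r))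
       \<le> C * (\<eta> ^ (4 * r) + \<eta> ^ (2 * r) * (t - s) ^ r) + E / sqrt (real n)" if n: "1 \<le> n" for n
    proof -
      define g where "g = (\<lambda>i \<omega>. F1 (B (node s t n i) \<omega>))"
      define Mt where "Mt = mart_sum s t n g n"
      have ba: "bdd_adapted s t n g 1"
        unfolding g_def using F1_bdd_adapted[OF a _ st n] F1 by blast
      note fm = mart_sum_fin_mom[OF ba, of n, folded Mt_def] cube_sum_fin_mom[OF st]
        riem_fin_mom[OF a st c[rule_format]] riem_fin_mom[OF p(1) st pc[rule_format]] quad_sum_fin_mom[OF ba]
      \<comment> \<open>Errors of order \<open>1 / real n\<close> are weakened to the rate
        \<open>1 / sqrt (real n)\<close> of the Burkholder estimate.\<close>
      have sn: "sqrt (real n) \<le> real n" "0 < sqrt (real n)"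
        using n real_sqrt_le_iff[of "real n" "(real n)\<^sup>2"] by (simp_all add: self_le_power)
      have "expectation (\<lambda>\<omega>. quad_sum s t n g n \<omega> ^ (2 * r)) \<le> expectation (\<lambda>\<omega>. riem pf s t n \<omega> ^ (2 * r))"
      proof (rule expectation_mono_fin_mom)
        fix \<omega>
        show "quad_sum s t n g n \<omega> ^ (2 * r) \<le> riem pf s t n \<omega> ^ (2 * r)"
          unfolding g_def
          by (rule power_mono[OF quad_sum_F1_le_riem[OF F1[rule_format] out[rule_format] p(2,3)] quad_sum_nonneg])
      qed (intro fin_mom_intros fm)+
      also have "\<dots> \<le> C2 * (3 * \<eta>) ^ (2 * r) * (t - s) ^ r + E2 / real n" by (rule E2(2)[OF n])
      finally have "C1 * expectation (\<lambda>\<omega>. quad_sum s t n g n \<omega> ^ (2 * r)) \<le> C1 * (C2 * (3 * \<eta>) ^ (2 * r) * (t - s) ^ r + E2 / real n)"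
        using C1(1) by (rule mult_left_mono)
      then have M: "expectation (\<lambda>\<omega>. Mt \<omega> ^ (4 * r)) \<le> C1 * (C2 * (3 * \<eta>) ^ (2 * r) * (t - s) ^ r + E2 / real n) + E1 / sqrt (real n)"
        using E1(2)[OF ba] unfolding Mt_def by linarith
      have "expectation (\<lambda>\<omega>. riem f s t n \<omega> ^ (4 * r)) \<le> 6 ^ (4 * r) * expectation (\<lambda>\<omega>. \<eta> ^ (4 * r))
         + 6 ^ (4 * r) * expectation (\<lambda>\<omega>. Mt \<omega> ^ (4 * r)) + 6 ^ (4 * r) * L ^ (4 * r) * expectation (\<lambda>\<omega>. cube_sum s t n \<omega> ^ (4 * r))"
      proof (rule expectation_le_lin3)
        fix \<omega>
        have F2d: "\<bar>F2 (B t \<omega>) - F2 (B s \<omega>)\<bar> \<le> \<eta>"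
          using localized_antiderivative_increment[OF F2] F1 out \<eta> by blast
        have "\<bar>riem f s t n \<omega>\<bar> \<le> 2 * \<eta> + 2 * \<bar>Mt \<omega>\<bar> + 2 * (L * cube_sum s t n \<omega>)"
        proof -
          have gen: "\<bar>R\<bar> \<le> 2 * p + 2 * \<bar>Q\<bar> + 2 * q" if "\<bar>d\<bar> \<le> p" "\<bar>R - (2 * d - 2 * Q)\<bar> \<le> 2 * q" for R p Q q d :: real
            using that by linarith
          show ?thesis
            by (rule gen[OF F2d]) (rule riem_Ito[OF a n, of s t \<omega>, folded g_def, folded Mt_def, unfolded mult.assoc])
        qed
        then have "\<bar>riem f s t n \<omega>\<bar> ^ (4 * r) \<le> (2 * \<eta> + 2 * \<bar>Mt \<omega>\<bar> + 2 * (L * cube_sum s t n \<omega>)) ^ (4 * r)"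
          by (rule power_mono) simp
        also have "\<dots> \<le> 3 ^ (4 * r) * ((2 * \<eta>) ^ (4 * r) + (2 * \<bar>Mt \<omega>\<bar>) ^ (4 * r) + (2 * (L * cube_sum s t n \<omega>)) ^ (4 * r))"
          using \<eta> L cube_sum_nonneg by (intro add3_power_le) simp_all
        also have "\<dots> = (3 ^ (4 * r) * 2 ^ (4 * r)) * \<eta> ^ (4 * r) + (3 ^ (4 * r) * 2 ^ (4 * r)) * \<bar>Mt \<omega>\<bar> ^ (4 * r)
            + (3 ^ (4 * r) * 2 ^ (4 * r)) * (L ^ (4 * r) * cube_sum s t n \<omega> ^ (4 * r))"
          unfolding power_mult_distrib distrib_left by (simp only: mult.assoc)
        also have "3 ^ (4 * r) * 2 ^ (4 * r) = (6::real) ^ (4 * r)" unfolding power_mult_distrib[symmetric] by simp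
        finally show "riem f s t n \<omega> ^ (4 * r) \<le> 6 ^ (4 * r) * \<eta> ^ (4 * r)
          + 6 ^ (4 * r) * Mt \<omega> ^ (4 * r) + 6 ^ (4 * r) * L ^ (4 * r) * cube_sum s t n \<omega> ^ (4 * r)"
          by (simp add: power_even_abs mult.assoc)
      qed (intro fin_mom_intros fm)+
      also have "\<dots> \<le> 6 ^ (4 * r) * \<eta> ^ (4 * r)
          + 6 ^ (4 * r) * (C1 * (C2 * (3 * \<eta>) ^ (2 * r) * (t - s) ^ r + E2 / real n) + E1 / sqrt (real n))
          + 6 ^ (4 * r) * L ^ (4 * r) * (E3 / real n)"
        using M E3(2)[OF n] L prob_space by (intro add_mono mult_left_mono) simp_all
      also have "\<dots> \<le> 6 ^ (4 * r) * \<eta> ^ (4 * r)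
          + 6 ^ (4 * r) * (C1 * (C2 * (3 * \<eta>) ^ (2 * r) * (t - s) ^ r + E2 / sqrt (real n)) + E1 / sqrt (real n))
          + 6 ^ (4 * r) * L ^ (4 * r) * (E3 / sqrt (real n))"
        using sn E2(1) E3(1) C1(1) L by (intro add_mono mult_left_mono divide_left_mono order_refl) simp_all
      also have "\<dots> = (6 ^ (4 * r) * \<eta> ^ (4 * r) + 6 ^ (4 * r) * (C1 * C2 * 3 ^ (2 * r)) * (\<eta> ^ (2 * r) * (t - s) ^ r)) + E / sqrt (real n)"
        unfolding E_def power_mult_distrib by (simp add: algebra_simps add_divide_distrib)
      also have "\<dots> \<le> C * (\<eta> ^ (4 * r) + \<eta> ^ (2 * r) * (t - s) ^ r) + E / sqrt (real n)"
      proof -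
        define P where "P = \<eta> ^ (4 * r)"
        define R where "R = \<eta> ^ (2 * r) * (t - s) ^ r"
        define S where "S = (6::real) ^ (4 * r)"
        define D where "D = C1 * C2 * 3 ^ (2 * r)"
        have "0 \<le> P" "0 \<le> R" "0 \<le> S" "0 \<le> D" unfolding P_def R_def S_def D_def using \<eta> st C1(1) C2(1) by simp_all
        then have "0 \<le> S * D * P" "0 \<le> S * R" by simp_all
        then have "S * P + S * D * R \<le> S * (1 + D) * (P + R)" by (simp add: algebra_simps)
        then show ?thesis unfolding C_def P_def R_def S_def D_def by simp
      qed
      finally show ?thesis .
    qed
    with E show ?thesis by blast
  qed
  with C show ?thesis by blast
qed

end

section \<open>Almost sure convergence from summable norms, and Fatou's lemma for moments\<close>

section \<open>Passing to the limit\<close>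

text \<open>The expected sum of all absolute values is finite, so almost every series converges and
  its terms tend to zero.\<close>

lemma AE_tendsto_0:
  fixes W :: "nat \<Rightarrow> 'a \<Rightarrow> real"
  assumes [measurable]: "\<And>j. W j \<in> borel_measurable M" and "\<And>j. (\<integral>\<^sup>+x. ennreal \<bar>W j x\<bar> \<partial>M) \<le> ennreal (c j)"
    and c: "\<And>j. 0 \<le> c j" "summable c"
  shows "AE x in M. (\<lambda>j. W j x) \<longlonglongrightarrow> 0"
proof -
  have "(\<integral>\<^sup>+x. (\<Sum>j. ennreal \<bar>W j x\<bar>) \<partial>M) = (\<Sum>j. \<integral>\<^sup>+x. ennreal \<bar>W j x\<bar> \<partial>M)"
    by (rule nn_integral_suminf) measurable
  also have "\<dots> \<le> (\<Sum>j. ennreal (c j))"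
    by (intro suminf_le assms(2) summableI)
  also have "\<dots> < \<infinity>"
    using suminf_ennreal2[OF c] by simp
  finally have "AE x in M. (\<Sum>j. ennreal \<bar>W j x\<bar>) \<noteq> \<infinity>"
    by (intro nn_integral_noteq_infinite) auto
  then show ?thesis
  proof eventually_elim
    case (elim x)
    then have "summable (\<lambda>j. \<bar>W j x\<bar>)" by (intro summable_suminf_not_top) auto
    then show ?case using summable_LIMSEQ_zero tendsto_rabs_zero_iff by blast
  qed
qed

text \<open>Fatou's lemma. The limit \<open>Z\<close> will be a pathwise Stieltjes integral whose
  measurability is not assumed, hence the bound is stated for a measurable version
  \<open>X\<close>.\<close>

lemma limit_moment_le:
  fixes Y :: "nat \<Rightarrow> 'a \<Rightarrow> real"
  assumes Y [measurable]: "\<And>j. Y j \<in> borel_measurable M" and lim: "AE x in M. (\<lambda>j. Y j x) \<longlonglongrightarrow> Z x"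
    and bd: "\<And>j. (\<integral>\<^sup>+x. ennreal (Y j x ^ p) \<partial>M) \<le> ennreal (D j)" and D: "D \<longlonglongrightarrow> d"
  shows "\<exists>X\<in>borel_measurable M. (AE x in M. X x = Z x) \<and> (\<integral>\<^sup>+x. ennreal (X x ^ p) \<partial>M) \<le> ennreal d"
proof -
  define X where "X x = lim (\<lambda>j. Y j x)" for x
  have X [measurable]: "X \<in> borel_measurable M" unfolding X_def by (rule borel_measurable_lim_metric) measurable
  have eq: "AE x in M. X x = Z x"
    using lim by eventually_elim (simp add: X_def limI)
  have "(\<integral>\<^sup>+x. ennreal (X x ^ p) \<partial>M) = (\<integral>\<^sup>+x. liminf (\<lambda>j. ennreal (Y j x ^ p)) \<partial>M)"
  proof (rule nn_integral_cong_AE)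
    show "AE x in M. ennreal (X x ^ p) = liminf (\<lambda>j. ennreal (Y j x ^ p))"
      using lim eq
    proof eventually_elim
      case (elim x)
      then have "(\<lambda>j. ennreal (Y j x ^ p)) \<longlonglongrightarrow> ennreal (X x ^ p)"
        by (intro tendsto_ennrealI tendsto_power) simp
      then show ?case using lim_imp_Liminf[OF sequentially_bot] by metis
    qed
  qed
  also have "\<dots> \<le> liminf (\<lambda>j. \<integral>\<^sup>+x. ennreal (Y j x ^ p) \<partial>M)"
    by (rule nn_integral_liminf) measurable
  also have "\<dots> \<le> liminf (\<lambda>j. ennreal (D j))"
    by (rule Liminf_mono) (simp add: bd)
  also have "\<dots> = ennreal d"
    using lim_imp_Liminf[OF sequentially_bot tendsto_ennrealI[OF D]] .
  finally show ?thesis using X eq by blast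
qed

section \<open>Riemann sums for a continuous increasing integrator\<close>

section \<open>Stieltjes integrals\<close>

locale continuous_increasing =
  fixes H :: "real \<Rightarrow> real"
  assumes mono: "x \<le> y \<Longrightarrow> H x \<le> H y" and cont: "continuous_on UNIV H"
begin

lemma right_cont: "continuous (at_right a) H"
  using cont by (simp add: continuous_on_eq_continuous_at continuous_at_imp_continuous_at_within)

lemma emeasure_Ioc: "a \<le> b \<Longrightarrow> emeasure (interval_measure H) {a<..b} = ennreal (H b - H a)"
  by (rule emeasure_interval_measure_Ioc[OF _ mono right_cont])

lemma measure_Ioc: "a \<le> b \<Longrightarrow> measure (interval_measure H) {a<..b} = H b - H a"
  by (simp add: measure_def emeasure_Ioc mono)

lemma AE_not_single: "AE u in interval_measure H. u \<noteq> a"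
proof -
  have "emeasure (interval_measure H) {a} = 0"
    using emeasure_interval_measure_Icc[OF order_refl mono cont, of a] by simp
  then have "{a} \<in> null_sets (interval_measure H)" by (simp add: null_sets_def)
  then show ?thesis by (rule AE_I') auto
qed

lemma set_integrable_Ioc:
  fixes g :: "real \<Rightarrow> real"
  assumes "g \<in> borel_measurable borel" "\<And>u. \<bar>g u\<bar> \<le> c"
  shows "set_integrable (interval_measure H) {a<..b} g"
proof (cases "a \<le> b")
  case True
  show ?thesis unfolding set_integrable_def
    by (rule integrableI_bounded_set_indicator[where B = c])
       (use assms in \<open>simp_all add: emeasure_Ioc[OF True] measurable_def\<close>)
next
  case False
  then have "{a<..b} = {}" by auto
  then show ?thesis by (simp add: set_integrable_def)
qed

lemma integral_Icc_eq_Ioc: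
  fixes g :: "real \<Rightarrow> real"
  assumes [measurable]: "g \<in> borel_measurable borel"
  shows "(LINT u:{a..b}|interval_measure H. g u) = (LINT u:{a<..b}|interval_measure H. g u)"
  unfolding set_lebesgue_integral_def
proof (rule integral_cong_AE)
  show "AE u in interval_measure H. indicat_real {a..b} u *\<^sub>R g u = indicat_real {a<..b} u *\<^sub>R g u"
    using AE_not_single[of a] by eventually_elim (auto simp: indicator_def)
qed measurable

lemma integral_Ioc_split:
  fixes g :: "real \<Rightarrow> real"
  assumes "g \<in> borel_measurable borel" "\<And>u. \<bar>g u\<bar> \<le> c" "a \<le> b" "b \<le> d"
  shows "(LINT u:{a<..d}|interval_measure H. g u)
    = (LINT u:{a<..b}|interval_measure H. g u) + (LINT u:{b<..d}|interval_measure H. g u)"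
proof -
  have "{a<..d} = {a<..b} \<union> {b<..d}" using assms(3,4) by auto
  then show ?thesis
    using set_integral_Un[OF _ set_integrable_Ioc set_integrable_Ioc, OF _ assms(1,2) assms(1,2), of a b b d] by simp
qed

lemma Riemann_sum_error:
  fixes g :: "real \<Rightarrow> real"
  assumes g: "continuous_on UNIV g" "\<And>u. \<bar>g u\<bar> \<le> c" and h: "0 \<le> h" and e: "0 \<le> e"
    and osc: "\<And>i u. i < j \<Longrightarrow> s + real i * h < u \<Longrightarrow> u \<le> s + real (Suc i) * h \<Longrightarrow> \<bar>g u - g (s + real i * h)\<bar> \<le> e"
  shows "\<bar>(LINT u:{s<..s + real j * h}|interval_measure H. g u)
      - (\<Sum>i<j. g (s + real i * h) * (H (s + real (Suc i) * h) - H (s + real i * h)))\<bar> \<le> e * (H (s + real j * h) - H s)"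
  using osc
proof (induction j)
  case 0
  show ?case by (simp add: set_lebesgue_integral_def)
next
  case (Suc j)
  define a where "a = s + real j * h"
  define b where "b = s + real (Suc j) * h"
  have gm: "g \<in> borel_measurable borel" by (rule borel_measurable_continuous_onI[OF g(1)])
  have ab: "a \<le> b" "s \<le> a" using h by (simp_all add: a_def b_def mult_right_mono)
  have split: "(LINT u:{s<..b}|interval_measure H. g u)
    = (LINT u:{s<..a}|interval_measure H. g u) + (LINT u:{a<..b}|interval_measure H. g u)"
    by (rule integral_Ioc_split[OF gm g(2) ab(2,1)])
  have const: "(LINT u:{a<..b}|interval_measure H. k) = k * (H b - H a)" for k :: real
    by (simp add: measure_Ioc[OF ab(1)] set_lebesgue_integral_def mult.commute)
  have cint: "set_integrable (interval_measure H) {a<..b} (\<lambda>_. k)" for k :: real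
    by (rule set_integrable_Ioc[where c = "\<bar>k\<bar>"]) simp_all
  note gint = set_integrable_Ioc[OF gm g(2), of a b]
  have "\<bar>(LINT u:{a<..b}|interval_measure H. g u) - g a * (H b - H a)\<bar> = \<bar>LINT u:{a<..b}|interval_measure H. g u - g a\<bar>"
    using set_integral_diff(2)[OF gint cint[of "g a"]] const[of "g a"] by simp
  also have "\<dots> \<le> (LINT u:{a<..b}|interval_measure H. \<bar>g u - g a\<bar>)"
    unfolding set_lebesgue_integral_def
    using integral_abs_bound[of "interval_measure H" "\<lambda>u. indicat_real {a<..b} u *\<^sub>R (g u - g a)"]
    by (simp add: abs_mult)
  also have "\<dots> \<le> (LINT u:{a<..b}|interval_measure H. e)"
  proof (rule set_integral_mono)
    show "set_integrable (interval_measure H) {a<..b} (\<lambda>u. \<bar>g u - g a\<bar>)"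
      by (rule set_integrable_abs[OF set_integral_diff(1)[OF gint cint]])
    show "\<bar>g u - g a\<bar> \<le> e" if "u \<in> {a<..b}" for u
      using Suc.prems[of j u] that by (simp add: a_def b_def)
  qed (rule cint)
  also have "\<dots> = e * (H b - H a)" by (rule const)
  finally have 1: "\<bar>(LINT u:{a<..b}|interval_measure H. g u) - g a * (H b - H a)\<bar> \<le> e * (H b - H a)" .
  have 2: "\<bar>(LINT u:{s<..a}|interval_measure H. g u)
      - (\<Sum>i<j. g (s + real i * h) * (H (s + real (Suc i) * h) - H (s + real i * h)))\<bar> \<le> e * (H a - H s)"
    unfolding a_def by (rule Suc.IH) (rule Suc.prems, simp_all)
  have "e * (H b - H s) = e * (H b - H a) + e * (H a - H s)" by (simp add: algebra_simps)
  then show ?case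
    using 1 2 unfolding sum.lessThan_Suc a_def[symmetric] b_def[symmetric] split by linarith
qed

lemma Riemann_sum_tendsto:
  fixes g :: "real \<Rightarrow> real"
  assumes g: "continuous_on UNIV g" "\<And>u. \<bar>g u\<bar> \<le> c" and st: "s \<le> t"
  shows "(\<lambda>k. \<Sum>i<k. g (s + real i * ((t - s) / real k)) * (H (s + real (Suc i) * ((t - s) / real k)) - H (s + real i * ((t - s) / real k))))
    \<longlonglongrightarrow> (LINT u:{s<..t}|interval_measure H. g u)"
proof (rule LIMSEQ_I)
  fix r :: real assume r: "0 < r"
  \<comment> \<open>The summand \<open>1\<close> in the denominator keeps \<open>e\<close> well
    defined when the integrator has no mass on the interval.\<close>
  define e where "e = r / (1 + (H t - H s))"
  have Hp: "0 < 1 + (H t - H s)" using mono[OF st] by simp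
  have e: "0 < e" using r Hp by (simp add: e_def)
  have "uniformly_continuous_on {s..t} g"
    by (rule compact_uniformly_continuous[OF continuous_on_subset[OF g(1)]]) auto
  then obtain d where d: "0 < d" "\<And>x y. x \<in> {s..t} \<Longrightarrow> y \<in> {s..t} \<Longrightarrow> \<bar>y - x\<bar> < d \<Longrightarrow> \<bar>g y - g x\<bar> < e"
    using e unfolding uniformly_continuous_on_def dist_real_def by (metis abs_minus_commute)
  obtain n0 :: nat where n0: "(t - s) / d < real n0" using reals_Archimedean2 by blast
  have "norm ((\<Sum>i<k. g (s + real i * ((t - s) / real k)) * (H (s + real (Suc i) * ((t - s) / real k)) - H (s + real i * ((t - s) / real k))))
      - (LINT u:{s<..t}|interval_measure H. g u)) < r" if k: "Suc n0 \<le> k" for k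
  proof -
    define h where "h = (t - s) / real k"
    have k0: "0 < real k" using k by simp
    have h0: "0 \<le> h" using st by (simp add: h_def)
    have kh: "s + real k * h = t" using k0 by (simp add: h_def)
    have "(t - s) / d < real k" using n0 k by (meson Suc_leD less_le_trans of_nat_le_iff)
    then have hd: "h < d" using d(1) k0 by (simp add: h_def field_simps)
    have "\<bar>(LINT u:{s<..s + real k * h}|interval_measure H. g u)
      - (\<Sum>i<k. g (s + real i * h) * (H (s + real (Suc i) * h) - H (s + real i * h)))\<bar> \<le> e * (H (s + real k * h) - H s)"
    proof (rule Riemann_sum_error[OF g h0])
      fix i u assume i: "i < k" and u: "s + real i * h < u" "u \<le> s + real (Suc i) * h"
      have "real (Suc i) * h \<le> real k * h" using i h0 by (intro mult_right_mono) auto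
      then have "u \<le> t" using u kh by linarith
      moreover have "0 \<le> real i * h" using h0 by simp
      moreover have "real (Suc i) * h = real i * h + h" by (simp add: algebra_simps)
      ultimately show "\<bar>g u - g (s + real i * h)\<bar> \<le> e"
        using d(2)[of "s + real i * h" u] u hd by force
    qed (use e in simp)
    also have "e * (H (s + real k * h) - H s) = e * (H t - H s)" unfolding kh ..
    also have "\<dots> < e * (1 + (H t - H s))" using e by simp
    also have "\<dots> = r" using Hp by (simp add: e_def)
    finally show ?thesis unfolding kh h_def[symmetric] by (simp add: abs_minus_commute)
  qed
  then show "\<exists>no. \<forall>k\<ge>no. norm ((\<Sum>i<k. g (s + real i * ((t - s) / real k)) * (H (s + real (Suc i) * ((t - s) / real k)) - H (s + real i * ((t - s) / real k))))
      - (LINT u:{s<..t}|interval_measure H. g u)) < r" by blast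
qed

end

section \<open>From grid sums of squared increments to pathwise integrals\<close>

section \<open>Integrals against the quadratic variation\<close>

text \<open>The defining convergence is kept in L1 under a single measure, but for increments over
  arbitrary intervals, which is the form needed on the cells of a coarse grid.\<close>

locale quadratic_variation_martingale = moment_martingale M B F
  for M :: "'a measure" and B :: "real \<Rightarrow> 'a \<Rightarrow> real" and F :: "real \<Rightarrow> 'a measure" +
  fixes A :: "real \<Rightarrow> 'a \<Rightarrow> real"
  assumes A_measurable: "0 \<le> t \<Longrightarrow> A t \<in> borel_measurable M"
    and A_good: "AE \<omega> in M. continuous_on {0..} (\<lambda>t. A t \<omega>) \<and> mono_on {0..} (\<lambda>t. A t \<omega>)"
    and B_continuous: "continuous_on {0..} (\<lambda>t. B t \<omega>)"
    and qv: "0 \<le> s \<Longrightarrow> s \<le> t \<Longrightarrow> 0 < e \<Longrightarrow> \<exists>n0. \<forall>n\<ge>n0.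
      (\<integral>\<^sup>+\<omega>. ennreal \<bar>(\<Sum>i<n. (inc s t n i \<omega>)\<^sup>2) - (A t \<omega> - A s \<omega>)\<bar> \<partial>M) \<le> ennreal e"
begin

definition qv_measure :: "'a \<Rightarrow> real measure" where
  "qv_measure \<omega> = interval_measure (\<lambda>u. A (max 0 u) \<omega>)"

text \<open>Half-open intervals make the integral additive in time, and \<open>max 0 u\<close>
  extends the path so that the integrand is continuous on the whole line.\<close>

definition stieltjes :: "(real \<Rightarrow> real) \<Rightarrow> real \<Rightarrow> real \<Rightarrow> 'a \<Rightarrow> real" where
  "stieltjes \<phi> s t \<omega> = (LINT u:{s<..t}|qv_measure \<omega>. \<phi> (B (max 0 u) \<omega>))"

definition good :: "'a \<Rightarrow> bool" where
  "good \<omega> \<longleftrightarrow> continuous_on {0..} (\<lambda>t. A t \<omega>) \<and> mono_on {0..} (\<lambda>t. A t \<omega>)"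

lemma AE_good: "AE \<omega> in M. good \<omega>"
  using A_good by (simp add: good_def)

lemma good_continuous_increasing:
  assumes "good \<omega>"
  shows "continuous_increasing (\<lambda>u. A (max 0 u) \<omega>)"
proof
  show "A (max 0 x) \<omega> \<le> A (max 0 y) \<omega>" if "x \<le> y" for x y :: real
    using assms that unfolding good_def by (auto intro: mono_onD)
  have "continuous_on UNIV ((\<lambda>t. A t \<omega>) \<circ> (\<lambda>u. max 0 u))"
    using assms unfolding good_def
    by (intro continuous_on_compose continuous_intros) (auto elim: continuous_on_subset)
  then show "continuous_on UNIV (\<lambda>u. A (max 0 u) \<omega>)" by (simp add: o_def)
qed

lemma B_max_continuous: "continuous_on UNIV (\<lambda>u. B (max 0 u) \<omega>)"
proof -
  have "continuous_on UNIV ((\<lambda>t. B t \<omega>) \<circ> (\<lambda>u. max 0 u))"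
    by (intro continuous_on_compose continuous_intros) (auto intro: continuous_on_subset[OF B_continuous])
  then show ?thesis by (simp add: o_def)
qed

lemma B_max_measurable [measurable]: "(\<lambda>u. B (max 0 u) \<omega>) \<in> borel_measurable borel"
  by (rule borel_measurable_continuous_onI[OF B_max_continuous])

text \<open>Riemann-Stieltjes sums with the exact increments of the integrator \<open>A\<close>:
  they converge pathwise, while moment bounds are available for \<open>riem\<close>.\<close>

definition coarse :: "(real \<Rightarrow> real) \<Rightarrow> real \<Rightarrow> real \<Rightarrow> nat \<Rightarrow> 'a \<Rightarrow> real" where
  "coarse f s t k \<omega> = (\<Sum>j<k. f (B (node s t k j) \<omega>) * (A (node s t k (Suc j)) \<omega> - A (node s t k j) \<omega>))"

lemma coarse_tendsto:
  assumes "good \<omega>" "continuous_on UNIV f" "\<And>x. \<bar>f x\<bar> \<le> c" "0 \<le> s" "s \<le> t"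
  shows "(\<lambda>k. coarse f s t k \<omega>) \<longlonglongrightarrow> stieltjes f s t \<omega>"
proof -
  interpret continuous_increasing "\<lambda>u. A (max 0 u) \<omega>" by (rule good_continuous_increasing[OF assms(1)])
  have "continuous_on UNIV (f \<circ> (\<lambda>u. B (max 0 u) \<omega>))"
    by (intro continuous_on_compose B_max_continuous continuous_on_subset[OF assms(2)]) simp
  then have fc: "continuous_on UNIV (\<lambda>u. f (B (max 0 u) \<omega>))" by (simp add: o_def)
  have nn: "max 0 (s + real i * ((t - s) / real k)) = node s t k i" for i k
    using node_nonneg[OF assms(4,5), of k i] by (simp add: node_def)
  show ?thesis
    using Riemann_sum_tendsto[OF fc assms(3,5)]
    unfolding nn coarse_def stieltjes_def qv_measure_def .
qed

lemma node_refine: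
  assumes "1 \<le> l" "1 \<le> k"
  shows "node s t (k * l) (j * l + m) = node (node s t k j) (node s t k (Suc j)) l m"
proof -
  have "real (j * l + m) * ((t - s) / real (k * l)) = real j * ((t - s) / real k) + real m * ((t - s) / real k / real l)"
    using assms by (simp add: field_simps)
  then show ?thesis unfolding node_def[of _ _ l] node_Suc_diff by (simp add: node_def)
qed

lemma riem_refine:
  assumes "1 \<le> l" "1 \<le> k"
  shows "riem f s t (k * l) \<omega> = (\<Sum>j<k. riem f (node s t k j) (node s t k (Suc j)) l \<omega>)"
proof -
  define g where "g i = f (B (node s t (k * l) i) \<omega>) * (inc s t (k * l) i \<omega>)\<^sup>2" for i
  have "riem f s t (k * l) \<omega> = sum g {..<k * l}" by (simp add: riem_def g_def)
  also have "\<dots> = (\<Sum>j<k. sum g {j * l..<j * l + l})" by (rule sum.nat_group[symmetric])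
  also have "\<dots> = (\<Sum>j<k. riem f (node s t k j) (node s t k (Suc j)) l \<omega>)"
  proof (rule sum.cong[OF refl])
    fix j
    have "sum g {j * l..<j * l + l} = (\<Sum>m<l. g (j * l + m))"
      using sum.shift_bounds_nat_ivl[of g 0 "j * l" l] by (simp add: atLeast0LessThan add.commute)
    also have "\<dots> = riem f (node s t k j) (node s t k (Suc j)) l \<omega>"
      unfolding g_def riem_def inc_def add_Suc_right[symmetric] node_refine[OF assms] ..
    finally show "sum g {j * l..<j * l + l} = riem f (node s t k j) (node s t k (Suc j)) l \<omega>" .
  qed
  finally show ?thesis .
qed

text \<open>Each summand is split by weighted squares into \<open>\<theta>\<close> times a squared
  displacement and \<open>1 / \<theta>\<close> times a fourth power of an increment. The weight
  stays free because its best value depends on how the interval was cut out of a coarser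
  grid.\<close>

lemma freeze_error:
  "\<exists>K\<ge>0. \<forall>s t f Lip l \<theta>. 0 \<le> s \<longrightarrow> s \<le> t \<longrightarrow> 1 \<le> l \<longrightarrow> 0 < \<theta> \<longrightarrow> 0 \<le> Lip \<longrightarrow> (\<forall>x y. \<bar>f x - f y\<bar> \<le> Lip * \<bar>x - y\<bar>) \<longrightarrow>
    (\<integral>\<^sup>+\<omega>. ennreal (\<Sum>m<l. \<bar>f (B (node s t l m) \<omega>) - f (B s \<omega>)\<bar> * (inc s t l m \<omega>)\<^sup>2) \<partial>M)
      \<le> ennreal (Lip * K * (real l * \<theta> * (t - s) + (t - s)\<^sup>2 / (real l * \<theta>)))"
proof -
  obtain K1 where K1: "K1 \<ge> 0" "\<And>s t. 0 \<le> s \<Longrightarrow> s \<le> t \<Longrightarrow>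
      expectation (\<lambda>\<omega>. (B t \<omega> - B s \<omega>) ^ (2 * 1)) \<le> K1 * (t - s) ^ 1" using mom[of 1] by blast
  obtain K2 where K2: "K2 \<ge> 0" "\<And>s t n i. 0 \<le> s \<Longrightarrow> s \<le> t \<Longrightarrow>
      expectation (\<lambda>\<omega>. inc s t n i \<omega> ^ (2 * 2)) \<le> K2 * ((t - s) / real n) ^ 2"
    using inc_moment[of 2] by blast
  define K where "K = max K1 K2"
  have K: "0 \<le> K" "K1 \<le> K" "K2 \<le> K" using K1(1) by (auto simp: K_def)
  have "(\<integral>\<^sup>+\<omega>. ennreal (\<Sum>m<l. \<bar>f (B (node s t l m) \<omega>) - f (B s \<omega>)\<bar> * (inc s t l m \<omega>)\<^sup>2) \<partial>M)
      \<le> ennreal (Lip * K * (real l * \<theta> * (t - s) + (t - s)\<^sup>2 / (real l * \<theta>)))"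
    if st: "0 \<le> s" "s \<le> t" and l: "1 \<le> l" and \<theta>: "0 < \<theta>" and Lip: "0 \<le> Lip" "\<forall>x y. \<bar>f x - f y\<bar> \<le> Lip * \<bar>x - y\<bar>"
    for s t f Lip l \<theta>
  proof -
    define D where "D m = (\<lambda>\<omega>. B (node s t l m) \<omega> - B s \<omega>)" for m
    have nm: "s \<le> node s t l m" for m using node_mono[OF st(2), of 0 m l] by simp
    have fmD: "fin_mom (D m)" for m unfolding D_def by (rule increment_fin_mom[OF st(1) nm])
    note fm = fmD inc_fin_mom[OF st]
    define U where "U = (\<lambda>\<omega>. \<Sum>m<l. Lip * (\<theta> * (D m \<omega>) ^ (2 * 1) + 1 / \<theta> * inc s t l m \<omega> ^ (2 * 2)))"
    have fU: "fin_mom U" unfolding U_def by (intro fin_mom_intros fm)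
    have le: "(\<Sum>m<l. \<bar>f (B (node s t l m) \<omega>) - f (B s \<omega>)\<bar> * (inc s t l m \<omega>)\<^sup>2) \<le> U \<omega>" for \<omega>
      unfolding U_def
    proof (rule sum_mono)
      fix m
      define a where "a = \<bar>D m \<omega>\<bar>"
      define b where "b = (inc s t l m \<omega>)\<^sup>2"
      have ab: "0 \<le> a" "0 \<le> b" by (simp_all add: a_def b_def)
      have "\<bar>f (B (node s t l m) \<omega>) - f (B s \<omega>)\<bar> * b \<le> (Lip * a) * b"
        using Lip(2) ab unfolding a_def D_def by (intro mult_right_mono) auto
      also have "\<dots> = Lip * (a * b)" by simp
      also have "a * b \<le> \<theta> * a\<^sup>2 + 1 / \<theta> * b\<^sup>2"
        using mult_le_weighted_squares[OF ab \<theta>] by simp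
      also have "a\<^sup>2 = D m \<omega> ^ (2 * 1)" by (simp add: a_def)
      also have "b\<^sup>2 = inc s t l m \<omega> ^ (2 * 2)" unfolding b_def power_mult ..
      finally show "\<bar>f (B (node s t l m) \<omega>) - f (B s \<omega>)\<bar> * (inc s t l m \<omega>)\<^sup>2
          \<le> Lip * (\<theta> * (D m \<omega>) ^ (2 * 1) + 1 / \<theta> * inc s t l m \<omega> ^ (2 * 2))"
        using Lip(1) by (simp add: b_def mult_left_mono)
    qed
    have nn: "0 \<le> (\<Sum>m<l. \<bar>f (B (node s t l m) \<omega>) - f (B s \<omega>)\<bar> * (inc s t l m \<omega>)\<^sup>2)" for \<omega>
      by (intro sum_nonneg) simp
    have "expectation U = (\<Sum>m<l. Lip * (\<theta> * expectation (\<lambda>\<omega>. D m \<omega> ^ (2 * 1)) + 1 / \<theta> * expectation (\<lambda>\<omega>. inc s t l m \<omega> ^ (2 * 2))))"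
    proof -
      have i1: "integrable M (\<lambda>\<omega>. D m \<omega> ^ (2 * 1))" "integrable M (\<lambda>\<omega>. inc s t l m \<omega> ^ (2 * 2))" for m
        by (intro fin_mom_integrable fin_mom_intros fm)+
      show ?thesis unfolding U_def
        by (subst Bochner_Integration.integral_sum) (use i1 in simp_all)
    qed
    also have "\<dots> \<le> (\<Sum>m<l. Lip * (\<theta> * (K * (t - s)) + 1 / \<theta> * (K * ((t - s) / real l)\<^sup>2)))"
    proof (rule sum_mono)
      fix m assume m: "m \<in> {..<l}"
      have "expectation (\<lambda>\<omega>. D m \<omega> ^ (2 * 1)) \<le> K1 * (node s t l m - s) ^ 1"
        unfolding D_def by (rule K1(2)[OF st(1) nm])
      also have "\<dots> \<le> K * (t - s)"
        using node_mono[OF st(2), of m l l] node_n[OF l] m K nm[of m] by (simp add: mult_mono)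
      finally have 1: "expectation (\<lambda>\<omega>. D m \<omega> ^ (2 * 1)) \<le> K * (t - s)" .
      have "expectation (\<lambda>\<omega>. inc s t l m \<omega> ^ (2 * 2)) \<le> K2 * ((t - s) / real l) ^ 2" by (rule K2(2)[OF st])
      also have "\<dots> \<le> K * ((t - s) / real l)\<^sup>2" using K by (intro mult_right_mono) auto
      finally have 2: "expectation (\<lambda>\<omega>. inc s t l m \<omega> ^ (2 * 2)) \<le> K * ((t - s) / real l)\<^sup>2" .
      show "Lip * (\<theta> * expectation (\<lambda>\<omega>. D m \<omega> ^ (2 * 1)) + 1 / \<theta> * expectation (\<lambda>\<omega>. inc s t l m \<omega> ^ (2 * 2)))
         \<le> Lip * (\<theta> * (K * (t - s)) + 1 / \<theta> * (K * ((t - s) / real l)\<^sup>2))"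
        by (intro mult_left_mono add_mono 1 2) (use \<theta> Lip(1) in simp_all)
    qed
    also have "\<dots> = Lip * K * (real l * \<theta> * (t - s) + (t - s)\<^sup>2 / (real l * \<theta>))"
    proof -
      have "real l * ((t - s) / real l)\<^sup>2 = (t - s)\<^sup>2 / real l"
        using l by (simp add: power2_eq_square)
      then have "K / \<theta> * (real l * ((t - s) / real l)\<^sup>2) = K / \<theta> * ((t - s)\<^sup>2 / real l)" by simp
      then have e1: "real l * (1 / \<theta> * (K * ((t - s) / real l)\<^sup>2)) = K * ((t - s)\<^sup>2 / (real l * \<theta>))"
        by (simp add: mult_ac)
      have e2: "(\<Sum>m<l. Lip * (P + Q)) = Lip * (real l * P + real l * Q)" for P Q :: real
        by (simp add: algebra_simps)
      show ?thesis unfolding e2 e1 by (simp add: distrib_left mult_ac)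
    qed
    finally have EU: "expectation U \<le> Lip * K * (real l * \<theta> * (t - s) + (t - s)\<^sup>2 / (real l * \<theta>))" .
    have "(\<integral>\<^sup>+\<omega>. ennreal (\<Sum>m<l. \<bar>f (B (node s t l m) \<omega>) - f (B s \<omega>)\<bar> * (inc s t l m \<omega>)\<^sup>2) \<partial>M) \<le> (\<integral>\<^sup>+\<omega>. ennreal (U \<omega>) \<partial>M)"
      by (intro nn_integral_mono ennreal_leI le)
    also have "\<dots> = ennreal (expectation U)"
      by (rule nn_integral_eq_integral[OF fin_mom_integrable[OF fU]]) (use order_trans[OF nn le] in auto)
    also have "\<dots> \<le> ennreal (Lip * K * (real l * \<theta> * (t - s) + (t - s)\<^sup>2 / (real l * \<theta>)))"
      by (rule ennreal_leI[OF EU])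
    finally show ?thesis .
  qed
  with K(1) show ?thesis by blast
qed

lemma coarse_measurable:
  assumes "continuous_on UNIV f" "0 \<le> s" "s \<le> t"
  shows "coarse f s t k \<in> borel_measurable M"
proof -
  have "f \<in> borel_measurable borel" by (rule borel_measurable_continuous_onI[OF assms(1)])
  then have "(\<lambda>\<omega>. f (B (node s t k j) \<omega>)) \<in> borel_measurable M" for j
    using B_measurable[OF node_nonneg[OF assms(2,3)]] by (auto intro: measurable_compose)
  then show ?thesis unfolding coarse_def[abs_def]
    by (intro borel_measurable_sum borel_measurable_times borel_measurable_diff A_measurable node_nonneg assms)
qed

lemma riem_measurable:
  assumes "continuous_on UNIV f" "0 \<le> s" "s \<le> t"
  shows "riem f s t k \<in> borel_measurable M"
proof -
  have "f \<in> borel_measurable borel" by (rule borel_measurable_continuous_onI[OF assms(1)])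
  then have "(\<lambda>\<omega>. f (B (node s t k j) \<omega>)) \<in> borel_measurable M" for j
    using B_measurable[OF node_nonneg[OF assms(2,3)]] by (auto intro: measurable_compose)
  moreover have "inc s t k j \<in> borel_measurable M" for j
    by (intro fin_mom_measurable inc_fin_mom assms)
  ultimately show ?thesis unfolding riem_def[abs_def]
    by (intro borel_measurable_sum borel_measurable_times borel_measurable_power)
qed

text \<open>The integrand is frozen on a coarse grid of \<open>k\<close> intervals while \<open>l\<close> steps within each of
  them approximate the quadratic variation.\<close>

lemma riem_close_coarse:
  assumes st: "0 \<le> s" "s \<le> t" and Lip: "0 \<le> Lip" "\<forall>x y. \<bar>f x - f y\<bar> \<le> Lip * \<bar>x - y\<bar>" and c: "\<And>x. \<bar>f x\<bar> \<le> c"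
  shows "\<exists>C\<ge>0. \<forall>k\<ge>1. \<exists>l\<ge>1. (\<integral>\<^sup>+\<omega>. ennreal \<bar>riem f s t (k * l) \<omega> - coarse f s t k \<omega>\<bar> \<partial>M) \<le> ennreal (C / sqrt (real k))"
proof -
  obtain K where K: "K \<ge> 0" "\<And>s t l \<theta>. 0 \<le> s \<Longrightarrow> s \<le> t \<Longrightarrow> 1 \<le> l \<Longrightarrow> 0 < \<theta> \<Longrightarrow>
    (\<integral>\<^sup>+\<omega>. ennreal (\<Sum>m<l. \<bar>f (B (node s t l m) \<omega>) - f (B s \<omega>)\<bar> * (inc s t l m \<omega>)\<^sup>2) \<partial>M)
      \<le> ennreal (Lip * K * (real l * \<theta> * (t - s) + (t - s)\<^sup>2 / (real l * \<theta>)))"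
    using freeze_error Lip by meson
  define \<tau> where "\<tau> = t - s"
  have \<tau>: "0 \<le> \<tau>" using st by (simp add: \<tau>_def)
  have c0: "0 \<le> c" using c[of 0] by linarith
  have "Lip-lipschitz_on UNIV f" using Lip by (simp add: lipschitz_on_def dist_real_def)
  then have fc: "continuous_on UNIV f" by (rule lipschitz_on_continuous_on)
  have [measurable]: "f \<in> borel_measurable borel" by (rule borel_measurable_continuous_onI[OF fc])
  define C where "C = Lip * K * (\<tau> + \<tau>\<^sup>2) + c"
  have C: "0 \<le> C" using Lip(1) K(1) \<tau> c0 by (simp add: C_def)
  have "\<exists>l\<ge>1. (\<integral>\<^sup>+\<omega>. ennreal \<bar>riem f s t (k * l) \<omega> - coarse f s t k \<omega>\<bar> \<partial>M) \<le> ennreal (C / sqrt (real k))" if k: "1 \<le> k" for k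
  proof -
    \<comment> \<open>The budget of one coarse cell; \<open>k\<close> of them add up to
      \<open>1 / sqrt (real k)\<close>.\<close>
    define e where "e = 1 / (real k * sqrt (real k))"
    have e: "0 < e" using k by (simp add: e_def)
    define x where "x j = node s t k j" for j
    have x: "0 \<le> x j" "x j \<le> x (Suc j)" "x (Suc j) - x j = \<tau> / real k" for j
      unfolding x_def using node_nonneg[OF st] node_mono[OF st(2)] node_Suc_diff by (auto simp: \<tau>_def)
    define Z where "Z l j = (\<lambda>\<omega>. (\<Sum>i<l. (inc (x j) (x (Suc j)) l i \<omega>)\<^sup>2) - (A (x (Suc j)) \<omega> - A (x j) \<omega>))" for l j
    have "\<forall>j. \<exists>n0. \<forall>n\<ge>n0. (\<integral>\<^sup>+\<omega>. ennreal \<bar>Z n j \<omega>\<bar> \<partial>M) \<le> ennreal e"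
      unfolding Z_def using qv[OF x(1,2) e] by blast
    then obtain N where N: "\<And>j n. N j \<le> n \<Longrightarrow> (\<integral>\<^sup>+\<omega>. ennreal \<bar>Z n j \<omega>\<bar> \<partial>M) \<le> ennreal e" by metis
    \<comment> \<open>The sum dominates every threshold \<open>N j\<close>, so one refinement serves
      all coarse cells; the successor ensures that \<open>l\<close> is positive.\<close>
    define l where "l = Suc (\<Sum>j<k. N j)"
    have l: "1 \<le> l" by (simp add: l_def)
    have Nl: "N j \<le> l" if "j < k" for j
    proof -
      have "N j \<le> (\<Sum>j<k. N j)" using that by (intro member_le_sum) auto
      then show ?thesis by (simp add: l_def)
    qed
    define Wj where "Wj j = (\<lambda>\<omega>. \<Sum>m<l. \<bar>f (B (node (x j) (x (Suc j)) l m) \<omega>) - f (B (x j) \<omega>)\<bar> * (inc (x j) (x (Suc j)) l m \<omega>)\<^sup>2)" for j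
    have bm: "B (node (x j) (x (Suc j)) l m) \<in> borel_measurable M" "B (x j) \<in> borel_measurable M"
      "inc (x j) (x (Suc j)) l m \<in> borel_measurable M" "A (x j) \<in> borel_measurable M" for j m
      using B_measurable[OF node_nonneg[OF x(1,2)]] B_measurable[OF x(1)] fin_mom_measurable[OF inc_fin_mom[OF x(1,2)]]
        A_measurable[OF x(1)] by auto
    note [measurable] = bm
    have Wm [measurable]: "Wj j \<in> borel_measurable M" for j unfolding Wj_def by measurable
    have Zm [measurable]: "Z l j \<in> borel_measurable M" for j unfolding Z_def by measurable
    have Wn: "0 \<le> Wj j \<omega>" for j \<omega> unfolding Wj_def by (intro sum_nonneg) simp
    have pt: "\<bar>riem f s t (k * l) \<omega> - coarse f s t k \<omega>\<bar> \<le> (\<Sum>j<k. Wj j \<omega> + c * \<bar>Z l j \<omega>\<bar>)" for \<omega>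
    proof -
      have eq: "riem f s t (k * l) \<omega> - coarse f s t k \<omega>
        = (\<Sum>j<k. riem f (x j) (x (Suc j)) l \<omega> - f (B (x j) \<omega>) * (A (x (Suc j)) \<omega> - A (x j) \<omega>))"
        unfolding riem_refine[OF l k] coarse_def x_def by (simp add: sum_subtractf)
      show ?thesis unfolding eq
      proof (rule order_trans[OF sum_abs sum_mono])
        fix j
        define V where "V = (\<Sum>m<l. (f (B (node (x j) (x (Suc j)) l m) \<omega>) - f (B (x j) \<omega>)) * (inc (x j) (x (Suc j)) l m \<omega>)\<^sup>2)"
        have "riem f (x j) (x (Suc j)) l \<omega> - f (B (x j) \<omega>) * (A (x (Suc j)) \<omega> - A (x j) \<omega>) = V + f (B (x j) \<omega>) * Z l j \<omega>"
          unfolding V_def riem_def Z_def left_diff_distrib sum_subtractf right_diff_distrib sum_distrib_left by simp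
        moreover have "\<bar>V\<bar> \<le> Wj j \<omega>"
          unfolding V_def Wj_def by (rule order_trans[OF sum_abs]) (simp add: abs_mult)
        moreover have "\<bar>f (B (x j) \<omega>) * Z l j \<omega>\<bar> \<le> c * \<bar>Z l j \<omega>\<bar>"
          unfolding abs_mult by (rule mult_right_mono[OF c]) simp
        ultimately show "\<bar>riem f (x j) (x (Suc j)) l \<omega> - f (B (x j) \<omega>) * (A (x (Suc j)) \<omega> - A (x j) \<omega>)\<bar> \<le> Wj j \<omega> + c * \<bar>Z l j \<omega>\<bar>"
          by linarith
      qed
    qed
    define w where "w = Lip * K * ((\<tau> + \<tau>\<^sup>2) * e)"
    have w: "0 \<le> w" unfolding w_def using Lip(1) K(1) \<tau> e by simp
    have Wint: "(\<integral>\<^sup>+\<omega>. ennreal (Wj j \<omega>) \<partial>M) \<le> ennreal w" for j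
    proof -
      \<comment> \<open>With this weight \<open>real l * \<theta> = 1 / sqrt (real k)\<close>, and
        for a cell of length \<open>\<tau> / real k\<close> both parts of the freezing error are
        proportional to \<open>e\<close>.\<close>
      define \<theta> where "\<theta> = 1 / (sqrt (real k) * real l)"
      have sk: "0 < sqrt (real k)" "sqrt (real k) * sqrt (real k) = real k" using k by simp_all
      have \<theta>: "0 < \<theta>" using sk l by (simp add: \<theta>_def)
      have l\<theta>: "real l * \<theta> = 1 / sqrt (real k)" using l by (simp add: \<theta>_def)
      have "real l * \<theta> * (x (Suc j) - x j) + (x (Suc j) - x j)\<^sup>2 / (real l * \<theta>) = (\<tau> + \<tau>\<^sup>2) * e"
      proof -
        have "sqrt (real k) / (real k * real k) = e"
          using sk k unfolding e_def by (simp add: field_simps)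
        then have "\<tau>\<^sup>2 * (sqrt (real k) / (real k * real k)) = \<tau>\<^sup>2 * e" by simp
        then have "(\<tau> / real k)\<^sup>2 / (1 / sqrt (real k)) = \<tau>\<^sup>2 * e" by (simp add: power2_eq_square)
        moreover have "1 / sqrt (real k) * (\<tau> / real k) = \<tau> * e" by (simp add: e_def)
        ultimately show ?thesis unfolding l\<theta> x(3) distrib_right by simp
      qed
      then show ?thesis
        using K(2)[OF x(1,2) l \<theta>, of j] unfolding Wj_def w_def by simp
    qed
    have "(\<integral>\<^sup>+\<omega>. ennreal \<bar>riem f s t (k * l) \<omega> - coarse f s t k \<omega>\<bar> \<partial>M)
        \<le> (\<integral>\<^sup>+\<omega>. ennreal (\<Sum>j<k. Wj j \<omega> + c * \<bar>Z l j \<omega>\<bar>) \<partial>M)"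
      by (intro nn_integral_mono ennreal_leI pt)
    also have "\<dots> = (\<integral>\<^sup>+\<omega>. (\<Sum>j<k. ennreal (Wj j \<omega>) + ennreal c * ennreal \<bar>Z l j \<omega>\<bar>) \<partial>M)"
      using Wn c0 by (intro nn_integral_cong) (simp add: sum_ennreal[symmetric] ennreal_plus ennreal_mult)
    also have "\<dots> = (\<Sum>j<k. (\<integral>\<^sup>+\<omega>. ennreal (Wj j \<omega>) \<partial>M) + ennreal c * (\<integral>\<^sup>+\<omega>. ennreal \<bar>Z l j \<omega>\<bar> \<partial>M))"
      by (subst nn_integral_sum) (simp_all add: nn_integral_add nn_integral_cmult)
    also have "\<dots> \<le> (\<Sum>j<k. ennreal w + ennreal c * ennreal e)"
    proof (rule sum_mono)
      fix j assume "j \<in> {..<k}"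
      then show "(\<integral>\<^sup>+\<omega>. ennreal (Wj j \<omega>) \<partial>M) + ennreal c * (\<integral>\<^sup>+\<omega>. ennreal \<bar>Z l j \<omega>\<bar> \<partial>M) \<le> ennreal w + ennreal c * ennreal e"
        using Wint N[OF Nl, of j] by (intro add_mono mult_left_mono) auto
    qed
    also have "\<dots> = (\<Sum>j<k. ennreal (w + c * e))"
      using w c0 e by (simp add: ennreal_plus ennreal_mult)
    also have "\<dots> = ennreal (real k * (w + c * e))"
      using w c0 e by (subst sum_ennreal) simp_all
    also have "real k * (w + c * e) = C / sqrt (real k)"
      using k unfolding w_def C_def e_def by (simp add: field_simps)
    finally show ?thesis using l by blast
  qed
  with C show ?thesis by blast
qed

end

context quadratic_variation_martingale
begin

text \<open>The coarse grids are chosen so fine that the L1 distances between \<open>riem\<close>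
  and \<open>coarse\<close> are summable. Along this subsequence \<open>riem\<close> converges
  almost surely to the pathwise integral and hands its moment bound over by Fatou's lemma.\<close>

lemma stieltjes_moment_Lipschitz:
  assumes st: "0 \<le> s" "s \<le> t" and Lip: "0 \<le> Lip" "\<forall>x y. \<bar>f x - f y\<bar> \<le> Lip * \<bar>x - y\<bar>" and c: "\<And>x. \<bar>f x\<bar> \<le> c"
    and E: "0 \<le> E" "\<And>n. 1 \<le> n \<Longrightarrow> expectation (\<lambda>\<omega>. riem f s t n \<omega> ^ p) \<le> D + E / sqrt (real n)"
    and p: "even p" and fm: "\<And>n. fin_mom (riem f s t n)"
  shows "\<exists>X\<in>borel_measurable M. (AE \<omega> in M. X \<omega> = stieltjes f s t \<omega>) \<and> (\<integral>\<^sup>+\<omega>. ennreal (X \<omega> ^ p) \<partial>M) \<le> ennreal D"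
proof -
  have "Lip-lipschitz_on UNIV f" using Lip by (simp add: lipschitz_on_def dist_real_def)
  then have fc: "continuous_on UNIV f" by (rule lipschitz_on_continuous_on)
  obtain C where C: "C \<ge> 0" "\<And>k. 1 \<le> k \<Longrightarrow> \<exists>l\<ge>1. (\<integral>\<^sup>+\<omega>. ennreal \<bar>riem f s t (k * l) \<omega> - coarse f s t k \<omega>\<bar> \<partial>M) \<le> ennreal (C / sqrt (real k))"
    using riem_close_coarse[OF st Lip c] by blast
  define P where "P j k l \<longleftrightarrow> Suc j \<le> k \<and> 1 \<le> l \<and> (C + E) / sqrt (real k) \<le> (1 / 2) ^ j \<and>
      (\<integral>\<^sup>+\<omega>. ennreal \<bar>riem f s t (k * l) \<omega> - coarse f s t k \<omega>\<bar> \<partial>M) \<le> ennreal (C / sqrt (real k))" for j k l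
  have "\<exists>k l. P j k l" for j
  proof -
    obtain n where n: "((C + E) * 2 ^ j)\<^sup>2 \<le> real n" using real_arch_simple by blast
    define k where "k = n + Suc j"
    have "((C + E) * 2 ^ j)\<^sup>2 \<le> real k" using n by (simp add: k_def)
    then have "(C + E) * 2 ^ j \<le> sqrt (real k)" by (rule real_le_rsqrt)
    moreover have "0 < sqrt (real k)" by (simp add: k_def)
    ultimately have "(C + E) / sqrt (real k) \<le> (1 / 2) ^ j" by (simp add: power_one_over field_simps)
    moreover have "Suc j \<le> k" "1 \<le> k" by (simp_all add: k_def)
    ultimately show ?thesis using C(2)[of k] unfolding P_def by blast
  qed
  then obtain k l where "\<And>j. P j (k j) (l j)" by metis
  then have kl: "\<And>j. Suc j \<le> k j" "\<And>j. 1 \<le> l j" "\<And>j. (C + E) / sqrt (real (k j)) \<le> (1 / 2) ^ j"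
      "\<And>j. (\<integral>\<^sup>+\<omega>. ennreal \<bar>riem f s t (k j * l j) \<omega> - coarse f s t (k j) \<omega>\<bar> \<partial>M) \<le> ennreal (C / sqrt (real (k j)))"
    unfolding P_def by blast+
  have k0: "0 < sqrt (real (k j))" for j using kl(1)[of j] by simp
  have CE: "C / sqrt (real (k j)) \<le> (1 / 2) ^ j" "E / sqrt (real (k j)) \<le> (1 / 2) ^ j" for j
    using kl(3)[of j] C(1) E(1) k0[of j] by (smt (verit, best) divide_right_mono)+
  define Y where "Y j = riem f s t (k j * l j)" for j
  have Ym: "Y j \<in> borel_measurable M" for j unfolding Y_def by (rule riem_measurable[OF fc st])
  have kf: "filterlim k at_top sequentially"
  proof (rule filterlim_at_top_mono[OF filterlim_ident], rule always_eventually, rule allI)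
    show "j \<le> k j" for j using kl(1)[of j] by simp
  qed
  have "AE \<omega> in M. (\<lambda>j. Y j \<omega> - coarse f s t (k j) \<omega>) \<longlonglongrightarrow> 0"
  proof (rule AE_tendsto_0)
    show "(\<lambda>\<omega>. Y j \<omega> - coarse f s t (k j) \<omega>) \<in> borel_measurable M" for j
      using Ym coarse_measurable[OF fc st] by simp
    show "(\<integral>\<^sup>+\<omega>. ennreal \<bar>Y j \<omega> - coarse f s t (k j) \<omega>\<bar> \<partial>M) \<le> ennreal ((1 / 2) ^ j)" for j
      unfolding Y_def using kl(4) ennreal_leI[OF CE(1)] by (rule order_trans)
  qed (simp_all add: summable_geometric)
  then have lim: "AE \<omega> in M. (\<lambda>j. Y j \<omega>) \<longlonglongrightarrow> stieltjes f s t \<omega>"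
    using AE_good
  proof eventually_elim
    case (elim \<omega>)
    have "(\<lambda>j. coarse f s t (k j) \<omega>) \<longlonglongrightarrow> stieltjes f s t \<omega>"
      by (rule filterlim_compose[OF coarse_tendsto[OF elim(2) fc c st] kf])
    from tendsto_add[OF elim(1) this] show ?case by simp
  qed
  show ?thesis
  proof (rule limit_moment_le[OF Ym lim])
    show "(\<integral>\<^sup>+\<omega>. ennreal (Y j \<omega> ^ p) \<partial>M) \<le> ennreal (D + (1 / 2) ^ j)" for j
    proof -
      have n1: "1 \<le> k j * l j" using kl(1,2)[of j] by (simp add: Suc_le_eq)
      have "k j * 1 \<le> k j * l j" using kl(2)[of j] by (intro mult_left_mono) simp_all
      then have "real (k j) \<le> real (k j * l j)" unfolding of_nat_le_iff mult_1_right .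
      then have "sqrt (real (k j)) \<le> sqrt (real (k j * l j))" by (rule real_sqrt_le_mono)
      then have "E / sqrt (real (k j * l j)) \<le> E / sqrt (real (k j))"
        using k0[of j] E(1) by (intro divide_left_mono) (auto intro: mult_pos_pos less_le_trans)
      then have "expectation (\<lambda>\<omega>. Y j \<omega> ^ p) \<le> D + (1 / 2) ^ j"
        using E(2)[OF n1] CE(2)[of j] unfolding Y_def by linarith
      moreover have "(\<integral>\<^sup>+\<omega>. ennreal (Y j \<omega> ^ p) \<partial>M) = ennreal (expectation (\<lambda>\<omega>. Y j \<omega> ^ p))"
        unfolding Y_def by (rule nn_integral_eq_integral[OF fin_mom_integrable[OF fin_mom_power[OF fm]]])
          (simp add: zero_le_even_power[OF p])
      ultimately show ?thesis by (simp add: ennreal_leI)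
    qed
    show "(\<lambda>j. D + (1 / 2) ^ j) \<longlonglongrightarrow> D"
      using tendsto_add[OF tendsto_const[of D] LIMSEQ_realpow_zero[of "1 / 2"]] by simp
  qed
qed

text \<open>Extends the bound to discontinuous \<open>\<phi>\<close> by pathwise dominated
  convergence. The leading bound \<open>D\<close> is common to all approximations, while the error
  constant may depend on \<open>k\<close> because its limit has been taken before.\<close>

lemma stieltjes_moment:
  assumes st: "0 \<le> s" "s \<le> t" and a: "\<And>k. antiderivs (Lip k) (f k) (F1 k) (F2 k)" and c: "\<And>k x. \<bar>f k x\<bar> \<le> c"
    and lim: "\<And>x. (\<lambda>k. f k x) \<longlonglongrightarrow> \<phi> x" and p: "even p"
    and E: "\<And>k. \<exists>E\<ge>0. \<forall>n\<ge>1. expectation (\<lambda>\<omega>. riem (f k) s t n \<omega> ^ p) \<le> D + E / sqrt (real n)"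
  shows "\<exists>X\<in>borel_measurable M. (AE \<omega> in M. X \<omega> = stieltjes \<phi> s t \<omega>) \<and> (\<integral>\<^sup>+\<omega>. ennreal (X \<omega> ^ p) \<partial>M) \<le> ennreal D"
proof -
  have "\<exists>X. X \<in> borel_measurable M \<and> (AE \<omega> in M. X \<omega> = stieltjes (f k) s t \<omega>) \<and> (\<integral>\<^sup>+\<omega>. ennreal (X \<omega> ^ p) \<partial>M) \<le> ennreal D" for k
  proof -
    obtain E where "E \<ge> 0" "\<And>n. 1 \<le> n \<Longrightarrow> expectation (\<lambda>\<omega>. riem (f k) s t n \<omega> ^ p) \<le> D + E / sqrt (real n)"
      using E[of k] by blast
    moreover have "0 \<le> Lip k" "\<forall>x y. \<bar>f k x - f k y\<bar> \<le> Lip k * \<bar>x - y\<bar>"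
      using a[of k] unfolding antiderivs_def by blast+
    ultimately show ?thesis
      using stieltjes_moment_Lipschitz[OF st _ _ c _ _ p riem_fin_mom[OF a st c]] by blast
  qed
  then obtain X where X: "\<And>k. X k \<in> borel_measurable M" "\<And>k. AE \<omega> in M. X k \<omega> = stieltjes (f k) s t \<omega>"
    "\<And>k. (\<integral>\<^sup>+\<omega>. ennreal (X k \<omega> ^ p) \<partial>M) \<le> ennreal D" by metis
  have fm: "f k \<in> borel_measurable borel" for k
    by (rule borel_measurable_continuous_onI[OF antiderivs_f_continuous[OF a]])
  have \<phi>m: "\<phi> \<in> borel_measurable borel"
    by (rule borel_measurable_LIMSEQ_real[OF lim fm])
  have "AE \<omega> in M. \<forall>k. X k \<omega> = stieltjes (f k) s t \<omega>" using X(2) by (simp add: AE_all_countable)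
  then have "AE \<omega> in M. (\<lambda>k. X k \<omega>) \<longlonglongrightarrow> stieltjes \<phi> s t \<omega>"
    using AE_good
  proof eventually_elim
    case (elim \<omega>)
    interpret continuous_increasing "\<lambda>u. A (max 0 u) \<omega>" by (rule good_continuous_increasing[OF elim(2)])
    have [measurable_cong]: "sets (qv_measure \<omega>) = sets borel" by (simp add: qv_measure_def)
    note [measurable] = fm \<phi>m
    have "(\<lambda>k. stieltjes (f k) s t \<omega>) \<longlonglongrightarrow> stieltjes \<phi> s t \<omega>"
      unfolding stieltjes_def set_lebesgue_integral_def
    proof (rule integral_dominated_convergence[where w = "\<lambda>u. indicator {s<..t} u *\<^sub>R c"])
      show "integrable (qv_measure \<omega>) (\<lambda>u. indicat_real {s<..t} u *\<^sub>R c)"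
        using set_integrable_Ioc[of "\<lambda>_. c" "\<bar>c\<bar>" s t] unfolding set_integrable_def qv_measure_def by simp
      show "AE u in qv_measure \<omega>. (\<lambda>k. indicat_real {s<..t} u *\<^sub>R f k (B (max 0 u) \<omega>)) \<longlonglongrightarrow> indicat_real {s<..t} u *\<^sub>R \<phi> (B (max 0 u) \<omega>)"
        by (intro AE_I2 tendsto_scaleR tendsto_const lim)
      show "AE u in qv_measure \<omega>. norm (indicat_real {s<..t} u *\<^sub>R f k (B (max 0 u) \<omega>)) \<le> indicat_real {s<..t} u *\<^sub>R c" for k
        by (rule AE_I2) (simp add: c indicator_def)
    qed measurable
    then show ?case using elim(1) by simp
  qed
  from limit_moment_le[OF X(1) this X(3) tendsto_const] show ?thesis .
qed

end

section \<open>Lipschitz approximations of window functions\<close>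

definition tent :: "nat \<Rightarrow> real \<Rightarrow> real \<Rightarrow> real" where
  "tent k \<epsilon> x = min 1 (real k * max 0 (\<epsilon> - \<bar>x\<bar>))"

lemma tent_bounds: "0 \<le> tent k \<epsilon> x" "tent k \<epsilon> x \<le> 1"
  by (simp_all add: tent_def)

text \<open>The approximation is from inside: the support does not grow with \<open>k\<close>, so
  the antiderivatives below live on an interval that depends on the window alone.\<close>

lemma tent_zero: "\<epsilon> \<le> \<bar>x\<bar> \<Longrightarrow> tent k \<epsilon> x = 0"
  by (simp add: tent_def)

lemma tent_Lipschitz: "\<bar>tent k \<epsilon> x - tent k \<epsilon> y\<bar> \<le> real k * \<bar>x - y\<bar>"
proof -
  have "\<bar>real k * max 0 (\<epsilon> - \<bar>x\<bar>) - real k * max 0 (\<epsilon> - \<bar>y\<bar>)\<bar> = real k * \<bar>max 0 (\<epsilon> - \<bar>x\<bar>) - max 0 (\<epsilon> - \<bar>y\<bar>)\<bar>"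
    by (simp add: abs_mult right_diff_distrib[symmetric])
  also have "\<dots> \<le> real k * \<bar>x - y\<bar>" by (rule mult_left_mono) linarith+
  finally have "\<bar>real k * max 0 (\<epsilon> - \<bar>x\<bar>) - real k * max 0 (\<epsilon> - \<bar>y\<bar>)\<bar> \<le> real k * \<bar>x - y\<bar>" .
  moreover have "\<bar>min 1 p - min 1 q\<bar> \<le> \<bar>p - q\<bar>" for p q :: real by linarith
  ultimately show ?thesis unfolding tent_def by (rule order_trans[rotated])
qed

lemma tent_continuous: "continuous_on UNIV (tent k \<epsilon>)"
  unfolding tent_def by (intro continuous_intros)

lemma tent_tendsto: "(\<lambda>k. tent k \<epsilon> x) \<longlonglongrightarrow> indicator {- \<epsilon><..<\<epsilon>} x"
proof (cases "\<bar>x\<bar> < \<epsilon>")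
  case True
  obtain n0 where n0: "1 / (\<epsilon> - \<bar>x\<bar>) \<le> real n0" using real_arch_simple by blast
  have "\<forall>\<^sub>F k in sequentially. tent k \<epsilon> x = 1"
    using eventually_ge_at_top[of n0]
  proof eventually_elim
    case (elim k)
    then have "1 / (\<epsilon> - \<bar>x\<bar>) \<le> real k" using n0 by linarith
    then have "1 \<le> real k * (\<epsilon> - \<bar>x\<bar>)" using True by (simp add: pos_divide_le_eq)
    then show ?case using True by (simp add: tent_def)
  qed
  moreover have "indicator {- \<epsilon><..<\<epsilon>} x = (1::real)" using True by (simp add: indicator_def abs_less_iff)
  ultimately show ?thesis by (simp add: tendsto_eventually)
next
  case False
  then have "tent k \<epsilon> x = 0" for k by (simp add: tent_zero)
  moreover have "indicator {- \<epsilon><..<\<epsilon>} x = (0::real)" using False by (auto simp: indicator_def abs_less_iff)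
  ultimately show ?thesis by simp
qed

lemma tent_antiderivative:
  assumes "0 < \<epsilon>"
  shows "\<exists>F. (\<forall>x. (F has_real_derivative tent k \<epsilon> x) (at x)) \<and> (\<forall>x\<le>- \<epsilon>. F x = 0) \<and> (\<forall>x\<ge>\<epsilon>. F x = F \<epsilon>) \<and>
    (\<forall>x. 0 \<le> F x \<and> F x \<le> 2 * \<epsilon>)"
proof -
  have z: "tent k \<epsilon> x = 0" if "x \<le> - \<epsilon> \<or> \<epsilon> \<le> x" for x
    by (rule tent_zero) (use that in linarith)
  have "\<exists>F. (\<forall>x. (F has_real_derivative tent k \<epsilon> x) (at x)) \<and> (\<forall>x\<le>- \<epsilon>. F x = 0) \<and> (\<forall>x\<ge>\<epsilon>. F x = F \<epsilon>) \<and>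
    (\<forall>x. 0 \<le> F x \<and> F x \<le> \<epsilon> - (- \<epsilon>))"
    by (rule antiderivative_of_bump[OF tent_continuous tent_bounds]) (use z assms in auto)
  then show ?thesis by simp
qed

text \<open>Dividing by the window length \<open>2 * \<epsilon>\<close> brings the total mass below
  1; this bounds \<open>F1\<close> uniformly in \<open>k\<close> and
  \<open>\<epsilon>\<close>.\<close>

lemma tent_antiderivs_time:
  assumes "0 < \<epsilon>"
  shows "\<exists>F1 F2. antiderivs (real k / (2 * \<epsilon>)) (\<lambda>x. tent k \<epsilon> (x - a) / (2 * \<epsilon>)) F1 F2 \<and> (\<forall>x. \<bar>F1 x\<bar> \<le> 1)"
proof -
  obtain \<Phi> where \<Phi>: "\<And>x. (\<Phi> has_real_derivative tent k \<epsilon> x) (at x)" "\<And>x. 0 \<le> \<Phi> x" "\<And>x. \<Phi> x \<le> 2 * \<epsilon>"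
    using tent_antiderivative[OF assms, of k] by blast
  define F1 where "F1 x = \<Phi> (x - a) / (2 * \<epsilon>)" for x
  have d: "(F1 has_real_derivative tent k \<epsilon> (x - a) / (2 * \<epsilon>)) (at x)" for x
  proof -
    have "((\<lambda>x. \<Phi> (x - a)) has_real_derivative tent k \<epsilon> (x - a) * 1) (at x)"
      by (rule DERIV_chain2[OF \<Phi>(1)]) (auto intro!: derivative_eq_intros)
    then show ?thesis unfolding F1_def using DERIV_cdivide[of "\<lambda>x. \<Phi> (x - a)" _ x UNIV "2 * \<epsilon>"] by simp
  qed
  then have "continuous_on UNIV F1" by (meson DERIV_isCont continuous_at_imp_continuous_on)
  then obtain F2 where F2: "\<And>x. (F2 has_real_derivative F1 x) (at x)"
    using continuous_antiderivative_exists by blast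
  have "\<bar>tent k \<epsilon> (x - a) / (2 * \<epsilon>) - tent k \<epsilon> (y - a) / (2 * \<epsilon>)\<bar> \<le> real k / (2 * \<epsilon>) * \<bar>x - y\<bar>" for x y
  proof -
    have "\<bar>tent k \<epsilon> (x - a) - tent k \<epsilon> (y - a)\<bar> / (2 * \<epsilon>) \<le> real k * \<bar>x - y\<bar> / (2 * \<epsilon>)"
      using tent_Lipschitz[of k \<epsilon> "x - a" "y - a"] assms by (intro divide_right_mono) simp_all
    then show ?thesis using assms by (simp add: diff_divide_distrib[symmetric])
  qed
  then have "antiderivs (real k / (2 * \<epsilon>)) (\<lambda>x. tent k \<epsilon> (x - a) / (2 * \<epsilon>)) F1 F2"
    unfolding antiderivs_def using d F2 assms by simp
  moreover have "\<bar>F1 x\<bar> \<le> 1" for x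
    using \<Phi>(2,3)[of "x - a"] assms by (simp add: F1_def)
  ultimately show ?thesis by blast
qed

text \<open>The two translated tents have the same mass, so the antiderivative of their difference
  returns to zero to the right of both. This cancellation confines \<open>F1\<close> to an interval
  of length \<open>b - a + 2 * \<epsilon>\<close> and is the source of the decay in the spatial
  distance.\<close>

lemma tent_antiderivs_space:
  assumes "0 < \<epsilon>" "a < b"
  shows "\<exists>F1 F2. antiderivs (real k / \<epsilon>) (\<lambda>x. tent k \<epsilon> (x - a) / (2 * \<epsilon>) - tent k \<epsilon> (x - b) / (2 * \<epsilon>)) F1 F2 \<and> (\<forall>x. \<bar>F1 x\<bar> \<le> 1) \<and>
    (\<forall>x<a - \<epsilon>. F1 x = 0) \<and> (\<forall>x>(a - \<epsilon>) + (b - a + 2 * \<epsilon>). F1 x = 0)"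
proof -
  obtain \<Phi> where \<Phi>: "\<And>x. (\<Phi> has_real_derivative tent k \<epsilon> x) (at x)" "\<And>x. x \<le> - \<epsilon> \<Longrightarrow> \<Phi> x = 0" "\<And>x. \<epsilon> \<le> x \<Longrightarrow> \<Phi> x = \<Phi> \<epsilon>"
    "\<And>x. 0 \<le> \<Phi> x" "\<And>x. \<Phi> x \<le> 2 * \<epsilon>"
    using tent_antiderivative[OF assms(1), of k] by blast
  define F1 where "F1 x = \<Phi> (x - a) / (2 * \<epsilon>) - \<Phi> (x - b) / (2 * \<epsilon>)" for x
  have d: "(F1 has_real_derivative tent k \<epsilon> (x - a) / (2 * \<epsilon>) - tent k \<epsilon> (x - b) / (2 * \<epsilon>)) (at x)" for x
  proof -
    have "((\<lambda>x. \<Phi> (x - a)) has_real_derivative tent k \<epsilon> (x - a) * 1) (at x)" for a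
      by (rule DERIV_chain2[OF \<Phi>(1)]) (auto intro!: derivative_eq_intros)
    then show ?thesis unfolding F1_def by (intro DERIV_diff DERIV_cdivide) simp_all
  qed
  then have "continuous_on UNIV F1" by (meson DERIV_isCont continuous_at_imp_continuous_on)
  then obtain F2 where F2: "\<And>x. (F2 has_real_derivative F1 x) (at x)"
    using continuous_antiderivative_exists by blast
  have "\<bar>(tent k \<epsilon> (x - a) / (2 * \<epsilon>) - tent k \<epsilon> (x - b) / (2 * \<epsilon>)) - (tent k \<epsilon> (y - a) / (2 * \<epsilon>) - tent k \<epsilon> (y - b) / (2 * \<epsilon>))\<bar>
      \<le> real k / \<epsilon> * \<bar>x - y\<bar>" for x y
  proof -
    have "\<bar>(tent k \<epsilon> (x - a) - tent k \<epsilon> (x - b)) - (tent k \<epsilon> (y - a) - tent k \<epsilon> (y - b))\<bar> \<le> 2 * (real k * \<bar>x - y\<bar>)"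
      using tent_Lipschitz[of k \<epsilon> "x - a" "y - a"] tent_Lipschitz[of k \<epsilon> "x - b" "y - b"] by simp
    then have "\<bar>(tent k \<epsilon> (x - a) - tent k \<epsilon> (x - b)) - (tent k \<epsilon> (y - a) - tent k \<epsilon> (y - b))\<bar> / (2 * \<epsilon>) \<le> 2 * (real k * \<bar>x - y\<bar>) / (2 * \<epsilon>)"
      using assms by (intro divide_right_mono) simp_all
    then show ?thesis using assms by (simp add: diff_divide_distrib[symmetric])
  qed
  then have "antiderivs (real k / \<epsilon>) (\<lambda>x. tent k \<epsilon> (x - a) / (2 * \<epsilon>) - tent k \<epsilon> (x - b) / (2 * \<epsilon>)) F1 F2"
    unfolding antiderivs_def using d F2 assms by simp
  moreover have "\<bar>F1 x\<bar> \<le> 1" for x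
  proof -
    have "\<bar>\<Phi> (x - a) - \<Phi> (x - b)\<bar> \<le> 2 * \<epsilon>"
      using \<Phi>(4,5)[of "x - a"] \<Phi>(4,5)[of "x - b"] by linarith
    then show ?thesis using assms by (simp add: F1_def diff_divide_distrib[symmetric])
  qed
  moreover have "F1 x = 0" if "x < a - \<epsilon>" for x
    using \<Phi>(2)[of "x - a"] \<Phi>(2)[of "x - b"] that assms by (simp add: F1_def)
  moreover have "F1 x = 0" if "x > (a - \<epsilon>) + (b - a + 2 * \<epsilon>)" for x
    using \<Phi>(3)[of "x - a"] \<Phi>(3)[of "x - b"] that assms by (simp add: F1_def)
  ultimately show ?thesis by blast
qed

section \<open>Occupation quotients and their limit\<close>

section \<open>Moments of the increments of local time\<close>

locale local_time_martingale = quadratic_variation_martingale M B F A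
  for M :: "'a measure" and B :: "real \<Rightarrow> 'a \<Rightarrow> real" and F :: "real \<Rightarrow> 'a measure" and A :: "real \<Rightarrow> 'a \<Rightarrow> real" +
  fixes L :: "real \<Rightarrow> real \<Rightarrow> 'a \<Rightarrow> real"
  assumes L_measurable: "0 \<le> t \<Longrightarrow> L a t \<in> borel_measurable M"
    and L_limit: "0 \<le> t \<Longrightarrow> ((\<lambda>\<epsilon>. \<integral>\<^sup>+\<omega>. ennreal (\<bar>1 / (2 * \<epsilon>) *
        (LINT u:{0..t}|qv_measure \<omega>. indicator {a - \<epsilon><..<a + \<epsilon>} (B u \<omega>)) - L a t \<omega>\<bar>\<^sup>2) \<partial>M) \<longlongrightarrow> 0) (at_right 0)"
begin

definition occ :: "real \<Rightarrow> real \<Rightarrow> real \<Rightarrow> real \<Rightarrow> 'a \<Rightarrow> real" where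
  "occ a \<epsilon> s t \<omega> = stieltjes (\<lambda>x. indicator {- \<epsilon><..<\<epsilon>} (x - a) / (2 * \<epsilon>)) s t \<omega>"

text \<open>A continuous integrator has no mass at time 0, which allows the passage from closed to
  half-open intervals.\<close>

lemma occ_eq:
  assumes "good \<omega>"
  shows "1 / (2 * \<epsilon>) * (LINT u:{0..t}|qv_measure \<omega>. indicator {a - \<epsilon><..<a + \<epsilon>} (B u \<omega>)) = occ a \<epsilon> 0 t \<omega>"
proof -
  interpret continuous_increasing "\<lambda>u. A (max 0 u) \<omega>" by (rule good_continuous_increasing[OF assms])
  define g where "g u = (indicator {- \<epsilon><..<\<epsilon>} (B (max 0 u) \<omega> - a) :: real)" for u
  have gm: "g \<in> borel_measurable borel" unfolding g_def by measurable
  have "(LINT u:{0..t}|qv_measure \<omega>. indicator {a - \<epsilon><..<a + \<epsilon>} (B u \<omega>)) = (LINT u:{0..t}|qv_measure \<omega>. g u)"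
    unfolding set_lebesgue_integral_def g_def
    by (rule Bochner_Integration.integral_cong) (auto simp: indicator_def max_def)
  also have "\<dots> = (LINT u:{0<..t}|qv_measure \<omega>. g u)"
    unfolding qv_measure_def by (rule integral_Icc_eq_Ioc[OF gm])
  also have "1 / (2 * \<epsilon>) * \<dots> = (LINT u:{0<..t}|qv_measure \<omega>. g u / (2 * \<epsilon>))"
    by (simp add: set_integral_divide_zero)
  finally show ?thesis unfolding occ_def stieltjes_def g_def .
qed

lemma occ_integrand_bounded: "0 < \<epsilon> \<Longrightarrow> \<bar>indicator {- \<epsilon><..<\<epsilon>} (x - a) / (2 * \<epsilon>)\<bar> \<le> 1 / (2 * \<epsilon> :: real)"
  by (simp add: indicator_def)

lemma occ_split:
  assumes "good \<omega>" "0 < \<epsilon>" "0 \<le> s" "s \<le> t"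
  shows "occ a \<epsilon> 0 t \<omega> - occ a \<epsilon> 0 s \<omega> = occ a \<epsilon> s t \<omega>"
proof -
  interpret continuous_increasing "\<lambda>u. A (max 0 u) \<omega>" by (rule good_continuous_increasing[OF assms(1)])
  have "(\<lambda>u. indicator {- \<epsilon><..<\<epsilon>} (B (max 0 u) \<omega> - a) / (2 * \<epsilon>)) \<in> borel_measurable borel" by measurable
  from integral_Ioc_split[OF this occ_integrand_bounded[OF assms(2)] assms(3,4)]
  show ?thesis unfolding occ_def stieltjes_def qv_measure_def by simp
qed

lemma occ_diff:
  assumes "good \<omega>" "0 < \<epsilon>"
  shows "occ a \<epsilon> 0 t \<omega> - occ b \<epsilon> 0 t \<omega>
    = stieltjes (\<lambda>x. indicator {- \<epsilon><..<\<epsilon>} (x - a) / (2 * \<epsilon>) - indicator {- \<epsilon><..<\<epsilon>} (x - b) / (2 * \<epsilon>)) 0 t \<omega>"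
proof -
  interpret continuous_increasing "\<lambda>u. A (max 0 u) \<omega>" by (rule good_continuous_increasing[OF assms(1)])
  have m: "(\<lambda>u. indicator {- \<epsilon><..<\<epsilon>} (B (max 0 u) \<omega> - a) / (2 * \<epsilon>)) \<in> borel_measurable borel" for a by measurable
  show ?thesis unfolding occ_def stieltjes_def qv_measure_def
    by (rule set_integral_diff(2)[symmetric];
        rule set_integrable_Ioc[OF m occ_integrand_bounded[OF assms(2)]])
qed

lemma tent_quotient_tendsto:
  "(\<lambda>k. tent k \<epsilon> (x - a) / (2 * \<epsilon>)) \<longlonglongrightarrow> indicator {- \<epsilon><..<\<epsilon>} (x - a) / (2 * \<epsilon>)"
  unfolding divide_inverse by (intro tendsto_mult tent_tendsto tendsto_const)

lemma tent_quotient_bounded: "0 < \<epsilon> \<Longrightarrow> \<bar>tent k \<epsilon> x / (2 * \<epsilon>)\<bar> \<le> 1 / (2 * \<epsilon>)"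
  using tent_bounds[of k \<epsilon> x] by (simp add: divide_right_mono)

text \<open>The time estimate with \<open>k = 1\<close> and \<open>m = 2 * r\<close>. The variable
  \<open>X\<close> stands in for the occupation quotient, for which only a measurable version is
  produced.\<close>

lemma occ_time_moment:
  assumes r: "2 \<le> r"
  shows "\<exists>C\<ge>0. \<forall>s t a \<epsilon>. 0 \<le> s \<longrightarrow> s \<le> t \<longrightarrow> 0 < \<epsilon> \<longrightarrow> (\<exists>X\<in>borel_measurable M. (AE \<omega> in M. X \<omega> = occ a \<epsilon> s t \<omega>) \<and>
    (\<integral>\<^sup>+\<omega>. ennreal (X \<omega> ^ (4 * r)) \<partial>M) \<le> ennreal (C * (t - s) ^ (2 * r)))"
proof -
  have r2: "2 \<le> 2 * r" "2 * (2 * r) = 4 * r" using r by simp_all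
  obtain C where C: "C \<ge> 0" "\<And>s t k L f F1 F2 c. 0 \<le> s \<Longrightarrow> s \<le> t \<Longrightarrow> antiderivs L f F1 F2 \<Longrightarrow> (\<forall>x. \<bar>F1 x\<bar> \<le> k) \<Longrightarrow> (\<forall>x. \<bar>f x\<bar> \<le> c) \<Longrightarrow>
    (\<exists>E\<ge>0. \<forall>n\<ge>1. expectation (\<lambda>\<omega>. riem f s t n \<omega> ^ (4 * r)) \<le> C * k ^ (4 * r) * (t - s) ^ (2 * r) + E / real n)"
    using riem_moment_time[OF r2(1)] unfolding r2(2) by metis
  have "\<exists>X\<in>borel_measurable M. (AE \<omega> in M. X \<omega> = occ a \<epsilon> s t \<omega>) \<and>
    (\<integral>\<^sup>+\<omega>. ennreal (X \<omega> ^ (4 * r)) \<partial>M) \<le> ennreal (C * (t - s) ^ (2 * r))"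
    if st: "0 \<le> s" "s \<le> t" and \<epsilon>: "0 < \<epsilon>" for s t a \<epsilon>
  proof -
    have "\<forall>k. \<exists>F1 F2. antiderivs (real k / (2 * \<epsilon>)) (\<lambda>x. tent k \<epsilon> (x - a) / (2 * \<epsilon>)) F1 F2 \<and> (\<forall>x. \<bar>F1 x\<bar> \<le> 1)"
      using tent_antiderivs_time[OF \<epsilon>] by blast
    then obtain F1 F2 where F: "\<And>k. antiderivs (real k / (2 * \<epsilon>)) (\<lambda>x. tent k \<epsilon> (x - a) / (2 * \<epsilon>)) (F1 k) (F2 k)"
      "\<And>k x. \<bar>F1 k x\<bar> \<le> 1" by metis
    show ?thesis unfolding occ_def
    proof (rule stieltjes_moment[OF st F(1) tent_quotient_bounded[OF \<epsilon>] tent_quotient_tendsto])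
      fix k
      obtain E where E: "E \<ge> 0" "\<And>n. n\<ge>1 \<Longrightarrow> expectation (\<lambda>\<omega>. riem (\<lambda>x. tent k \<epsilon> (x - a) / (2 * \<epsilon>)) s t n \<omega> ^ (4 * r))
          \<le> C * 1 ^ (4 * r) * (t - s) ^ (2 * r) + E / real n"
        using C(2)[OF st F(1)[of k], of 1 "1 / (2 * \<epsilon>)"] F(2) tent_quotient_bounded[OF \<epsilon>] by blast
      have "expectation (\<lambda>\<omega>. riem (\<lambda>x. tent k \<epsilon> (x - a) / (2 * \<epsilon>)) s t n \<omega> ^ (4 * r))
          \<le> C * (t - s) ^ (2 * r) + E / sqrt (real n)" if n: "1 \<le> n" for n
      proof -
        have "sqrt (real n) \<le> real n" "0 < sqrt (real n)"
          using n real_sqrt_le_iff[of "real n" "(real n)\<^sup>2"] by (simp_all add: self_le_power)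
        then have "E / real n \<le> E / sqrt (real n)" using E(1) n by (intro divide_left_mono) simp_all
        then show ?thesis using E(2)[OF n] by simp
      qed
      then show "\<exists>E\<ge>0. \<forall>n\<ge>1. expectation (\<lambda>\<omega>. riem (\<lambda>x. tent k \<epsilon> (x - a) / (2 * \<epsilon>)) s t n \<omega> ^ (4 * r))
          \<le> C * (t - s) ^ (2 * r) + E / sqrt (real n)" using E(1) by blast
    qed simp
  qed
  with C(1) show ?thesis by blast
qed

text \<open>The bound stays finite as the window shrinks, since \<open>\<epsilon>\<close> enters
  only through the length \<open>b - a + 2 * \<epsilon>\<close>.\<close>

lemma occ_space_moment:
  assumes r: "2 \<le> r"
  shows "\<exists>C\<ge>0. \<forall>t a b \<epsilon>. 0 \<le> t \<longrightarrow> a < b \<longrightarrow> 0 < \<epsilon> \<longrightarrow> (\<exists>X\<in>borel_measurable M. (AE \<omega> in M. X \<omega> = occ a \<epsilon> 0 t \<omega> - occ b \<epsilon> 0 t \<omega>) \<and>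
    (\<integral>\<^sup>+\<omega>. ennreal (X \<omega> ^ (4 * r)) \<partial>M) \<le> ennreal (C * ((b - a + 2 * \<epsilon>) ^ (4 * r) + (b - a + 2 * \<epsilon>) ^ (2 * r) * t ^ r)))"
proof -
  obtain C where C: "C \<ge> 0" "\<And>s t \<eta> lo L f F1 F2 c. 0 \<le> s \<Longrightarrow> s \<le> t \<Longrightarrow> antiderivs L f F1 F2 \<Longrightarrow> (\<forall>x. \<bar>F1 x\<bar> \<le> 1) \<Longrightarrow> (\<forall>x. \<bar>f x\<bar> \<le> c) \<Longrightarrow>
    0 < \<eta> \<Longrightarrow> (\<forall>x<lo. F1 x = 0) \<Longrightarrow> (\<forall>x>lo + \<eta>. F1 x = 0) \<Longrightarrow>
    (\<exists>E\<ge>0. \<forall>n\<ge>1. expectation (\<lambda>\<omega>. riem f s t n \<omega> ^ (4 * r))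
       \<le> C * (\<eta> ^ (4 * r) + \<eta> ^ (2 * r) * (t - s) ^ r) + E / sqrt (real n))"
    using riem_moment_space[OF r] by blast
  have "\<exists>X\<in>borel_measurable M. (AE \<omega> in M. X \<omega> = occ a \<epsilon> 0 t \<omega> - occ b \<epsilon> 0 t \<omega>) \<and>
    (\<integral>\<^sup>+\<omega>. ennreal (X \<omega> ^ (4 * r)) \<partial>M) \<le> ennreal (C * ((b - a + 2 * \<epsilon>) ^ (4 * r) + (b - a + 2 * \<epsilon>) ^ (2 * r) * t ^ r))"
    if t: "0 \<le> t" and ab: "a < b" and \<epsilon>: "0 < \<epsilon>" for t a b \<epsilon>
  proof -
    define f where "f k x = tent k \<epsilon> (x - a) / (2 * \<epsilon>) - tent k \<epsilon> (x - b) / (2 * \<epsilon>)" for k x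
    define \<phi> where "\<phi> x = indicator {- \<epsilon><..<\<epsilon>} (x - a) / (2 * \<epsilon>) - indicator {- \<epsilon><..<\<epsilon>} (x - b) / (2 * \<epsilon>)" for x
    have fe: "f k = (\<lambda>x. tent k \<epsilon> (x - a) / (2 * \<epsilon>) - tent k \<epsilon> (x - b) / (2 * \<epsilon>))" for k
      by (rule ext) (rule f_def)
    have "\<forall>k. \<exists>F1 F2. antiderivs (real k / \<epsilon>) (f k) F1 F2 \<and> (\<forall>x. \<bar>F1 x\<bar> \<le> 1) \<and>
      (\<forall>x<a - \<epsilon>. F1 x = 0) \<and> (\<forall>x>(a - \<epsilon>) + (b - a + 2 * \<epsilon>). F1 x = 0)"
      unfolding fe using tent_antiderivs_space[OF \<epsilon> ab] by blast
    then obtain F1 F2 where F: "\<And>k. antiderivs (real k / \<epsilon>) (f k) (F1 k) (F2 k)" "\<And>k. \<forall>x. \<bar>F1 k x\<bar> \<le> 1"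
      "\<And>k. \<forall>x<a - \<epsilon>. F1 k x = 0" "\<And>k. \<forall>x>(a - \<epsilon>) + (b - a + 2 * \<epsilon>). F1 k x = 0" by metis
    have fb: "\<bar>f k x\<bar> \<le> 1 / (2 * \<epsilon>) + 1 / (2 * \<epsilon>)" for k x
      unfolding f_def using tent_quotient_bounded[OF \<epsilon>, of k "x - a"] tent_quotient_bounded[OF \<epsilon>, of k "x - b"]
      by (intro order_trans[OF abs_triangle_ineq4] add_mono)
    have flim: "(\<lambda>k. f k x) \<longlonglongrightarrow> \<phi> x" for x
      unfolding f_def \<phi>_def by (intro tendsto_diff tent_quotient_tendsto)
    have \<eta>: "0 < b - a + 2 * \<epsilon>" using ab \<epsilon> by simp
    have "\<exists>X\<in>borel_measurable M. (AE \<omega> in M. X \<omega> = stieltjes \<phi> 0 t \<omega>) \<and>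
      (\<integral>\<^sup>+\<omega>. ennreal (X \<omega> ^ (4 * r)) \<partial>M) \<le> ennreal (C * ((b - a + 2 * \<epsilon>) ^ (4 * r) + (b - a + 2 * \<epsilon>) ^ (2 * r) * (t - 0) ^ r))"
    proof (rule stieltjes_moment[OF order_refl t F(1) fb flim])
      show "\<exists>E\<ge>0. \<forall>n\<ge>1. expectation (\<lambda>\<omega>. riem (f k) 0 t n \<omega> ^ (4 * r))
         \<le> C * ((b - a + 2 * \<epsilon>) ^ (4 * r) + (b - a + 2 * \<epsilon>) ^ (2 * r) * (t - 0) ^ r) + E / sqrt (real n)" for k
        by (rule C(2)[OF order_refl t F(1,2) _ \<eta> F(3,4)]) (use fb in blast)
    qed simp
    then obtain X where X: "X \<in> borel_measurable M" "AE \<omega> in M. X \<omega> = stieltjes \<phi> 0 t \<omega>"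
      "(\<integral>\<^sup>+\<omega>. ennreal (X \<omega> ^ (4 * r)) \<partial>M) \<le> ennreal (C * ((b - a + 2 * \<epsilon>) ^ (4 * r) + (b - a + 2 * \<epsilon>) ^ (2 * r) * t ^ r))"
      by auto
    have "AE \<omega> in M. X \<omega> = occ a \<epsilon> 0 t \<omega> - occ b \<epsilon> 0 t \<omega>"
      using X(2) AE_good
    proof eventually_elim
      case (elim \<omega>)
      then show ?case unfolding occ_diff[OF elim(2) \<epsilon>] \<phi>_def by simp
    qed
    with X(1,3) show ?thesis by blast
  qed
  with C(1) show ?thesis by blast
qed

lemma occ_close_L:
  assumes t: "0 \<le> t" and \<delta>: "0 < \<delta>"
  shows "\<exists>e>0. \<forall>\<epsilon>. 0 < \<epsilon> \<longrightarrow> \<epsilon> < e \<longrightarrow> (\<integral>\<^sup>+\<omega>. ennreal (\<bar>occ a \<epsilon> 0 t \<omega> - L a t \<omega>\<bar>\<^sup>2) \<partial>M) \<le> ennreal \<delta>"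
proof -
  have "\<forall>\<^sub>F \<epsilon> in at_right 0. (\<integral>\<^sup>+\<omega>. ennreal (\<bar>1 / (2 * \<epsilon>) *
        (LINT u:{0..t}|qv_measure \<omega>. indicator {a - \<epsilon><..<a + \<epsilon>} (B u \<omega>)) - L a t \<omega>\<bar>\<^sup>2) \<partial>M) < ennreal \<delta>"
    by (rule order_tendstoD(2)[OF L_limit[OF t]]) (use \<delta> in simp)
  then obtain e where e: "0 < e" "\<And>\<epsilon>. 0 < \<epsilon> \<Longrightarrow> \<epsilon> < e \<Longrightarrow> (\<integral>\<^sup>+\<omega>. ennreal (\<bar>1 / (2 * \<epsilon>) *
        (LINT u:{0..t}|qv_measure \<omega>. indicator {a - \<epsilon><..<a + \<epsilon>} (B u \<omega>)) - L a t \<omega>\<bar>\<^sup>2) \<partial>M) < ennreal \<delta>"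
    unfolding eventually_at_right_field by blast
  have "(\<integral>\<^sup>+\<omega>. ennreal (\<bar>occ a \<epsilon> 0 t \<omega> - L a t \<omega>\<bar>\<^sup>2) \<partial>M) = (\<integral>\<^sup>+\<omega>. ennreal (\<bar>1 / (2 * \<epsilon>) *
        (LINT u:{0..t}|qv_measure \<omega>. indicator {a - \<epsilon><..<a + \<epsilon>} (B u \<omega>)) - L a t \<omega>\<bar>\<^sup>2) \<partial>M)" for \<epsilon>
  proof (rule nn_integral_cong_AE)
    show "AE \<omega> in M. ennreal (\<bar>occ a \<epsilon> 0 t \<omega> - L a t \<omega>\<bar>\<^sup>2) = ennreal (\<bar>1 / (2 * \<epsilon>) *
        (LINT u:{0..t}|qv_measure \<omega>. indicator {a - \<epsilon><..<a + \<epsilon>} (B u \<omega>)) - L a t \<omega>\<bar>\<^sup>2)"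
      using AE_good
    proof eventually_elim
      case (elim \<omega>)
      show ?case unfolding occ_eq[OF elim] ..
    qed
  qed
  then show ?thesis using e by (metis less_imp_le)
qed

lemma occ_AE_limit:
  assumes t: "0 \<le> t" and \<epsilon>: "\<And>j. 0 < \<epsilon> j"
    and small: "\<And>j. (\<integral>\<^sup>+\<omega>. ennreal (\<bar>occ a (\<epsilon> j) 0 t \<omega> - L a t \<omega>\<bar>\<^sup>2) \<partial>M) \<le> ennreal ((1 / 2) ^ j)"
  shows "AE \<omega> in M. (\<lambda>j. occ a (\<epsilon> j) 0 t \<omega>) \<longlonglongrightarrow> L a t \<omega>"
proof -
  \<comment> \<open>Only the measurable versions of the occupation quotients are taken from the
    moment bound.\<close>
  obtain C where "\<forall>s t a \<epsilon>. 0 \<le> s \<longrightarrow> s \<le> t \<longrightarrow> 0 < \<epsilon> \<longrightarrow> (\<exists>X\<in>borel_measurable M. (AE \<omega> in M. X \<omega> = occ a \<epsilon> s t \<omega>) \<and>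
    (\<integral>\<^sup>+\<omega>. ennreal (X \<omega> ^ (4 * 2)) \<partial>M) \<le> ennreal (C * (t - s) ^ (2 * 2)))"
    using occ_time_moment[of 2] by auto
  then have "\<forall>j. \<exists>X. X \<in> borel_measurable M \<and> (AE \<omega> in M. X \<omega> = occ a (\<epsilon> j) 0 t \<omega>)"
    using t \<epsilon> by blast
  then obtain X where X: "\<And>j. X j \<in> borel_measurable M" "\<And>j. AE \<omega> in M. X j \<omega> = occ a (\<epsilon> j) 0 t \<omega>" by metis
  have "AE \<omega> in M. (\<lambda>j. (X j \<omega> - L a t \<omega>)\<^sup>2) \<longlonglongrightarrow> 0"
  proof (rule AE_tendsto_0)
    show "(\<lambda>\<omega>. (X j \<omega> - L a t \<omega>)\<^sup>2) \<in> borel_measurable M" for j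
      using X(1)[of j] L_measurable[OF t, of a] by measurable
    show "(\<integral>\<^sup>+\<omega>. ennreal \<bar>(X j \<omega> - L a t \<omega>)\<^sup>2\<bar> \<partial>M) \<le> ennreal ((1 / 2) ^ j)" for j
    proof -
      have "(\<integral>\<^sup>+\<omega>. ennreal \<bar>(X j \<omega> - L a t \<omega>)\<^sup>2\<bar> \<partial>M) = (\<integral>\<^sup>+\<omega>. ennreal (\<bar>occ a (\<epsilon> j) 0 t \<omega> - L a t \<omega>\<bar>\<^sup>2) \<partial>M)"
        using X(2)[of j] by (intro nn_integral_cong_AE) (auto elim!: eventually_mono)
      then show ?thesis using small[of j] by simp
    qed
  qed (simp_all add: summable_geometric)
  moreover have "AE \<omega> in M. \<forall>j. X j \<omega> = occ a (\<epsilon> j) 0 t \<omega>" using X(2) by (simp add: AE_all_countable)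
  ultimately show ?thesis
  proof eventually_elim
    case (elim \<omega>)
    then have "(\<lambda>j. sqrt ((occ a (\<epsilon> j) 0 t \<omega> - L a t \<omega>)\<^sup>2)) \<longlonglongrightarrow> sqrt 0"
      by (intro tendsto_real_sqrt) simp
    then have "(\<lambda>j. occ a (\<epsilon> j) 0 t \<omega> - L a t \<omega>) \<longlonglongrightarrow> 0" by (simp add: tendsto_rabs_zero_iff)
    then show ?case by (simp add: LIM_zero_iff)
  qed
qed

text \<open>One sequence of windows serves two space-time points at once, so that differences of
  occupation quotients converge too. The rate \<open>(1 / 2) ^ j\<close> makes the convergence
  almost sure and forces the windows to shrink.\<close>

lemma occ_AE_limits:
  assumes "0 \<le> s" "0 \<le> t"
  shows "\<exists>\<epsilon>. (\<forall>j. 0 < \<epsilon> j \<and> \<epsilon> j \<le> (1 / 2) ^ j) \<and> (AE \<omega> in M. (\<lambda>j. occ a (\<epsilon> j) 0 s \<omega>) \<longlonglongrightarrow> L a s \<omega>) \<and>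
    (AE \<omega> in M. (\<lambda>j. occ b (\<epsilon> j) 0 t \<omega>) \<longlonglongrightarrow> L b t \<omega>)"
proof -
  define P where "P j e \<longleftrightarrow> 0 < e \<and> e \<le> (1 / 2) ^ j \<and>
     (\<integral>\<^sup>+\<omega>. ennreal (\<bar>occ a e 0 s \<omega> - L a s \<omega>\<bar>\<^sup>2) \<partial>M) \<le> ennreal ((1 / 2) ^ j) \<and>
     (\<integral>\<^sup>+\<omega>. ennreal (\<bar>occ b e 0 t \<omega> - L b t \<omega>\<bar>\<^sup>2) \<partial>M) \<le> ennreal ((1 / 2) ^ j)" for j and e :: real
  have "\<exists>e. P j e" for j
  proof -
    have p: "(0::real) < (1 / 2) ^ j" by simp
    obtain e1 where e1: "0 < e1" "\<And>\<epsilon>. 0 < \<epsilon> \<Longrightarrow> \<epsilon> < e1 \<Longrightarrow> (\<integral>\<^sup>+\<omega>. ennreal (\<bar>occ a \<epsilon> 0 s \<omega> - L a s \<omega>\<bar>\<^sup>2) \<partial>M) \<le> ennreal ((1 / 2) ^ j)"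
      using occ_close_L[OF assms(1) p] by blast
    obtain e2 where e2: "0 < e2" "\<And>\<epsilon>. 0 < \<epsilon> \<Longrightarrow> \<epsilon> < e2 \<Longrightarrow> (\<integral>\<^sup>+\<omega>. ennreal (\<bar>occ b \<epsilon> 0 t \<omega> - L b t \<omega>\<bar>\<^sup>2) \<partial>M) \<le> ennreal ((1 / 2) ^ j)"
      using occ_close_L[OF assms(2) p] by blast
    define e where "e = min ((1 / 2) ^ j) (min e1 e2) / 2"
    have "0 < e" "e < e1" "e < e2" "e \<le> (1 / 2) ^ j" using p e1(1) e2(1) by (auto simp: e_def min_def)
    then show ?thesis using e1(2) e2(2) unfolding P_def by blast
  qed
  then obtain \<epsilon> where \<epsilon>: "\<And>j. P j (\<epsilon> j)" by metis
  have "AE \<omega> in M. (\<lambda>j. occ a (\<epsilon> j) 0 s \<omega>) \<longlonglongrightarrow> L a s \<omega>"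
    by (rule occ_AE_limit[OF assms(1)]) (use \<epsilon> in \<open>simp_all add: P_def\<close>)
  moreover have "AE \<omega> in M. (\<lambda>j. occ b (\<epsilon> j) 0 t \<omega>) \<longlonglongrightarrow> L b t \<omega>"
    by (rule occ_AE_limit[OF assms(2)]) (use \<epsilon> in \<open>simp_all add: P_def\<close>)
  ultimately show ?thesis using \<epsilon> unfolding P_def by blast
qed

lemma local_time_time_moment:
  assumes r: "2 \<le> r"
  shows "\<exists>C\<ge>0. \<forall>s t a. 0 \<le> s \<longrightarrow> s \<le> t \<longrightarrow>
    (\<integral>\<^sup>+\<omega>. ennreal ((L a t \<omega> - L a s \<omega>) ^ (4 * r)) \<partial>M) \<le> ennreal (C * (t - s) ^ (2 * r))"
proof -
  obtain C where C: "C \<ge> 0" "\<And>s t a \<epsilon>. 0 \<le> s \<Longrightarrow> s \<le> t \<Longrightarrow> 0 < \<epsilon> \<Longrightarrow> \<exists>X\<in>borel_measurable M. (AE \<omega> in M. X \<omega> = occ a \<epsilon> s t \<omega>) \<and>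
    (\<integral>\<^sup>+\<omega>. ennreal (X \<omega> ^ (4 * r)) \<partial>M) \<le> ennreal (C * (t - s) ^ (2 * r))"
    using occ_time_moment[OF r] by blast
  have "(\<integral>\<^sup>+\<omega>. ennreal ((L a t \<omega> - L a s \<omega>) ^ (4 * r)) \<partial>M) \<le> ennreal (C * (t - s) ^ (2 * r))"
    if st: "0 \<le> s" "s \<le> t" for s t a
  proof -
    have t: "0 \<le> t" using st by simp
    obtain \<epsilon> where \<epsilon>: "\<And>j. 0 < \<epsilon> j" "AE \<omega> in M. (\<lambda>j. occ a (\<epsilon> j) 0 s \<omega>) \<longlonglongrightarrow> L a s \<omega>"
      "AE \<omega> in M. (\<lambda>j. occ a (\<epsilon> j) 0 t \<omega>) \<longlonglongrightarrow> L a t \<omega>"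
      using occ_AE_limits[OF st(1) t, of a a] by blast
    define P where "P j X \<longleftrightarrow> X \<in> borel_measurable M \<and> (AE \<omega> in M. X \<omega> = occ a (\<epsilon> j) s t \<omega>) \<and>
      (\<integral>\<^sup>+\<omega>. ennreal (X \<omega> ^ (4 * r)) \<partial>M) \<le> ennreal (C * (t - s) ^ (2 * r))" for j X
    have "\<exists>X. P j X" for j
      using C(2)[OF st \<epsilon>(1), of a j] unfolding P_def by blast
    then obtain X where "\<And>j. P j (X j)" by metis
    then have X: "\<And>j. X j \<in> borel_measurable M" "\<And>j. AE \<omega> in M. X j \<omega> = occ a (\<epsilon> j) s t \<omega>"
      "\<And>j. (\<integral>\<^sup>+\<omega>. ennreal (X j \<omega> ^ (4 * r)) \<partial>M) \<le> ennreal (C * (t - s) ^ (2 * r))"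
      unfolding P_def by blast+
    have "AE \<omega> in M. \<forall>j. X j \<omega> = occ a (\<epsilon> j) s t \<omega>" using X(2) by (simp add: AE_all_countable)
    then have "AE \<omega> in M. (\<lambda>j. X j \<omega>) \<longlonglongrightarrow> L a t \<omega> - L a s \<omega>"
      using \<epsilon>(2,3) AE_good
    proof eventually_elim
      case (elim \<omega>)
      have "X j \<omega> = occ a (\<epsilon> j) 0 t \<omega> - occ a (\<epsilon> j) 0 s \<omega>" for j
        unfolding occ_split[OF elim(4) \<epsilon>(1) st] using elim(1) by blast
      then show ?case using tendsto_diff[OF elim(3,2)] by simp
    qed
    from limit_moment_le[OF X(1) this X(3) tendsto_const]
    obtain Y where Y: "AE \<omega> in M. Y \<omega> = L a t \<omega> - L a s \<omega>"
      "(\<integral>\<^sup>+\<omega>. ennreal (Y \<omega> ^ (4 * r)) \<partial>M) \<le> ennreal (C * (t - s) ^ (2 * r))" by blast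
    have "(\<integral>\<^sup>+\<omega>. ennreal ((L a t \<omega> - L a s \<omega>) ^ (4 * r)) \<partial>M) = (\<integral>\<^sup>+\<omega>. ennreal (Y \<omega> ^ (4 * r)) \<partial>M)"
      using Y(1) by (intro nn_integral_cong_AE) (auto elim!: eventually_mono)
    with Y(2) show ?thesis by simp
  qed
  with C(1) show ?thesis by blast
qed

text \<open>Here the bounds for the approximations vary with the window, and Fatou's lemma is
  applied with their limit.\<close>

lemma local_time_space_moment:
  assumes r: "2 \<le> r"
  shows "\<exists>C\<ge>0. \<forall>t a b. 0 \<le> t \<longrightarrow> a < b \<longrightarrow>
    (\<integral>\<^sup>+\<omega>. ennreal ((L a t \<omega> - L b t \<omega>) ^ (4 * r)) \<partial>M) \<le> ennreal (C * ((b - a) ^ (4 * r) + (b - a) ^ (2 * r) * t ^ r))"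
proof -
  obtain C where C: "C \<ge> 0" "\<And>t a b \<epsilon>. 0 \<le> t \<Longrightarrow> a < b \<Longrightarrow> 0 < \<epsilon> \<Longrightarrow> \<exists>X\<in>borel_measurable M. (AE \<omega> in M. X \<omega> = occ a \<epsilon> 0 t \<omega> - occ b \<epsilon> 0 t \<omega>) \<and>
    (\<integral>\<^sup>+\<omega>. ennreal (X \<omega> ^ (4 * r)) \<partial>M) \<le> ennreal (C * ((b - a + 2 * \<epsilon>) ^ (4 * r) + (b - a + 2 * \<epsilon>) ^ (2 * r) * t ^ r))"
    using occ_space_moment[OF r] by blast
  have "(\<integral>\<^sup>+\<omega>. ennreal ((L a t \<omega> - L b t \<omega>) ^ (4 * r)) \<partial>M) \<le> ennreal (C * ((b - a) ^ (4 * r) + (b - a) ^ (2 * r) * t ^ r))"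
    if t: "0 \<le> t" and ab: "a < b" for t a b
  proof -
    obtain \<epsilon> where \<epsilon>: "\<And>j. 0 < \<epsilon> j" "\<And>j. \<epsilon> j \<le> (1 / 2) ^ j" "AE \<omega> in M. (\<lambda>j. occ a (\<epsilon> j) 0 t \<omega>) \<longlonglongrightarrow> L a t \<omega>"
      "AE \<omega> in M. (\<lambda>j. occ b (\<epsilon> j) 0 t \<omega>) \<longlonglongrightarrow> L b t \<omega>"
      using occ_AE_limits[OF t t, of a b] by blast
    define D where "D j = C * ((b - a + 2 * \<epsilon> j) ^ (4 * r) + (b - a + 2 * \<epsilon> j) ^ (2 * r) * t ^ r)" for j
    define P where "P j X \<longleftrightarrow> X \<in> borel_measurable M \<and> (AE \<omega> in M. X \<omega> = occ a (\<epsilon> j) 0 t \<omega> - occ b (\<epsilon> j) 0 t \<omega>) \<and>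
      (\<integral>\<^sup>+\<omega>. ennreal (X \<omega> ^ (4 * r)) \<partial>M) \<le> ennreal (D j)" for j X
    have "\<exists>X. P j X" for j
      using C(2)[OF t ab \<epsilon>(1), of j] unfolding P_def D_def by blast
    then obtain X where "\<And>j. P j (X j)" by metis
    then have X: "\<And>j. X j \<in> borel_measurable M" "\<And>j. AE \<omega> in M. X j \<omega> = occ a (\<epsilon> j) 0 t \<omega> - occ b (\<epsilon> j) 0 t \<omega>"
      "\<And>j. (\<integral>\<^sup>+\<omega>. ennreal (X j \<omega> ^ (4 * r)) \<partial>M) \<le> ennreal (D j)"
      unfolding P_def by blast+
    have "\<epsilon> \<longlonglongrightarrow> 0"
      by (rule tendsto_sandwich[OF _ _ tendsto_const LIMSEQ_realpow_zero[of "1 / 2"]])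
         (use \<epsilon>(1,2) in \<open>simp_all add: less_imp_le\<close>)
    then have "D \<longlonglongrightarrow> C * ((b - a + 2 * 0) ^ (4 * r) + (b - a + 2 * 0) ^ (2 * r) * t ^ r)"
      unfolding D_def by (intro tendsto_intros)
    then have D: "D \<longlonglongrightarrow> C * ((b - a) ^ (4 * r) + (b - a) ^ (2 * r) * t ^ r)" by simp
    have "AE \<omega> in M. \<forall>j. X j \<omega> = occ a (\<epsilon> j) 0 t \<omega> - occ b (\<epsilon> j) 0 t \<omega>" using X(2) by (simp add: AE_all_countable)
    then have "AE \<omega> in M. (\<lambda>j. X j \<omega>) \<longlonglongrightarrow> L a t \<omega> - L b t \<omega>"
      using \<epsilon>(3,4)
    proof eventually_elim
      case (elim \<omega>)
      then show ?case using tendsto_diff[OF elim(2,3)] by simp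
    qed
    from limit_moment_le[OF X(1) this X(3) D]
    obtain Y where Y: "AE \<omega> in M. Y \<omega> = L a t \<omega> - L b t \<omega>"
      "(\<integral>\<^sup>+\<omega>. ennreal (Y \<omega> ^ (4 * r)) \<partial>M) \<le> ennreal (C * ((b - a) ^ (4 * r) + (b - a) ^ (2 * r) * t ^ r))" by blast
    have "(\<integral>\<^sup>+\<omega>. ennreal ((L a t \<omega> - L b t \<omega>) ^ (4 * r)) \<partial>M) = (\<integral>\<^sup>+\<omega>. ennreal (Y \<omega> ^ (4 * r)) \<partial>M)"
      using Y(1) by (intro nn_integral_cong_AE) (auto elim!: eventually_mono)
    with Y(2) show ?thesis by simp
  qed
  with C(1) show ?thesis by blast
qed

text \<open>Windows of half-width at most 1 around \<open>a\<close> miss the range of the path, so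
  every occupation quotient vanishes; this is what the margin in \<open>K + 1\<close> is for. The
  exceptional null set depends on \<open>a\<close> and \<open>t\<close>.\<close>

lemma local_time_support:
  assumes t: "0 \<le> t" and a: "K + 1 \<le> \<bar>a\<bar>"
  shows "AE \<omega> in M. (\<forall>u\<in>{0..t}. \<bar>B u \<omega>\<bar> \<le> K) \<longrightarrow> L a t \<omega> = 0"
proof -
  obtain \<epsilon> where \<epsilon>: "\<And>j. 0 < \<epsilon> j" "\<And>j. \<epsilon> j \<le> (1 / 2) ^ j" "AE \<omega> in M. (\<lambda>j. occ a (\<epsilon> j) 0 t \<omega>) \<longlonglongrightarrow> L a t \<omega>"
    using occ_AE_limits[OF t t, of a a] by blast
  show ?thesis using \<epsilon>(3)
  proof (eventually_elim, intro impI)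
    fix \<omega> assume lim: "(\<lambda>j. occ a (\<epsilon> j) 0 t \<omega>) \<longlonglongrightarrow> L a t \<omega>" and K: "\<forall>u\<in>{0..t}. \<bar>B u \<omega>\<bar> \<le> K"
    have "occ a (\<epsilon> j) 0 t \<omega> = 0" for j
    proof -
      have "\<epsilon> j \<le> 1" using \<epsilon>(2)[of j] power_le_one[of "1 / 2 :: real" j] by simp
      then have z: "indicat_real {0<..t} u *\<^sub>R (indicator {- \<epsilon> j<..<\<epsilon> j} (B (max 0 u) \<omega> - a) / (2 * \<epsilon> j)) = (0::real)" for u
      proof (cases "u \<in> {0<..t}")
        case True
        then have "\<bar>B (max 0 u) \<omega>\<bar> \<le> K" using K by simp
        then have "B (max 0 u) \<omega> - a \<notin> {- \<epsilon> j<..<\<epsilon> j}"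
          using a \<open>\<epsilon> j \<le> 1\<close> by (simp add: abs_le_iff) linarith
        then show ?thesis by simp
      qed simp
      show ?thesis unfolding occ_def stieltjes_def set_lebesgue_integral_def z by simp
    qed
    then show "L a t \<omega> = 0" using LIMSEQ_unique[OF lim, of 0] by simp
  qed
qed

end

section \<open>Deterministic regularity of a function known at dyadic points\<close>

section \<open>Dyadic chaining\<close>

definition dy :: "nat \<Rightarrow> int \<Rightarrow> real" where
  "dy n i = real_of_int i / 2 ^ n"

text \<open>Control over neighbouring indices on one level covers both the passage to the next level
  and pairs of points at distance \<open>(1 / 2) ^ n\<close>. The space index is unrestricted, since
  far away the field will vanish; the time index ranges over a window.\<close>

definition dyadic_hoelder :: "nat \<Rightarrow> real \<Rightarrow> real \<Rightarrow> (real \<Rightarrow> real \<Rightarrow> real) \<Rightarrow> bool" where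
  "dyadic_hoelder N \<gamma> C u \<longleftrightarrow> (\<forall>n i j d e. \<bar>j\<bar> \<le> int (N * 2 ^ n) \<longrightarrow> \<bar>d\<bar> \<le> 2 \<longrightarrow> \<bar>e\<bar> \<le> 2 \<longrightarrow>
     \<bar>u (dy n i) (dy n j) - u (dy n (i + d)) (dy n (j + e))\<bar> \<le> C * (2 powr - \<gamma>) ^ n)"

text \<open>For \<open>r = m + 3\<close> this is \<open>(2r - 4) / (4r)\<close>, the order that
  moments of order \<open>4 * r\<close> deliver with room to spare. It is positive and approaches
  \<open>1/2\<close>, so countably many orders suffice.\<close>

definition exponent :: "nat \<Rightarrow> real" where
  "exponent m = 1 / 2 - 1 / (real m + 3)"

text \<open>The properties of a path from which continuity and Hoelder regularity follow without
  probability. Support bound, constants and orders are indexed by natural numbers to make the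
  condition countable, hence Borel in the path.\<close>

definition dyadic_regular :: "nat \<Rightarrow> (real \<Rightarrow> real \<Rightarrow> real) \<Rightarrow> bool" where
  "dyadic_regular N u \<longleftrightarrow> (\<exists>K::nat. \<forall>n i j. real K \<le> \<bar>dy n i\<bar> \<longrightarrow> u (dy n i) (dy n j) = 0) \<and>
     (\<forall>m. \<exists>C::nat. dyadic_hoelder N (exponent m) (real C) u)"

definition approx :: "nat \<Rightarrow> (real \<Rightarrow> real \<Rightarrow> real) \<Rightarrow> real \<Rightarrow> real \<Rightarrow> real" where
  "approx n u a t = u (dy n \<lfloor>a * 2 ^ n\<rfloor>) (dy n \<lfloor>t * 2 ^ n\<rfloor>)"

text \<open>Meaningful only where the limit exists.\<close>

definition extension :: "(real \<Rightarrow> real \<Rightarrow> real) \<Rightarrow> real \<Rightarrow> real \<Rightarrow> real" where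
  "extension u a t = lim (\<lambda>n. approx n u a t)"

lemma dy_double: "dy (Suc n) (2 * i) = dy n i"
  by (simp add: dy_def)

lemma floor_double: "\<lfloor>2 * x\<rfloor> = 2 * \<lfloor>x\<rfloor> \<or> \<lfloor>2 * x\<rfloor> = 2 * \<lfloor>x\<rfloor> + (1::int)" for x :: real
  by linarith

lemma floor_scaled_bound:
  assumes "\<bar>t\<bar> \<le> real N"
  shows "\<bar>\<lfloor>t * 2 ^ n\<rfloor>\<bar> \<le> int (N * 2 ^ n)"
proof -
  have "t * 2 ^ n \<le> real N * 2 ^ n" "- real N * 2 ^ n \<le> t * 2 ^ n"
    using assms by (intro mult_right_mono; simp)+
  then have "t * 2 ^ n \<le> real_of_int (int (N * 2 ^ n))" "real_of_int (- int (N * 2 ^ n)) \<le> t * 2 ^ n" by simp_all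
  then show ?thesis by linarith
qed

lemma geometric_Cauchy:
  fixes x :: "nat \<Rightarrow> real"
  assumes \<rho>: "0 < \<rho>" "\<rho> < 1" and C: "0 \<le> C" and step: "\<And>n. \<bar>x (Suc n) - x n\<bar> \<le> C * \<rho> ^ Suc n"
  shows "convergent x" and "\<bar>lim x - x n\<bar> \<le> C / (1 - \<rho>) * \<rho> ^ n"
proof -
  define c where "c = C / (1 - \<rho>)"
  \<comment> \<open>Writing \<open>C\<close> as \<open>c * (1 - \<rho>)\<close> turns the bound on
    one step into a telescoping difference of powers of \<open>\<rho>\<close>.\<close>
  have c: "0 \<le> c" "C = c * (1 - \<rho>)" using \<rho> C by (simp_all add: c_def)
  have fin: "\<bar>x (n + k) - x n\<bar> \<le> c * (\<rho> ^ n - \<rho> ^ (n + k))" for n k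
  proof (induction k)
    case (Suc k)
    have "\<bar>x (n + Suc k) - x n\<bar> \<le> c * (\<rho> ^ n - \<rho> ^ (n + k)) + C * \<rho> ^ Suc (n + k)"
      using Suc step[of "n + k"] by (simp only: add_Suc_right)
    also have "C * \<rho> ^ Suc (n + k) \<le> C * \<rho> ^ (n + k)"
      using \<rho> C by (intro mult_left_mono power_decreasing) auto
    also have "c * (\<rho> ^ n - \<rho> ^ (n + k)) + C * \<rho> ^ (n + k) = c * (\<rho> ^ n - \<rho> ^ (n + Suc k))"
      unfolding c(2) by (simp add: algebra_simps)
    finally show ?case by simp
  qed simp
  have bd: "\<bar>x m - x n\<bar> \<le> c * \<rho> ^ n" if "n \<le> m" for m n
  proof -
    have "c * (\<rho> ^ n - \<rho> ^ (n + (m - n))) \<le> c * \<rho> ^ n" using c \<rho> by (intro mult_left_mono) auto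
    then show ?thesis using fin[of n "m - n"] that by simp
  qed
  have "Cauchy x"
  proof (rule CauchyI)
    fix e :: real assume e: "0 < e"
    have "(\<lambda>n. c * \<rho> ^ n) \<longlonglongrightarrow> c * 0" using \<rho> by (intro tendsto_mult tendsto_const LIMSEQ_realpow_zero) auto
    then have "\<forall>\<^sub>F n in sequentially. c * \<rho> ^ n < e / 2"
      using e by (intro order_tendstoD(2)) auto
    then obtain N where N: "c * \<rho> ^ N < e / 2" by (auto simp: eventually_sequentially)
    have "norm (x m - x n) < e" if "N \<le> m" "N \<le> n" for m n
    proof -
      have "\<bar>x m - x n\<bar> \<le> \<bar>x m - x N\<bar> + \<bar>x n - x N\<bar>" by linarith
      then show ?thesis using bd[OF that(1)] bd[OF that(2)] N unfolding real_norm_def by linarith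
    qed
    then show "\<exists>M. \<forall>m\<ge>M. \<forall>n\<ge>M. norm (x m - x n) < e" by blast
  qed
  then show conv: "convergent x" by (rule real_Cauchy_convergent)
  have "(\<lambda>m. \<bar>x m - x n\<bar>) \<longlonglongrightarrow> \<bar>lim x - x n\<bar>"
    by (intro tendsto_intros) (use conv in \<open>simp add: convergent_LIMSEQ_iff\<close>)
  then show "\<bar>lim x - x n\<bar> \<le> C / (1 - \<rho>) * \<rho> ^ n"
    unfolding c_def[symmetric] by (rule LIMSEQ_le_const2) (use bd in blast)
qed

context
  fixes N :: nat and \<gamma> C :: real and u :: "real \<Rightarrow> real \<Rightarrow> real"
  assumes H: "dyadic_hoelder N \<gamma> C u" and \<gamma>: "0 < \<gamma>" and C: "0 \<le> C"
begin

definition rate :: real where "rate = 2 powr - \<gamma>"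

lemma rate_bounds: "0 < rate" "rate < 1"
proof -
  show "0 < rate" unfolding rate_def by simp
  have "2 powr - \<gamma> < 2 powr (0::real)" using \<gamma> by (intro powr_less_mono) auto
  then show "rate < 1" unfolding rate_def by simp
qed

lemma dyadic_hoelderD:
  "\<bar>j\<bar> \<le> int (N * 2 ^ n) \<Longrightarrow> \<bar>d\<bar> \<le> 2 \<Longrightarrow> \<bar>e\<bar> \<le> 2 \<Longrightarrow>
    \<bar>u (dy n i) (dy n j) - u (dy n (i + d)) (dy n (j + e))\<bar> \<le> C * rate ^ n"
  using H unfolding dyadic_hoelder_def rate_def by blast

text \<open>The grid point of level \<open>n\<close> is also a point of level \<open>n + 1\<close>,
  with doubled indices, and these differ by at most one from the floors at the finer level.\<close>

lemma approx_step:
  assumes "\<bar>t\<bar> \<le> real N"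
  shows "\<bar>approx (Suc n) u a t - approx n u a t\<bar> \<le> C * rate ^ Suc n"
proof -
  have s: "x * 2 ^ Suc n = 2 * (x * 2 ^ n)" for x :: real by simp
  define i where "i = \<lfloor>a * 2 ^ Suc n\<rfloor>"
  define j where "j = \<lfloor>t * 2 ^ Suc n\<rfloor>"
  define d where "d = 2 * \<lfloor>a * 2 ^ n\<rfloor> - i"
  define e where "e = 2 * \<lfloor>t * 2 ^ n\<rfloor> - j"
  have de: "\<bar>d\<bar> \<le> 2" "\<bar>e\<bar> \<le> 2"
    unfolding d_def i_def e_def j_def s using floor_double[of "a * 2 ^ n"] floor_double[of "t * 2 ^ n"] by linarith+
  have "approx n u a t = u (dy (Suc n) (i + d)) (dy (Suc n) (j + e))"
    unfolding approx_def d_def e_def by (simp add: dy_double)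
  moreover have "approx (Suc n) u a t = u (dy (Suc n) i) (dy (Suc n) j)"
    unfolding approx_def i_def j_def ..
  moreover have "\<bar>j\<bar> \<le> int (N * 2 ^ Suc n)" unfolding j_def by (rule floor_scaled_bound[OF assms])
  ultimately show ?thesis using dyadic_hoelderD[of j "Suc n" d e i] de by simp
qed

lemma extension_approx:
  assumes "\<bar>t\<bar> \<le> real N"
  shows "convergent (\<lambda>n. approx n u a t)" "\<bar>extension u a t - approx n u a t\<bar> \<le> C / (1 - rate) * rate ^ n"
  unfolding extension_def
  by (rule geometric_Cauchy[OF rate_bounds C approx_step[OF assms]])+

lemma approx_neighbours:
  assumes "\<bar>t\<bar> \<le> real N" and "\<bar>a - a'\<bar> \<le> (1 / 2) ^ n" "\<bar>t - t'\<bar> \<le> (1 / 2) ^ n"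
  shows "\<bar>approx n u a t - approx n u a' t'\<bar> \<le> C * rate ^ n"
proof -
  have scale: "\<bar>\<lfloor>y * 2 ^ n\<rfloor> - \<lfloor>x * 2 ^ n\<rfloor>\<bar> \<le> 2" if "\<bar>x - y\<bar> \<le> (1 / 2) ^ n" for x y :: real
  proof -
    have "\<bar>x * 2 ^ n - y * 2 ^ n\<bar> = \<bar>x - y\<bar> * 2 ^ n" by (simp add: abs_mult left_diff_distrib[symmetric])
    also have "\<dots> \<le> (1 / 2) ^ n * 2 ^ n" using that by (intro mult_right_mono) auto
    also have "\<dots> = 1" by (simp add: power_one_over)
    finally show ?thesis by linarith
  qed
  show ?thesis
    using dyadic_hoelderD[where n = n and i = "\<lfloor>a * 2 ^ n\<rfloor>", OF floor_scaled_bound[OF assms(1)] scale[OF assms(2)] scale[OF assms(3)]]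
    unfolding approx_def by simp
qed

definition hoelder_const :: real where "hoelder_const = (C + 2 * (C / (1 - rate))) * 2 powr \<gamma>"

text \<open>The two points are compared on the level whose mesh is \<open>d\<close> up to a factor
  2: both limits are within a geometric tail of their approximations there, and the approximations
  are neighbours.\<close>

lemma extension_local_hoelder:
  assumes t: "\<bar>t\<bar> \<le> real N" "\<bar>t'\<bar> \<le> real N" and d: "0 < d" "d \<le> 1" and ad: "\<bar>a - a'\<bar> \<le> d" and td: "\<bar>t - t'\<bar> \<le> d"
  shows "\<bar>extension u a t - extension u a' t'\<bar> \<le> hoelder_const * d powr \<gamma>"
proof -
  define P where "P n \<longleftrightarrow> (1 / 2) ^ Suc n < d" for n :: nat
  have "\<exists>n. (1 / 2 :: real) ^ n < d" using real_arch_pow_inv[OF d(1), of "1 / 2"] by simp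
  then obtain n0 where "(1 / 2 :: real) ^ n0 < d" by blast
  have "(1 / 2 :: real) ^ Suc n0 \<le> (1 / 2) ^ n0" by (rule power_decreasing) auto
  then have "P n0" unfolding P_def using \<open>(1 / 2) ^ n0 < d\<close> by (rule le_less_trans)
  define n where "n = (LEAST n. P n)"
  have Pn: "P n" unfolding n_def using \<open>P n0\<close> by (rule LeastI)
  have dn: "d \<le> (1 / 2) ^ n"
  proof (cases n)
    case 0
    then show ?thesis using d by simp
  next
    case (Suc k)
    then have "\<not> P k" unfolding n_def by (metis not_less_Least lessI)
    then show ?thesis unfolding P_def Suc by simp
  qed
  have an: "\<bar>a - a'\<bar> \<le> (1 / 2) ^ n" "\<bar>t - t'\<bar> \<le> (1 / 2) ^ n" using ad td dn by linarith+
  have "\<bar>extension u a t - extension u a' t'\<bar> \<le> \<bar>extension u a t - approx n u a t\<bar> + \<bar>approx n u a t - approx n u a' t'\<bar>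
      + \<bar>extension u a' t' - approx n u a' t'\<bar>" by linarith
  also have "\<dots> \<le> C / (1 - rate) * rate ^ n + C * rate ^ n + C / (1 - rate) * rate ^ n"
    by (intro add_mono extension_approx t approx_neighbours an)
  also have "\<dots> = (C + 2 * (C / (1 - rate))) * rate ^ n" by (simp add: algebra_simps)
  also have "\<dots> \<le> (C + 2 * (C / (1 - rate))) * (2 powr \<gamma> * d powr \<gamma>)"
  proof (rule mult_left_mono)
    \<comment> \<open>The lower bound on \<open>d\<close> involves level \<open>n + 1\<close>; the
      factor \<open>2 powr \<gamma>\<close> in \<open>hoelder_const\<close> pays for the
      shift.\<close>
    have "rate ^ n = 2 powr (\<gamma> - \<gamma> * real (Suc n))"
      unfolding rate_def powr_realpow[symmetric, of "2 powr - \<gamma>", simplified] powr_powr by (simp add: algebra_simps)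
    also have "\<dots> = 2 powr \<gamma> * (2 powr (- real (Suc n))) powr \<gamma>"
      unfolding powr_powr powr_add[symmetric] by (simp add: algebra_simps)
    also have "2 powr (- real (Suc n)) = (1 / 2) ^ Suc n"
      unfolding powr_minus powr_realpow[OF zero_less_numeral] by (simp add: power_one_over inverse_eq_divide)
    also have "2 powr \<gamma> * ((1 / 2) ^ Suc n) powr \<gamma> \<le> 2 powr \<gamma> * d powr \<gamma>"
      using Pn \<gamma> unfolding P_def by (intro mult_left_mono powr_mono2) auto
    finally show "rate ^ n \<le> 2 powr \<gamma> * d powr \<gamma>" .
    show "0 \<le> C + 2 * (C / (1 - rate))" using C rate_bounds by simp
  qed
  finally show ?thesis unfolding hoelder_const_def by (simp add: mult.assoc)
qed

lemma hoelder_const_nonneg: "0 \<le> hoelder_const"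
  unfolding hoelder_const_def using C rate_bounds by simp

end

lemma dyadic_hoelder_mono:
  assumes "dyadic_hoelder N \<gamma> C u" "\<gamma>' \<le> \<gamma>" "0 \<le> C"
  shows "dyadic_hoelder N \<gamma>' C u"
  unfolding dyadic_hoelder_def
proof (intro allI impI)
  fix n i j d e assume a: "\<bar>j\<bar> \<le> int (N * 2 ^ n)" "\<bar>d\<bar> \<le> (2::int)" "\<bar>e\<bar> \<le> (2::int)"
  have "\<bar>u (dy n i) (dy n j) - u (dy n (i + d)) (dy n (j + e))\<bar> \<le> C * (2 powr - \<gamma>) ^ n"
    using assms(1) a unfolding dyadic_hoelder_def by blast
  also have "\<dots> \<le> C * (2 powr - \<gamma>') ^ n"
    using assms(2,3) by (intro mult_left_mono power_mono powr_mono) auto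
  finally show "\<bar>u (dy n i) (dy n j) - u (dy n (i + d)) (dy n (j + e))\<bar> \<le> C * (2 powr - \<gamma>') ^ n" .
qed

lemma exponent_above:
  assumes "\<gamma> < 1 / 2"
  shows "\<exists>m. \<gamma> \<le> exponent m"
proof -
  obtain m :: nat where m: "1 / (1 / 2 - \<gamma>) \<le> real m" using real_arch_simple by blast
  then have "1 / (1 / 2 - \<gamma>) \<le> real m + 3" by linarith
  then have "1 / (real m + 3) \<le> 1 / 2 - \<gamma>" using assms by (simp add: field_simps)
  then show ?thesis unfolding exponent_def by (intro exI[of _ m]) linarith
qed

lemma dyadic_regular_hoelder:
  assumes "dyadic_regular N u" "0 < \<gamma>" "\<gamma> < 1 / 2"
  shows "\<exists>C\<ge>0. dyadic_hoelder N \<gamma> C u"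
proof -
  obtain m where m: "\<gamma> \<le> exponent m" using exponent_above[OF assms(3)] by blast
  obtain C :: nat where "dyadic_hoelder N (exponent m) (real C) u"
    using assms(1) unfolding dyadic_regular_def by blast
  then have "dyadic_hoelder N \<gamma> (real C) u" using m by (rule dyadic_hoelder_mono) simp
  then show ?thesis by (intro exI[of _ "real C"]) simp
qed

text \<open>Rounding down to a dyadic point moves \<open>a\<close> by at most 1 on every level,
  hence the enlarged threshold \<open>real K + 1\<close>.\<close>

lemma extension_zero:
  assumes "\<forall>n i j. real K \<le> \<bar>dy n i\<bar> \<longrightarrow> u (dy n i) (dy n j) = 0" "real K + 1 \<le> \<bar>a\<bar>"
  shows "extension u a t = 0"
proof -
  have "approx n u a t = 0" for n
  proof -
    have "\<bar>dy n \<lfloor>a * 2 ^ n\<rfloor> - a\<bar> \<le> 1"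
    proof -
      have "\<bar>dy n \<lfloor>a * 2 ^ n\<rfloor> - a\<bar> = \<bar>real_of_int \<lfloor>a * 2 ^ n\<rfloor> - a * 2 ^ n\<bar> / 2 ^ n"
        by (simp add: dy_def diff_divide_distrib[symmetric] field_simps abs_divide[symmetric])
      also have "\<dots> \<le> 1 / 1"
        by (rule frac_le) (simp_all, linarith)
      finally show ?thesis by simp
    qed
    then have "real K \<le> \<bar>dy n \<lfloor>a * 2 ^ n\<rfloor>\<bar>" using assms(2) by linarith
    then show ?thesis using assms(1) unfolding approx_def by blast
  qed
  then show ?thesis unfolding extension_def by (simp add: limI)
qed

lemma extension_continuous:
  assumes "dyadic_regular N u" "T \<le> real N"
  shows "continuous_on (UNIV \<times> {0..T}) (\<lambda>(a, t). extension u a t)"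
proof -
  \<comment> \<open>Any order strictly between \<open>0\<close> and \<open>1 / 2\<close> would serve
    for continuity.\<close>
  obtain C where C: "0 \<le> C" "dyadic_hoelder N (1 / 4) C u"
    using dyadic_regular_hoelder[OF assms(1), of "1 / 4"] by auto
  have q: "(0::real) < 1 / 4" by simp
  define c where "c = hoelder_const (1 / 4) C"
  have c: "0 \<le> c" unfolding c_def by (rule hoelder_const_nonneg[OF C(2) q C(1)])
  show ?thesis unfolding continuous_on_iff
  proof (intro ballI allI impI)
    fix p :: "real \<times> real" and e :: real assume p: "p \<in> UNIV \<times> {0..T}" and e: "0 < e"
    define \<delta> where "\<delta> = min 1 ((e / (c + 1)) powr 4)"
    have \<delta>: "0 < \<delta>" using e c by (simp add: \<delta>_def)
    have "dist (case q of (a, t) \<Rightarrow> extension u a t) (case p of (a, t) \<Rightarrow> extension u a t) < e"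
      if q': "q \<in> UNIV \<times> {0..T}" "dist q p < \<delta>" for q
    proof (cases "q = p")
      case False
      obtain a t a' t' where eq: "p = (a, t)" "q = (a', t')" by fastforce
      define d where "d = dist q p"
      have d: "0 < d" "d \<le> 1" "d < (e / (c + 1)) powr 4" using False q'(2) by (simp_all add: d_def \<delta>_def)
      have ad: "\<bar>a' - a\<bar> \<le> d" "\<bar>t' - t\<bar> \<le> d"
        using dist_fst_le[of q p] dist_snd_le[of q p] unfolding d_def eq by (simp_all add: dist_real_def)
      have "\<bar>extension u a' t' - extension u a t\<bar> \<le> c * d powr (1 / 4)"
        unfolding c_def using p q' assms(2) unfolding eq
        by (intro extension_local_hoelder[OF C(2) q C(1)] d ad) auto
      also have "\<dots> \<le> c * (e / (c + 1))"
      proof (rule mult_left_mono[OF _ c])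
        have "d powr (1 / 4) \<le> ((e / (c + 1)) powr 4) powr (1 / 4)" using d by (intro powr_mono2) auto
        also have "\<dots> = e / (c + 1)" unfolding powr_powr using e c by simp
        finally show "d powr (1 / 4) \<le> e / (c + 1)" .
      qed
      also have "\<dots> < e" using e c by (simp add: field_simps)
      finally show ?thesis unfolding eq by (simp add: dist_real_def)
    qed (use e in simp)
    then show "\<exists>\<delta>>0. \<forall>q\<in>UNIV \<times> {0..T}. dist q p < \<delta> \<longrightarrow>
        dist (case q of (a, t) \<Rightarrow> extension u a t) (case p of (a, t) \<Rightarrow> extension u a t) < e"
      using \<delta> by blast
  qed
qed

text \<open>Up to distance 1 the local estimate applies. Beyond it the function is merely bounded,
  by continuity on a compact box and vanishing outside, and this suffices because the power of the
  distance is then at least 1.\<close>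

lemma extension_hoelder:
  assumes reg: "dyadic_regular N u" and T: "T \<le> real N" and \<gamma>: "0 < \<gamma>" "\<gamma> < 1 / 2"
  shows "hoelder_on \<gamma> (UNIV \<times> {0..T}) (\<lambda>(a, t). extension u a t)"
proof -
  obtain C where C: "0 \<le> C" "dyadic_hoelder N \<gamma> C u"
    using dyadic_regular_hoelder[OF reg \<gamma>] by auto
  define c where "c = hoelder_const \<gamma> C"
  have c: "0 \<le> c" unfolding c_def by (rule hoelder_const_nonneg[OF C(2) \<gamma>(1) C(1)])
  obtain K :: nat where K: "\<forall>n i j. real K \<le> \<bar>dy n i\<bar> \<longrightarrow> u (dy n i) (dy n j) = 0"
    using reg unfolding dyadic_regular_def by blast
  let ?S = "{- (real K + 1)..real K + 1} \<times> {0..T}"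
  have "compact ((\<lambda>(a, t). extension u a t) ` ?S)"
    by (intro compact_continuous_image compact_Times continuous_on_subset[OF extension_continuous[OF reg T]]) auto
  then have "bounded ((\<lambda>(a, t). extension u a t) ` ?S)" by (rule compact_imp_bounded)
  then obtain b where b: "\<And>p. p \<in> ?S \<Longrightarrow> norm (case p of (a, t) \<Rightarrow> extension u a t) \<le> b"
    unfolding bounded_iff by blast
  have bd: "\<bar>extension u a t\<bar> \<le> \<bar>b\<bar>" if "t \<in> {0..T}" for a t
  proof (cases "\<bar>a\<bar> \<le> real K + 1")
    case True
    then have "(a, t) \<in> ?S" using that by auto
    from b[OF this] show ?thesis by simp
  next
    case False
    then show ?thesis using extension_zero[OF K, of a t] by simp
  qed
  have "dist (case p of (a, t) \<Rightarrow> extension u a t) (case q of (a, t) \<Rightarrow> extension u a t) \<le> (c + 2 * \<bar>b\<bar>) * dist p q powr \<gamma>"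
    if pq: "p \<in> UNIV \<times> {0..T}" "q \<in> UNIV \<times> {0..T}" for p q
  proof -
    obtain a t a' t' where eq: "p = (a, t)" "q = (a', t')" by fastforce
    define d where "d = dist p q"
    have ad: "\<bar>a - a'\<bar> \<le> d" "\<bar>t - t'\<bar> \<le> d"
      using dist_fst_le[of p q] dist_snd_le[of p q] unfolding d_def eq by (simp_all add: dist_real_def)
    consider "d = 0" | "0 < d" "d \<le> 1" | "1 < d" using zero_le_dist[of p q] unfolding d_def by linarith
    then have "\<bar>extension u a t - extension u a' t'\<bar> \<le> (c + 2 * \<bar>b\<bar>) * d powr \<gamma>"
    proof cases
      case 1
      then show ?thesis using ad by simp
    next
      case 2
      have "\<bar>extension u a t - extension u a' t'\<bar> \<le> c * d powr \<gamma>"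
        unfolding c_def using pq T unfolding eq
        by (intro extension_local_hoelder[OF C(2) \<gamma>(1) C(1)] 2 ad) auto
      also have "\<dots> \<le> (c + 2 * \<bar>b\<bar>) * d powr \<gamma>" by (intro mult_right_mono) auto
      finally show ?thesis .
    next
      case 3
      have "\<bar>extension u a t - extension u a' t'\<bar> \<le> 2 * \<bar>b\<bar>"
        using bd[of t a] bd[of t' a'] pq unfolding eq by auto
      also have "\<dots> \<le> (c + 2 * \<bar>b\<bar>) * 1" using c by simp
      also have "\<dots> \<le> (c + 2 * \<bar>b\<bar>) * d powr \<gamma>"
        using c 3 \<gamma>(1) by (intro mult_left_mono ge_one_powr_ge_zero) auto
      finally show ?thesis .
    qed
    then show ?thesis unfolding eq d_def by (simp add: dist_real_def)
  qed
  then show ?thesis unfolding hoelder_on_def by blast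
qed

section \<open>Probabilistic input for the chaining\<close>

section \<open>Kolmogorov's continuity criterion\<close>

lemma Bseq_of_tendsto_0:
  fixes W :: "nat \<Rightarrow> real"
  assumes "W \<longlonglongrightarrow> 0"
  shows "\<exists>S\<ge>0. \<forall>n. W n \<le> S"
proof -
  have "Bseq W" using assms by (intro convergent_imp_Bseq convergentI)
  then obtain S where "0 < S" "\<And>n. norm (W n) \<le> S" by (auto simp: Bseq_def)
  then show ?thesis by (intro exI[of _ S]) (auto intro: order_trans[OF abs_ge_self])
qed

lemma dyadic_floor_close: "\<bar>dy n \<lfloor>a * 2 ^ n\<rfloor> - a\<bar> \<le> (1 / 2) ^ n"
proof -
  have "dy n \<lfloor>a * 2 ^ n\<rfloor> - a = (real_of_int \<lfloor>a * 2 ^ n\<rfloor> - a * 2 ^ n) / 2 ^ n"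
    by (simp add: dy_def field_simps)
  then have "\<bar>dy n \<lfloor>a * 2 ^ n\<rfloor> - a\<bar> = \<bar>real_of_int \<lfloor>a * 2 ^ n\<rfloor> - a * 2 ^ n\<bar> / 2 ^ n" by simp
  also have "\<dots> \<le> 1 / 2 ^ n" by (rule divide_right_mono) (linarith, simp)
  finally show ?thesis by (simp add: power_one_over)
qed

context prob_space
begin

text \<open>The sum \<open>W n\<close> collects the normalised increments over all neighbouring
  pairs of level \<open>n\<close> in the window. There are of order \<open>4 ^ n\<close> pairs, each
  of expectation of order \<open>(1 / 16) ^ n\<close>, so the expectations are summable. Almost
  surely \<open>W n\<close> tends to zero, hence is bounded, and it dominates each of its
  terms.\<close>

lemma kolmogorov_window:
  fixes U :: "real \<Rightarrow> real \<Rightarrow> 'a \<Rightarrow> real" and K :: nat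
  assumes U [measurable]: "\<And>a t. U a t \<in> borel_measurable M"
    and mom: "\<And>r. 2 \<le> r \<Longrightarrow> \<exists>C\<ge>0. \<forall>a b s t h. 0 \<le> h \<longrightarrow> h \<le> 2 \<longrightarrow> \<bar>a - b\<bar> \<le> h \<longrightarrow> \<bar>s - t\<bar> \<le> h \<longrightarrow>
      (\<integral>\<^sup>+\<omega>. ennreal ((U a s \<omega> - U b t \<omega>) ^ (4 * r)) \<partial>M) \<le> ennreal (C * h ^ (2 * r))"
    and K: "1 \<le> K"
  shows "AE \<omega> in M. \<exists>C::nat. \<forall>n i j d e. \<bar>i\<bar> \<le> int (K * 2 ^ n) \<longrightarrow> \<bar>j\<bar> \<le> int (K * 2 ^ n) \<longrightarrow> \<bar>d\<bar> \<le> 2 \<longrightarrow> \<bar>e\<bar> \<le> 2 \<longrightarrow>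
     \<bar>U (dy n i) (dy n j) \<omega> - U (dy n (i + d)) (dy n (j + e)) \<omega>\<bar> \<le> real C * (2 powr - exponent m) ^ n"
proof -
  \<comment> \<open>For this \<open>r\<close> one has
    \<open>\<rho> ^ (4 * r) = (1 / 2) ^ (2 * r - 4)\<close>, four factors of one half short of the
    decay of the moments; they make up the \<open>1 / 16\<close>.\<close>
  define r where "r = m + 3"
  have r: "2 \<le> r" "3 \<le> r" by (simp_all add: r_def)
  obtain C where C: "C \<ge> 0" "\<And>a b s t h. 0 \<le> h \<Longrightarrow> h \<le> 2 \<Longrightarrow> \<bar>a - b\<bar> \<le> h \<Longrightarrow> \<bar>s - t\<bar> \<le> h \<Longrightarrow>
      (\<integral>\<^sup>+\<omega>. ennreal ((U a s \<omega> - U b t \<omega>) ^ (4 * r)) \<partial>M) \<le> ennreal (C * h ^ (2 * r))"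
    using mom[OF r(1)] by blast
  define \<rho> where "\<rho> = 2 powr - exponent m"
  have \<rho>0: "0 < \<rho>" by (simp add: \<rho>_def)
  have \<rho>r: "\<rho> ^ (4 * r) = (1 / 2) ^ (2 * r - 4)"
  proof -
    have "exponent m * real (4 * r) = real (2 * r - 4)"
      using r unfolding exponent_def r_def by (simp add: of_nat_diff field_simps)
    then have "\<rho> powr real (4 * r) = 2 powr - real (2 * r - 4)"
      unfolding \<rho>_def powr_powr by simp
    also have "\<dots> = inverse (2 ^ (2 * r - 4))" unfolding powr_minus powr_realpow[OF zero_less_numeral] ..
    finally have "\<rho> ^ (4 * r) = inverse (2 ^ (2 * r - 4))" unfolding powr_realpow[OF \<rho>0] .
    then show ?thesis by (simp add: power_one_over inverse_eq_divide)
  qed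
  define P where "P n = {- int (K * 2 ^ n)..int (K * 2 ^ n)} \<times> {- int (K * 2 ^ n)..int (K * 2 ^ n)} \<times> {- 2..2::int} \<times> {- 2..2::int}" for n
  have finP: "finite (P n)" for n unfolding P_def by (intro finite_cartesian_product) simp_all
  \<comment> \<open>Each index range has at most \<open>3 * K * 2 ^ n\<close> elements because
    \<open>K\<close> is at least 1, and there are 25 shifts:
    \<open>225 = 3 * 3 * 25\<close>.\<close>
  have cardP: "real (card (P n)) \<le> 225 * (real K)\<^sup>2 * 4 ^ n" for n
  proof -
    have 1: "real (card {- int (K * 2 ^ n)..int (K * 2 ^ n)}) \<le> 3 * real K * 2 ^ n"
    proof -
      have "1 * 1 \<le> real K * 2 ^ n" using K by (intro mult_mono) auto
      moreover have "card {- int k..int k} = 2 * k + 1" for k by simp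
      from this[of "K * 2 ^ n"] have "card {- int (K * 2 ^ n)..int (K * 2 ^ n)} = 2 * (K * 2 ^ n) + 1" .
      ultimately show ?thesis by simp
    qed
    have "real (card (P n)) = real (card {- int (K * 2 ^ n)..int (K * 2 ^ n)}) * (real (card {- int (K * 2 ^ n)..int (K * 2 ^ n)}) * 25)"
      unfolding P_def card_cartesian_product by simp
    also have "\<dots> \<le> (3 * real K * 2 ^ n) * ((3 * real K * 2 ^ n) * 25)"
      by (intro mult_mono 1) simp_all
    also have "\<dots> = 225 * (real K)\<^sup>2 * 4 ^ n"
    proof -
      have "(4::real) ^ n = 2 ^ n * 2 ^ n" by (simp flip: power_mult_distrib)
      then show ?thesis by (simp add: power2_eq_square)
    qed
    finally show ?thesis .
  qed
  define D where "D n x = (\<lambda>\<omega>. case x of (i, j, d, e) \<Rightarrow> U (dy n i) (dy n j) \<omega> - U (dy n (i + d)) (dy n (j + e)) \<omega>)" for n x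
  have Dm [measurable]: "D n x \<in> borel_measurable M" for n x
    unfolding D_def by (cases x) (simp, measurable)
  define W where "W n \<omega> = (\<Sum>x\<in>P n. (D n x \<omega> / \<rho> ^ n) ^ (4 * r))" for n \<omega>
  have ev: "even (4 * r)" by simp
  have term_nn: "0 \<le> (D n x \<omega> / \<rho> ^ n) ^ (4 * r)" for n x \<omega> by (rule zero_le_even_power[OF ev])
  have term_int: "(\<integral>\<^sup>+\<omega>. ennreal ((D n x \<omega> / \<rho> ^ n) ^ (4 * r)) \<partial>M) \<le> ennreal (C * 2 ^ (2 * r) * (1 / 16) ^ n)" if x: "x \<in> P n" for n x
  proof -
    obtain i j d e where xe: "x = (i, j, d, e)" by (cases x)
    have de: "\<bar>d\<bar> \<le> 2" "\<bar>e\<bar> \<le> 2" using x unfolding xe P_def by auto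
    define h where "h = 2 * (1 / 2 :: real) ^ n"
    have h: "0 \<le> h" "h \<le> 2" unfolding h_def using power_le_one[of "1 / 2 :: real" n] by simp_all
    have close: "\<bar>dy n i - dy n (i + d)\<bar> \<le> h" if "\<bar>d\<bar> \<le> 2" for i d
    proof -
      have "dy n i - dy n (i + d) = - real_of_int d / 2 ^ n" by (simp add: dy_def diff_divide_distrib[symmetric])
      then have "\<bar>dy n i - dy n (i + d)\<bar> = \<bar>real_of_int d\<bar> / 2 ^ n" by simp
      also have "\<dots> \<le> 2 / 2 ^ n" using that by (intro divide_right_mono) auto
      finally show ?thesis by (simp add: h_def power_one_over)
    qed
    have pos: "0 < (\<rho> ^ n) ^ (4 * r)" using \<rho>0 by simp
    have "(\<integral>\<^sup>+\<omega>. ennreal ((D n x \<omega> / \<rho> ^ n) ^ (4 * r)) \<partial>M) = (\<integral>\<^sup>+\<omega>. ennreal (1 / (\<rho> ^ n) ^ (4 * r)) * ennreal (D n x \<omega> ^ (4 * r)) \<partial>M)"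
    proof (rule nn_integral_cong)
      fix \<omega>
      have "0 \<le> D n x \<omega> ^ (4 * r)" by (rule zero_le_even_power[OF ev])
      then show "ennreal ((D n x \<omega> / \<rho> ^ n) ^ (4 * r)) = ennreal (1 / (\<rho> ^ n) ^ (4 * r)) * ennreal (D n x \<omega> ^ (4 * r))"
        using pos by (subst ennreal_mult[symmetric]) (simp_all add: power_divide)
    qed
    also have "\<dots> = ennreal (1 / (\<rho> ^ n) ^ (4 * r)) * (\<integral>\<^sup>+\<omega>. ennreal (D n x \<omega> ^ (4 * r)) \<partial>M)"
      by (rule nn_integral_cmult) measurable
    also have "\<dots> \<le> ennreal (1 / (\<rho> ^ n) ^ (4 * r)) * ennreal (C * h ^ (2 * r))"
      using C(2)[OF h close[OF de(1)] close[OF de(2)]] unfolding D_def xe by (intro mult_left_mono) simp_all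
    also have "\<dots> = ennreal (1 / (\<rho> ^ n) ^ (4 * r) * (C * h ^ (2 * r)))"
      using C(1) h pos by (intro ennreal_mult[symmetric]) simp_all
    also have "1 / (\<rho> ^ n) ^ (4 * r) * (C * h ^ (2 * r)) = C * 2 ^ (2 * r) * (1 / 16) ^ n"
    proof -
      have a: "(\<rho> ^ n) ^ (4 * r) = ((1 / 2) ^ (2 * r - 4)) ^ n"
        unfolding \<rho>r[symmetric] power_mult[symmetric] by (simp add: mult.commute)
      have b: "h ^ (2 * r) = 2 ^ (2 * r) * ((1 / 2) ^ (2 * r)) ^ n"
        unfolding h_def power_mult_distrib power_mult[symmetric] by (simp add: mult_ac)
      have "2 * r = (2 * r - 4) + 4" using r by simp
      then have "(1 / 2 :: real) ^ (2 * r) = (1 / 2) ^ (2 * r - 4) * (1 / 2) ^ 4" by (metis power_add)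
      then have c: "((1 / 2 :: real) ^ (2 * r)) ^ n = ((1 / 2) ^ (2 * r - 4)) ^ n * (1 / 16) ^ n"
        by (simp add: power_mult_distrib power_divide)
      have "((1 / 2 :: real) ^ (2 * r - 4)) ^ n \<noteq> 0" by simp
      then show ?thesis unfolding a b c by simp
    qed
    finally show ?thesis .
  qed
  define c0 where "c0 = 225 * (real K)\<^sup>2 * (C * 2 ^ (2 * r))"
  have "AE \<omega> in M. (\<lambda>n. W n \<omega>) \<longlonglongrightarrow> 0"
  proof (rule AE_tendsto_0)
    show "(\<lambda>\<omega>. W n \<omega>) \<in> borel_measurable M" for n unfolding W_def by measurable
    show "(\<integral>\<^sup>+\<omega>. ennreal \<bar>W n \<omega>\<bar> \<partial>M) \<le> ennreal (c0 * (1 / 4) ^ n)" for n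
    proof -
      have "(\<integral>\<^sup>+\<omega>. ennreal \<bar>W n \<omega>\<bar> \<partial>M) = (\<integral>\<^sup>+\<omega>. (\<Sum>x\<in>P n. ennreal ((D n x \<omega> / \<rho> ^ n) ^ (4 * r))) \<partial>M)"
        unfolding W_def using term_nn by (intro nn_integral_cong) (simp add: sum_nonneg sum_ennreal)
      also have "\<dots> = (\<Sum>x\<in>P n. \<integral>\<^sup>+\<omega>. ennreal ((D n x \<omega> / \<rho> ^ n) ^ (4 * r)) \<partial>M)"
        by (rule nn_integral_sum) measurable
      also have "\<dots> \<le> (\<Sum>x\<in>P n. ennreal (C * 2 ^ (2 * r) * (1 / 16) ^ n))"
        by (rule sum_mono) (rule term_int)
      also have "\<dots> = ennreal (real (card (P n)) * (C * 2 ^ (2 * r) * (1 / 16) ^ n))"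
        using C(1) by (subst sum_ennreal) simp_all
      also have "\<dots> \<le> ennreal ((225 * (real K)\<^sup>2 * 4 ^ n) * (C * 2 ^ (2 * r) * (1 / 16) ^ n))"
        using cardP C(1) by (intro ennreal_leI mult_right_mono) simp_all
      also have "(225 * (real K)\<^sup>2 * 4 ^ n) * (C * 2 ^ (2 * r) * (1 / 16) ^ n) = c0 * (1 / 4) ^ n"
      proof -
        have "(4::real) ^ n * (1 / 16) ^ n = (1 / 4) ^ n" unfolding power_mult_distrib[symmetric] by simp
        then show ?thesis unfolding c0_def by (simp add: mult_ac)
      qed
      finally show ?thesis .
    qed
    show "0 \<le> c0 * (1 / 4) ^ n" for n unfolding c0_def using C(1) by simp
    show "summable (\<lambda>n. c0 * (1 / 4) ^ n)" by (intro summable_mult summable_geometric) simp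
  qed
  then show ?thesis
  proof eventually_elim
    case (elim \<omega>)
    then obtain S where S: "0 \<le> S" "\<And>n. W n \<omega> \<le> S" using Bseq_of_tendsto_0 by blast
    obtain C0 :: nat where C0: "1 + S \<le> real C0" using real_arch_simple by blast
    show ?case unfolding \<rho>_def[symmetric]
    proof (intro exI[of _ C0] allI impI)
      fix n :: nat and i j d e :: int assume x: "\<bar>i\<bar> \<le> int (K * 2 ^ n)" "\<bar>j\<bar> \<le> int (K * 2 ^ n)" "\<bar>d\<bar> \<le> 2" "\<bar>e\<bar> \<le> (2::int)"
      define y where "y = \<bar>D n (i, j, d, e) \<omega>\<bar> / \<rho> ^ n"
      have "(i, j, d, e) \<in> P n" using x unfolding P_def by auto
      then have "(D n (i, j, d, e) \<omega> / \<rho> ^ n) ^ (4 * r) \<le> W n \<omega>"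
        unfolding W_def using term_nn finP by (intro member_le_sum[of "(i, j, d, e)" "P n" "\<lambda>x. (D n x \<omega> / \<rho> ^ n) ^ (4 * r)"])
      then have "\<bar>D n (i, j, d, e) \<omega> / \<rho> ^ n\<bar> ^ (4 * r) \<le> S"
        using S(2)[of n] unfolding power_even_abs[OF ev] by linarith
      then have yS: "y ^ (4 * r) \<le> S" unfolding y_def using \<rho>0 by (simp add: abs_divide)
      have "y \<le> 1 + S"
      \<comment> \<open>A number above 1 is below its powers, so the bound on the power passes to
        \<open>y\<close> without extracting a root.\<close>
      proof (rule ccontr)
        assume "\<not> y \<le> 1 + S"
        then have "1 \<le> y" using S(1) by simp
        then have "y \<le> y ^ (4 * r)" using r by (intro self_le_power) simp_all
        with yS \<open>\<not> y \<le> 1 + S\<close> show False by simp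
      qed
      then have "y * \<rho> ^ n \<le> real C0 * \<rho> ^ n" using C0 \<rho>0 by (intro mult_right_mono) auto
      then show "\<bar>U (dy n i) (dy n j) \<omega> - U (dy n (i + d)) (dy n (j + e)) \<omega>\<bar> \<le> real C0 * \<rho> ^ n"
        unfolding y_def using \<rho>0 by (simp add: D_def)
    qed
  qed
qed

text \<open>The support bound is random, so the window estimates are required almost surely for all
  window sizes simultaneously; the size is then chosen path by path.\<close>

lemma kolmogorov_dyadic_regular:
  fixes U :: "real \<Rightarrow> real \<Rightarrow> 'a \<Rightarrow> real"
  assumes U: "\<And>a t. U a t \<in> borel_measurable M"
    and mom: "\<And>r. 2 \<le> r \<Longrightarrow> \<exists>C\<ge>0. \<forall>a b s t h. 0 \<le> h \<longrightarrow> h \<le> 2 \<longrightarrow> \<bar>a - b\<bar> \<le> h \<longrightarrow> \<bar>s - t\<bar> \<le> h \<longrightarrow>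
      (\<integral>\<^sup>+\<omega>. ennreal ((U a s \<omega> - U b t \<omega>) ^ (4 * r)) \<partial>M) \<le> ennreal (C * h ^ (2 * r))"
    and supp: "AE \<omega> in M. \<exists>K::nat. \<forall>n i j. real K \<le> \<bar>dy n i\<bar> \<longrightarrow> U (dy n i) (dy n j) \<omega> = 0"
  shows "AE \<omega> in M. dyadic_regular N (\<lambda>a t. U a t \<omega>)"
proof -
  define Win where "Win \<omega> K m \<longleftrightarrow> (\<exists>C::nat. \<forall>n i j d e. \<bar>i\<bar> \<le> int (Suc K * 2 ^ n) \<longrightarrow> \<bar>j\<bar> \<le> int (Suc K * 2 ^ n) \<longrightarrow> \<bar>d\<bar> \<le> 2 \<longrightarrow> \<bar>e\<bar> \<le> 2 \<longrightarrow>
     \<bar>U (dy n i) (dy n j) \<omega> - U (dy n (i + d)) (dy n (j + e)) \<omega>\<bar> \<le> real C * (2 powr - exponent m) ^ n)" for \<omega> and K m :: nat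
  have "AE \<omega> in M. Win \<omega> K m" for K m
    unfolding Win_def by (rule kolmogorov_window[OF U mom]) simp_all
  then have "AE \<omega> in M. \<forall>K m. Win \<omega> K m" by (simp add: AE_all_countable)
  with supp show ?thesis
  proof eventually_elim
    case (elim \<omega>)
    then obtain K0 :: nat where K0: "\<And>n i j. real K0 \<le> \<bar>dy n i\<bar> \<Longrightarrow> U (dy n i) (dy n j) \<omega> = 0" by blast
    have "\<exists>C::nat. dyadic_hoelder N (exponent m) (real C) (\<lambda>a t. U a t \<omega>)" for m
    proof -
      \<comment> \<open>\<open>K0\<close> puts indices outside the window into the region where the
        field vanishes, \<open>2\<close> keeps their neighbours there, and \<open>N\<close> makes
        the window contain all admissible time indices.\<close>
      define K where "K = K0 + 2 + N"
      have "Win \<omega> K m" using elim by blast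
      then obtain C :: nat where C: "\<And>n i j d e. \<bar>i\<bar> \<le> int (Suc K * 2 ^ n) \<Longrightarrow> \<bar>j\<bar> \<le> int (Suc K * 2 ^ n) \<Longrightarrow> \<bar>d\<bar> \<le> 2 \<Longrightarrow> \<bar>e\<bar> \<le> 2 \<Longrightarrow>
         \<bar>U (dy n i) (dy n j) \<omega> - U (dy n (i + d)) (dy n (j + e)) \<omega>\<bar> \<le> real C * (2 powr - exponent m) ^ n"
        unfolding Win_def by blast
      have "\<bar>U (dy n i) (dy n j) \<omega> - U (dy n (i + d)) (dy n (j + e)) \<omega>\<bar> \<le> real C * (2 powr - exponent m) ^ n"
        if j: "\<bar>j\<bar> \<le> int (N * 2 ^ n)" and d: "\<bar>d\<bar> \<le> 2" and e: "\<bar>e\<bar> \<le> 2" for n i j d e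
      proof (cases "\<bar>i\<bar> \<le> int (Suc K * 2 ^ n)")
        case True
        have "N * 2 ^ n \<le> Suc K * 2 ^ n" by (rule mult_right_mono) (simp_all add: K_def)
        then have "\<bar>j\<bar> \<le> int (Suc K * 2 ^ n)" using j by linarith
        then show ?thesis by (rule C[OF True _ d e])
      next
        case False
        have "real (Suc K) * 2 ^ n \<le> \<bar>real_of_int i\<bar>"
        proof -
          have "real_of_int (int (Suc K * 2 ^ n)) \<le> real_of_int \<bar>i\<bar>" using False by (simp only: of_int_le_iff)
          then show ?thesis by (simp add: algebra_simps)
        qed
        then have "real (Suc K) \<le> \<bar>real_of_int i\<bar> / 2 ^ n" by (simp add: pos_le_divide_eq)
        then have i: "real (Suc K) \<le> \<bar>dy n i\<bar>" by (simp add: dy_def)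
        have "\<bar>dy n (i + d) - dy n i\<bar> \<le> 2"
        proof -
          have "\<bar>dy n (i + d) - dy n i\<bar> = \<bar>real_of_int d\<bar> / 2 ^ n" by (simp add: dy_def diff_divide_distrib[symmetric])
          also have "\<dots> \<le> 2 / 1" using d by (intro frac_le) auto
          finally show ?thesis by simp
        qed
        then have "real K0 \<le> \<bar>dy n (i + d)\<bar>" "real K0 \<le> \<bar>dy n i\<bar>" using i unfolding K_def by linarith+
        then show ?thesis using K0 by simp
      qed
      then have "dyadic_hoelder N (exponent m) (real C) (\<lambda>a t. U a t \<omega>)" unfolding dyadic_hoelder_def by blast
      then show ?thesis by blast
    qed
    then show ?case unfolding dyadic_regular_def using K0 by blast
  qed
qed

text \<open>Identifies the extension with the original field at each fixed point. Rounding moves a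
  point by at most \<open>(1 / 2) ^ n\<close>, so the eighth moments of the differences are of order
  \<open>(1 / 16) ^ n\<close> and summable.\<close>

lemma kolmogorov_approx_tendsto:
  fixes U :: "real \<Rightarrow> real \<Rightarrow> 'a \<Rightarrow> real"
  assumes U [measurable]: "\<And>a t. U a t \<in> borel_measurable M"
    and mom: "\<exists>C\<ge>0. \<forall>a b s t h. 0 \<le> h \<longrightarrow> h \<le> 2 \<longrightarrow> \<bar>a - b\<bar> \<le> h \<longrightarrow> \<bar>s - t\<bar> \<le> h \<longrightarrow>
      (\<integral>\<^sup>+\<omega>. ennreal ((U a s \<omega> - U b t \<omega>) ^ (4 * 2)) \<partial>M) \<le> ennreal (C * h ^ (2 * 2))"
  shows "AE \<omega> in M. (\<lambda>n. approx n (\<lambda>a t. U a t \<omega>) a t) \<longlonglongrightarrow> U a t \<omega>"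
proof -
  obtain C where C: "C \<ge> 0" "\<And>a b s t h. 0 \<le> h \<Longrightarrow> h \<le> 2 \<Longrightarrow> \<bar>a - b\<bar> \<le> h \<Longrightarrow> \<bar>s - t\<bar> \<le> h \<Longrightarrow>
      (\<integral>\<^sup>+\<omega>. ennreal ((U a s \<omega> - U b t \<omega>) ^ 8) \<partial>M) \<le> ennreal (C * h ^ 4)"
    using mom by auto
  have "AE \<omega> in M. (\<lambda>n. (approx n (\<lambda>a t. U a t \<omega>) a t - U a t \<omega>) ^ 8) \<longlonglongrightarrow> 0"
  proof (rule AE_tendsto_0)
    show "(\<lambda>\<omega>. (approx n (\<lambda>a t. U a t \<omega>) a t - U a t \<omega>) ^ 8) \<in> borel_measurable M" for n
      unfolding approx_def by measurable
    show "(\<integral>\<^sup>+\<omega>. ennreal \<bar>(approx n (\<lambda>a t. U a t \<omega>) a t - U a t \<omega>) ^ 8\<bar> \<partial>M) \<le> ennreal (C * ((1 / 2) ^ 4) ^ n)" for n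
    proof -
      have "(1 / 2 :: real) ^ n \<le> 2" using power_le_one[of "1 / 2 :: real" n] by simp
      moreover have "((1 / 2 :: real) ^ n) ^ 4 = ((1 / 2) ^ 4) ^ n" unfolding power_mult[symmetric] by (simp add: mult.commute)
      ultimately show ?thesis
        using C(2)[of "(1 / 2) ^ n" "dy n \<lfloor>a * 2 ^ n\<rfloor>" a "dy n \<lfloor>t * 2 ^ n\<rfloor>" t] dyadic_floor_close[of n a] dyadic_floor_close[of n t]
        unfolding approx_def by simp
    qed
    show "0 \<le> C * ((1 / 2) ^ 4) ^ n" for n using C(1) by simp
    show "summable (\<lambda>n. C * ((1 / 2) ^ 4) ^ n)"
      by (intro summable_mult summable_geometric) (simp add: power_one_over)
  qed
  then show ?thesis
  proof eventually_elim
    case (elim \<omega>)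
    then have "(\<lambda>n. root 8 (\<bar>approx n (\<lambda>a t. U a t \<omega>) a t - U a t \<omega>\<bar> ^ 8)) \<longlonglongrightarrow> root 8 0"
      by (intro tendsto_real_root) (simp add: power_even_abs)
    moreover have "root 8 (\<bar>x\<bar> ^ 8) = \<bar>x\<bar>" for x :: real by (rule real_root_power_cancel) simp_all
    ultimately have "(\<lambda>n. approx n (\<lambda>a t. U a t \<omega>) a t - U a t \<omega>) \<longlonglongrightarrow> 0"
      by (simp only: real_root_zero tendsto_rabs_zero_iff)
    then show ?case by (simp add: LIM_zero_iff)
  qed
qed

end

section \<open>Verification of the abstract hypotheses for the coordinate process\<close>

section \<open>The coordinate process under a representing measure\<close>

lemma path_measure_facts:
  assumes "\<P> \<subseteq> path_measures" "Q \<in> \<P>"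
  shows "prob_space Q" "sets Q = sets borel" "space Q = UNIV"
proof -
  show "prob_space Q" and *: "sets Q = sets borel" using assms by (auto simp: path_measures_def)
  show "space Q = UNIV" using sets_eq_imp_space_eq[OF *] by simp
qed

lemma quasi_surely_AE:
  assumes "\<P> \<subseteq> path_measures" "Q \<in> \<P>" "quasi_surely \<P> R"
  shows "AE \<omega> in Q. R \<omega>"
proof -
  obtain N where N: "N \<in> sets borel" "capacity \<P> N = 0" "\<And>\<omega>. \<omega> \<notin> N \<Longrightarrow> R \<omega>"
    using assms(3) unfolding quasi_surely_def polar_def by blast
  have "emeasure Q N \<le> capacity \<P> N" unfolding capacity_def by (rule SUP_upper[OF assms(2)])
  then have "N \<in> null_sets Q" using N(1,2) path_measure_facts(2)[OF assms(1,2)] by (simp add: null_sets_def)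
  then show ?thesis by (rule AE_I') (use N(3) in auto)
qed

text \<open>The exceptional set itself is the polar set, which is why it must be Borel: null sets
  chosen separately for each measure could not be united.\<close>

lemma quasi_surely_of_AE:
  assumes "\<P> \<subseteq> path_measures" "\<And>Q. Q \<in> \<P> \<Longrightarrow> AE \<omega> in Q. R \<omega>" "{\<omega>. \<not> R \<omega>} \<in> sets borel"
  shows "quasi_surely \<P> R"
proof -
  have "emeasure Q {\<omega>. \<not> R \<omega>} = 0" if Q: "Q \<in> \<P>" for Q
  proof -
    have "emeasure Q {\<omega> \<in> space Q. \<not> R \<omega>} = 0"
      using assms(2)[OF Q] assms(3) path_measure_facts[OF assms(1) Q]
      by (subst AE_iff_measurable[symmetric, where P = R]) auto
    then show ?thesis using path_measure_facts(3)[OF assms(1) Q] by simp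
  qed
  then have "capacity \<P> {\<omega>. \<not> R \<omega>} \<le> 0" unfolding capacity_def by (intro SUP_least) simp
  then have "polar \<P> {\<omega>. \<not> R \<omega>}" using assms(3) by (simp add: polar_def)
  then show ?thesis unfolding quasi_surely_def by blast
qed

lemma moment_martingale_BM:
  assumes P: "\<P> \<noteq> {}" "\<P> \<subseteq> path_measures" and G: "G_Brownian \<sigma>l \<sigma>u \<P>" and Q: "Q \<in> \<P>"
  shows "moment_martingale Q BM path_filtration"
proof -
  interpret prob_space Q by (rule path_measure_facts(1)[OF P(2) Q])
  note sQ = path_measure_facts(2,3)[OF P(2) Q]
  have BMQ: "BM t \<in> borel_measurable Q" for t
    unfolding measurable_cong_sets[OF sQ(1) refl] by (rule borel_measurable_BM)
  have mom: "integrable Q (\<lambda>\<omega>. (BM t \<omega> - BM s \<omega>) ^ (2 * m)) \<and>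
      expectation (\<lambda>\<omega>. (BM t \<omega> - BM s \<omega>) ^ (2 * m)) \<le> fact (2 * m) * exp (\<sigma>u\<^sup>2 / 2 + 1) * (t - s) ^ m"
    if st: "0 \<le> s" "s \<le> t" for s t m
  proof (cases "s = t")
    \<comment> \<open>The moment bound requires a positive time difference. For \<open>m = 0\<close>
      the right-hand side contains \<open>0 ^ 0 = 1\<close>, so the constant must be at least
      1.\<close>
    case True
    have "(1::real) * 1 \<le> fact (2 * m) * exp (\<sigma>u\<^sup>2 / 2 + 1)"
      by (intro mult_mono fact_ge_1) simp_all
    then show ?thesis using True by (cases m) (simp_all add: prob_space)
  next
    case False
    have "G_normal \<P> (\<sigma>l\<^sup>2 * (t - s)) (\<sigma>u\<^sup>2 * (t - s)) (\<lambda>\<omega>. BM t \<omega> - BM s \<omega>)"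
      using G[unfolded G_Brownian_def, rule_format, of s "t - s", THEN conjunct1] st by simp
    from G_normal_moment[OF P this _ _ _ Q] show ?thesis using False st by simp
  qed
  have inth: "integrable Q (\<lambda>\<omega>. BM t \<omega> - BM s \<omega>)" if "0 \<le> s" "s \<le> t" for s t
  proof (rule square_integrable_imp_integrable)
    show "(\<lambda>\<omega>. BM t \<omega> - BM s \<omega>) \<in> borel_measurable Q" using BMQ by simp
    show "integrable Q (\<lambda>\<omega>. (BM t \<omega> - BM s \<omega>)\<^sup>2)" using mom[OF that, of 1] by simp
  qed
  show ?thesis
  proof (unfold_locales)
    show "subalgebra Q (path_filtration t)" for t
      using sets_path_filtration_borel[of t] by (simp add: subalgebra_def sQ)
    show "subalgebra (path_filtration t) (path_filtration s)" if "s \<le> t" for s t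
      using sets_path_filtration_mono[OF that] by (simp add: subalgebra_def)
    show "BM t \<in> borel_measurable (path_filtration t)" if "0 \<le> t" for t
      by (rule BM_measurable_path_filtration[OF that order_refl])
    show "\<exists>K\<ge>0. \<forall>s t. 0 \<le> s \<longrightarrow> s \<le> t \<longrightarrow> integrable Q (\<lambda>\<omega>. (BM t \<omega> - BM s \<omega>) ^ (2 * m)) \<and>
        expectation (\<lambda>\<omega>. (BM t \<omega> - BM s \<omega>) ^ (2 * m)) \<le> K * (t - s) ^ m" for m
      using mom by (intro exI[of _ "fact (2 * m) * exp (\<sigma>u\<^sup>2 / 2 + 1)"]) simp
    show "expectation (\<lambda>\<omega>. Z \<omega> * (BM t \<omega> - BM s \<omega>)) = 0"
      if "0 \<le> s" "s \<le> t" "Z \<in> borel_measurable (path_filtration s)"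
        "integrable Q (\<lambda>\<omega>. Z \<omega> * (BM t \<omega> - BM s \<omega>))" for s t Z
      by (rule G_Brownian_martingale[OF P G Q that(1,2) inth[OF that(1,2)] that(3,4)])
  qed
qed

lemma partition_of_map:
  assumes p0: "p 0 = 0" and pN: "p N = t" and inc: "\<And>i. i < N \<Longrightarrow> p i < p (Suc i)"
  shows "partition_of t (map p [0..<Suc N])"
proof -
  have mono: "p i < p (i + Suc k)" if "i + Suc k \<le> N" for i k
    using that
  proof (induction k)
    case 0
    then show ?case using inc[of i] by simp
  next
    case (Suc k)
    then show ?case using inc[of "i + Suc k"] by (auto intro: less_trans)
  qed
  have "sorted_wrt (<) (map p [0..<Suc N])"
    unfolding sorted_wrt_iff_nth_less
  proof (intro allI impI)
    fix i j assume ij: "i < j" "j < length (map p [0..<Suc N])"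
    then have j: "j \<le> N" by simp
    have "p i < p (i + Suc (j - i - 1))" by (rule mono) (use ij(1) j in simp)
    then show "map p [0..<Suc N] ! i < map p [0..<Suc N] ! j" using ij(1) j by (simp del: upt_Suc add: nth_map)
  qed
  then show ?thesis using p0 pN unfolding partition_of_def
    by (simp del: upt_Suc add: hd_map last_map hd_upt last_upt)
qed

lemma mesh_less_map:
  assumes "\<And>i. i < N \<Longrightarrow> p (Suc i) - p i < \<delta>"
  shows "mesh_less (map p [0..<Suc N]) \<delta>"
  unfolding mesh_less_def using assms by (simp del: upt_Suc add: nth_map)

lemma qv_sum_map:
  "qv_sum (map p [0..<Suc N]) \<omega> = (\<Sum>i<N. (BM (p (Suc i)) \<omega> - BM (p i) \<omega>)\<^sup>2)"
  unfolding qv_sum_def by (simp del: upt_Suc add: nth_map)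

lemma sum_lessThan_add: "(\<Sum>i<n + k. f i) = (\<Sum>i<n. f i) + (\<Sum>i<k. f (n + i))" for f :: "nat \<Rightarrow> real"
  by (induction k) simp_all

lemma qv_sum_measurable [measurable]: "qv_sum ts \<in> borel_measurable borel"
  unfolding qv_sum_def[abs_def] by measurable

text \<open>The elementary inequality \<open>\<bar>z\<bar> \<le> z\<^sup>2 / e + e / 4\<close>
  converts an L2 error of \<open>e\<^sup>2 / 4\<close> into an L1 error of
  \<open>e / 2\<close>.\<close>

lemma quadratic_variation_L1:
  assumes P: "\<P> \<subseteq> path_measures" and Q: "Q \<in> \<P>" and qv: "quadratic_variation \<P> A" and t: "0 \<le> t" and e: "0 < e"
  shows "\<exists>\<delta>>0. \<forall>ts. partition_of t ts \<longrightarrow> mesh_less ts \<delta> \<longrightarrow> (\<integral>\<^sup>+\<omega>. ennreal \<bar>qv_sum ts \<omega> - A t \<omega>\<bar> \<partial>Q) \<le> ennreal (e / 2)"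
proof -
  interpret prob_space Q by (rule path_measure_facts(1)[OF P Q])
  note sQ [measurable_cong] = path_measure_facts(2)[OF P Q]
  have A [measurable]: "A t \<in> borel_measurable borel"
    using qv t unfolding quadratic_variation_def in_L2_def by blast
  have "0 < ennreal (e\<^sup>2 / 4)" using e by simp
  then obtain \<delta> where \<delta>: "0 < \<delta>" "\<And>ts. partition_of t ts \<Longrightarrow> mesh_less ts \<delta> \<Longrightarrow> L2_dist_sq \<P> (qv_sum ts) (A t) < ennreal (e\<^sup>2 / 4)"
    using qv t unfolding quadratic_variation_def by blast
  have "(\<integral>\<^sup>+\<omega>. ennreal \<bar>qv_sum ts \<omega> - A t \<omega>\<bar> \<partial>Q) \<le> ennreal (e / 2)" if ts: "partition_of t ts" "mesh_less ts \<delta>" for ts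
  proof -
    define Z where "Z \<omega> = qv_sum ts \<omega> - A t \<omega>" for \<omega>
    have Zm [measurable]: "Z \<in> borel_measurable borel" unfolding Z_def by measurable
    have "(\<integral>\<^sup>+\<omega>. ennreal (\<bar>Z \<omega>\<bar>\<^sup>2) \<partial>Q) \<le> L2_dist_sq \<P> (qv_sum ts) (A t)"
      unfolding L2_dist_sq_def Ehat_nn_def Z_def by (rule SUP_upper[OF Q])
    then have Z2: "(\<integral>\<^sup>+\<omega>. ennreal (\<bar>Z \<omega>\<bar>\<^sup>2) \<partial>Q) \<le> ennreal (e\<^sup>2 / 4)"
      using \<delta>(2)[OF ts] by simp
    have em: "ennreal (1 / e) * ennreal x = ennreal (1 / e * x)" if "0 \<le> x" for x
      by (rule ennreal_mult[symmetric]) (use e that in simp_all)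
    have "(\<integral>\<^sup>+\<omega>. ennreal \<bar>Z \<omega>\<bar> \<partial>Q) \<le> (\<integral>\<^sup>+\<omega>. ennreal (1 / e) * ennreal (\<bar>Z \<omega>\<bar>\<^sup>2) + ennreal (e / 4) \<partial>Q)"
    proof (rule nn_integral_mono)
      fix \<omega>
      have "0 \<le> (\<bar>Z \<omega>\<bar> - e / 2)\<^sup>2 / e" using e by simp
      also have "(\<bar>Z \<omega>\<bar> - e / 2)\<^sup>2 = \<bar>Z \<omega>\<bar>\<^sup>2 - \<bar>Z \<omega>\<bar> * e + e * e / 4"
      proof -
        have "(x - e / 2)\<^sup>2 = x\<^sup>2 - x * e + e * e / 4" for x :: real by (simp add: power2_eq_square algebra_simps)
        then show ?thesis .
      qed
      also have "\<dots> / e = 1 / e * \<bar>Z \<omega>\<bar>\<^sup>2 - \<bar>Z \<omega>\<bar> + e / 4" using e by (simp add: add_divide_distrib diff_divide_distrib)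
      finally have "\<bar>Z \<omega>\<bar> \<le> 1 / e * \<bar>Z \<omega>\<bar>\<^sup>2 + e / 4" by simp
      then have "ennreal \<bar>Z \<omega>\<bar> \<le> ennreal (1 / e * \<bar>Z \<omega>\<bar>\<^sup>2 + e / 4)" by (rule ennreal_leI)
      also have "\<dots> = ennreal (1 / e) * ennreal (\<bar>Z \<omega>\<bar>\<^sup>2) + ennreal (e / 4)"
        unfolding em[OF zero_le_power2] using e by (intro ennreal_plus) simp_all
      finally show "ennreal \<bar>Z \<omega>\<bar> \<le> ennreal (1 / e) * ennreal (\<bar>Z \<omega>\<bar>\<^sup>2) + ennreal (e / 4)" .
    qed
    also have "\<dots> = ennreal (1 / e) * (\<integral>\<^sup>+\<omega>. ennreal (\<bar>Z \<omega>\<bar>\<^sup>2) \<partial>Q) + ennreal (e / 4)"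
      by (subst nn_integral_add) (simp_all add: nn_integral_cmult emeasure_space_1)
    also have "\<dots> \<le> ennreal (1 / e) * ennreal (e\<^sup>2 / 4) + ennreal (e / 4)"
      using Z2 by (intro add_right_mono mult_left_mono) simp_all
    also have "\<dots> = ennreal (1 / e * (e\<^sup>2 / 4) + e / 4)"
    proof -
      have p: "0 \<le> e\<^sup>2 / 4" by simp
      show ?thesis unfolding em[OF p] using e by (intro ennreal_plus[symmetric]) simp_all
    qed
    also have "1 / e * (e\<^sup>2 / 4) + e / 4 = e / 2" using e by (simp add: power2_eq_square)
    finally show ?thesis unfolding Z_def .
  qed
  then show ?thesis using \<delta>(1) by blast
qed

text \<open>The definition compares sums over partitions of \<open>[0,t]\<close> only. A partition
  of \<open>[0,s]\<close> is continued by the grid on \<open>[s,t]\<close>: the sums over the common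
  part cancel, leaving two errors of size \<open>e / 2\<close>.\<close>

lemma quadratic_variation_martingale_BM:
  assumes P: "\<P> \<noteq> {}" "\<P> \<subseteq> path_measures" and G: "G_Brownian \<sigma>l \<sigma>u \<P>" and Q: "Q \<in> \<P>"
    and qv: "quadratic_variation \<P> A"
  shows "quadratic_variation_martingale Q BM path_filtration A"
proof -
  interpret moment_martingale Q BM path_filtration by (rule moment_martingale_BM[OF P G Q])
  note sQ [measurable_cong] = path_measure_facts(2)[OF P(2) Q]
  have Ab [measurable]: "A t \<in> borel_measurable borel" if "0 \<le> t" for t
    using qv that unfolding quadratic_variation_def in_L2_def by blast
  have AQ: "A t \<in> borel_measurable Q" if "0 \<le> t" for t
    unfolding measurable_cong_sets[OF sQ refl] by (rule Ab[OF that])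
  have qvQ: "qv_sum ts \<in> borel_measurable Q" for ts
    unfolding measurable_cong_sets[OF sQ refl] by (rule qv_sum_measurable)
  have key: "\<exists>n0. \<forall>n\<ge>n0. (\<integral>\<^sup>+\<omega>. ennreal \<bar>(\<Sum>i<n. (inc s t n i \<omega>)\<^sup>2) - (A t \<omega> - A s \<omega>)\<bar> \<partial>Q) \<le> ennreal e"
    if st: "0 \<le> s" "s \<le> t" and e: "0 < e" for s t e
  proof (cases "s = t")
    case True
    then have "(\<Sum>i<n. (inc s t n i \<omega>)\<^sup>2) - (A t \<omega> - A s \<omega>) = 0" for n \<omega> by (simp add: inc_def node_def)
    then show ?thesis by simp
  next
    case False
    then have st': "s < t" using st by simp
    obtain \<delta>1 where \<delta>1: "0 < \<delta>1" "\<And>ts. partition_of s ts \<Longrightarrow> mesh_less ts \<delta>1 \<Longrightarrow> (\<integral>\<^sup>+\<omega>. ennreal \<bar>qv_sum ts \<omega> - A s \<omega>\<bar> \<partial>Q) \<le> ennreal (e / 2)"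
      using quadratic_variation_L1[OF P(2) Q qv st(1) e] by blast
    have t0: "0 \<le> t" using st by simp
    obtain \<delta>2 where \<delta>2: "0 < \<delta>2" "\<And>ts. partition_of t ts \<Longrightarrow> mesh_less ts \<delta>2 \<Longrightarrow> (\<integral>\<^sup>+\<omega>. ennreal \<bar>qv_sum ts \<omega> - A t \<omega>\<bar> \<partial>Q) \<le> ennreal (e / 2)"
      using quadratic_variation_L1[OF P(2) Q qv t0 e] by blast
    define \<delta> where "\<delta> = min \<delta>1 \<delta>2"
    have \<delta>: "0 < \<delta>" using \<delta>1 \<delta>2 by (simp add: \<delta>_def)
    obtain n1 :: nat where n1: "t / \<delta> < real n1" using reals_Archimedean2 by blast
    have small: "\<exists>us ws. partition_of s us \<and> mesh_less us \<delta>1 \<and> partition_of t ws \<and> mesh_less ws \<delta>2 \<and>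
        (\<forall>\<omega>. qv_sum ws \<omega> = qv_sum us \<omega> + (\<Sum>i<n. (inc s t n i \<omega>)\<^sup>2))" if n: "Suc n1 \<le> n" for n
    proof -
      have n0: "0 < real n" using n by simp
      have "t / \<delta> < real n" using n1 n by linarith
      then have tn: "t / real n < \<delta>" using \<delta> n0 by (simp add: field_simps)
      have "s / real n \<le> t / real n" "(t - s) / real n \<le> t / real n" using st n0 by (simp_all add: divide_right_mono)
      then have small: "s / real n < \<delta>1" "s / real n < \<delta>2" "(t - s) / real n < \<delta>2" using tn unfolding \<delta>_def by linarith+
      have tail: "(BM (node s t n (Suc i)) \<omega> - BM (node s t n i) \<omega>)\<^sup>2 = (inc s t n i \<omega>)\<^sup>2" for i \<omega>
        by (simp add: inc_def)
      have stp: "node s t n i < node s t n (Suc i)" "node s t n (Suc i) - node s t n i < \<delta>2" for i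
        using node_Suc_diff[of s t n i] st' n0 small(3) by (auto simp: algebra_simps)
      show ?thesis
      proof (cases "s = 0")
        \<comment> \<open>A strictly increasing partition of \<open>[0,0]\<close> is the single
          point \<open>0\<close>, written as the image of a one-element list.\<close>
        case True
        have "partition_of s (map (\<lambda>i. 0) [0..<Suc 0])" using True by (intro partition_of_map) auto
        moreover have "mesh_less (map (\<lambda>i. 0) [0..<Suc 0]) \<delta>1" by (rule mesh_less_map) simp
        moreover have "partition_of t (map (node s t n) [0..<Suc n])"
          by (rule partition_of_map) (use True n node_n[of n s t] stp in auto)
        moreover have "mesh_less (map (node s t n) [0..<Suc n]) \<delta>2" by (rule mesh_less_map) (rule stp(2))
        moreover have "qv_sum (map (node s t n) [0..<Suc n]) \<omega> = qv_sum (map (\<lambda>i. 0) [0..<Suc 0]) \<omega> + (\<Sum>i<n. (inc s t n i \<omega>)\<^sup>2)" for \<omega>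
          unfolding qv_sum_map tail by simp
        ultimately show ?thesis by blast
      next
        case False
        then have s0: "0 < s" using st by simp
        \<comment> \<open>Two grids of \<open>n\<close> steps joined at index \<open>n\<close>,
          where both formulas give \<open>s\<close>.\<close>
        define p where "p i = (if i \<le> n then node 0 s n i else node s t n (i - n))" for i
        have stp0: "node 0 s n i < node 0 s n (Suc i)" "node 0 s n (Suc i) - node 0 s n i < \<delta>1" "node 0 s n (Suc i) - node 0 s n i < \<delta>2" for i
          using node_Suc_diff[of 0 s n i] s0 n0 small(1,2) by (auto simp: algebra_simps)
        have pn: "node 0 s n n = s" by (rule node_n) (use n in simp)
        have p1: "p i = node 0 s n i" if "i \<le> n" for i using that by (simp add: p_def)
        have p2: "p (n + i) = node s t n i" for i by (cases i) (simp_all add: p_def pn)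
        have step: "p i < p (Suc i) \<and> p (Suc i) - p i < \<delta>2" for i
        proof (cases "i < n")
          case True
          then show ?thesis using stp0 by (simp add: p1)
        next
          case False
          then obtain k where k: "i = n + k" using le_Suc_ex not_less by blast
          show ?thesis unfolding k add_Suc_right[symmetric] p2 using stp by blast
        qed
        have "partition_of s (map (node 0 s n) [0..<Suc n])"
          by (rule partition_of_map) (use pn stp0 in auto)
        moreover have "mesh_less (map (node 0 s n) [0..<Suc n]) \<delta>1" by (rule mesh_less_map) (rule stp0(2))
        moreover have "partition_of t (map p [0..<Suc (n + n)])"
          by (rule partition_of_map) (use p1[of 0] p2[of n] node_n[of n s t] n step in auto)
        moreover have "mesh_less (map p [0..<Suc (n + n)]) \<delta>2" by (rule mesh_less_map) (use step in blast)
        moreover have "qv_sum (map p [0..<Suc (n + n)]) \<omega> = qv_sum (map (node 0 s n) [0..<Suc n]) \<omega> + (\<Sum>i<n. (inc s t n i \<omega>)\<^sup>2)" for \<omega>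
        proof -
          have "qv_sum (map p [0..<Suc (n + n)]) \<omega> = (\<Sum>i<n + n. (BM (p (Suc i)) \<omega> - BM (p i) \<omega>)\<^sup>2)" by (rule qv_sum_map)
          also have "\<dots> = (\<Sum>i<n. (BM (p (Suc i)) \<omega> - BM (p i) \<omega>)\<^sup>2) + (\<Sum>i<n. (inc s t n i \<omega>)\<^sup>2)"
            unfolding sum_lessThan_add add_Suc_right[symmetric] p2 tail ..
          also have "(\<Sum>i<n. (BM (p (Suc i)) \<omega> - BM (p i) \<omega>)\<^sup>2) = qv_sum (map (node 0 s n) [0..<Suc n]) \<omega>"
            unfolding qv_sum_map by (intro sum.cong refl) (simp add: p1)
          finally show ?thesis .
        qed
        ultimately show ?thesis by blast
      qed
    qed
    have "(\<integral>\<^sup>+\<omega>. ennreal \<bar>(\<Sum>i<n. (inc s t n i \<omega>)\<^sup>2) - (A t \<omega> - A s \<omega>)\<bar> \<partial>Q) \<le> ennreal e" if n: "Suc n1 \<le> n" for n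
    proof -
      obtain us ws where uw: "partition_of s us" "mesh_less us \<delta>1" "partition_of t ws" "mesh_less ws \<delta>2"
        "\<And>\<omega>. qv_sum ws \<omega> = qv_sum us \<omega> + (\<Sum>i<n. (inc s t n i \<omega>)\<^sup>2)" using small[OF n] by blast
      have "(\<integral>\<^sup>+\<omega>. ennreal \<bar>(\<Sum>i<n. (inc s t n i \<omega>)\<^sup>2) - (A t \<omega> - A s \<omega>)\<bar> \<partial>Q)
          \<le> (\<integral>\<^sup>+\<omega>. ennreal \<bar>qv_sum ws \<omega> - A t \<omega>\<bar> + ennreal \<bar>qv_sum us \<omega> - A s \<omega>\<bar> \<partial>Q)"
      proof (rule nn_integral_mono)
        fix \<omega>
        have "\<bar>(\<Sum>i<n. (inc s t n i \<omega>)\<^sup>2) - (A t \<omega> - A s \<omega>)\<bar> \<le> \<bar>qv_sum ws \<omega> - A t \<omega>\<bar> + \<bar>qv_sum us \<omega> - A s \<omega>\<bar>"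
          using uw(5)[of \<omega>] by linarith
        then show "ennreal \<bar>(\<Sum>i<n. (inc s t n i \<omega>)\<^sup>2) - (A t \<omega> - A s \<omega>)\<bar> \<le> ennreal \<bar>qv_sum ws \<omega> - A t \<omega>\<bar> + ennreal \<bar>qv_sum us \<omega> - A s \<omega>\<bar>"
          by (simp add: ennreal_plus[symmetric] ennreal_leI del: ennreal_plus)
      qed
      also have "\<dots> = (\<integral>\<^sup>+\<omega>. ennreal \<bar>qv_sum ws \<omega> - A t \<omega>\<bar> \<partial>Q) + (\<integral>\<^sup>+\<omega>. ennreal \<bar>qv_sum us \<omega> - A s \<omega>\<bar> \<partial>Q)"
        using AQ[OF st(1)] AQ[OF t0] qvQ by (intro nn_integral_add) simp_all
      also have "\<dots> \<le> ennreal (e / 2) + ennreal (e / 2)"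
        by (intro add_mono \<delta>1(2) \<delta>2(2) uw)
      also have "\<dots> = ennreal e" using e by (simp add: ennreal_plus[symmetric] del: ennreal_plus)
      finally show ?thesis .
    qed
    then show ?thesis by blast
  qed
  show ?thesis
  proof unfold_locales
    show "AE \<omega> in Q. continuous_on {0..} (\<lambda>t. A t \<omega>) \<and> mono_on {0..} (\<lambda>t. A t \<omega>)"
      using qv unfolding quadratic_variation_def by (intro quasi_surely_AE[OF P(2) Q]) blast
    show "continuous_on {0..} (\<lambda>t. BM t \<omega>)" for \<omega> by (rule continuous_on_path)
  qed (rule AQ key; assumption)+
qed

text \<open>\<open>L2_dist_sq\<close> is a supremum over the family, so it dominates the squared
  distance under \<open>Q\<close>.\<close>

lemma local_time_martingale_BM:
  assumes P: "\<P> \<noteq> {}" "\<P> \<subseteq> path_measures" and G: "G_Brownian \<sigma>l \<sigma>u \<P>" and Q: "Q \<in> \<P>"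
    and qv: "quadratic_variation \<P> A" and lt: "local_time \<P> A L"
  shows "local_time_martingale Q BM path_filtration A L"
proof -
  interpret quadratic_variation_martingale Q BM path_filtration A
    by (rule quadratic_variation_martingale_BM[OF P G Q qv])
  note sQ = path_measure_facts(2)[OF P(2) Q]
  show ?thesis
  proof unfold_locales
    fix t :: real and a assume t: "0 \<le> t"
    have "L a t \<in> borel_measurable borel" using lt t unfolding local_time_def in_L2_def by blast
    then show "L a t \<in> borel_measurable Q" unfolding measurable_cong_sets[OF sQ refl] .
    have lim: "((\<lambda>\<epsilon>. L2_dist_sq \<P>
         (\<lambda>\<omega>. 1 / (2 * \<epsilon>) * integral_dA A t (\<lambda>s. indicator {a - \<epsilon><..<a + \<epsilon>} (BM s \<omega>)) \<omega>) (L a t)) \<longlongrightarrow> 0) (at_right 0)"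
      using lt t unfolding local_time_def by blast
    show "((\<lambda>\<epsilon>. \<integral>\<^sup>+\<omega>. ennreal (\<bar>1 / (2 * \<epsilon>) *
        (LINT u:{0..t}|qv_measure \<omega>. indicator {a - \<epsilon><..<a + \<epsilon>} (BM u \<omega>)) - L a t \<omega>\<bar>\<^sup>2) \<partial>Q) \<longlongrightarrow> 0) (at_right 0)"
    proof (rule tendsto_sandwich[OF _ _ tendsto_const lim])
      show "\<forall>\<^sub>F \<epsilon> in at_right 0. (\<integral>\<^sup>+\<omega>. ennreal (\<bar>1 / (2 * \<epsilon>) *
        (LINT u:{0..t}|qv_measure \<omega>. indicator {a - \<epsilon><..<a + \<epsilon>} (BM u \<omega>)) - L a t \<omega>\<bar>\<^sup>2) \<partial>Q)
        \<le> L2_dist_sq \<P> (\<lambda>\<omega>. 1 / (2 * \<epsilon>) * integral_dA A t (\<lambda>s. indicator {a - \<epsilon><..<a + \<epsilon>} (BM s \<omega>)) \<omega>) (L a t)"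
        unfolding L2_dist_sq_def Ehat_nn_def integral_dA_def qv_measure_def
        by (intro always_eventually allI SUP_upper[OF Q])
    qed simp
  qed
qed

section \<open>The field with clamped time, and the modification\<close>

lemma clamp_Lipschitz: "\<bar>max 0 (min T s) - max 0 (min T t)\<bar> \<le> \<bar>s - t\<bar>" for s t T :: real
  by linarith

context local_time_martingale
begin

text \<open>Freezing time outside \<open>[0,T]\<close> makes the field defined at all dyadic points.\<close>

definition clamped :: "real \<Rightarrow> real \<Rightarrow> real \<Rightarrow> 'a \<Rightarrow> real" where
  "clamped T a t = L a (max 0 (min T t))"

lemma clamped_measurable: "clamped T a t \<in> borel_measurable M"
  unfolding clamped_def by (rule L_measurable) simp

text \<open>A difference in both variables is split at the intermediate point with the first space
  and the second time coordinate. Clamping does not increase time distances.\<close>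

lemma clamped_moment:
  assumes r: "2 \<le> r" and T: "0 \<le> T"
  shows "\<exists>C\<ge>0. \<forall>a b s t h. 0 \<le> h \<longrightarrow> h \<le> 2 \<longrightarrow> \<bar>a - b\<bar> \<le> h \<longrightarrow> \<bar>s - t\<bar> \<le> h \<longrightarrow>
      (\<integral>\<^sup>+\<omega>. ennreal ((clamped T a s \<omega> - clamped T b t \<omega>) ^ (4 * r)) \<partial>M) \<le> ennreal (C * h ^ (2 * r))"
proof -
  obtain C1 where C1: "C1 \<ge> 0" "\<And>s t a. 0 \<le> s \<Longrightarrow> s \<le> t \<Longrightarrow>
    (\<integral>\<^sup>+\<omega>. ennreal ((L a t \<omega> - L a s \<omega>) ^ (4 * r)) \<partial>M) \<le> ennreal (C1 * (t - s) ^ (2 * r))"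
    using local_time_time_moment[OF r] by blast
  obtain C2 where C2: "C2 \<ge> 0" "\<And>t a b. 0 \<le> t \<Longrightarrow> a < b \<Longrightarrow>
    (\<integral>\<^sup>+\<omega>. ennreal ((L a t \<omega> - L b t \<omega>) ^ (4 * r)) \<partial>M) \<le> ennreal (C2 * ((b - a) ^ (4 * r) + (b - a) ^ (2 * r) * t ^ r))"
    using local_time_space_moment[OF r] by blast
  \<comment> \<open>Since \<open>h \<le> 2\<close>, one half of the power \<open>4 * r\<close> in
    the spatial bound is replaced by \<open>2 ^ (2 * r)\<close>, and the time factor by
    \<open>T ^ r\<close>.\<close>
  define D where "D = 2 ^ (2 * r) + T ^ r"
  have D: "0 \<le> D" using T by (simp add: D_def)
  have ev: "even (4 * r)" by simp
  have swap: "(x - y) ^ (4 * r) = (y - x) ^ (4 * r)" for x y :: real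
    using power_even_abs[OF ev] by (metis abs_minus_commute)
  define C where "C = 2 ^ (4 * r) * (C1 + C2 * D)"
  have C: "0 \<le> C" unfolding C_def using C1(1) C2(1) D by simp
  have time: "(\<integral>\<^sup>+\<omega>. ennreal ((L a s \<omega> - L a t \<omega>) ^ (4 * r)) \<partial>M) \<le> ennreal (C1 * h ^ (2 * r))"
    if st: "0 \<le> s" "0 \<le> t" and h: "\<bar>s - t\<bar> \<le> h" for a s t h
  proof (cases "s \<le> t")
    case True
    have "(\<integral>\<^sup>+\<omega>. ennreal ((L a t \<omega> - L a s \<omega>) ^ (4 * r)) \<partial>M) \<le> ennreal (C1 * (t - s) ^ (2 * r))"
      by (rule C1(2)[OF st(1) True])
    also have "\<dots> \<le> ennreal (C1 * h ^ (2 * r))"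
      using h True C1(1) by (intro ennreal_leI mult_left_mono power_mono) auto
    finally show ?thesis by (subst swap)
  next
    case False
    have "(\<integral>\<^sup>+\<omega>. ennreal ((L a s \<omega> - L a t \<omega>) ^ (4 * r)) \<partial>M) \<le> ennreal (C1 * (s - t) ^ (2 * r))"
      by (rule C1(2)[OF st(2)]) (use False in simp)
    also have "\<dots> \<le> ennreal (C1 * h ^ (2 * r))"
      using h False C1(1) by (intro ennreal_leI mult_left_mono power_mono) auto
    finally show ?thesis .
  qed
  have space_lt: "(\<integral>\<^sup>+\<omega>. ennreal ((L a t \<omega> - L b t \<omega>) ^ (4 * r)) \<partial>M) \<le> ennreal (C2 * D * h ^ (2 * r))"
    if t: "0 \<le> t" "t \<le> T" and ab: "a < b" and h: "b - a \<le> h" "h \<le> 2" for a b t h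
  proof -
    have d0: "0 \<le> b - a" using ab by simp
    have "(b - a) ^ (4 * r) = (b - a) ^ (2 * r) * (b - a) ^ (2 * r)" by (simp flip: power_add)
    also have "\<dots> \<le> h ^ (2 * r) * 2 ^ (2 * r)" using h d0 by (intro mult_mono power_mono) simp_all
    finally have 1: "(b - a) ^ (4 * r) \<le> h ^ (2 * r) * 2 ^ (2 * r)" .
    have 2: "(b - a) ^ (2 * r) * t ^ r \<le> h ^ (2 * r) * T ^ r" using h d0 t by (intro mult_mono power_mono) simp_all
    have "(b - a) ^ (4 * r) + (b - a) ^ (2 * r) * t ^ r \<le> D * h ^ (2 * r)"
      using add_mono[OF 1 2] unfolding D_def by (simp add: algebra_simps)
    then have "C2 * ((b - a) ^ (4 * r) + (b - a) ^ (2 * r) * t ^ r) \<le> C2 * (D * h ^ (2 * r))"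
      using C2(1) by (rule mult_left_mono)
    then show ?thesis using order_trans[OF C2(2)[OF t(1) ab] ennreal_leI] by (simp add: mult.assoc)
  qed
  have space: "(\<integral>\<^sup>+\<omega>. ennreal ((L a t \<omega> - L b t \<omega>) ^ (4 * r)) \<partial>M) \<le> ennreal (C2 * D * h ^ (2 * r))"
    if t: "0 \<le> t" "t \<le> T" and ab: "\<bar>a - b\<bar> \<le> h" and h: "h \<le> 2" for a b t h
  proof -
    consider "a < b" | "a = b" | "b < a" by linarith
    then show ?thesis
    proof cases
      case 1
      then show ?thesis using space_lt[OF t 1 _ h] ab by simp
    next
      case 2
      then show ?thesis using r by (simp add: power_0_left)
    next
      case 3
      then show ?thesis using space_lt[OF t 3 _ h] ab by (subst swap) simp
    qed
  qed
  have "(\<integral>\<^sup>+\<omega>. ennreal ((clamped T a s \<omega> - clamped T b t \<omega>) ^ (4 * r)) \<partial>M) \<le> ennreal (C * h ^ (2 * r))"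
    if h: "0 \<le> h" "h \<le> 2" and ab: "\<bar>a - b\<bar> \<le> h" and st: "\<bar>s - t\<bar> \<le> h" for a b s t h
  proof -
    define s' where "s' = max 0 (min T s)"
    define t' where "t' = max 0 (min T t)"
    have s't': "0 \<le> s'" "0 \<le> t'" "t' \<le> T" "\<bar>s' - t'\<bar> \<le> h"
      using T order_trans[OF clamp_Lipschitz st] by (simp_all add: s'_def t'_def)
    define V1 where "V1 \<omega> = (L a s' \<omega> - L a t' \<omega>) ^ (4 * r)" for \<omega>
    define V2 where "V2 \<omega> = (L a t' \<omega> - L b t' \<omega>) ^ (4 * r)" for \<omega>
    have Vn: "0 \<le> V1 \<omega>" "0 \<le> V2 \<omega>" for \<omega> unfolding V1_def V2_def by (rule zero_le_even_power[OF ev])+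
    have Vm: "V1 \<in> borel_measurable M" "V2 \<in> borel_measurable M"
      unfolding V1_def V2_def using L_measurable[OF s't'(1)] L_measurable[OF s't'(2)] by simp_all
    have "(\<integral>\<^sup>+\<omega>. ennreal ((clamped T a s \<omega> - clamped T b t \<omega>) ^ (4 * r)) \<partial>M)
        \<le> (\<integral>\<^sup>+\<omega>. ennreal (2 ^ (4 * r)) * (ennreal (V1 \<omega>) + ennreal (V2 \<omega>)) \<partial>M)"
    proof (rule nn_integral_mono)
      fix \<omega>
      define x where "x = \<bar>L a s' \<omega> - L a t' \<omega>\<bar>"
      define y where "y = \<bar>L a t' \<omega> - L b t' \<omega>\<bar>"
      have "\<bar>L a s' \<omega> - L b t' \<omega>\<bar> \<le> x + y" unfolding x_def y_def by linarith
      then have "\<bar>L a s' \<omega> - L b t' \<omega>\<bar> ^ (4 * r) \<le> (x + y) ^ (4 * r)" by (rule power_mono) simp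
      also have "\<dots> \<le> 2 ^ (4 * r) * (x ^ (4 * r) + y ^ (4 * r))" by (rule add_power_le) (simp_all add: x_def y_def)
      finally have "(L a s' \<omega> - L b t' \<omega>) ^ (4 * r) \<le> 2 ^ (4 * r) * (V1 \<omega> + V2 \<omega>)"
        unfolding V1_def V2_def x_def y_def power_even_abs[OF ev] .
      then have "ennreal ((L a s' \<omega> - L b t' \<omega>) ^ (4 * r)) \<le> ennreal (2 ^ (4 * r) * (V1 \<omega> + V2 \<omega>))" by (rule ennreal_leI)
      also have "\<dots> = ennreal (2 ^ (4 * r)) * (ennreal (V1 \<omega>) + ennreal (V2 \<omega>))"
        using Vn[of \<omega>] by (subst ennreal_mult) (simp_all add: ennreal_plus)
      finally show "ennreal ((clamped T a s \<omega> - clamped T b t \<omega>) ^ (4 * r)) \<le> ennreal (2 ^ (4 * r)) * (ennreal (V1 \<omega>) + ennreal (V2 \<omega>))"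
        unfolding clamped_def s'_def[symmetric] t'_def[symmetric] .
    qed
    also have "\<dots> = ennreal (2 ^ (4 * r)) * ((\<integral>\<^sup>+\<omega>. ennreal (V1 \<omega>) \<partial>M) + (\<integral>\<^sup>+\<omega>. ennreal (V2 \<omega>) \<partial>M))"
      using Vm by (subst nn_integral_cmult) (simp_all add: nn_integral_add)
    also have "\<dots> \<le> ennreal (2 ^ (4 * r)) * (ennreal (C1 * h ^ (2 * r)) + ennreal (C2 * D * h ^ (2 * r)))"
      unfolding V1_def V2_def
      by (intro mult_left_mono add_mono time space s't' ab h) simp
    also have "\<dots> = ennreal (2 ^ (4 * r) * (C1 * h ^ (2 * r) + C2 * D * h ^ (2 * r)))"
      using C1(1) C2(1) D h by (subst ennreal_mult) (simp_all add: ennreal_plus)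
    also have "2 ^ (4 * r) * (C1 * h ^ (2 * r) + C2 * D * h ^ (2 * r)) = C * h ^ (2 * r)"
      unfolding C_def by (simp add: algebra_simps)
    finally show ?thesis .
  qed
  with C show ?thesis by blast
qed

text \<open>The support statement holds outside a null set for countably many dyadic points and
  integer bounds at once; the bound is then chosen from the compact range of the individual path on
  \<open>[0,T]\<close>.\<close>

lemma clamped_support:
  assumes T: "0 \<le> T"
  shows "AE \<omega> in M. \<exists>K::nat. \<forall>n i j. real K \<le> \<bar>dy n i\<bar> \<longrightarrow> clamped T (dy n i) (dy n j) \<omega> = 0"
proof -
  define S where "S n i j K \<omega> \<longleftrightarrow> ((\<forall>u\<in>{0..max 0 (min T (dy n j))}. \<bar>B u \<omega>\<bar> \<le> real K) \<longrightarrow> real K + 1 \<le> \<bar>dy n i\<bar> \<longrightarrow> clamped T (dy n i) (dy n j) \<omega> = 0)"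
    for n :: nat and i j and K :: nat and \<omega>
  have "AE \<omega> in M. S n i j K \<omega>" for n i j K
  proof (cases "real K + 1 \<le> \<bar>dy n i\<bar>")
    case True
    have "AE \<omega> in M. (\<forall>u\<in>{0..max 0 (min T (dy n j))}. \<bar>B u \<omega>\<bar> \<le> real K) \<longrightarrow> L (dy n i) (max 0 (min T (dy n j))) \<omega> = 0"
      by (rule local_time_support[OF _ True]) simp
    then show ?thesis unfolding S_def clamped_def by eventually_elim blast
  next
    case False
    then show ?thesis by (simp add: S_def)
  qed
  then have "AE \<omega> in M. \<forall>n i j K. S n i j K \<omega>" by (simp add: AE_all_countable)
  then show ?thesis
  proof eventually_elim
    case (elim \<omega>)
    have "compact ((\<lambda>u. B u \<omega>) ` {0..T})"
      by (intro compact_continuous_image continuous_on_subset[OF B_continuous]) auto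
    then have "bounded ((\<lambda>u. B u \<omega>) ` {0..T})" by (rule compact_imp_bounded)
    then obtain b where "\<forall>x\<in>(\<lambda>u. B u \<omega>) ` {0..T}. norm x \<le> b" unfolding bounded_iff by blast
    then have b: "\<bar>B u \<omega>\<bar> \<le> b" if "u \<in> {0..T}" for u using that by simp
    obtain K :: nat where K: "b \<le> real K" using real_arch_simple by blast
    have "clamped T (dy n i) (dy n j) \<omega> = 0" if "real (Suc K) \<le> \<bar>dy n i\<bar>" for n i j
    proof -
      have "\<bar>B u \<omega>\<bar> \<le> real K" if "u \<in> {0..max 0 (min T (dy n j))}" for u
      proof -
        have "u \<in> {0..T}" using that T by auto
        then show ?thesis using b K by (meson order_trans)
      qed
      moreover have "real K + 1 \<le> \<bar>dy n i\<bar>" using that by simp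
      moreover have "S n i j K \<omega>" using elim by blast
      ultimately show ?thesis unfolding S_def by blast
    qed
    then show ?case by blast
  qed
qed

lemma clamped_regular:
  assumes T: "0 \<le> T"
  shows "AE \<omega> in M. dyadic_regular N (\<lambda>a t. clamped T a t \<omega>)"
    and "AE \<omega> in M. (\<lambda>n. approx n (\<lambda>a t. clamped T a t \<omega>) a t) \<longlonglongrightarrow> clamped T a t \<omega>"
proof -
  show "AE \<omega> in M. dyadic_regular N (\<lambda>a t. clamped T a t \<omega>)"
    by (rule kolmogorov_dyadic_regular[OF clamped_measurable clamped_moment[OF _ T] clamped_support[OF T]])
  show "AE \<omega> in M. (\<lambda>n. approx n (\<lambda>a t. clamped T a t \<omega>) a t) \<longlonglongrightarrow> clamped T a t \<omega>"
    by (rule kolmogorov_approx_tendsto[OF clamped_measurable clamped_moment[OF order_refl T]])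
qed

end

lemma dyadic_regular_measurable:
  fixes U :: "real \<Rightarrow> real \<Rightarrow> cpath \<Rightarrow> real"
  assumes [measurable]: "\<And>a t. U a t \<in> borel_measurable borel"
  shows "{\<omega>. dyadic_regular N (\<lambda>a t. U a t \<omega>)} \<in> sets borel"
proof -
  have "Measurable.pred borel (\<lambda>\<omega>. dyadic_regular N (\<lambda>a t. U a t \<omega>))"
    unfolding dyadic_regular_def dyadic_hoelder_def by measurable
  then show ?thesis by (simp add: pred_def)
qed

theorem theorem4p13:
  fixes \<sigma>l \<sigma>u T :: real
    and \<P> :: "cpath measure set"
    and A :: "real \<Rightarrow> cpath \<Rightarrow> real"
    and L :: "real \<Rightarrow> real \<Rightarrow> cpath \<Rightarrow> real"
  assumes "0 \<le> \<sigma>l" and "\<sigma>l \<le> \<sigma>u"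
    and "represents_G_expectation \<sigma>l \<sigma>u \<P>"
    and "quadratic_variation \<P> A"
    and "local_time \<P> A L"
    and "0 < T"
  shows "\<exists>L'. modification \<P> T L L' \<and>
    (\<forall>\<omega>. continuous_on (UNIV \<times> {0..T}) (\<lambda>(a, t). L' a t \<omega>)) \<and>
    quasi_surely \<P> (\<lambda>\<omega>. \<forall>\<gamma>. 0 < \<gamma> \<and> \<gamma> < 1 / 2 \<longrightarrow>
      hoelder_on \<gamma> (UNIV \<times> {0..T}) (\<lambda>(a, t). L' a t \<omega>))"
proof -
  note P = represents_G_expectationD[OF assms(3)]
  have T: "0 \<le> T" using assms(6) by simp
  obtain N :: nat where N: "T \<le> real N" using real_arch_simple by blast
  \<comment> \<open>The clamped field, defined without reference to a measure, so that one
    \<open>U\<close>, one set of regular paths and one \<open>L'\<close> serve all representing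
    measures.\<close>
  define U where "U a t = L a (max 0 (min T t))" for a t
  have Lm: "L a t \<in> borel_measurable borel" if "0 \<le> t" for a t
    using assms(5) that unfolding local_time_def in_L2_def by blast
  have Um [measurable]: "U a t \<in> borel_measurable borel" for a t
    unfolding U_def by (rule Lm) simp
  define R where "R \<omega> \<longleftrightarrow> dyadic_regular N (\<lambda>a t. U a t \<omega>)" for \<omega>
  have Rm: "{\<omega>. R \<omega>} \<in> sets borel"
    unfolding R_def by (rule dyadic_regular_measurable[OF Um])
  \<comment> \<open>The default value \<open>0\<close> off the regular paths makes every sample path
    of \<open>L'\<close> continuous, not just quasi-surely every one.\<close>
  define L' where "L' a t \<omega> = (if R \<omega> then extension (\<lambda>a t. U a t \<omega>) a t else 0)" for a t \<omega>
  have reg: "AE \<omega> in Q. R \<omega>"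
    and lim: "AE \<omega> in Q. (\<lambda>n. approx n (\<lambda>a t. U a t \<omega>) a t) \<longlonglongrightarrow> U a t \<omega>" if Q: "Q \<in> \<P>" for Q a t
  proof -
    interpret local_time_martingale Q BM path_filtration A L
      by (rule local_time_martingale_BM[OF P(1,2,3) Q assms(4,5)])
    have e: "clamped T = U" by (intro ext) (simp add: clamped_def U_def)
    show "AE \<omega> in Q. R \<omega>" unfolding R_def using clamped_regular(1)[OF T, of N] unfolding e .
    show "AE \<omega> in Q. (\<lambda>n. approx n (\<lambda>a t. U a t \<omega>) a t) \<longlonglongrightarrow> U a t \<omega>"
      using clamped_regular(2)[OF T, of a t] unfolding e .
  qed
  have L'm: "L' a t \<in> borel_measurable borel" for a t
  proof -
    have "(\<lambda>\<omega>. extension (\<lambda>a t. U a t \<omega>) a t) \<in> borel_measurable borel"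
      unfolding extension_def approx_def by (rule borel_measurable_lim_metric) measurable
    moreover have "Measurable.pred borel R" using Rm by (simp add: pred_def)
    ultimately show ?thesis unfolding L'_def[abs_def] by measurable
  qed
  have "quasi_surely \<P> (\<lambda>\<omega>. L' a t \<omega> = L a t \<omega>)" if t: "t \<in> {0..T}" for a t
  proof (rule quasi_surely_of_AE[OF P(2)])
    have Lat [measurable]: "L a t \<in> borel_measurable borel" by (rule Lm) (use t in simp)
    note [measurable] = L'm
    have "Measurable.pred borel (\<lambda>\<omega>. L' a t \<omega> \<noteq> L a t \<omega>)" by measurable
    then show "{\<omega>. L' a t \<omega> \<noteq> L a t \<omega>} \<in> sets borel" by (simp add: pred_def)
    fix Q assume Q: "Q \<in> \<P>"
    show "AE \<omega> in Q. L' a t \<omega> = L a t \<omega>"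
      using reg[OF Q] lim[OF Q, of a t]
    proof eventually_elim
      case (elim \<omega>)
      have "U a t \<omega> = L a t \<omega>" using t by (simp add: U_def)
      then show ?case using elim unfolding L'_def extension_def by (simp add: limI)
    qed
  qed
  then have "modification \<P> T L L'" using L'm unfolding modification_def by blast
  moreover have "continuous_on (UNIV \<times> {0..T}) (\<lambda>(a, t). L' a t \<omega>)" for \<omega>
  proof (cases "R \<omega>")
    case True
    then show ?thesis using extension_continuous[OF _ N] unfolding L'_def R_def by simp
  next
    case False
    then show ?thesis unfolding L'_def by (simp add: case_prod_unfold)
  qed
  moreover have "quasi_surely \<P> R"
  proof (rule quasi_surely_of_AE[OF P(2) reg])
    have "{\<omega>. \<not> R \<omega>} = UNIV - {\<omega>. R \<omega>}" by auto
    then show "{\<omega>. \<not> R \<omega>} \<in> sets borel" using sets.compl_sets[OF Rm] by simp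
  qed
  then have "quasi_surely \<P> (\<lambda>\<omega>. \<forall>\<gamma>. 0 < \<gamma> \<and> \<gamma> < 1 / 2 \<longrightarrow>
      hoelder_on \<gamma> (UNIV \<times> {0..T}) (\<lambda>(a, t). L' a t \<omega>))"
    unfolding quasi_surely_def
  proof (elim exE conjE, intro exI conjI allI impI)
    fix S \<omega> \<gamma> assume S: "\<forall>\<omega>. \<omega> \<notin> S \<longrightarrow> R \<omega>" "\<omega> \<notin> S" and \<gamma>: "0 < \<gamma> \<and> \<gamma> < (1 / 2 :: real)"
    then have "R \<omega>" by blast
    then show "hoelder_on \<gamma> (UNIV \<times> {0..T}) (\<lambda>(a, t). L' a t \<omega>)"
      using extension_hoelder[OF _ N] \<gamma> unfolding L'_def R_def by simp
  qed
  ultimately show ?thesis by blast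
qed

end
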